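(* For $0<a<1$ consider the system of partial differential equations $$D_x(D_x-2D_y)F+x(D_x+a)(D_x+1-a)F=0,\qquad D_y^2F-y(2D_y-D_x+1)(2D_y-D_x)F=0,$$ where $D_x=x\,\partial/\partial x$, $D_y=y\,\partial/\partial y$, and where $x=\frac{t_1+t_2}{(t_1-1)(t_2-1)}$, $y=\frac{t_1t_2}{(t_1+t_2)^2}$ with $t_j=t(\tau_j)$ ($j=1,2$) for a function $t(\tau)$ specified below. In each of the following cases, the given function $F(\tau_1,\tau_2)$, regarded as a function of $x$ and $y$, is a solution of this system for the indicated $a$: (a) $a=1/2$: $F=\theta_4(\tau_1)^2\theta_4(\tau_2)^2$, $t=\theta_2(\tau)^4/\theta_3(\tau)^4$; these are modular on $\Gamma_0(4)\times\Gamma_0(4)$. (b) $a=1/3$: $F=\frac12(3E_2(3\tau_1)-E_2(\tau_1))^{1/2}(3E_2(3\tau_2)-E_2(\tau_2))^{1/2}$, $t=-27\eta(3\tau)^{12}/\eta(\tau)^{12}$; these are modular on $\Gamma_0(3)\times\Gamma_0(3)$. (c) $a=1/4$: $F=(2E_2(2\tau_1)-E_2(\tau_1))^{1/2}(2E_2(2\tau_2)-E_2(\tau_2))^{1/2}$, $t=-64\eta(2\tau)^{24}/\eta(\tau)^{24}$; these are modular on $\Gamma_0(2)\times\Gamma_0(2)$. (d) $a=1/6$: $F=(E_4(\tau_1)E_4(\tau_2))^{1/4}$, $t=\dfrac{\sqrt{1-1728/j(\tau)}-1}{\sqrt{1-1728/j(\tau)}+1}$.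
   Context: $q=e^{2\pi i\tau}$. $\eta(\tau)=q^{1/24}\prod_{n\ge1}(1-q^n)$; $\theta_2(\tau)=q^{1/4}\sum_{n\in\mathbb Z}q^{n(n+1)}$, $\theta_3(\tau)=\sum_{n\in\mathbb Z}q^{n^2}$, $\theta_4(\tau)=\sum_{n\in\mathbb Z}(-1)^nq^{n^2}$; $E_2(\tau)=1-24\sum_{n\ge1}\frac{nq^n}{1-q^n}$, $E_4(\tau)=1+240\sum_{n\ge1}\frac{n^3q^n}{1-q^n}$; $j$ is the elliptic modular $j$-function. Fractional powers and square roots are the branches that are holomorphic near $q=0$ with leading coefficient given by the principal value. *)

theory Defs
  imports "HOL-Complex_Analysis.Complex_Analysis"
begin

definition UHP :: "complex set" where
  "UHP = {\<tau>. 0 < Im \<tau>}"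

text \<open>The power \<open>q\<^sup>s\<close> of the nome \<open>q = exp (2 \<pi> \<i> \<tau>)\<close>, as a function of \<open>\<tau>\<close>.\<close>

definition qpow :: "real \<Rightarrow> complex \<Rightarrow> complex" where
  "qpow s \<tau> = exp (2 * of_real pi * \<i> * of_real s * \<tau>)"

abbreviation qq :: "complex \<Rightarrow> complex" where
  "qq \<equiv> qpow 1"

definition dedekind_eta :: "complex \<Rightarrow> complex" where
  "dedekind_eta \<tau> = qpow (1/24) \<tau> * (\<Prod>n. 1 - qq \<tau> ^ Suc n)"

definition theta2 :: "complex \<Rightarrow> complex" where
  "theta2 \<tau> = qpow (1/4) \<tau> * (\<Sum>\<^sub>\<infinity>n\<in>(UNIV::int set). qq \<tau> powi (n * (n + 1)))"

definition theta3 :: "complex \<Rightarrow> complex" where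
  "theta3 \<tau> = (\<Sum>\<^sub>\<infinity>n\<in>(UNIV::int set). qq \<tau> powi (n ^ 2))"

definition theta4 :: "complex \<Rightarrow> complex" where
  "theta4 \<tau> = (\<Sum>\<^sub>\<infinity>n\<in>(UNIV::int set). (-1) powi n * qq \<tau> powi (n ^ 2))"

definition Eis2 :: "complex \<Rightarrow> complex" where
  "Eis2 \<tau> = 1 - 24 * (\<Sum>\<^sub>\<infinity>n\<in>{1::nat..}. of_nat n * qq \<tau> ^ n / (1 - qq \<tau> ^ n))"

definition Eis4 :: "complex \<Rightarrow> complex" where
  "Eis4 \<tau> = 1 + 240 * (\<Sum>\<^sub>\<infinity>n\<in>{1::nat..}. of_nat n ^ 3 * qq \<tau> ^ n / (1 - qq \<tau> ^ n))"

text \<open>Normalised so that \<open>j = q\<^sup>-\<^sup>1 + 744 + \<dots>\<close>.\<close>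

definition klein_j :: "complex \<Rightarrow> complex" where
  "klein_j \<tau> = Eis4 \<tau> ^ 3 / dedekind_eta \<tau> ^ 24"

text \<open>Complex differentiability in two variables: \<^const>\<open>has_derivative\<close> is only real-linear
  in general, so complex linearity of the derivative is spelled out.\<close>

definition holomorphic2_on :: "(complex \<times> complex \<Rightarrow> complex) \<Rightarrow> (complex \<times> complex) set \<Rightarrow> bool"
  where "holomorphic2_on G V \<longleftrightarrow>
    (\<forall>z\<in>V. \<exists>A B. (G has_derivative (\<lambda>(h, k). A * h + B * k)) (at z within V))"

definition at_i_inf :: "complex filter" where
  "at_i_inf = filtercomap Im at_top"

definition at_i_inf2 :: "(complex \<times> complex) filter" where
  "at_i_inf2 = filtercomap (\<lambda>(\<tau>1, \<tau>2). min (Im \<tau>1) (Im \<tau>2)) at_top"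

definition cusp_region :: "complex set \<Rightarrow> bool" where
  "cusp_region \<Omega> \<longleftrightarrow> open \<Omega> \<and> connected \<Omega> \<and> \<Omega> \<subseteq> UHP \<and> (\<exists>Y. {\<tau>. Im \<tau> > Y} \<subseteq> \<Omega>)"

text \<open>
  \<open>g\<close> is the branch on \<open>\<Omega>\<close> of \<open>\<phi>\<^bsup>1/n\<^esup>\<close> that is holomorphic near \<open>q = 0\<close> and whose leading
  coefficient there is the principal value of \<open>c\<^bsup>1/n\<^esup>\<close>, \<open>c\<close> being the constant term of \<open>\<phi>\<close>.
  Since \<open>g\<close> has a nonzero limit, it is automatically a holomorphic function of \<open>q\<close> near \<open>q = 0\<close>
  whenever \<open>\<phi>\<close> is.  Some of the roots below branch inside the upper half-plane; \<open>\<Omega>\<close> is then any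
  connected region around the cusp to which the branch continues.
\<close>

definition root_branch :: "nat \<Rightarrow> (complex \<Rightarrow> complex) \<Rightarrow> complex set \<Rightarrow> (complex \<Rightarrow> complex) \<Rightarrow> bool"
  where "root_branch n \<phi> \<Omega> g \<longleftrightarrow>
    cusp_region \<Omega> \<and> g holomorphic_on \<Omega> \<and> (\<forall>\<tau>\<in>\<Omega>. g \<tau> ^ n = \<phi> \<tau>) \<and>
    (\<exists>c. c \<noteq> 0 \<and> (\<phi> \<longlongrightarrow> c) at_i_inf \<and> (g \<longlongrightarrow> c powr (1 / of_nat n)) at_i_inf)"

definition root_branch2 ::
  "nat \<Rightarrow> (complex \<times> complex \<Rightarrow> complex) \<Rightarrow> complex set \<Rightarrow> (complex \<times> complex \<Rightarrow> complex) \<Rightarrow> bool"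
  where "root_branch2 n \<Phi> \<Omega> F \<longleftrightarrow>
    cusp_region \<Omega> \<and> holomorphic2_on F (\<Omega> \<times> \<Omega>) \<and> (\<forall>z\<in>\<Omega> \<times> \<Omega>. F z ^ n = \<Phi> z) \<and>
    (\<exists>c. c \<noteq> 0 \<and> (\<Phi> \<longlongrightarrow> c) at_i_inf2 \<and> (F \<longlongrightarrow> c powr (1 / of_nat n)) at_i_inf2)"

definition SL2Z :: "(int ^ 2 ^ 2) set" where
  "SL2Z = {A. det A = 1}"

definition Gamma0 :: "nat \<Rightarrow> (int ^ 2 ^ 2) set" where
  "Gamma0 N = {A \<in> SL2Z. int N dvd A $ 2 $ 1}"

definition mact :: "int ^ 2 ^ 2 \<Rightarrow> complex \<Rightarrow> complex" where
  "mact A \<tau> = (of_int (A $ 1 $ 1) * \<tau> + of_int (A $ 1 $ 2)) /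
              (of_int (A $ 2 $ 1) * \<tau> + of_int (A $ 2 $ 2))"

definition autj :: "int ^ 2 ^ 2 \<Rightarrow> complex \<Rightarrow> complex" where
  "autj A \<tau> = of_int (A $ 2 $ 1) * \<tau> + of_int (A $ 2 $ 2)"

definition finite_character ::
  "(int ^ 2 ^ 2) set \<Rightarrow> (int ^ 2 ^ 2) set \<Rightarrow> (int ^ 2 ^ 2 \<Rightarrow> int ^ 2 ^ 2 \<Rightarrow> complex) \<Rightarrow> bool"
  where "finite_character \<Gamma>1 \<Gamma>2 \<rho> \<longleftrightarrow>
    (\<forall>A\<in>\<Gamma>1. \<forall>A'\<in>\<Gamma>1. \<forall>B\<in>\<Gamma>2. \<forall>B'\<in>\<Gamma>2. \<rho> (A ** A') (B ** B') = \<rho> A B * \<rho> A' B') \<and>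
    (\<exists>m>0. \<forall>A\<in>\<Gamma>1. \<forall>B\<in>\<Gamma>2. \<rho> A B ^ m = 1)"

text \<open>
  Holomorphic modular forms of weight \<open>(k1, k2)\<close> on \<open>\<Gamma>1 \<times> \<Gamma>2\<close>, for subgroups of \<open>SL\<^sub>2(\<int>)\<close> of
  finite index, with some character of finite order.  Boundedness of all translates on every
  product of half-planes \<open>Im \<tau> \<ge> Y\<close> is holomorphy at the boundary components of the product of
  the two compactified upper half-planes, including the mixed ones (cusp, interior point).
\<close>

definition bimodular_form ::
  "(int ^ 2 ^ 2) set \<Rightarrow> (int ^ 2 ^ 2) set \<Rightarrow> nat \<Rightarrow> nat \<Rightarrow> (complex \<times> complex \<Rightarrow> complex) \<Rightarrow> bool"
  where "bimodular_form \<Gamma>1 \<Gamma>2 k1 k2 F \<longleftrightarrow>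
    holomorphic2_on F (UHP \<times> UHP) \<and>
    (\<exists>\<rho>. finite_character \<Gamma>1 \<Gamma>2 \<rho> \<and>
      (\<forall>A\<in>\<Gamma>1. \<forall>B\<in>\<Gamma>2. \<forall>\<tau>1\<in>UHP. \<forall>\<tau>2\<in>UHP.
        F (mact A \<tau>1, mact B \<tau>2) = \<rho> A B * autj A \<tau>1 ^ k1 * autj B \<tau>2 ^ k2 * F (\<tau>1, \<tau>2))) \<and>
    (\<forall>A\<in>SL2Z. \<forall>B\<in>SL2Z. \<forall>Y>0. \<exists>C. \<forall>\<tau>1 \<tau>2. Im \<tau>1 \<ge> Y \<longrightarrow> Im \<tau>2 \<ge> Y \<longrightarrow>
      norm (F (mact A \<tau>1, mact B \<tau>2) / (autj A \<tau>1 ^ k1 * autj B \<tau>2 ^ k2)) \<le> C)"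

text \<open>
  The transformation law of weight \<open>(k1, k2)\<close>, up to \<open>m\<close>-th roots of unity depending on the
  branch, for a branch \<open>F\<close> on \<open>D\<close> of the \<open>m\<close>-th root of a single-valued function.
\<close>

definition transforms_up_to_root ::
  "nat \<Rightarrow> (int ^ 2 ^ 2) set \<Rightarrow> (int ^ 2 ^ 2) set \<Rightarrow> nat \<Rightarrow> nat \<Rightarrow> (complex \<times> complex) set \<Rightarrow>
   (complex \<times> complex \<Rightarrow> complex) \<Rightarrow> bool"
  where "transforms_up_to_root m \<Gamma>1 \<Gamma>2 k1 k2 D F \<longleftrightarrow>
    (\<forall>A\<in>\<Gamma>1. \<forall>B\<in>\<Gamma>2. \<forall>\<tau>1 \<tau>2. (\<tau>1, \<tau>2) \<in> D \<longrightarrow> (mact A \<tau>1, mact B \<tau>2) \<in> D \<longrightarrow>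
      (\<exists>\<epsilon>. \<epsilon> ^ m = 1 \<and>
        F (mact A \<tau>1, mact B \<tau>2) = \<epsilon> * autj A \<tau>1 ^ k1 * autj B \<tau>2 ^ k2 * F (\<tau>1, \<tau>2)))"

text \<open>Invariant holomorphic functions with at most poles along the cusps, and their quotients,
  which are the modular functions.\<close>

definition weakly_bimodular_function ::
  "(int ^ 2 ^ 2) set \<Rightarrow> (int ^ 2 ^ 2) set \<Rightarrow> (complex \<times> complex \<Rightarrow> complex) \<Rightarrow> bool"
  where "weakly_bimodular_function \<Gamma>1 \<Gamma>2 P \<longleftrightarrow>
    holomorphic2_on P (UHP \<times> UHP) \<and>
    (\<forall>A\<in>\<Gamma>1. \<forall>B\<in>\<Gamma>2. \<forall>\<tau>1\<in>UHP. \<forall>\<tau>2\<in>UHP. P (mact A \<tau>1, mact B \<tau>2) = P (\<tau>1, \<tau>2)) \<and>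
    (\<forall>A\<in>SL2Z. \<forall>B\<in>SL2Z. \<forall>Y>0. \<exists>C K. \<forall>\<tau>1 \<tau>2. Im \<tau>1 \<ge> Y \<longrightarrow> Im \<tau>2 \<ge> Y \<longrightarrow>
      norm (P (mact A \<tau>1, mact B \<tau>2)) \<le> C * exp (K * (Im \<tau>1 + Im \<tau>2)))"

definition bimodular_function ::
  "(int ^ 2 ^ 2) set \<Rightarrow> (int ^ 2 ^ 2) set \<Rightarrow> (complex \<times> complex \<Rightarrow> complex) \<Rightarrow> bool"
  where "bimodular_function \<Gamma>1 \<Gamma>2 F \<longleftrightarrow>
    (\<exists>P Q. weakly_bimodular_function \<Gamma>1 \<Gamma>2 P \<and> weakly_bimodular_function \<Gamma>1 \<Gamma>2 Q \<and>
      (\<exists>z\<in>UHP \<times> UHP. Q z \<noteq> 0) \<and> (\<forall>z\<in>UHP \<times> UHP. Q z \<noteq> 0 \<longrightarrow> F z = P z / Q z))"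

definition Dx :: "(complex \<times> complex \<Rightarrow> complex) \<Rightarrow> complex \<times> complex \<Rightarrow> complex" where
  "Dx G = (\<lambda>(x, y). x * deriv (\<lambda>u. G (u, y)) x)"

definition Dy :: "(complex \<times> complex \<Rightarrow> complex) \<Rightarrow> complex \<times> complex \<Rightarrow> complex" where
  "Dy G = (\<lambda>(x, y). y * deriv (\<lambda>v. G (x, v)) y)"

definition pde_system :: "real \<Rightarrow> (complex \<times> complex \<Rightarrow> complex) \<Rightarrow> complex \<times> complex \<Rightarrow> bool" where
  "pde_system a G z \<longleftrightarrow>
     (let H = (\<lambda>w. Dx G w + (1 - of_real a) * G w);
          K = (\<lambda>w. 2 * Dy G w - Dx G w)
      in Dx (\<lambda>w. Dx G w - 2 * Dy G w) z + fst z * (Dx H z + of_real a * H z) = 0 \<and>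
         Dy (Dy G) z - snd z * (2 * Dy K z - Dx K z + K z) = 0)"

definition xcoord :: "(complex \<Rightarrow> complex) \<Rightarrow> complex \<times> complex \<Rightarrow> complex" where
  "xcoord t = (\<lambda>(\<tau>1, \<tau>2). (t \<tau>1 + t \<tau>2) / ((t \<tau>1 - 1) * (t \<tau>2 - 1)))"

definition ycoord :: "(complex \<Rightarrow> complex) \<Rightarrow> complex \<times> complex \<Rightarrow> complex" where
  "ycoord t = (\<lambda>(\<tau>1, \<tau>2). t \<tau>1 * t \<tau>2 / (t \<tau>1 + t \<tau>2) ^ 2)"

definition jacobian ::
  "(complex \<times> complex \<Rightarrow> complex) \<Rightarrow> (complex \<times> complex \<Rightarrow> complex) \<Rightarrow> complex \<times> complex \<Rightarrow> complex"
  where "jacobian X Y = (\<lambda>(\<tau>1, \<tau>2).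
    deriv (\<lambda>s. X (s, \<tau>2)) \<tau>1 * deriv (\<lambda>s. Y (\<tau>1, s)) \<tau>2 -
    deriv (\<lambda>s. X (\<tau>1, s)) \<tau>2 * deriv (\<lambda>s. Y (s, \<tau>2)) \<tau>1)"

text \<open>The points at which \<open>x\<close> and \<open>y\<close> are defined and form local coordinates.\<close>

definition chart_points :: "(complex \<Rightarrow> complex) \<Rightarrow> complex set \<Rightarrow> (complex \<times> complex) set" where
  "chart_points t \<Omega> = {(\<tau>1, \<tau>2). \<tau>1 \<in> \<Omega> \<and> \<tau>2 \<in> \<Omega> \<and> t \<tau>1 \<noteq> 1 \<and> t \<tau>2 \<noteq> 1 \<and> t \<tau>1 + t \<tau>2 \<noteq> 0 \<and>
     jacobian (xcoord t) (ycoord t) (\<tau>1, \<tau>2) \<noteq> 0}"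

text \<open>
  \<open>F\<close>, regarded as a function of \<open>x\<close> and \<open>y\<close>, solves the system with parameter \<open>a\<close>: the pair
  \<open>(x, y)\<close> is a local coordinate system at generic points of \<open>\<Omega> \<times> \<Omega>\<close>, and near every such point
  \<open>F\<close> is \<open>G (x, y)\<close> for a holomorphic solution \<open>G\<close>.  The map \<open>(x, y)\<close> has no global inverse (it is
  symmetric in \<open>\<tau>1, \<tau>2\<close>, for instance); as it maps \<open>U\<close> bijectively to \<open>V\<close>, \<open>G\<close> is unique on \<open>V\<close>.
\<close>

definition solves_in_xy ::
  "real \<Rightarrow> (complex \<Rightarrow> complex) \<Rightarrow> complex set \<Rightarrow> (complex \<times> complex \<Rightarrow> complex) \<Rightarrow> bool"
  where "solves_in_xy a t \<Omega> F \<longleftrightarrow>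
    t holomorphic_on \<Omega> \<and> \<Omega> \<times> \<Omega> \<subseteq> closure (chart_points t \<Omega>) \<and>
    (\<forall>p \<in> chart_points t \<Omega>. \<exists>U V G.
       open U \<and> p \<in> U \<and> U \<subseteq> chart_points t \<Omega> \<and> open V \<and>
       bij_betw (\<lambda>z. (xcoord t z, ycoord t z)) U V \<and>
       holomorphic2_on G V \<and>
       (\<forall>z\<in>U. F z = G (xcoord t z, ycoord t z)) \<and>
       (\<forall>w\<in>V. pde_system a G w))"

definition coordinates_modular :: "(int ^ 2 ^ 2) set \<Rightarrow> (complex \<Rightarrow> complex) \<Rightarrow> bool" where
  "coordinates_modular \<Gamma> t \<longleftrightarrow>
     bimodular_function \<Gamma> \<Gamma> (\<lambda>(\<tau>1, \<tau>2). t \<tau>1) \<and> bimodular_function \<Gamma> \<Gamma> (\<lambda>(\<tau>1, \<tau>2). t \<tau>2) \<and>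
     bimodular_function \<Gamma> \<Gamma> (xcoord t) \<and> bimodular_function \<Gamma> \<Gamma> (ycoord t)"

text \<open>\<open>E_level2\<close> has zeros of odd order in the upper half-plane, so its square root is not
  single-valued there; \<open>E_level3\<close> has only zeros of even order.\<close>

definition t_level4 :: "complex \<Rightarrow> complex" where
  "t_level4 \<tau> = theta2 \<tau> ^ 4 / theta3 \<tau> ^ 4"

definition t_level3 :: "complex \<Rightarrow> complex" where
  "t_level3 \<tau> = - 27 * dedekind_eta (3 * \<tau>) ^ 12 / dedekind_eta \<tau> ^ 12"

definition t_level2 :: "complex \<Rightarrow> complex" where
  "t_level2 \<tau> = - 64 * dedekind_eta (2 * \<tau>) ^ 24 / dedekind_eta \<tau> ^ 24"

definition E_level3 :: "complex \<Rightarrow> complex" where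
  "E_level3 \<tau> = 3 * Eis2 (3 * \<tau>) - Eis2 \<tau>"

definition E_level2 :: "complex \<Rightarrow> complex" where
  "E_level2 \<tau> = 2 * Eis2 (2 * \<tau>) - Eis2 \<tau>"

end

theory Submission
  imports Defs
begin

text \<open>
  Let \<open>\<kappa> = t' / t\<close>.  For \<open>\<theta>\<^sub>j = t\<^sub>j d/dt\<^sub>j\<close> the operators \<open>D\<^sub>x\<close> and \<open>D\<^sub>y\<close> are combinations of
  \<open>\<theta>\<^sub>1\<close> and \<open>\<theta>\<^sub>2\<close> with rational coefficients in \<open>t\<^sub>1, t\<^sub>2\<close>, and a product \<open>u(\<tau>\<^sub>1) u(\<tau>\<^sub>2)\<close> solves the
  system as soon as \<open>\<theta>\<^sup>2 u = - a (1 - a) t / (t - 1)\<^sup>2 u\<close>.  For \<open>u = \<kappa>\<^bsup>1/2\<^esup>\<close> this is the Schwarzian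
  equation \<open>2 \<kappa> \<kappa>'' - 3 \<kappa>'\<^sup>2 = - 4 a (1 - a) t / (t - 1)\<^sup>2 \<kappa>\<^sup>4\<close>, and the branches of the roots
  do not matter: it suffices that \<open>F\<close> is continuous and \<open>F\<^sup>4\<close> is a constant multiple of
  \<open>(\<kappa>(\<tau>\<^sub>1) \<kappa>(\<tau>\<^sub>2))\<^sup>2\<close>.

  Up to the factor \<open>2 \<pi> \<i>\<close>, \<open>\<kappa>\<close> is \<open>\<theta>\<^sub>4\<^sup>4\<close>, half of \<open>E_level3\<close>, \<open>E_level2\<close> and a square root of \<open>E\<^sub>4\<close>,
  respectively, so the Schwarzian equation is a consequence of Ramanujan's differential equations
  and their analogues in levels 2, 3 and 4.  Those are identities between modular forms, obtained
  from a Liouville theorem for functions of \<open>q\<close> compatible with a Fricke involution.  The behaviour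
  of \<open>\<eta>\<close>, \<open>E\<^sub>2\<close> and \<open>E\<^sub>4\<close> under inversion follows by comparing the Weierstrass zeta functions of
  the lattice spanned by \<open>1\<close> and \<open>\<tau>\<close> with respect to the bases \<open>(1, \<tau>)\<close> and \<open>(\<tau>, -1)\<close>.
\<close>

section \<open>Lambert series and Euler's product\<close>

text \<open>The square root is forced: for theta = (1/\<open>\<kappa>\<close>) d/d\<tau> the
  functions \<open>\<kappa>\<close>^(1/2) and \<tau> \<open>\<kappa>\<close>^(1/2) have constant
  Wronskian, so they are the natural basis for an equation theta^2 u = Q u whose ratio of solutions
  is \<tau>. With Q as above the exponents are 0, 0 at t = 0 and at infinity, and a, 1 - a at t = 1;
  the solution regular at t = 0 is (1 - t)^a 2F1(a, a; 1; t). Translations together with the Fricke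
  involution gain height only if N/4 < 1; for N = 4 the point 1/2 is a third cusp. So the Liouville
  argument covers N <= 3, and level 4 is reached from level 2 at q and q^2 by factoring quadratic
  relations. Only the square of eta is inverted. The level 3 forms are odd powers of eta, hence
  accessible through quadratic monomials only, and identities of level 3 are raised to weight 6 by a
  weight 2 factor. In the differential system the product u1 u2 and its derivatives by theta1,
  theta2 and theta1 theta2 are treated as independent: the coefficient of each vanishes as a
  rational function of t1 and t2.\<close>

definition euler_prod :: "complex \<Rightarrow> complex" where
  "euler_prod q = (\<Prod>n. 1 - q ^ Suc n)"

definition lambert :: "nat \<Rightarrow> complex \<Rightarrow> complex" where
  "lambert k q = (\<Sum>n. of_nat (Suc n) ^ k * q ^ Suc n / (1 - q ^ Suc n))"

lemma norm_power_less_1: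
  fixes q :: complex
  assumes "norm q < 1"
  shows "norm (q ^ Suc n) < 1"
  using power_le_one[of "norm q" n] mult_left_mono[of "norm q ^ n" 1 "norm q"] assms
  by (simp add: norm_mult norm_power)

lemma one_minus_power_nz:
  fixes q :: complex
  assumes "norm q < 1"
  shows "1 - q ^ Suc n \<noteq> 0"
  using norm_power_less_1[OF assms, of n] by fastforce

lemma norm_one_minus_power_ge:
  fixes q :: complex
  assumes "norm q \<le> r" "r < 1"
  shows "norm (1 - q ^ Suc n) \<ge> 1 - r"
proof -
  have "norm (q ^ Suc n) \<le> r"
    using assms by (metis dual_order.trans norm_ge_zero norm_power power_Suc_le_self less_imp_le power_mono)
  moreover have "1 = norm ((1 - q ^ Suc n) + q ^ Suc n)" by simp
  ultimately show ?thesis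
    using norm_triangle_ineq[of "1 - q ^ Suc n" "q ^ Suc n"] by linarith
qed

lemma euler_prod_has_prod:
  assumes "norm q < 1"
  shows "convergent_prod (\<lambda>n. 1 - q ^ Suc n)" "(\<lambda>n. \<Prod>k<n. 1 - q ^ Suc k) \<longlonglongrightarrow> euler_prod q"
proof -
  have "summable (\<lambda>n. norm q ^ Suc n)"
    using assms by (subst summable_Suc_iff) (auto intro: summable_geometric)
  then have "summable (\<lambda>n. norm ((1 - q ^ Suc n) - 1))"
    by (simp add: norm_mult norm_power)
  then have "abs_convergent_prod (\<lambda>n. 1 - q ^ Suc n)"
    by (rule summable_imp_abs_convergent_prod)
  then show c: "convergent_prod (\<lambda>n. 1 - q ^ Suc n)"
    by (rule abs_convergent_prod_imp_convergent_prod)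
  have "(\<lambda>n. \<Prod>k\<le>n. 1 - q ^ Suc k) \<longlonglongrightarrow> euler_prod q"
    unfolding euler_prod_def by (rule convergent_prod_LIMSEQ[OF c])
  then show "(\<lambda>n. \<Prod>k<n. 1 - q ^ Suc k) \<longlonglongrightarrow> euler_prod q"
    using LIMSEQ_lessThan_iff_atMost by blast
qed

lemma euler_prod_nz:
  assumes "norm q < 1"
  shows "euler_prod q \<noteq> 0"
  unfolding euler_prod_def
  by (rule prodinf_nonzero[OF euler_prod_has_prod(1)[OF assms]]) (use one_minus_power_nz[OF assms] in auto)

lemma euler_prod_0: "euler_prod 0 = 1"
  by (simp add: euler_prod_def)

text \<open>Weierstrass test with |q^n| <= r^n. Uniformity on closed discs is what later gives both
  holomorphy and termwise logarithmic differentiation.\<close>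

lemma euler_prod_uniform_limit:
  assumes "0 \<le> r" "r < 1"
  shows "uniform_limit (cball 0 r) (\<lambda>n q. \<Prod>k<n. 1 - q ^ Suc k) euler_prod sequentially"
proof -
  have s: "summable (\<lambda>n. r ^ Suc n)"
    using assms by (subst summable_Suc_iff) (auto intro: summable_geometric)
  have "uniformly_convergent_on (cball 0 r) (\<lambda>N q. \<Sum>n<N. norm ((1 - q ^ Suc n) - 1 :: complex))"
    by (rule Weierstrass_m_test'[OF _ s]) (use assms in \<open>auto simp: norm_mult norm_power intro!: mult_mono power_mono\<close>)
  then have "uniformly_convergent_on (cball 0 r) (\<lambda>N q. \<Prod>n<N. (1 - q ^ Suc n :: complex))"
    by (intro uniformly_convergent_on_prod'[where f="\<lambda>n q. 1 - q ^ Suc n"]) (auto intro!: continuous_intros)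
  then obtain l :: "complex \<Rightarrow> complex"
    where l: "uniform_limit (cball 0 r) (\<lambda>n q. \<Prod>k<n. 1 - q ^ Suc k) l sequentially"
    by (auto simp: uniformly_convergent_on_def)
  have "l q = euler_prod q" if "q \<in> cball 0 r" for q
    using tendsto_uniform_limitI[OF l that] euler_prod_has_prod(2)[of q] that assms LIMSEQ_unique by auto
  then show ?thesis
    using l uniform_limit_cong'[of "cball 0 r" "\<lambda>n q. \<Prod>k<n. 1 - q ^ Suc k" "\<lambda>n q. \<Prod>k<n. 1 - q ^ Suc k" l euler_prod]
    by blast
qed

lemma local_cball_in_disc:
  assumes "x \<in> ball (0::complex) 1"
  shows "\<exists>d r. 0 < d \<and> r < 1 \<and> 0 \<le> r \<and> cball x d \<subseteq> cball 0 r \<and> cball x d \<subseteq> ball 0 1"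
proof -
  define d where "d = (1 - norm x) / 2"
  have d: "d > 0" "norm x + d < 1" using assms by (auto simp: d_def field_simps)
  have 1: "cball x d \<subseteq> cball 0 (norm x + d)"
    by (intro cball_subset_cball_iff[THEN iffD2]) simp
  moreover have "cball 0 (norm x + d) \<subseteq> ball (0::complex) 1" using d by auto
  ultimately have "cball x d \<subseteq> ball 0 1" by blast
  with 1 d show ?thesis by (intro exI[of _ d] exI[of _ "norm x + d"]) auto
qed

lemma euler_prod_holomorphic: "euler_prod holomorphic_on ball 0 1"
proof (rule holomorphic_uniform_sequence)
  fix x :: complex assume "x \<in> ball 0 1"
  then obtain d r where "0 < d" "0 \<le> r" "r < 1" "cball x d \<subseteq> cball 0 r" "cball x d \<subseteq> ball 0 1"
    using local_cball_in_disc by metis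
  then show "\<exists>d. 0 < d \<and> cball x d \<subseteq> ball 0 1 \<and>
     uniform_limit (cball x d) (\<lambda>n q. \<Prod>k<n. 1 - q ^ Suc k) euler_prod sequentially"
    using uniform_limit_on_subset[OF euler_prod_uniform_limit] by blast
qed (auto intro!: holomorphic_intros)

lemma lambert_term_bound:
  assumes "norm (q::complex) \<le> r" "r < 1"
  shows "norm (of_nat (Suc n) ^ k * q ^ m / (1 - q ^ Suc n)) \<le> real (Suc n) ^ k * r ^ m / (1 - r)"
proof -
  have r: "0 \<le> r" using assms norm_ge_zero order_trans by blast
  have "norm (q ^ m) \<le> r ^ m" using assms by (simp add: norm_power power_mono)
  then show ?thesis
    using norm_one_minus_power_ge[OF assms, of n] assms r
    unfolding norm_divide norm_mult norm_power norm_of_nat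
    by (intro frac_le mult_left_mono mult_nonneg_nonneg) auto
qed

text \<open>Induction on \<open>k\<close>: the series with coefficients n^k has the termwise
  derivative with coefficients (n+1)^(k+1), and termwise differentiation does not shrink the disc of
  convergence.\<close>

lemma summable_power_mult_geometric:
  fixes z :: "'a::{real_normed_field,banach}"
  assumes "norm z < 1"
  shows "summable (\<lambda>n. of_nat (Suc n) ^ k * z ^ n)"
  using assms
proof (induction k arbitrary: z)
  case (Suc k)
  have "summable (\<lambda>n. of_nat n ^ k * x ^ n)" if "norm x < 1" for x :: 'a
  proof -
    have "summable (\<lambda>n. x * (of_nat (Suc n) ^ k * x ^ n))"
      using Suc.IH[OF that] by (rule summable_mult)
    then have "summable (\<lambda>n. of_nat (Suc n) ^ k * x ^ Suc n)"
      by (simp add: mult_ac)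
    then show ?thesis by (subst (asm) summable_Suc_iff)
  qed
  then have "summable (\<lambda>n. diffs (\<lambda>n. of_nat n ^ k) n * z ^ n)"
    by (rule termdiff_converges[OF Suc.prems])
  then show ?case by (simp add: diffs_def)
qed (simp add: summable_geometric)

text \<open>The Lambert series with one factor \<open>q\<close> removed. It makes the behaviour at q
  = 0 accessible, where identities for q d/dq carry no information.\<close>

definition lambert' :: "nat \<Rightarrow> complex \<Rightarrow> complex" where
  "lambert' k q = (\<Sum>n. of_nat (Suc n) ^ k * q ^ n / (1 - q ^ Suc n))"

lemma lambert'_summable:
  fixes q :: complex
  assumes "norm q < 1"
  shows "summable (\<lambda>n. norm (of_nat (Suc n) ^ k * q ^ n / (1 - q ^ Suc n)))"
proof (rule summable_comparison_test')
  show "summable (\<lambda>n. real (Suc n) ^ k * norm q ^ n / (1 - norm q))"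
    using summable_power_mult_geometric[of "norm q" k] assms by (intro summable_divide) auto
qed (use lambert_term_bound[of q "norm q"] assms in auto)

lemma lambert_eq:
  assumes "norm q < 1"
  shows "lambert k q = q * lambert' k q"
  unfolding lambert_def lambert'_def
  by (subst suminf_mult[symmetric]) (use summable_norm_cancel[OF lambert'_summable[OF assms]] in \<open>auto simp: mult_ac\<close>)

lemma lambert'_holomorphic: "lambert' k holomorphic_on ball 0 1"
proof (rule holomorphic_uniform_sequence)
  fix x :: complex assume "x \<in> ball 0 1"
  then obtain d r where dr: "0 < d" "r < 1" "0 \<le> r" "cball x d \<subseteq> cball 0 r" "cball x d \<subseteq> ball 0 1"
    using local_cball_in_disc by metis
  have s: "summable (\<lambda>n. real (Suc n) ^ k * r ^ n / (1 - r))"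
    using summable_power_mult_geometric[of r k] dr by (intro summable_divide) auto
  have "uniform_limit (cball 0 r) (\<lambda>n q. \<Sum>i<n. of_nat (Suc i) ^ k * q ^ i / (1 - q ^ Suc i))
      (\<lambda>q. \<Sum>n. of_nat (Suc n) ^ k * q ^ n / (1 - q ^ Suc n :: complex)) sequentially"
    by (rule Weierstrass_m_test[OF _ s]) (use lambert_term_bound[of _ r] dr in auto)
  then show "\<exists>d. 0 < d \<and> cball x d \<subseteq> ball 0 1 \<and>
     uniform_limit (cball x d) (\<lambda>n q. \<Sum>i<n. of_nat (Suc i) ^ k * q ^ i / (1 - q ^ Suc i)) (lambert' k) sequentially"
    unfolding lambert'_def[abs_def]
    using uniform_limit_on_subset dr by blast
qed (use one_minus_power_nz in \<open>auto intro!: holomorphic_intros\<close>)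

lemma lambert'_0: "lambert' k 0 = 1"
proof -
  have "lambert' k 0 = (\<Sum>n\<in>{0}. of_nat (Suc n) ^ k * 0 ^ n / (1 - 0 ^ Suc n))"
    unfolding lambert'_def by (rule suminf_finite) auto
  then show ?thesis by simp
qed

lemma lambert_holomorphic: "lambert k holomorphic_on ball 0 1"
proof -
  have "(\<lambda>q. q * lambert' k q) holomorphic_on ball 0 1"
    by (intro holomorphic_intros lambert'_holomorphic)
  then show ?thesis
    by (rule holomorphic_transform) (auto simp: lambert_eq)
qed

text \<open>q d/dq log (1 - q^n) = - n q^n / (1 - q^n), and summing over n is legitimate by uniform
  convergence of the partial products. The sum is the Lambert series of E2, which is how E2 becomes
  the logarithmic derivative of eta.\<close>

lemma euler_prod_logderiv:
  assumes "norm q < 1"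
  shows "q * deriv euler_prod q = - lambert 1 q * euler_prod q"
proof -
  define r where "r = (1 + norm q) / 2"
  have r: "0 \<le> r" "r < 1" "norm q < r" using assms by (auto simp: r_def)
  have "uniform_limit (ball 0 r) (\<lambda>n q. \<Prod>k<n. 1 - q ^ Suc k) euler_prod sequentially"
    using uniform_limit_on_subset[OF euler_prod_uniform_limit[OF r(1,2)]] ball_subset_cball by blast
  then have "(\<lambda>k. deriv (\<lambda>q. 1 - q ^ Suc k) q / (1 - q ^ Suc k)) sums (deriv euler_prod q / euler_prod q)"
    by (rule logderiv_prodinf_complex_uniform_limit)
       (use r assms euler_prod_nz in \<open>auto intro!: holomorphic_intros\<close>)
  moreover have "deriv (\<lambda>q. 1 - q ^ Suc k) q = - of_nat (Suc k) * q ^ k" for k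
  proof (rule DERIV_imp_deriv)
    have "((\<lambda>q. 1 - q ^ Suc k) has_field_derivative 0 - of_nat (Suc k) * (1 * q ^ (Suc k - Suc 0))) (at q)"
      by (intro derivative_intros)
    then show "((\<lambda>q. 1 - q ^ Suc k) has_field_derivative - of_nat (Suc k) * q ^ k) (at q)"
      by (simp add: algebra_simps)
  qed
  ultimately have "(\<lambda>k. - (of_nat (Suc k) * q ^ k / (1 - q ^ Suc k))) sums (deriv euler_prod q / euler_prod q)"
    by (simp only: minus_divide_left minus_mult_left)
  then have "(\<lambda>k. of_nat (Suc k) * q ^ k / (1 - q ^ Suc k)) sums (- (deriv euler_prod q / euler_prod q))"
    by (metis (no_types, lifting) sums_minus sums_cong minus_minus)
  then have "lambert' 1 q = - (deriv euler_prod q / euler_prod q)"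
    unfolding lambert'_def by (simp add: sums_iff)
  then show ?thesis
    using lambert_eq[OF assms, of 1] euler_prod_nz[OF assms] by (simp add: field_simps)
qed

section \<open>Inversion of Eisenstein series and of the eta function\<close>

text \<open>The contribution of the positive multiples of \<tau> to the zeta function, as partial
  fractions: it makes sense for every \<open>w\<close>, while its expansion
  \<open>lambert_series\<close> in powers of \<open>w\<close> needs |q w| < 1.\<close>

definition geo :: "complex \<Rightarrow> complex \<Rightarrow> complex" where
  "geo q w = (\<Sum>n. q ^ Suc n * w / (1 - q ^ Suc n * w))"

text \<open>The term n = 0 is a division by 1 - q^0 = 0 and thus 0, also for j = 0; the sum is
  really over n >= 1.\<close>

definition lambert_series :: "complex \<Rightarrow> nat \<Rightarrow> complex \<Rightarrow> complex" where
  "lambert_series q j w = (\<Sum>n. (of_nat n ^ j * q ^ n / (1 - q ^ n)) * w ^ n)"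

lemma norm_power_mult_tendsto_0:
  fixes q w :: complex
  assumes "norm q < 1"
  shows "(\<lambda>n. norm (q ^ Suc n * w)) \<longlonglongrightarrow> 0"
proof -
  have "(\<lambda>n. norm (q * q ^ n * w)) \<longlonglongrightarrow> norm (q * 0 * w)"
    by (intro tendsto_mult tendsto_const tendsto_norm LIMSEQ_power_zero assms)
  then show ?thesis by (simp only: power_Suc) simp
qed

text \<open>As \<open>w\<close> is arbitrary, finitely many terms may be large; once |q^n w| < 1/2
  the denominators are at least 1/2 and a geometric series dominates. A pole contributes a term
  0.\<close>

lemma geo_summable:
  fixes q w :: complex
  assumes "norm q < 1"
  shows "summable (\<lambda>n. norm (q ^ Suc n * w / (1 - q ^ Suc n * w)))"
proof -
  have "\<forall>\<^sub>F n in sequentially. norm (q ^ Suc n * w) < 1/2"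
    using norm_power_mult_tendsto_0[OF assms] by (rule order_tendstoD) auto
  then obtain N where N: "\<And>n. n \<ge> N \<Longrightarrow> norm (q ^ Suc n * w) < 1/2"
    by (auto simp: eventually_sequentially)
  have "norm (norm (q ^ Suc n * w / (1 - q ^ Suc n * w))) \<le> 2 * norm w * norm q ^ Suc n" if "n \<ge> N" for n
  proof -
    have "1/2 \<le> norm (1 - q ^ Suc n * w)"
      using norm_triangle_ineq2[of 1 "q ^ Suc n * w"] N[OF that] by simp
    then have "norm (q ^ Suc n * w) / norm (1 - q ^ Suc n * w) \<le> norm (q ^ Suc n * w) / (1/2)"
      by (intro divide_left_mono) auto
    then show ?thesis by (simp add: norm_divide norm_mult norm_power mult_ac)
  qed
  moreover have "summable (\<lambda>n. 2 * norm w * norm q ^ Suc n)"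
    using assms by (intro summable_mult) (subst summable_Suc_iff, auto intro: summable_geometric)
  ultimately show ?thesis by (rule summable_comparison_test'[rotated])
qed

text \<open>This functional equation serves twice: it continues differentiability beyond |q w| < 1,
  and it produces the quasi-period of the zeta function.\<close>

lemma geo_split:
  assumes "norm q < 1"
  shows "geo q w = q * w / (1 - q * w) + geo q (q * w)"
proof -
  have "geo q w = (\<Sum>n. q ^ Suc (Suc n) * w / (1 - q ^ Suc (Suc n) * w)) + q ^ Suc 0 * w / (1 - q ^ Suc 0 * w)"
    unfolding geo_def
    by (subst suminf_split_head[OF summable_norm_cancel[OF geo_summable[OF assms, of w]]]) simp
  then show ?thesis by (simp add: geo_def mult_ac)
qed

lemma lambert_series_summable:
  fixes q w :: complex
  assumes "norm q < 1" "norm (q * w) < 1"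
  shows "summable (\<lambda>n. norm ((of_nat n ^ j * q ^ n / (1 - q ^ n)) * w ^ n))"
proof (subst summable_Suc_iff[symmetric], rule summable_comparison_test')
  show "summable (\<lambda>n. (real (Suc n) ^ j * norm (q * w) ^ n) * (norm (q * w) / (1 - norm q)))"
    using summable_power_mult_geometric[of "norm (q * w)" j] assms by (intro summable_mult2) auto
  fix n
  have "norm (of_nat (Suc n) ^ j * q ^ Suc n / (1 - q ^ Suc n)) * norm (w ^ Suc n) \<le>
    real (Suc n) ^ j * norm q ^ Suc n / (1 - norm q) * norm (w ^ Suc n)"
    using assms by (intro mult_right_mono lambert_term_bound) auto
  then show "norm (norm ((of_nat (Suc n) ^ j * q ^ Suc n / (1 - q ^ Suc n)) * w ^ Suc n)) \<le>
    (real (Suc n) ^ j * norm (q * w) ^ n) * (norm (q * w) / (1 - norm q))"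
    by (simp add: norm_mult norm_power norm_divide power_mult_distrib mult_ac)
qed

lemma lambert_series_1:
  assumes "norm q < 1"
  shows "lambert_series q j 1 = lambert j q"
  unfolding lambert_series_def lambert_def
  by (subst suminf_split_head) (use lambert_series_summable[of q 1 j] assms in \<open>auto intro: summable_norm_cancel\<close>)

lemma lambert_series_deriv:
  assumes "norm q < 1" "norm (q * w) < 1"
  shows "(lambert_series q j has_field_derivative
    (\<Sum>n. diffs (\<lambda>n. of_nat n ^ j * q ^ n / (1 - q ^ n)) n * w ^ n)) (at w)"
    "w * (\<Sum>n. diffs (\<lambda>n. of_nat n ^ j * q ^ n / (1 - q ^ n)) n * w ^ n) = lambert_series q (Suc j) w"
proof -
  \<comment> \<open>Differentiating a power series at \<open>w\<close> requires convergence at some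
    point \<open>K\<close> of larger modulus.\<close>
  have "\<exists>K. norm w < norm (K::complex) \<and> norm (q * K) < 1"
  proof (cases "q = 0")
    case True
    then show ?thesis by (intro exI[of _ "of_real (norm w + 1)"]) (auto simp: norm_of_real)
  next
    case False
    then have "norm w < 1 / norm q" using assms by (simp add: norm_mult field_simps)
    then obtain r where r: "norm w < r" "r < 1 / norm q" using dense by blast
    then have "r > 0" using norm_ge_zero le_less_trans by blast
    with r False show ?thesis
      by (intro exI[of _ "of_real r"]) (auto simp: norm_mult field_simps)
  qed
  then obtain K :: complex where K: "norm w < norm K" "norm (q * K) < 1" by blast
  show "(lambert_series q j has_field_derivative
    (\<Sum>n. diffs (\<lambda>n. of_nat n ^ j * q ^ n / (1 - q ^ n)) n * w ^ n)) (at w)"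
    unfolding lambert_series_def[abs_def]
    by (rule termdiffs_strong[OF summable_norm_cancel[OF lambert_series_summable[OF assms(1) K(2)]] K(1)])
  have s: "summable (\<lambda>n. of_nat n ^ Suc j * q ^ n / (1 - q ^ n) * w ^ n)"
    by (rule summable_norm_cancel[OF lambert_series_summable[OF assms]])
  have s': "summable (\<lambda>n. diffs (\<lambda>n. of_nat n ^ j * q ^ n / (1 - q ^ n)) n * w ^ n)"
  proof (rule termdiff_converges[OF K(1)])
    fix x :: complex assume "norm x < norm K"
    then have "norm (q * x) \<le> norm (q * K)" by (simp add: norm_mult mult_left_mono)
    with K show "summable (\<lambda>n. of_nat n ^ j * q ^ n / (1 - q ^ n) * x ^ n)"
      by (intro summable_norm_cancel[OF lambert_series_summable[OF assms(1)]]) auto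
  qed
  have "lambert_series q (Suc j) w = (\<Sum>n. of_nat (Suc n) ^ Suc j * q ^ Suc n / (1 - q ^ Suc n) * w ^ Suc n)"
    unfolding lambert_series_def by (subst suminf_split_head[OF s]) simp
  also have "\<dots> = (\<Sum>n. w * (diffs (\<lambda>n. of_nat n ^ j * q ^ n / (1 - q ^ n)) n * w ^ n))"
    by (simp add: diffs_def mult_ac)
  also have "\<dots> = w * (\<Sum>n. diffs (\<lambda>n. of_nat n ^ j * q ^ n / (1 - q ^ n)) n * w ^ n)"
    by (rule suminf_mult[OF s'])
  finally show "w * (\<Sum>n. diffs (\<lambda>n. of_nat n ^ j * q ^ n / (1 - q ^ n)) n * w ^ n) = lambert_series q (Suc j) w" ..
qed

text \<open>Each term is a geometric series in q^n w. The double series over (n, k) converges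
  absolutely, and summing over n first gives q^k / (1 - q^k) as the coefficient of w^k.\<close>

lemma geo_eq_lambert_series:
  assumes "norm q < 1" "norm (q * w) < 1"
  shows "geo q w = lambert_series q 0 w"
proof -
  define f where "f = (\<lambda>n k. (q ^ Suc n * w) ^ Suc k)"
  have y: "norm (q ^ Suc n * w) \<le> norm (q * w)" "norm (q ^ Suc n * w) < 1" for n
  proof -
    have "norm q ^ n * norm (q * w) \<le> 1 * norm (q * w)"
      using assms by (intro mult_right_mono power_le_one) auto
    then show "norm (q ^ Suc n * w) \<le> norm (q * w)" by (simp add: norm_mult norm_power mult_ac)
    with assms show "norm (q ^ Suc n * w) < 1" by simp
  qed
  have sum1: "(\<lambda>k. x ^ Suc k) sums (x / (1 - x))" if "norm x < 1" for x :: "'a::real_normed_field"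
    using sums_mult[OF geometric_sums[OF that], of x] by simp
  have n1: "((\<lambda>k. x ^ Suc k) has_sum (x / (1 - x))) UNIV" if "norm x < 1" for x :: "'a::{banach,real_normed_field}"
  proof (rule norm_summable_imp_has_sum[OF _ sum1[OF that]])
    have "(\<lambda>k. norm x ^ Suc k) sums (norm x / (1 - norm x))" using sum1[of "norm x"] that by simp
    then show "summable (\<lambda>n. norm (x ^ Suc n))" by (simp add: sums_iff norm_power norm_mult)
  qed
  have inner: "infsum (f n) UNIV = q ^ Suc n * w / (1 - q ^ Suc n * w)" for n
    unfolding f_def using n1[OF y(2)] infsumI by blast
  have inner_abs: "infsum (\<lambda>k. norm (f n k)) UNIV = norm (q ^ Suc n * w) / (1 - norm (q ^ Suc n * w))" for n
    unfolding f_def norm_power using n1[of "norm (q ^ Suc n * w)"] y(2) infsumI by fastforce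
  have swap: "f n k = w ^ Suc k * (q ^ Suc k) ^ Suc n" for n k
    unfolding f_def power_mult_distrib power_mult[symmetric] by (simp only: mult.commute)
  have inner2: "infsum (\<lambda>n. f n k) UNIV = w ^ Suc k * (q ^ Suc k / (1 - q ^ Suc k))" for k
    unfolding swap using n1[OF norm_power_less_1[OF assms(1), of k]]
    by (intro infsumI has_sum_cmult_right) blast
  have abs: "(\<lambda>x. norm (case x of (n, k) \<Rightarrow> f n k)) summable_on UNIV \<times> UNIV"
  proof (rule Infinite_Sum.abs_summable_on_Sigma_iff[THEN iffD2], intro conjI ballI)
    fix n
    show "(\<lambda>k. norm (case (n, k) of (n, k) \<Rightarrow> f n k)) summable_on UNIV"
      unfolding f_def using n1[of "norm (q ^ Suc n * w)"] y(2)
      by (auto simp: norm_power summable_on_def norm_mult)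
  next
    have "norm (norm (infsum (\<lambda>k. norm (f n k)) UNIV)) \<le> norm (q ^ Suc n * w) / (1 - norm (q * w))" for n
      unfolding inner_abs using y[of n] assms by (auto intro!: divide_left_mono simp: abs_divide)
    moreover have "summable (\<lambda>n. norm (q ^ Suc n * w) / (1 - norm (q * w)))"
    proof -
      have "summable (\<lambda>n. (norm q ^ Suc n) * (norm w / (1 - norm (q * w))))"
        using assms by (intro summable_mult2) (subst summable_Suc_iff, auto intro: summable_geometric)
      then show ?thesis by (simp add: norm_mult norm_power mult_ac)
    qed
    ultimately have "summable (\<lambda>n. norm (infsum (\<lambda>k. norm (f n k)) UNIV))"
      by (rule summable_comparison_test'[rotated])
    then show "(\<lambda>n. norm (\<Sum>\<^sub>\<infinity>k. norm (case (n, k) of (n, k) \<Rightarrow> f n k))) summable_on UNIV"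
      by (simp add: summable_on_UNIV_nonneg_real_iff)
  qed
  then have "(\<lambda>(n, k). f n k) summable_on UNIV \<times> UNIV"
    by (rule abs_summable_summable)
  then have "(\<Sum>\<^sub>\<infinity>n. infsum (f n) UNIV) = (\<Sum>\<^sub>\<infinity>k. infsum (\<lambda>n. f n k) UNIV)"
    by (rule infsum_swap_banach)
  then have "(\<Sum>\<^sub>\<infinity>n. q ^ Suc n * w / (1 - q ^ Suc n * w)) = (\<Sum>\<^sub>\<infinity>k. w ^ Suc k * (q ^ Suc k / (1 - q ^ Suc k)))"
    unfolding inner inner2 .
  moreover have "(\<Sum>\<^sub>\<infinity>n. q ^ Suc n * w / (1 - q ^ Suc n * w)) = geo q w"
    unfolding geo_def using norm_summable_imp_has_sum[OF geo_summable[OF assms(1), of w]]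
      summable_norm_cancel[OF geo_summable[OF assms(1), of w]] by (meson infsumI summable_sums)
  moreover have "(\<Sum>\<^sub>\<infinity>k. w ^ Suc k * (q ^ Suc k / (1 - q ^ Suc k))) = lambert_series q 0 w"
  proof -
    have s: "summable (\<lambda>n. norm ((q ^ n / (1 - q ^ n)) * w ^ n))"
      using lambert_series_summable[OF assms, of 0] by simp
    have s2: "summable (\<lambda>n. norm (w ^ Suc n * (q ^ Suc n / (1 - q ^ Suc n))))"
      using s by (subst (asm) summable_Suc_iff[symmetric]) (simp add: mult_ac)
    have "lambert_series q 0 w = (\<Sum>k. w ^ Suc k * (q ^ Suc k / (1 - q ^ Suc k)))"
      unfolding lambert_series_def using summable_norm_cancel[OF s]
      by (subst suminf_split_head) (auto simp: mult_ac)
    moreover have "(\<Sum>\<^sub>\<infinity>k. w ^ Suc k * (q ^ Suc k / (1 - q ^ Suc k))) = (\<Sum>k. w ^ Suc k * (q ^ Suc k / (1 - q ^ Suc k)))"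
      using norm_summable_imp_has_sum[OF s2] summable_norm_cancel[OF s2] by (meson infsumI summable_sums)
    ultimately show ?thesis by simp
  qed
  ultimately show ?thesis by simp
qed

text \<open>Where |q w| < 1 the power series is differentiable. Elsewhere \<open>geo_split\<close>
  reduces the claim at \<open>w\<close> to that at \<open>q * w\<close>, and finitely many
  multiplications by \<open>q\<close> reach the disc.\<close>

lemma geo_field_differentiable:
  assumes "norm q < 1" "\<And>n. q ^ Suc n * w \<noteq> 1"
  shows "geo q field_differentiable at w"
proof -
  have base: "geo q field_differentiable at w" if "norm (q * w) < 1" for w
  proof -
    have op: "open {w. norm (q * w) < 1}" by (intro open_Collect_less continuous_intros)
    have "\<forall>\<^sub>F w in nhds w. geo q w = lambert_series q 0 w"
      unfolding eventually_nhds
      by (rule exI[of _ "{w. norm (q * w) < 1}"]) (use op that geo_eq_lambert_series[OF assms(1)] in simp)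
    moreover have "lambert_series q 0 field_differentiable at w"
      unfolding field_differentiable_def by (rule exI, rule lambert_series_deriv(1)[OF assms(1) that])
    ultimately show ?thesis
      unfolding field_differentiable_def by (subst DERIV_cong_ev[OF refl _ refl])
  qed
  have ind: "norm (q ^ Suc N * w) < 1 \<Longrightarrow> (\<And>n. q ^ Suc n * w \<noteq> 1) \<Longrightarrow> geo q field_differentiable at w" for N w
  proof (induction N arbitrary: w)
    case 0 then show ?case using base by simp
  next
    case (Suc N)
    have "norm (q ^ Suc N * (q * w)) < 1" using Suc.prems(1) by (simp add: mult_ac)
    moreover have "q ^ Suc n * (q * w) \<noteq> 1" for n using Suc.prems(2)[of "Suc n"] by (simp add: mult_ac)
    ultimately have "geo q field_differentiable at (q * w)" by (rule Suc.IH)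
    then have 1: "(geo q \<circ> (\<lambda>w. q * w)) field_differentiable at w"
      by (intro field_differentiable_compose field_differentiable_mult field_differentiable_const field_differentiable_ident)
    have "(\<lambda>w. q * w / (1 - q * w) + (geo q \<circ> (\<lambda>w. q * w)) w) field_differentiable at w"
    proof (rule field_differentiable_add[OF _ 1])
      have "1 - q * w \<noteq> 0" using Suc.prems(2)[of 0] by simp
      moreover have "(\<lambda>w. q * w) field_differentiable at w"
        by (intro field_differentiable_mult field_differentiable_const field_differentiable_ident)
      ultimately show "(\<lambda>w. q * w / (1 - q * w)) field_differentiable at w"
        by (intro field_differentiable_divide field_differentiable_diff field_differentiable_const)
    qed
    moreover have "(\<lambda>w. q * w / (1 - q * w) + (geo q \<circ> (\<lambda>w. q * w)) w) = geo q"
      by (rule ext) (simp add: geo_split[OF assms(1), symmetric])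
    ultimately show ?case by simp
  qed
  obtain N where N: "norm (q ^ Suc N * w) < 1"
  proof -
    have "\<forall>\<^sub>F n in sequentially. norm (q ^ Suc n * w) < 1"
      using norm_power_mult_tendsto_0[OF assms(1)] by (rule order_tendstoD) auto
    then obtain N where "\<forall>n\<ge>N. norm (q ^ Suc n * w) < 1" unfolding eventually_sequentially ..
    then show ?thesis using that[of N] by blast
  qed
  show ?thesis by (rule ind[OF N assms(2)])
qed

text \<open>For \<open>w = exp (2 \<pi> \<i> z)\<close> this is the Weierstrass zeta function of the lattice spanned by \<open>1\<close>
  and \<open>\<tau>\<close>, rescaled and made 1-periodic by a linear term.\<close>

definition weier_zeta :: "complex \<Rightarrow> complex \<Rightarrow> complex" where
  "weier_zeta q w = 1/2 * (1 + w) / (1 - w) + geo q w - geo q (1 / w)"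

text \<open>Telescoping: passing from \<open>w\<close> to \<open>q * w\<close> loses the term qw/(1
  - qw) of the first sum and puts 1/(w - 1) into the second. The rational summand is normalised so
  that each of the two exchanges leaves 1/2.\<close>

lemma weier_zeta_shift:
  assumes "norm q < 1" "q \<noteq> 0" "w \<noteq> 0" "w \<noteq> 1" "q * w \<noteq> 1"
  shows "weier_zeta q (q * w) = weier_zeta q w + 1"
proof -
  have 1: "geo q (q * w) = geo q w - q * w / (1 - q * w)"
    using geo_split[OF assms(1), of w] by simp
  have 2: "geo q (1 / (q * w)) = (1 / w) / (1 - 1 / w) + geo q (1 / w)"
    using geo_split[OF assms(1), of "1 / (q * w)"] assms by simp
  have 3: "(1 / w) / (1 - 1 / w) = 1 / (w - 1)"
    using assms by (simp add: field_simps)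
  have "1/2 * (1 + q * w) / (1 - q * w) - q * w / (1 - q * w) = (1/2 * (1 - q * w)) / (1 - q * w)"
    unfolding diff_divide_distrib[symmetric] by (rule arg_cong[of _ _ "\<lambda>x. x / _"]) (simp add: field_simps)
  then have X: "1/2 * (1 + q * w) / (1 - q * w) = 1/2 + q * w / (1 - q * w)"
    using assms by (simp add: diff_eq_eq)
  have R: "1 / (w - 1) = - 1/2 - 1/2 * (1 + w) / (1 - w)"
    using assms by (simp add: divide_simps)
  show ?thesis
    unfolding weier_zeta_def 1 2 3 X R by simp
qed

section \<open>The nome and the period lattice\<close>

lemma qq_eq: "qq z = exp (2 * of_real pi * \<i> * z)"
  by (simp add: qpow_def)

lemma qq_nz [simp]: "qq z \<noteq> 0"
  by (simp add: qq_eq)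

lemma qq_add: "qq (z + w) = qq z * qq w"
  by (simp add: qq_eq exp_add[symmetric] algebra_simps)

lemma qq_minus: "qq (- z) = 1 / qq z"
  by (simp add: qq_eq exp_minus field_simps)

lemma qq_mult_of_nat: "qq (of_nat n * z) = qq z ^ n"
  by (simp add: qq_eq exp_of_nat_mult[symmetric] algebra_simps)

lemma qq_eq_1_iff: "qq z = 1 \<longleftrightarrow> z \<in> \<int>"
proof
  assume "qq z = 1"
  then obtain n :: int where n: "Re (2 * of_real pi * \<i> * z) = 0" "Im (2 * of_real pi * \<i> * z) = of_int (2 * n) * pi"
    unfolding qq_eq exp_eq_1 by auto
  then have "Im z = 0" "Re z = of_int n" by auto
  then have "z = of_int n" by (simp add: complex_eq_iff)
  then show "z \<in> \<int>" by simp
next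
  assume "z \<in> \<int>"
  then obtain n :: int where "z = of_int n" by (auto elim: Ints_cases)
  then show "qq z = 1"
    using exp_integer_2pi[of "of_int n"] by (simp add: qq_eq mult_ac)
qed

lemma qq_1 [simp]: "qq 1 = 1"
  by (simp add: qq_eq_1_iff)

lemma norm_qq: "norm (qq z) = exp (- 2 * pi * Im z)"
  by (simp add: qq_eq norm_exp_eq_Re)

lemma norm_qq_less_1: "\<tau> \<in> UHP \<Longrightarrow> norm (qq \<tau>) < 1"
  by (simp add: norm_qq UHP_def)

lemma qq_field_derivative [derivative_intros]:
  assumes "(f has_field_derivative f') (at z within S)"
  shows "((\<lambda>z. qq (f z)) has_field_derivative (2 * of_real pi * \<i> * f' * qq (f z))) (at z within S)"
  unfolding qq_eq using assms by (auto intro!: derivative_eq_intros)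

lemma qq_holomorphic [holomorphic_intros]:
  "f holomorphic_on S \<Longrightarrow> (\<lambda>z. qq (f z)) holomorphic_on S"
  unfolding qq_eq by (intro holomorphic_intros)

text \<open>Integrality of the two real coordinates in the basis (1, \<tau>), rather than a set of
  combinations: this form exhibits the lattice as an intersection of preimages of the integers,
  hence as closed.\<close>

definition lat :: "complex \<Rightarrow> complex set" where
  "lat \<tau> = {z. Im z / Im \<tau> \<in> \<int> \<and> Re z - Im z / Im \<tau> * Re \<tau> \<in> \<int>}"

lemma lat_altdef:
  assumes "Im \<tau> \<noteq> 0"
  shows "lat \<tau> = {of_int m + of_int n * \<tau> | m n. True}"
proof safe
  fix z assume "z \<in> lat \<tau>"
  then have *: "Im z / Im \<tau> \<in> \<int>" "Re z - Im z / Im \<tau> * Re \<tau> \<in> \<int>" by (auto simp: lat_def)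
  obtain m n where "Im z / Im \<tau> = of_int n" "Re z - Im z / Im \<tau> * Re \<tau> = of_int m"
    using Ints_cases[OF *(1)] Ints_cases[OF *(2)] by metis
  with assms have "z = of_int m + of_int n * \<tau>"
    by (simp add: complex_eq_iff field_simps)
  then show "\<exists>m n. z = of_int m + of_int n * \<tau> \<and> True" by blast
next
  fix m n show "of_int m + of_int n * \<tau> \<in> lat \<tau>"
    using assms by (simp add: lat_def)
qed

lemma closed_lat:
  assumes "Im \<tau> \<noteq> 0" shows "closed (lat \<tau>)"
proof -
  have "lat \<tau> = (\<lambda>z. Im z / Im \<tau>) -` \<int> \<inter> (\<lambda>z. Re z - Im z / Im \<tau> * Re \<tau>) -` \<int>"
    by (auto simp: lat_def)
  moreover have "closed \<dots>"
    using assms by (intro closed_Int closed_vimage closed_Ints continuous_intros) auto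
  ultimately show ?thesis by simp
qed

lemma lat_add_1:
  assumes "Im \<tau> \<noteq> 0" shows "z + 1 \<in> lat \<tau> \<longleftrightarrow> z \<in> lat \<tau>"
  using Ints_add[of "Re z - Im z / Im \<tau> * Re \<tau>" 1] Ints_diff[of "Re z + 1 - Im z / Im \<tau> * Re \<tau>" 1]
  by (auto simp: lat_def algebra_simps)

lemma lat_add_tau:
  assumes "Im \<tau> \<noteq> 0" shows "z + \<tau> \<in> lat \<tau> \<longleftrightarrow> z \<in> lat \<tau>"
  using Ints_add[of "Im z / Im \<tau>" 1] Ints_diff[of "Im z / Im \<tau> + 1" 1] assms
  by (auto simp: lat_def algebra_simps add_divide_distrib)

lemma lat_uminus: "- z \<in> lat \<tau> \<longleftrightarrow> z \<in> lat \<tau>"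
proof -
  have "- x \<in> \<int> \<longleftrightarrow> x \<in> \<int>" for x :: real by simp
  from this[of "Re z - Im z / Im \<tau> * Re \<tau>"] this[of "Im z / Im \<tau>"] show ?thesis
    by (simp add: lat_def algebra_simps)
qed

text \<open>Division by \<tau> turns 1 and \<tau> into 1/\<tau> and 1, up to sign and order the
  standard basis of the lattice of -1/\<tau>.\<close>

lemma lat_inversion:
  assumes "Im \<tau> \<noteq> 0" shows "z / \<tau> \<in> lat (-1 / \<tau>) \<longleftrightarrow> z \<in> lat \<tau>"
proof -
  have t: "\<tau> \<noteq> 0" using assms by auto
  then have "Im (-1 / \<tau>) \<noteq> 0" using assms by (simp add: Im_divide power2_eq_square[symmetric] sum_power2_eq_zero_iff)
  then have 1: "z / \<tau> \<in> lat (-1 / \<tau>) \<longleftrightarrow> (\<exists>m n. z / \<tau> = of_int m + of_int n * (-1 / \<tau>))"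
    by (simp add: lat_altdef)
  have 2: "z / \<tau> = of_int m + of_int n * (-1 / \<tau>) \<longleftrightarrow> z = of_int (- n) + of_int m * \<tau>" for m n
    using t by (auto simp: field_simps)
  show ?thesis
    unfolding 1 2 lat_altdef[OF assms] mem_Collect_eq by (metis minus_minus)
qed

text \<open>q^n w = 1 means that n \<tau> + z is an integer. Off the lattice all denominators of the
  zeta function are therefore nonzero; for its second sum this is applied to -z.\<close>

lemma lat_qq_power:
  assumes "\<tau> \<in> UHP" "z \<notin> lat \<tau>"
  shows "qq \<tau> ^ n * qq z \<noteq> 1"
proof
  assume "qq \<tau> ^ n * qq z = 1"
  then have "qq (of_nat n * \<tau> + z) = 1" by (simp add: qq_add qq_mult_of_nat)
  then obtain m where "of_nat n * \<tau> + z = of_int m" by (auto simp: qq_eq_1_iff elim!: Ints_cases)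
  then have "z = of_int m + of_int (- int n) * \<tau>" by (simp add: algebra_simps eq_neg_iff_add_eq_0)
  then have "z \<in> lat \<tau>" using assms(1) by (subst lat_altdef) (auto simp: UHP_def simp del: of_int_minus)
  with assms show False by simp
qed

definition zf :: "complex \<Rightarrow> complex \<Rightarrow> complex" where
  "zf \<tau> z = weier_zeta (qq \<tau>) (qq z)"

lemma zf_add_1: "zf \<tau> (z + 1) = zf \<tau> z"
  by (simp add: zf_def qq_add)

lemma zf_add_tau:
  assumes "\<tau> \<in> UHP" "z \<notin> lat \<tau>"
  shows "zf \<tau> (z + \<tau>) = zf \<tau> z + 1"
  using weier_zeta_shift[of "qq \<tau>" "qq z"] assms norm_qq_less_1 lat_qq_power[OF assms, of 0] lat_qq_power[OF assms, of 1]
  by (simp add: zf_def qq_add mult.commute)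

lemma zf_diff_tau:
  assumes "\<tau> \<in> UHP" "z \<notin> lat \<tau>"
  shows "zf \<tau> (z - \<tau>) = zf \<tau> z - 1"
  using zf_add_tau[of \<tau> "z - \<tau>"] lat_add_tau[of \<tau> "z - \<tau>"] assms by (simp add: UHP_def)

lemma qq_field_differentiable: "qq field_differentiable at z"
  unfolding field_differentiable_def using qq_field_derivative[OF DERIV_ident] by blast

lemma zf_field_differentiable:
  assumes "\<tau> \<in> UHP" "z \<notin> lat \<tau>"
  shows "zf \<tau> field_differentiable at z"
proof -
  have n: "norm (qq \<tau>) < 1" using norm_qq_less_1 assms by blast
  have 1: "qq \<tau> ^ Suc n * qq z \<noteq> 1" for n by (rule lat_qq_power[OF assms])
  have 2: "qq \<tau> ^ Suc n * qq (- z) \<noteq> 1" for n using lat_qq_power[OF assms(1), of "- z"] assms(2) lat_uminus by blast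
  have 3: "1 - qq z \<noteq> 0" using lat_qq_power[OF assms, of 0] by simp
  have "(\<lambda>z. 1/2 * (1 + qq z) / (1 - qq z) + (geo (qq \<tau>) \<circ> qq) z - (geo (qq \<tau>) \<circ> (\<lambda>z. qq (- z))) z) field_differentiable at z"
    by (intro field_differentiable_diff field_differentiable_add field_differentiable_divide field_differentiable_mult
       field_differentiable_const qq_field_differentiable field_differentiable_compose geo_field_differentiable[OF n 1]
       geo_field_differentiable[OF n 2] 3 field_differentiable_compose[of "\<lambda>z. - z" _ qq, unfolded o_def] field_differentiable_minus field_differentiable_ident)
  then show ?thesis
    by (simp add: zf_def[abs_def] weier_zeta_def qq_minus o_def)
qed

text \<open>The Taylor coefficients of \<open>coth0\<close>, up to signs Bernoulli numbers, come from the
  differential equation \<open>C' = C\<^sup>2 - 1/4\<close> of \<open>C = (1 + e\<^sup>u) / (2 (1 - e\<^sup>u))\<close>.\<close>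

lemma exp_neq_1_ball:
  assumes "u \<in> ball (0::complex) 1 - {0}"
  shows "exp u \<noteq> 1"
proof
  assume "exp u = 1"
  then obtain n :: int where n: "Re u = 0" "Im u = of_int (2 * n) * pi" unfolding exp_eq_1 by auto
  have "\<bar>Im u\<bar> < 1" using assms abs_Im_le_cmod[of u] by (simp del: Im_eq_0)
  then have "\<bar>of_int n\<bar> * (2 * pi) < 1" using n by (simp add: abs_mult)
  moreover have "n \<noteq> 0" using n assms by (auto simp: complex_eq_iff)
  then have "1 \<le> \<bar>real_of_int n\<bar>" by linarith
  then have "1 * (2 * pi) \<le> \<bar>of_int n\<bar> * (2 * pi)" by (intro mult_right_mono) auto
  ultimately show False using pi_ge_two by linarith
qed

lemma coth0_exists:
  "\<exists>m. m holomorphic_on ball 0 1 \<and> m 0 = 0 \<and> deriv m 0 = -1/12 \<and> (deriv ^^ 3) m 0 = 1/120 \<and>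
     (\<forall>u\<in>ball 0 1 - {0}. m u = 1/2 * (1 + exp u) / (1 - exp u) + 1 / u)"
proof -
  define k where "k = (\<lambda>u::complex. 1/2 * (1 + exp u) / (1 - exp u) + 1 / u)"
  have nz: "1 - exp u \<noteq> 0" if "u \<in> ball 0 1 - {0}" for u :: complex
    using exp_neq_1_ball[OF that] by simp
  have k_holo: "k holomorphic_on ball 0 1 - {0}"
    unfolding k_def using nz by (intro holomorphic_intros) auto
  have "(exp has_field_derivative 1) (at (0::complex))" using DERIV_exp[of 0] by simp
  then have e1: "((\<lambda>u. (exp u - 1) / u) \<longlongrightarrow> (1::complex)) (at 0)"
    by (simp add: has_field_derivative_iff)
  have "((\<lambda>u::complex. - (1/2 * (1 + exp u) / ((exp u - 1) / u)) + 1) \<longlongrightarrow> - (1/2 * (1 + exp 0) / 1) + 1) (at 0)"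
    using e1 by (intro tendsto_intros) auto
  moreover have "\<forall>\<^sub>F u in at 0. - (1/2 * (1 + exp u) / ((exp u - 1) / u)) + 1 = (u - 0) * k u"
  proof -
    have "- (1/2 * (1 + exp u) / ((exp u - 1) / u)) + 1 = (u - 0) * k u" if "u \<in> ball 0 1 - {0}" for u :: complex
      using exp_neq_1_ball[OF that] that unfolding k_def by (simp add: divide_simps) (simp add: algebra_simps)
    then show ?thesis
      by (auto simp: eventually_at intro!: exI[of _ 1])
  qed
  ultimately have "((\<lambda>u. (u - 0) * k u) \<longlongrightarrow> 0) (at 0)"
    by (simp add: tendsto_cong)
  then obtain m where m: "m holomorphic_on ball 0 1" "\<And>u. u \<in> ball 0 1 - {0} \<Longrightarrow> m u = k u"
    using holomorphic_on_extend_lim[OF k_holo] by auto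
  \<comment> \<open>Oddness gives \<open>m 0 = 0\<close> by continuity, which also settles the
    differential equation below at u = 0.\<close>
  have odd: "k (- u) = - k u" if "u \<in> ball 0 1 - {0}" for u
    using exp_neq_1_ball[OF that] that unfolding k_def by (simp add: exp_minus divide_simps) (simp add: algebra_simps)
  have m_cont: "continuous_on (ball 0 1) m" using m(1) by (rule holomorphic_on_imp_continuous_on)
  have "(m \<longlongrightarrow> m 0) (at 0)" using m_cont by (simp add: continuous_on_def at_within_open[of _ "ball 0 1"])
  then have "isCont m (- 0)" by (simp add: isCont_def)
  then have "((\<lambda>u. m (- u)) \<longlongrightarrow> m (- 0)) (at 0)"
    by (rule isCont_tendsto_compose) (intro tendsto_intros)
  then have "((\<lambda>u. m (- u)) \<longlongrightarrow> m 0) (at 0)" by simp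
  moreover have "((\<lambda>u. m (- u)) \<longlongrightarrow> - m 0) (at 0)"
  proof (rule Lim_transform_eventually)
    show "((\<lambda>u. - m u) \<longlongrightarrow> - m 0) (at 0)" using \<open>(m \<longlongrightarrow> m 0) (at 0)\<close> by (rule tendsto_minus)
    show "\<forall>\<^sub>F u in at 0. - m u = m (- u)"
      unfolding eventually_at by (intro exI[of _ 1]) (use m(2) odd in auto)
  qed
  ultimately have "m 0 = - m 0" using tendsto_unique[OF trivial_limit_at] by blast
  then have m0: "m 0 = 0" by simp
  \<comment> \<open>Substituting C = m - 1/u into C' = C^2 - 1/4: the double poles cancel, and the
    factor u clears the remaining 2m/u.\<close>
  have ode: "u * deriv m u + 2 * m u = u * m u ^ 2 - 1/4 * u" if "u \<in> ball 0 1" for u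
  proof (cases "u = 0")
    case False
    then have u: "u \<in> ball 0 1 - {0}" using that by simp
    have "(k has_field_derivative ((1/2 * exp u) * (1 - exp u) - (1/2 * (1 + exp u)) * (- exp u)) / ((1 - exp u) * (1 - exp u))
        + (0 * u - 1 * 1) / (u * u)) (at u)"
      unfolding k_def by (rule DERIV_add[OF DERIV_divide DERIV_divide])
        (use nz[OF u] False in \<open>auto intro!: derivative_eq_intros\<close>)
    moreover have "((1/2 * exp u) * (1 - exp u) - (1/2 * (1 + exp u)) * (- exp u)) / ((1 - exp u) * (1 - exp u))
        + (0 * u - 1 * 1) / (u * u) = exp u / (1 - exp u) ^ 2 - 1 / u ^ 2"
    proof -
      have "(1/2 * exp u) * (1 - exp u) - (1/2 * (1 + exp u)) * (- exp u) = exp u" by (simp add: field_simps)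
      then show ?thesis by (simp add: power2_eq_square)
    qed
    ultimately have "(k has_field_derivative (exp u / (1 - exp u) ^ 2 - 1 / u ^ 2)) (at u)" by (simp only:)
    moreover have "deriv m u = deriv k u"
    proof (rule deriv_cong_ev)
      show "\<forall>\<^sub>F x in nhds u. m x = k x"
        unfolding eventually_nhds by (rule exI[of _ "ball 0 1 - {0}"]) (use u m(2) in \<open>auto intro: open_Diff\<close>)
    qed simp
    ultimately have d: "deriv m u = exp u / (1 - exp u) ^ 2 - 1 / u ^ 2"
      using DERIV_imp_deriv by simp
    show ?thesis
      unfolding d m(2)[OF u] k_def using nz[OF u] False
      by (simp add: divide_simps power2_eq_square) (simp add: algebra_simps)
  qed (simp add: m0)
  define F where "F = fps_expansion m 0"
  have F: "m has_fps_expansion F"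
    unfolding F_def by (rule has_fps_expansion_fps_expansion[of "ball 0 1"]) (use m in auto)
  have 1: "(\<lambda>u. u * deriv m u + 2 * m u) has_fps_expansion fps_X * fps_deriv F + fps_const 2 * F"
    by (intro has_fps_expansion_add has_fps_expansion_mult has_fps_expansion_deriv has_fps_expansion_fps_X has_fps_expansion_const F)
  have 2: "(\<lambda>u. u * m u ^ 2 - 1/4 * u) has_fps_expansion fps_X * F ^ 2 - fps_const (1/4) * fps_X"
    by (intro has_fps_expansion_diff has_fps_expansion_mult has_fps_expansion_power has_fps_expansion_fps_X has_fps_expansion_const F)
  have "\<forall>\<^sub>F u in nhds 0. u * deriv m u + 2 * m u = u * m u ^ 2 - 1/4 * u"
    using ode by (auto simp: eventually_nhds intro!: exI[of _ "ball 0 1"])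
  from has_fps_expansion_cong[OF this refl] 1 have "(\<lambda>u. u * m u ^ 2 - 1/4 * u) has_fps_expansion fps_X * fps_deriv F + fps_const 2 * F"
    by blast
  from fps_expansion_unique_complex[OF this 2]
  have eq: "fps_X * fps_deriv F + fps_const 2 * F = fps_X * F ^ 2 - fps_const (1/4) * fps_X" .
  \<comment> \<open>The coefficient of u^(n+1): the derivative contributes the factor n + 1 and the
    term 2m another 2. This recursion yields the coefficients up to u^3.\<close>
  have c: "of_nat (n + 3) * fps_nth F (n + 1) = fps_nth (F ^ 2) n - (if n = 0 then 1/4 else 0)" for n
    using arg_cong[OF eq, of "\<lambda>f. fps_nth f (n + 1)"] by (simp add: algebra_simps split: if_splits)
  have F0: "fps_nth F 0 = 0" using fps_nth_fps_expansion[OF F, of 0] m0 by simp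
  have F1: "fps_nth F 1 = -1/12"
  proof -
    have "3 * fps_nth F 1 = 3 * (-1/12)" using c[of 0] F0 by (simp add: power2_eq_square)
    then show ?thesis by (subst (asm) mult_left_cancel) simp_all
  qed
  have F2: "fps_nth F 2 = 0"
    using c[of 1] F0 by (simp add: power2_eq_square fps_mult_nth numeral_2_eq_2)
  have F3: "fps_nth F 3 = 1/720"
  proof -
    have "5 * fps_nth F 3 = 5 * (1/720)"
      using c[of 2] F0 F1 F2 by (simp add: power2_eq_square fps_mult_nth numeral_2_eq_2 numeral_3_eq_3)
    then show ?thesis by (subst (asm) mult_left_cancel) simp_all
  qed
  have "deriv m 0 = -1/12" using fps_nth_fps_expansion[OF F, of 1] F1 by simp
  moreover have "(deriv ^^ 3) m 0 = 1/120" using fps_nth_fps_expansion[OF F, of 3] F3 by (simp add: fact_numeral)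
  ultimately show ?thesis using m m0 unfolding k_def by blast
qed

definition coth0 :: "complex \<Rightarrow> complex" where
  "coth0 = (SOME m. m holomorphic_on ball 0 1 \<and> m 0 = 0 \<and> deriv m 0 = -1/12 \<and> (deriv ^^ 3) m 0 = 1/120 \<and>
     (\<forall>u\<in>ball 0 1 - {0}. m u = 1/2 * (1 + exp u) / (1 - exp u) + 1 / u))"

lemma coth0_holomorphic: "coth0 holomorphic_on ball 0 1"
  and coth0_0: "coth0 0 = 0"
  and coth0_deriv: "deriv coth0 0 = -1/12" "(deriv ^^ 3) coth0 0 = 1/120"
  and coth0_eq: "u \<in> ball 0 1 - {0} \<Longrightarrow> coth0 u = 1/2 * (1 + exp u) / (1 - exp u) + 1 / u"
  using someI_ex[OF coth0_exists, folded coth0_def] by blast+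

section \<open>Taylor coefficients of the zeta function at the origin\<close>

lemma higher_deriv_sequence:
  assumes "open S" "\<And>j u. u \<in> S \<Longrightarrow> (H j has_field_derivative H (Suc j) u) (at u)" "u \<in> S"
  shows "(deriv ^^ n) (H 0) u = (H n u :: complex)"
  using assms(3)
proof (induction n arbitrary: u)
  case (Suc n)
  have "(deriv ^^ Suc n) (H 0) u = deriv (H n) u"
    by (simp, rule deriv_cong_ev) (use Suc assms(1) in \<open>auto simp: eventually_nhds\<close>)
  then show ?case using DERIV_imp_deriv[OF assms(2)[OF Suc.prems]] by simp
qed simp

text \<open>The sign makes d/du raise the index \<open>j\<close> by one. At u = 0 the halves cancel
  for even \<open>j\<close> and double for odd \<open>j\<close>; the cases 1 and 3 are the Lambert
  sums of E2 and E4.\<close>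

definition lam_diff :: "complex \<Rightarrow> nat \<Rightarrow> complex \<Rightarrow> complex" where
  "lam_diff q j u = lambert_series q j (exp u) - (-1) ^ j * lambert_series q j (exp (- u))"

definition strip :: "complex \<Rightarrow> complex set" where
  "strip q = {u. norm (q * exp u) < 1 \<and> norm (q * exp (- u)) < 1}"

lemma open_strip: "open (strip q)"
  unfolding strip_def by (intro open_Collect_conj open_Collect_less continuous_intros)

lemma lam_diff_deriv:
  assumes "norm q < 1" "u \<in> strip q"
  shows "(lam_diff q j has_field_derivative lam_diff q (Suc j) u) (at u)"
proof -
  define d where "d = (\<lambda>w. \<Sum>n. diffs (\<lambda>n. of_nat n ^ j * q ^ n / (1 - q ^ n)) n * w ^ n)"
  have d: "(lambert_series q j has_field_derivative d w) (at w)" "w * d w = lambert_series q (Suc j) w"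
    if "norm (q * w) < 1" for w
    using lambert_series_deriv[OF assms(1) that] unfolding d_def by auto
  have "((\<lambda>u. lambert_series q j (exp u) - (-1) ^ j * lambert_series q j (exp (- u))) has_field_derivative
     (d (exp u) * exp u - (-1) ^ j * (d (exp (- u)) * (exp (- u) * - 1)))) (at u)"
    using assms(2) by (intro DERIV_diff DERIV_cmult DERIV_chain2[OF d(1)] derivative_intros) (auto simp: strip_def intro!: derivative_eq_intros)
  moreover have "d (exp u) * exp u - (-1) ^ j * (d (exp (- u)) * (exp (- u) * - 1)) = lam_diff q (Suc j) u"
    using d(2)[of "exp u"] d(2)[of "exp (- u)"] assms(2) by (simp add: lam_diff_def strip_def mult_ac)
  ultimately show ?thesis by (simp add: lam_diff_def[abs_def])
qed

lemma lam_diff_holomorphic: "norm q < 1 \<Longrightarrow> lam_diff q 0 holomorphic_on strip q"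
  using lam_diff_deriv[of q _ 0] open_strip by (auto simp: holomorphic_on_open)

lemma higher_deriv_lam_diff:
  assumes "norm q < 1"
  shows "(deriv ^^ n) (lam_diff q 0) 0 = (if even n then 0 else 2 * lambert n q)"
proof -
  have "(deriv ^^ n) (lam_diff q 0) 0 = lam_diff q n 0"
    by (rule higher_deriv_sequence[OF open_strip[of q]])
      (rule lam_diff_deriv[OF assms], use assms in \<open>auto simp: strip_def\<close>)
  then show ?thesis using lambert_series_1[OF assms] by (simp add: lam_diff_def)
qed

text \<open>The zeta function in the variable u = 2 pi i z with its principal part -1/u removed; its
  odd Taylor coefficients at 0 are multiples of Eisenstein series.\<close>

definition zeta_reg :: "complex \<Rightarrow> complex \<Rightarrow> complex" where
  "zeta_reg q u = coth0 u + lam_diff q 0 u"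

lemma zeta_reg_holomorphic: "norm q < 1 \<Longrightarrow> zeta_reg q holomorphic_on (ball 0 1 \<inter> strip q)"
  unfolding zeta_reg_def[abs_def]
  by (intro holomorphic_on_add holomorphic_on_subset[OF coth0_holomorphic] holomorphic_on_subset[OF lam_diff_holomorphic]) auto

lemma zeta_reg_0: "zeta_reg q 0 = 0"
  by (simp add: zeta_reg_def coth0_0 lam_diff_def)

text \<open>The constants of E2 and E4 arise here: -1/12 + 2 L1 = -(1 - 24 L1)/12 and 1/120 + 2 L3 =
  (1 + 240 L3)/120, where L1 and L3 are the Lambert sums.\<close>

lemma zeta_reg_derivs:
  assumes "norm q < 1"
  shows "deriv (zeta_reg q) 0 = - (1 - 24 * lambert 1 q) / 12"
    "(deriv ^^ 3) (zeta_reg q) 0 = (1 + 240 * lambert 3 q) / 120"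
proof -
  have "0 \<in> strip q" using assms by (simp add: strip_def)
  then have *: "(deriv ^^ n) (zeta_reg q) 0 = (deriv ^^ n) coth0 0 + (deriv ^^ n) (lam_diff q 0) 0" for n
    unfolding zeta_reg_def[abs_def]
    by (intro higher_deriv_add[of _ "ball 0 1 \<inter> strip q"] holomorphic_on_subset[OF coth0_holomorphic]
      holomorphic_on_subset[OF lam_diff_holomorphic] open_Int open_strip assms) auto
  show "deriv (zeta_reg q) 0 = - (1 - 24 * lambert 1 q) / 12"
    using *[of 1] higher_deriv_lam_diff[OF assms, of 1] by (simp add: coth0_deriv field_simps)
  show "(deriv ^^ 3) (zeta_reg q) 0 = (1 + 240 * lambert 3 q) / 120"
    using *[of 3] higher_deriv_lam_diff[OF assms, of 3] by (simp add: coth0_deriv(2) field_simps)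
qed

lemma weier_zeta_reg:
  assumes "norm q < 1" "u \<in> ball 0 1 \<inter> strip q" "u \<noteq> 0"
  shows "weier_zeta q (exp u) = zeta_reg q u - 1 / u"
proof -
  have "1 / exp u = exp (- u)" by (simp add: exp_minus field_simps)
  then show ?thesis
    using assms coth0_eq[of u] geo_eq_lambert_series[OF assms(1)]
    by (simp add: weier_zeta_def zeta_reg_def lam_diff_def strip_def)
qed

text \<open>The poles cancel, and \<open>0\<close> is the limit at the lattice points: an entire elliptic function
  vanishing at \<open>0\<close>, hence zero.\<close>

definition zf_diff :: "complex \<Rightarrow> complex \<Rightarrow> complex" where
  "zf_diff \<tau> z = (if z \<in> lat \<tau> then 0 else zf (-1 / \<tau>) (z / \<tau>) / \<tau> - zf \<tau> z + z / \<tau>)"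

lemma UHP_inversion:
  assumes "\<tau> \<in> UHP" shows "-1 / \<tau> \<in> UHP" "Im (-1 / \<tau>) = Im \<tau> / norm \<tau> ^ 2"
proof -
  have "\<tau> \<noteq> 0" using assms by (auto simp: UHP_def)
  show 2: "Im (-1 / \<tau>) = Im \<tau> / norm \<tau> ^ 2" by (simp add: Im_divide cmod_power2)
  have "0 < Im \<tau> / norm \<tau> ^ 2" using assms \<open>\<tau> \<noteq> 0\<close> by (simp add: UHP_def)
  then show "-1 / \<tau> \<in> UHP" using 2 by (simp add: UHP_def del: Im_divide)
qed

lemma UHP_nz: "\<tau> \<in> UHP \<Longrightarrow> \<tau> \<noteq> 0"
  by (auto simp: UHP_def)

text \<open>For the lattice of -1/\<tau>, adding 1 to z subtracts the period -1/\<tau> from z/\<tau>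
  and so costs -1; after the outer division by \<tau> this is offset by the linear term
  z/\<tau>.\<close>

lemma zf_diff_add_1:
  assumes "\<tau> \<in> UHP" shows "zf_diff \<tau> (z + 1) = zf_diff \<tau> z"
proof (cases "z \<in> lat \<tau>")
  case False
  have i: "Im \<tau> \<noteq> 0" using assms by (simp add: UHP_def)
  have "z / \<tau> \<notin> lat (-1 / \<tau>)" using False lat_inversion[OF i] by simp
  then have "zf (-1 / \<tau>) (z / \<tau> - (-1 / \<tau>)) = zf (-1 / \<tau>) (z / \<tau>) - 1"
    by (rule zf_diff_tau[OF UHP_inversion(1)[OF assms]])
  moreover have "z / \<tau> - (-1 / \<tau>) = (z + 1) / \<tau>" by (simp add: add_divide_distrib)
  ultimately show ?thesis
    using False UHP_nz[OF assms] by (simp add: zf_diff_def lat_add_1[OF i] zf_add_1 diff_divide_distrib add_divide_distrib)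
qed (use assms in \<open>simp add: zf_diff_def lat_add_1 UHP_def\<close>)

text \<open>Here the zeta function of -1/\<tau> is periodic, and the linear term offsets the
  quasi-period of the other one.\<close>

lemma zf_diff_add_tau:
  assumes "\<tau> \<in> UHP" shows "zf_diff \<tau> (z + \<tau>) = zf_diff \<tau> z"
proof (cases "z \<in> lat \<tau>")
  case False
  have i: "Im \<tau> \<noteq> 0" using assms by (simp add: UHP_def)
  have "(z + \<tau>) / \<tau> = z / \<tau> + 1" using UHP_nz[OF assms] by (simp add: add_divide_distrib)
  then show ?thesis
    using False UHP_nz[OF assms] zf_add_tau[OF assms False] by (simp add: zf_diff_def lat_add_tau[OF i] zf_add_1)
qed (use assms in \<open>simp add: zf_diff_def lat_add_tau UHP_def\<close>)

lemma zf_diff_periodic: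
  assumes "\<tau> \<in> UHP" shows "zf_diff \<tau> (z + (of_int m + of_int n * \<tau>)) = zf_diff \<tau> z"
proof -
  interpret a: periodic_fun_simple "zf_diff \<tau>" 1 by unfold_locales (rule zf_diff_add_1[OF assms])
  interpret b: periodic_fun_simple "zf_diff \<tau>" \<tau> by unfold_locales (rule zf_diff_add_tau[OF assms])
  show ?thesis using a.plus_of_int[of "z + of_int n * \<tau>" m] b.plus_of_int[of z n] by (simp add: algebra_simps)
qed

definition c2pi :: complex where "c2pi = 2 * of_real pi * \<i>"

lemma c2pi_nz [simp]: "c2pi \<noteq> 0" by (simp add: c2pi_def)

lemma norm_c2pi: "norm c2pi \<le> 7"
  using pi_approx by (simp add: c2pi_def norm_mult)

lemma qq_c2pi: "qq z = exp (c2pi * z)" by (simp add: qq_eq c2pi_def)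

lemma zf_near_0:
  assumes "\<tau> \<in> UHP" "norm z < 1/7" "norm z < Im \<tau>"
  shows "c2pi * z \<in> ball 0 1 \<inter> strip (qq \<tau>)"
    and "z \<noteq> 0 \<Longrightarrow> zf \<tau> z = zeta_reg (qq \<tau>) (c2pi * z) - 1 / (c2pi * z)"
proof -
  have 1: "norm (c2pi * z) < 1"
    using mult_mono[OF norm_c2pi, of "norm z" "norm z"] assms(2) by (simp add: norm_mult)
  have "\<bar>Im z\<bar> < Im \<tau>" using assms(3) abs_Im_le_cmod[of z] by linarith
  then have "norm (qq (\<tau> + z)) < 1" "norm (qq (\<tau> - z)) < 1"
    by (auto intro!: norm_qq_less_1 simp: UHP_def)
  then have "norm (qq \<tau> * qq z) < 1" "norm (qq \<tau> * qq (- z)) < 1" by (simp_all add: qq_add[symmetric])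
  then show 2: "c2pi * z \<in> ball 0 1 \<inter> strip (qq \<tau>)" using 1 by (simp add: strip_def qq_c2pi)
  show "zf \<tau> z = zeta_reg (qq \<tau>) (c2pi * z) - 1 / (c2pi * z)" if "z \<noteq> 0"
    unfolding zf_def qq_c2pi[of z] by (rule weier_zeta_reg[OF norm_qq_less_1[OF assms(1)] 2]) (use that in simp)
qed

lemma lat_near_0:
  assumes "\<tau> \<in> UHP" "norm z < 1" "norm z < Im \<tau>" "z \<in> lat \<tau>"
  shows "z = 0"
proof -
  have *: "Im z / Im \<tau> \<in> \<int>" "Re z - Im z / Im \<tau> * Re \<tau> \<in> \<int>" using assms(4) by (auto simp: lat_def)
  have "\<bar>Im z / Im \<tau>\<bar> < 1" using assms abs_Im_le_cmod[of z] by (simp add: abs_divide UHP_def)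
  then have "Im z / Im \<tau> = 0" using *(1) Ints_nonzero_abs_less1 by blast
  then have i: "Im z = 0" using assms(1) by (simp add: UHP_def)
  then have "Re z \<in> \<int>" using *(2) by simp
  moreover have "\<bar>Re z\<bar> < 1" using assms abs_Re_le_cmod[of z] by simp
  ultimately have "Re z = 0" using Ints_nonzero_abs_less1 by blast
  with i assms(1) show ?thesis by (simp add: complex_eq_iff UHP_def)
qed

text \<open>Within this radius z meets the conditions of \<open>zf_near_0\<close> for \<tau>, and
  z/\<tau> those for -1/\<tau>. The 7 is a bound for 2 pi, and |z/\<tau>| < Im(-1/\<tau>) amounts to
  |z| < Im \<tau> / |\<tau>|.\<close>

definition loc_rad :: "complex \<Rightarrow> real" where
  "loc_rad \<tau> = Min {1/7, Im \<tau>, norm \<tau> / 7, Im \<tau> / norm \<tau>}"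

lemma loc_rad:
  assumes "\<tau> \<in> UHP"
  shows "loc_rad \<tau> > 0"
    "norm z < loc_rad \<tau> \<Longrightarrow> norm z < 1/7" "norm z < loc_rad \<tau> \<Longrightarrow> norm z < Im \<tau>"
    "norm z < loc_rad \<tau> \<Longrightarrow> norm (z / \<tau>) < 1/7" "norm z < loc_rad \<tau> \<Longrightarrow> norm (z / \<tau>) < Im (-1 / \<tau>)"
proof -
  have t: "norm \<tau> > 0" "Im \<tau> > 0" using assms by (auto simp: UHP_def)
  then show "loc_rad \<tau> > 0" by (simp add: loc_rad_def)
  assume *: "norm z < loc_rad \<tau>"
  then show "norm z < 1/7" "norm z < Im \<tau>" by (auto simp: loc_rad_def)
  have "norm z < norm \<tau> / 7" "norm z < Im \<tau> / norm \<tau>" using * by (auto simp: loc_rad_def)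
  then show "norm (z / \<tau>) < 1/7" "norm (z / \<tau>) < Im (-1 / \<tau>)"
    unfolding UHP_inversion(2)[OF assms] using t by (simp_all add: norm_divide field_simps power2_eq_square)
qed

definition zf_diff_loc :: "complex \<Rightarrow> complex \<Rightarrow> complex" where
  "zf_diff_loc \<tau> z = zeta_reg (qq (-1 / \<tau>)) (c2pi / \<tau> * z) / \<tau> - zeta_reg (qq \<tau>) (c2pi * z) + z / \<tau>"

text \<open>The principal parts agree: 1/(2 pi i z/\<tau>), divided by \<tau>, is 1/(2 pi i z). What
  remains is regular and vanishes at 0, matching the value prescribed at lattice points.\<close>

lemma zf_diff_loc_eq:
  assumes "\<tau> \<in> UHP" "norm z < loc_rad \<tau>"
  shows "zf_diff \<tau> z = zf_diff_loc \<tau> z"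
proof (cases "z = 0")
  case True
  then show ?thesis by (simp add: zf_diff_def zf_diff_loc_def zeta_reg_0 lat_def)
next
  case False
  note r = loc_rad(2-)[OF assms(1) assms(2)]
  have "z \<notin> lat \<tau>" using lat_near_0[OF assms(1) _ r(2)] r(1) False by auto
  moreover have "1 / (c2pi * (z / \<tau>)) / \<tau> = 1 / (c2pi * z)" using UHP_nz[OF assms(1)] by simp
  moreover have "z / \<tau> \<noteq> 0" using False UHP_nz[OF assms(1)] by simp
  ultimately show ?thesis
    using zf_near_0(2)[OF assms(1) r(1,2) False] zf_near_0(2)[OF UHP_inversion(1)[OF assms(1)] r(3,4)]
    by (simp add: zf_diff_def zf_diff_loc_def diff_divide_distrib)
qed

lemma zf_diff_loc_holomorphic:
  assumes "\<tau> \<in> UHP"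
  shows "(\<lambda>z. zeta_reg (qq (-1 / \<tau>)) (c2pi / \<tau> * z)) holomorphic_on ball 0 (loc_rad \<tau>)" (is ?A)
    "(\<lambda>z. zeta_reg (qq \<tau>) (c2pi * z)) holomorphic_on ball 0 (loc_rad \<tau>)" (is ?B)
    "zf_diff_loc \<tau> holomorphic_on ball 0 (loc_rad \<tau>)" (is ?C)
proof -
  note r = loc_rad(2-)[OF assms(1)]
  have "(zeta_reg (qq (-1 / \<tau>)) \<circ> (\<lambda>z. c2pi / \<tau> * z)) holomorphic_on ball 0 (loc_rad \<tau>)"
    by (intro holomorphic_on_compose_gen[OF _ zeta_reg_holomorphic[OF norm_qq_less_1[OF UHP_inversion(1)[OF assms]]]] holomorphic_intros)
      (use zf_near_0(1)[OF UHP_inversion(1)[OF assms] r(3,4)] in auto)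
  then show A: ?A by (simp add: o_def)
  have "(zeta_reg (qq \<tau>) \<circ> (\<lambda>z. c2pi * z)) holomorphic_on ball 0 (loc_rad \<tau>)"
    by (intro holomorphic_on_compose_gen[OF _ zeta_reg_holomorphic[OF norm_qq_less_1[OF assms]]] holomorphic_intros)
      (use zf_near_0(1)[OF assms r(1,2)] in auto)
  then show B: ?B by (simp add: o_def)
  show ?C unfolding zf_diff_loc_def[abs_def] using UHP_nz[OF assms] by (intro holomorphic_intros A B) auto
qed

text \<open>By periodicity a lattice point is moved to 0, where the pole-free local formula applies;
  off the lattice, which is closed, the defining expression is differentiable.\<close>

lemma zf_diff_holomorphic:
  assumes "\<tau> \<in> UHP" shows "zf_diff \<tau> holomorphic_on UNIV"
proof -
  have i: "Im \<tau> \<noteq> 0" using assms by (simp add: UHP_def)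
  have 0: "zf_diff \<tau> field_differentiable at 0"
  proof -
    have "zf_diff \<tau> holomorphic_on ball 0 (loc_rad \<tau>)"
      using zf_diff_loc_eq[OF assms] by (intro holomorphic_transform[OF zf_diff_loc_holomorphic(3)[OF assms]]) auto
    then show ?thesis
      by (rule holomorphic_on_imp_differentiable_at) (use loc_rad(1)[OF assms] in auto)
  qed
  have "zf_diff \<tau> field_differentiable at z" for z
  proof (cases "z \<in> lat \<tau>")
    case True
    then obtain m n where z: "z = of_int m + of_int n * \<tau>" using lat_altdef[OF i] by auto
    have "zf_diff \<tau> w = zf_diff \<tau> (w - z)" for w
      using zf_diff_periodic[OF assms, of "w - z" m n] z by simp
    then have eq: "zf_diff \<tau> = zf_diff \<tau> \<circ> (\<lambda>w. w - z)" unfolding fun_eq_iff o_def by blast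
    have "(\<lambda>w. w - z) field_differentiable at z"
      by (intro field_differentiable_diff field_differentiable_ident field_differentiable_const)
    moreover have "zf_diff \<tau> field_differentiable at ((\<lambda>w. w - z) z)" using 0 by simp
    ultimately have "zf_diff \<tau> \<circ> (\<lambda>w. w - z) field_differentiable at z"
      by (rule field_differentiable_compose)
    then show ?thesis by (subst eq)
  next
    case False
    have zt: "z / \<tau> \<notin> lat (-1 / \<tau>)" using False lat_inversion[OF i] by simp
    have d: "(\<lambda>z. z / \<tau>) field_differentiable at z"
      using UHP_nz[OF assms] by (intro field_differentiable_divide field_differentiable_ident field_differentiable_const)
    have "zf (-1 / \<tau>) \<circ> (\<lambda>z. z / \<tau>) field_differentiable at z"
      by (rule field_differentiable_compose[OF d zf_field_differentiable[OF UHP_inversion(1)[OF assms] zt]])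
    then have "(\<lambda>z. (zf (-1 / \<tau>) \<circ> (\<lambda>z. z / \<tau>)) z / \<tau>) field_differentiable at z"
      using UHP_nz[OF assms] by (intro field_differentiable_divide field_differentiable_const)
    then have "(\<lambda>z. (zf (-1 / \<tau>) \<circ> (\<lambda>z. z / \<tau>)) z / \<tau> - zf \<tau> z + z / \<tau>) field_differentiable at z"
      by (intro field_differentiable_add field_differentiable_diff d zf_field_differentiable[OF assms False])
    moreover have "\<forall>\<^sub>F w in nhds z. zf_diff \<tau> w = (zf (-1 / \<tau>) \<circ> (\<lambda>z. z / \<tau>)) w / \<tau> - zf \<tau> w + w / \<tau>"
      unfolding eventually_nhds by (rule exI[of _ "- lat \<tau>"]) (use False closed_lat[OF i] in \<open>auto simp: zf_diff_def\<close>)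
    ultimately show ?thesis
      unfolding field_differentiable_def by (subst DERIV_cong_ev[OF refl _ refl])
  qed
  then show ?thesis by (auto simp: holomorphic_on_def)
qed

lemma zf_diff_eq_0:
  assumes "\<tau> \<in> UHP" shows "zf_diff \<tau> z = 0"
proof -
  have i: "Im \<tau> > 0" using assms by (simp add: UHP_def)
  have "bounded (zf_diff \<tau> ` cball 0 (1 + norm \<tau>))"
    by (intro compact_imp_bounded compact_continuous_image)
      (auto intro: holomorphic_on_imp_continuous_on holomorphic_on_subset[OF zf_diff_holomorphic[OF assms]])
  moreover have "range (zf_diff \<tau>) \<subseteq> zf_diff \<tau> ` cball 0 (1 + norm \<tau>)"
  proof safe
    fix z
    define y x where "y = Im z / Im \<tau>" and "x = Re z - y * Re \<tau>"
    have z: "z = of_real x + of_real y * \<tau>" using i by (simp add: complex_eq_iff x_def y_def)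
    \<comment> \<open>Reduction to the period parallelogram, which lies in a disc of radius 1 +
      |\<tau>|; hence a bound on this compact disc holds everywhere.\<close>
    define z' where "z' = of_real (frac x) + of_real (frac y) * \<tau>"
    have "z = z' + (of_int \<lfloor>x\<rfloor> + of_int \<lfloor>y\<rfloor> * \<tau>)"
      unfolding z z'_def frac_def by (simp add: algebra_simps)
    then have "zf_diff \<tau> z = zf_diff \<tau> z'" using zf_diff_periodic[OF assms] by simp
    moreover have "norm z' \<le> 1 + norm \<tau>"
    proof -
      have "norm z' \<le> frac x + frac y * norm \<tau>"
        unfolding z'_def using norm_triangle_ineq[of "of_real (frac x)" "of_real (frac y) * \<tau>"]
        by (simp add: norm_mult frac_ge_0)
      also have "\<dots> \<le> 1 + 1 * norm \<tau>" using frac_lt_1 less_imp_le by (intro add_mono mult_right_mono) auto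
      finally show ?thesis by simp
    qed
    ultimately show "zf_diff \<tau> z \<in> zf_diff \<tau> ` cball 0 (1 + norm \<tau>)" by auto
  qed
  ultimately have "bounded (range (zf_diff \<tau>))" using bounded_subset by blast
  then have "zf_diff \<tau> constant_on UNIV" using Liouville_theorem zf_diff_holomorphic[OF assms] by blast
  then have "zf_diff \<tau> z = zf_diff \<tau> 0" by (auto simp: constant_on_def)
  also have "\<dots> = 0" by (simp add: zf_diff_def lat_def)
  finally show ?thesis .
qed

text \<open>Eisenstein series as functions of the nome on the whole unit disc: the cusp becomes the
  point q = 0, which can enter the maximum principle and power series.\<close>

definition e2 :: "complex \<Rightarrow> complex" where "e2 q = 1 - 24 * lambert 1 q"
definition e4 :: "complex \<Rightarrow> complex" where "e4 q = 1 + 240 * lambert 3 q"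

text \<open>Comparison of the \<open>n\<close>-th Taylor coefficients of the two zeta functions at z
  = 0. The linear term z/\<tau> enters for n = 1 only: it is the source of the non-modular term of
  E2, while n = 3 gives the clean law of E4.\<close>

lemma zeta_reg_inversion:
  assumes "\<tau> \<in> UHP"
  shows "(c2pi / \<tau>) ^ n * (deriv ^^ n) (zeta_reg (qq (-1 / \<tau>))) 0 / \<tau> =
     c2pi ^ n * (deriv ^^ n) (zeta_reg (qq \<tau>)) 0 - (if n = 1 then 1 / \<tau> else 0)"
proof -
  note r = loc_rad[OF assms] and T = UHP_inversion(1)[OF assms]
  have o: "open (ball 0 1 \<inter> strip q)" for q by (intro open_Int open_strip) auto
  let ?B = "ball 0 (loc_rad \<tau>) :: complex set"
  let ?f = "\<lambda>z. zeta_reg (qq (-1 / \<tau>)) (c2pi / \<tau> * z)" and ?g = "\<lambda>z. zeta_reg (qq \<tau>) (c2pi * z)"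
  note h = zf_diff_loc_holomorphic[OF assms]
  have 1: "(deriv ^^ n) ?f 0 = (c2pi / \<tau>) ^ n * (deriv ^^ n) (zeta_reg (qq (-1 / \<tau>))) (c2pi / \<tau> * 0)"
    by (rule higher_deriv_compose_linear[OF zeta_reg_holomorphic[OF norm_qq_less_1[OF T]] _ o, of ?B])
      (use r(1) zf_near_0(1)[OF T r(4,5)] in auto)
  have 2: "(deriv ^^ n) ?g 0 = c2pi ^ n * (deriv ^^ n) (zeta_reg (qq \<tau>)) (c2pi * 0)"
    by (rule higher_deriv_compose_linear[OF zeta_reg_holomorphic[OF norm_qq_less_1[OF assms]] _ o, of ?B])
      (use r(1) zf_near_0(1)[OF assms r(2,3)] in auto)
  have "1 / \<tau> * ?f z = ?g z - 1 / \<tau> * z" if "z \<in> ?B" for z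
    using zf_diff_loc_eq[OF assms, of z] that zf_diff_eq_0[OF assms, of z] by (simp add: zf_diff_loc_def algebra_simps)
  then have "(deriv ^^ n) (\<lambda>z. 1 / \<tau> * ?f z) 0 = (deriv ^^ n) (\<lambda>z. ?g z - 1 / \<tau> * z) 0"
    by (intro higher_deriv_transform_within_open[of _ ?B] holomorphic_intros h) (use r(1) in auto)
  also have "(deriv ^^ n) (\<lambda>z. 1 / \<tau> * ?f z) 0 = 1 / \<tau> * (deriv ^^ n) ?f 0"
    by (rule higher_deriv_cmult[OF h(1)]) (use r(1) in auto)
  also have "(deriv ^^ n) (\<lambda>z. ?g z - 1 / \<tau> * z) 0 = (deriv ^^ n) ?g 0 - (deriv ^^ n) (\<lambda>z. 1 / \<tau> * z) 0"
    by (rule higher_deriv_diff[OF h(2)]) (use r(1) in \<open>auto intro!: holomorphic_intros\<close>)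
  finally show ?thesis unfolding 1 2 higher_deriv_linear by (simp add: mult_ac)
qed

theorem e2_inversion:
  assumes "\<tau> \<in> UHP"
  shows "e2 (qq (-1 / \<tau>)) = \<tau> ^ 2 * e2 (qq \<tau>) + 12 * \<tau> / c2pi"
proof -
  have d: "deriv (zeta_reg (qq \<sigma>)) 0 = - e2 (qq \<sigma>) / 12" if "\<sigma> \<in> UHP" for \<sigma>
    unfolding zeta_reg_derivs(1)[OF norm_qq_less_1[OF that]] e2_def ..
  have "c2pi / \<tau> * (- e2 (qq (-1 / \<tau>)) / 12) / \<tau> = c2pi * (- e2 (qq \<tau>) / 12) - 1 / \<tau>"
    using zeta_reg_inversion[OF assms, of 1] by (simp add: d[OF assms] d[OF UHP_inversion(1)[OF assms], simplified])
  then show ?thesis using UHP_nz[OF assms] by (simp add: field_simps power2_eq_square)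
qed

theorem e4_inversion:
  assumes "\<tau> \<in> UHP"
  shows "e4 (qq (-1 / \<tau>)) = \<tau> ^ 4 * e4 (qq \<tau>)"
proof -
  have d: "(deriv ^^ 3) (zeta_reg (qq \<sigma>)) 0 = e4 (qq \<sigma>) / 120" if "\<sigma> \<in> UHP" for \<sigma>
    unfolding zeta_reg_derivs(2)[OF norm_qq_less_1[OF that]] e4_def ..
  have "(c2pi / \<tau>) ^ 3 * (e4 (qq (-1 / \<tau>)) / 120) / \<tau> = c2pi ^ 3 * (e4 (qq \<tau>) / 120)"
    using zeta_reg_inversion[OF assms, of 3] unfolding d[OF assms] d[OF UHP_inversion(1)[OF assms]] by simp
  then show ?thesis using UHP_nz[OF assms] by (simp add: power_divide divide_simps eval_nat_numeral)
qed

section \<open>Inversion and Fricke involutions on eta and Eisenstein series\<close>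

lemma open_UHP: "open UHP" and convex_UHP: "convex UHP" and connected_UHP: "connected UHP"
proof -
  show "open UHP" unfolding UHP_def by (rule open_halfspace_Im_gt)
  show c: "convex UHP" unfolding UHP_def by (rule convex_halfspace_Im_gt)
  show "connected UHP" using c by (rule convex_connected)
qed

lemma UHP_mult: "\<tau> \<in> UHP \<Longrightarrow> 0 < r \<Longrightarrow> of_real r * \<tau> \<in> UHP"
  by (simp add: UHP_def)

lemma UHP_mult_nat: "\<tau> \<in> UHP \<Longrightarrow> 0 < n \<Longrightarrow> of_nat n * \<tau> \<in> UHP"
  using UHP_mult[of \<tau> "real n"] by simp

lemma UHP_fricke: "\<tau> \<in> UHP \<Longrightarrow> 0 < n \<Longrightarrow> -1 / (of_nat n * \<tau>) \<in> UHP"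
  by (rule UHP_inversion(1)[OF UHP_mult_nat])

lemma qq_surj:
  assumes "q \<noteq> 0" "norm q < 1"
  obtains \<tau> where "\<tau> \<in> UHP" "qq \<tau> = q"
proof
  have "Im (Ln q / c2pi) = - ln (norm q) / (2 * pi)"
    using assms by (simp add: c2pi_def Im_divide power2_eq_square)
  moreover have "ln (norm q) / (2 * pi) < 0" using assms by (intro divide_neg_pos) auto
  ultimately show "Ln q / c2pi \<in> UHP" by (simp add: UHP_def)
  show "qq (Ln q / c2pi) = q" using assms by (simp add: qq_c2pi)
qed

lemma lambert_infsum:
  assumes "norm q < 1"
  shows "(\<Sum>\<^sub>\<infinity>n\<in>{1::nat..}. of_nat n ^ k * q ^ n / (1 - q ^ n)) = lambert k q"
proof -
  have s: "summable (\<lambda>n. norm (of_nat (Suc n) ^ k * q ^ Suc n / (1 - q ^ Suc n)))"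
    using summable_mult[OF lambert'_summable[OF assms, of k], of "norm q"]
    by (simp add: norm_mult norm_divide mult_ac)
  have "(\<Sum>\<^sub>\<infinity>n\<in>{1::nat..}. of_nat n ^ k * q ^ n / (1 - q ^ n)) = (\<Sum>\<^sub>\<infinity>n\<in>range Suc. of_nat n ^ k * q ^ n / (1 - q ^ n))"
    by (rule arg_cong[of _ _ "infsum _"]) (auto simp: image_iff Suc_le_eq gr0_conv_Suc)
  also have "\<dots> = (\<Sum>\<^sub>\<infinity>n. of_nat (Suc n) ^ k * q ^ Suc n / (1 - q ^ Suc n))"
    by (subst infsum_reindex) (auto simp: o_def)
  also have "\<dots> = lambert k q"
    unfolding lambert_def using norm_summable_imp_has_sum[OF s] summable_norm_cancel[OF s]
    by (meson infsumI summable_sums)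
  finally show ?thesis .
qed

lemma Eis2_eq: "\<tau> \<in> UHP \<Longrightarrow> Eis2 \<tau> = e2 (qq \<tau>)"
  using lambert_infsum[OF norm_qq_less_1, of \<tau> 1] by (simp add: Eis2_def e2_def)

lemma Eis4_eq: "\<tau> \<in> UHP \<Longrightarrow> Eis4 \<tau> = e4 (qq \<tau>)"
  using lambert_infsum[OF norm_qq_less_1, of \<tau> 3] by (simp add: Eis4_def e4_def)

lemma dedekind_eta_eq: "dedekind_eta \<tau> = qpow (1/24) \<tau> * euler_prod (qq \<tau>)"
  by (simp add: dedekind_eta_def euler_prod_def)

lemma qpow_24_power: "qpow (1/24) \<tau> ^ 24 = qq \<tau>"
  by (simp add: qpow_def exp_of_nat_mult[symmetric] mult_ac)

lemma qpow_24_mult: "qpow (1/24) (of_nat n * \<tau>) = qpow (1/24) \<tau> ^ n"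
  by (simp add: qpow_def exp_of_nat_mult[symmetric] mult_ac)

lemma qpow_nz [simp]: "qpow s \<tau> \<noteq> 0" by (simp add: qpow_def)

lemma dedekind_eta_nz: "\<tau> \<in> UHP \<Longrightarrow> dedekind_eta \<tau> \<noteq> 0"
  using euler_prod_nz[OF norm_qq_less_1] by (simp add: dedekind_eta_eq)

lemma eta_24: "dedekind_eta \<tau> ^ 24 = qq \<tau> * euler_prod (qq \<tau>) ^ 24"
  by (simp add: dedekind_eta_eq power_mult_distrib qpow_24_power)

lemma qq_deriv: "(qq has_field_derivative c2pi * qq \<tau>) (at \<tau>)"
  using qq_field_derivative[OF DERIV_ident, of \<tau> UNIV] by (simp add: c2pi_def)

lemma dedekind_eta_deriv:
  assumes "\<tau> \<in> UHP"
  shows "(dedekind_eta has_field_derivative c2pi / 24 * e2 (qq \<tau>) * dedekind_eta \<tau>) (at \<tau>)"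
proof -
  note n = norm_qq_less_1[OF assms]
  have 1: "(qpow (1/24) has_field_derivative c2pi / 24 * qpow (1/24) \<tau>) (at \<tau>)"
    unfolding qpow_def[abs_def] c2pi_def by (auto intro!: derivative_eq_intros)
  have "(euler_prod has_field_derivative deriv euler_prod (qq \<tau>)) (at (qq \<tau>))"
    by (rule holomorphic_derivI[OF euler_prod_holomorphic]) (use n in auto)
  then have 2: "((\<lambda>\<tau>. euler_prod (qq \<tau>)) has_field_derivative deriv euler_prod (qq \<tau>) * (c2pi * qq \<tau>)) (at \<tau>)"
    by (rule DERIV_chain2[OF _ qq_deriv])
  have "(dedekind_eta has_field_derivative
      c2pi / 24 * qpow (1/24) \<tau> * euler_prod (qq \<tau>) + deriv euler_prod (qq \<tau>) * (c2pi * qq \<tau>) * qpow (1/24) \<tau>) (at \<tau>)"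
    unfolding dedekind_eta_eq[abs_def] by (rule DERIV_mult[OF 1 2])
  moreover have "deriv euler_prod (qq \<tau>) * (c2pi * qq \<tau>) = c2pi * (qq \<tau> * deriv euler_prod (qq \<tau>))"
    by simp
  ultimately show ?thesis
    by (simp only: euler_prod_logderiv[OF n]) (simp add: dedekind_eta_eq e2_def algebra_simps)
qed

text \<open>The logarithmic derivative of eta is (2 pi i/24) E2, and the inhomogeneous term of
  \<open>e2_inversion\<close> accounts for the factor \<tau>; so the quotient of both sides is
  constant. Squares avoid a branch of the root of \<tau>.\<close>

theorem eta_inversion:
  assumes "\<tau> \<in> UHP"
  shows "dedekind_eta (-1 / \<tau>) ^ 2 = - \<i> * \<tau> * dedekind_eta \<tau> ^ 2"
proof -
  define R where "R = (\<lambda>\<tau>. dedekind_eta (-1 / \<tau>) ^ 2 / (\<tau> * dedekind_eta \<tau> ^ 2))"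
  have "(R has_field_derivative 0) (at \<tau>)" if "\<tau> \<in> UHP" for \<tau>
  proof -
    note T = UHP_inversion(1)[OF that] and nz = UHP_nz[OF that] dedekind_eta_nz[OF that]
    define x y P where "x = dedekind_eta (-1 / \<tau>)" and "y = dedekind_eta \<tau>" and "P = e2 (qq \<tau>)"
    have "((\<lambda>\<tau>. -1 / \<tau>) has_field_derivative 1 / \<tau> ^ 2) (at \<tau>)"
      using nz by (auto intro!: derivative_eq_intros simp: power2_eq_square)
    from DERIV_chain2[OF dedekind_eta_deriv[OF T] this]
    have 1: "((\<lambda>\<tau>. dedekind_eta (-1 / \<tau>)) has_field_derivative
       c2pi / 24 * (\<tau> ^ 2 * P + 12 * \<tau> / c2pi) * x * (1 / \<tau> ^ 2)) (at \<tau>)"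
      by (simp only: e2_inversion[OF that] x_def P_def)
    have 2: "(dedekind_eta has_field_derivative c2pi / 24 * P * y) (at \<tau>)"
      using dedekind_eta_deriv[OF that] by (simp add: P_def y_def)
    have "(R has_field_derivative
      ((of_nat 2 * (c2pi / 24 * (\<tau> ^ 2 * P + 12 * \<tau> / c2pi) * x * (1 / \<tau> ^ 2) * x ^ (2 - Suc 0))) * (\<tau> * y ^ 2) -
       x ^ 2 * (1 * y ^ 2 + of_nat 2 * (c2pi / 24 * P * y * y ^ (2 - Suc 0)) * \<tau>)) / (\<tau> * y ^ 2 * (\<tau> * y ^ 2))) (at \<tau>)"
      unfolding R_def x_def y_def
      by (rule DERIV_divide[OF DERIV_power[OF 1[unfolded x_def]] DERIV_mult[OF DERIV_ident DERIV_power[OF 2[unfolded y_def]]]])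
        (use nz in auto)
    moreover have "(of_nat 2 * (c2pi / 24 * (\<tau> ^ 2 * P + 12 * \<tau> / c2pi) * x * (1 / \<tau> ^ 2) * x ^ (2 - Suc 0))) * (\<tau> * y ^ 2) =
       x ^ 2 * (1 * y ^ 2 + of_nat 2 * (c2pi / 24 * P * y * y ^ (2 - Suc 0)) * \<tau>)"
      using nz by (simp add: field_simps power2_eq_square)
    ultimately show ?thesis by simp
  qed
  then have "\<exists>c. \<forall>\<tau>\<in>UHP. R \<tau> = c"
    by (intro has_field_derivative_zero_constant convex_UHP) (auto intro: has_field_derivative_at_within)
  then obtain c where c: "\<And>\<tau>. \<tau> \<in> UHP \<Longrightarrow> R \<tau> = c" by blast
  \<comment> \<open>The fixed point of the inversion: eta cancels there, and the constant is seen to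
    be 1/i.\<close>
  have i: "\<i> \<in> UHP" by (simp add: UHP_def)
  have "-1 / \<i> = \<i>" by simp
  then have "R \<i> = 1 / \<i>" using dedekind_eta_nz[OF i] by (simp add: R_def)
  then have "R \<tau> = - \<i>" using c[OF i] c[OF assms] by simp
  then show ?thesis
    using UHP_nz[OF assms] dedekind_eta_nz[OF assms] by (simp add: R_def field_simps)
qed

lemma eta_fricke:
  assumes "\<tau> \<in> UHP" "0 < n"
  shows "dedekind_eta (-1 / (of_nat n * \<tau>)) ^ 2 = - \<i> * of_nat n * \<tau> * dedekind_eta (of_nat n * \<tau>) ^ 2"
    "dedekind_eta (of_nat n * (-1 / (of_nat n * \<tau>))) ^ 2 = - \<i> * \<tau> * dedekind_eta \<tau> ^ 2"
  using eta_inversion[OF UHP_mult_nat[OF assms]] eta_inversion[OF assms(1)] assms(2) by simp_all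

lemma qq_fricke:
  assumes "0 < n"
  shows "qq (-1 / (of_nat n * \<tau>)) ^ n = qq (-1 / \<tau>)"
  using assms by (simp flip: qq_mult_of_nat)

lemma e4_fricke:
  assumes "\<tau> \<in> UHP" "0 < n"
  shows "e4 (qq (-1 / (of_nat n * \<tau>))) = (of_nat n * \<tau>) ^ 4 * e4 (qq \<tau> ^ n)"
    "e4 (qq (-1 / (of_nat n * \<tau>)) ^ n) = \<tau> ^ 4 * e4 (qq \<tau>)"
  using e4_inversion[OF UHP_mult_nat[OF assms]] e4_inversion[OF assms(1)]
  unfolding qq_fricke[OF assms(2)] qq_mult_of_nat by blast+

text \<open>The combination n E2(n \<tau>) - E2(\<tau>) is the one in which the inhomogeneous terms
  cancel, leaving a form of weight 2.\<close>

lemma e2_fricke: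
  assumes "\<tau> \<in> UHP" "0 < n"
  shows "of_nat n * e2 (qq (-1 / (of_nat n * \<tau>)) ^ n) - e2 (qq (-1 / (of_nat n * \<tau>))) =
    - of_nat n * \<tau> ^ 2 * (of_nat n * e2 (qq \<tau> ^ n) - e2 (qq \<tau>))"
  unfolding qq_fricke[OF assms(2)] e2_inversion[OF assms(1)] e2_inversion[OF UHP_mult_nat[OF assms]] qq_mult_of_nat
  by (simp add: algebra_simps power2_eq_square)

lemma e2_holomorphic: "e2 holomorphic_on ball 0 1" and e4_holomorphic: "e4 holomorphic_on ball 0 1"
  unfolding e2_def[abs_def] e4_def[abs_def] by (intro holomorphic_intros lambert_holomorphic)+

lemma lambert_0: "lambert k 0 = 0"
  by (simp add: lambert_eq)

lemma e2_0: "e2 0 = 1" and e4_0: "e4 0 = 1"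
  by (simp_all add: e2_def e4_def lambert_0)

section \<open>A Liouville theorem for the Fricke groups of level 1, 2, 3\<close>

text \<open>After a translation |Re \<tau>| <= 1/2, and if Im \<tau> < 1/5 then N |\<tau>|^2 <= 3
  (1/4 + 1/25) < 7/8. The Fricke involution then raises the height by a factor of at least 8/7 and
  exchanges \<open>h1\<close> with \<open>h2\<close>; after finitely many steps the height is at
  least 1/5.\<close>

lemma fricke_reduction:
  fixes N :: nat
  assumes N: "1 \<le> N" "N \<le> 3"
    and W: "\<And>\<tau>. \<tau> \<in> UHP \<Longrightarrow> h1 (qq (-1 / (of_nat N * \<tau>))) = h2 (qq \<tau>)"
  defines "S \<equiv> {h1 (qq \<tau>) | \<tau>. Im \<tau> \<ge> 1/5} \<union> {h2 (qq \<tau>) | \<tau>. Im \<tau> \<ge> 1/5}"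
  assumes "\<tau> \<in> UHP"
  shows "h1 (qq \<tau>) \<in> S \<and> h2 (qq \<tau>) \<in> S"
proof -
  have ind: "(1/5) * (7/8) ^ k \<le> Im \<tau> \<Longrightarrow> \<tau> \<in> UHP \<Longrightarrow> h1 (qq \<tau>) \<in> S \<and> h2 (qq \<tau>) \<in> S" for k \<tau>
  proof (induction k arbitrary: \<tau>)
    case 0
    then show ?case unfolding S_def by auto
  next
    case (Suc k)
    show ?case
    proof (cases "Im \<tau> \<ge> 1/5")
      case True
      then show ?thesis unfolding S_def by auto
    next
      case False
      define \<tau>0 where "\<tau>0 = \<tau> - of_int (round (Re \<tau>))"
      have t0: "\<tau>0 \<in> UHP" "Im \<tau>0 = Im \<tau>" using Suc.prems by (auto simp: \<tau>0_def UHP_def)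
      have q0: "qq \<tau>0 = qq \<tau>"
      proof -
        have "qq \<tau> = qq \<tau>0 * qq (of_int (round (Re \<tau>)))" by (simp add: qq_add[symmetric] \<tau>0_def)
        then show ?thesis by (simp add: qq_eq_1_iff[THEN iffD2])
      qed
      define \<sigma> where "\<sigma> = -1 / (of_nat N * \<tau>0)"
      have s: "\<sigma> \<in> UHP" unfolding \<sigma>_def using UHP_fricke[OF t0(1)] N by simp
      have re: "\<bar>Re \<tau>0\<bar> \<le> 1/2"
        using of_int_round_abs_le[of "Re \<tau>"] by (simp add: \<tau>0_def abs_minus_commute)
      have "norm \<tau>0 ^ 2 = (Re \<tau>0) ^ 2 + (Im \<tau>0) ^ 2" by (simp add: cmod_power2)
      also have "\<dots> \<le> (1/2) ^ 2 + (1/5) ^ 2"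
        using re False Suc.prems(2) t0 by (intro add_mono power_mono abs_le_square_iff[THEN iffD1]) (auto simp: UHP_def)
      finally have "real N * norm \<tau>0 ^ 2 \<le> 3 * ((1/2) ^ 2 + (1/5) ^ 2)"
        using N by (intro mult_mono) auto
      then have le: "real N * norm \<tau>0 ^ 2 \<le> 7/8 + 0" by (simp add: power2_eq_square)
      have pos: "0 < real N * norm \<tau>0 ^ 2" using N UHP_nz[OF t0(1)] by simp
      have "Im \<sigma> = real N * Im \<tau>0 / norm (of_nat N * \<tau>0) ^ 2"
        unfolding \<sigma>_def using UHP_inversion(2)[OF UHP_mult_nat[OF t0(1)], of N] N by simp
      also have "\<dots> = Im \<tau>0 / (real N * norm \<tau>0 ^ 2)"
        using N by (simp add: norm_mult power2_eq_square field_simps)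
      also have "\<dots> \<ge> Im \<tau> / (7/8)"
        unfolding t0(2) using le pos Suc.prems(2) by (intro divide_left_mono) (auto simp: UHP_def)
      finally have "(1/5) * (7/8) ^ k \<le> Im \<sigma>" using Suc.prems(1) by simp
      from Suc.IH[OF this s] have IH: "h1 (qq \<sigma>) \<in> S" "h2 (qq \<sigma>) \<in> S" by auto
      have "-1 / (of_nat N * \<sigma>) = \<tau>0" using N UHP_nz[OF t0(1)] by (simp add: \<sigma>_def)
      with W[OF s] have "h1 (qq \<tau>0) = h2 (qq \<sigma>)" by simp
      moreover have "h1 (qq \<sigma>) = h2 (qq \<tau>0)" using W[OF t0(1)] by (simp add: \<sigma>_def)
      ultimately show ?thesis using IH q0 by simp
    qed
  qed
  have "(\<lambda>k. (1/5) * (7/8::real) ^ k) \<longlonglongrightarrow> (1/5) * 0"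
    by (intro tendsto_intros LIMSEQ_power_zero) auto
  then have "\<forall>\<^sub>F k in sequentially. (1/5) * (7/8) ^ k < Im \<tau>"
    by (rule order_tendstoD) (use assms(5) in \<open>simp add: UHP_def\<close>)
  then obtain k where "(1/5) * (7/8) ^ k < Im \<tau>" by (auto simp: eventually_sequentially)
  then show ?thesis using ind[of k \<tau>] assms(5) by simp
qed

text \<open>All values of \<open>h1\<close> and \<open>h2\<close> already occur on the compact disc
  |q| <= exp(-2 pi/5), as values of one of the two. So one of them attains the common maximum
  modulus in the interior and is constant; if this is \<open>h2\<close>, the involution passes
  constancy on to \<open>h1\<close>.\<close>

theorem fricke_liouville:
  fixes N :: nat
  assumes N: "1 \<le> N" "N \<le> 3" and h1: "h1 holomorphic_on ball 0 1" and h2: "h2 holomorphic_on ball 0 1"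
    and W: "\<And>\<tau>. \<tau> \<in> UHP \<Longrightarrow> h1 (qq (-1 / (of_nat N * \<tau>))) = h2 (qq \<tau>)" and q: "norm q < 1"
  shows "h1 q = h1 0"
proof -
  define r where "r = exp (- 2 * pi * (1/5))"
  have r: "0 < r" "r < 1" by (auto simp: r_def)
  have c: "continuous_on (cball 0 r) h1" "continuous_on (cball 0 r) h2"
    using h1 h2 r by (auto intro!: holomorphic_on_imp_continuous_on elim!: holomorphic_on_subset)
  have ne: "cball (0::complex) r \<noteq> {}" using r by auto
  obtain q1 where q1: "q1 \<in> cball 0 r" "\<And>q. q \<in> cball 0 r \<Longrightarrow> norm (h1 q) \<le> norm (h1 q1)"
    using continuous_attains_sup[OF compact_cball ne continuous_on_norm[OF c(1)]] by blast
  obtain q2 where q2: "q2 \<in> cball 0 r" "\<And>q. q \<in> cball 0 r \<Longrightarrow> norm (h2 q) \<le> norm (h2 q2)"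
    using continuous_attains_sup[OF compact_cball ne continuous_on_norm[OF c(2)]] by blast
  define M where "M = max (norm (h1 q1)) (norm (h2 q2))"
  have small: "qq \<tau> \<in> cball 0 r" if "Im \<tau> \<ge> 1/5" for \<tau>
    using that by (simp add: r_def norm_qq)
  have bound: "norm (h1 q) \<le> M \<and> norm (h2 q) \<le> M" if "q \<in> ball 0 1" for q
  proof (cases "q = 0")
    case True
    then show ?thesis using q1(2)[of 0] q2(2)[of 0] r by (auto simp: M_def)
  next
    case False
    moreover have "norm q < 1" using that by simp
    ultimately obtain \<tau> where t: "\<tau> \<in> UHP" "qq \<tau> = q" by (rule qq_surj)
    have "x \<in> {h1 (qq \<tau>) | \<tau>. Im \<tau> \<ge> 1/5} \<union> {h2 (qq \<tau>) | \<tau>. Im \<tau> \<ge> 1/5} \<Longrightarrow> norm x \<le> M" for x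
      using q1(2)[OF small] q2(2)[OF small] by (fastforce simp: M_def)
    then show ?thesis using fricke_reduction[where ?h1.0=h1 and ?h2.0=h2, OF N W t(1)] t(2) by blast
  qed
  have in_ball: "q1 \<in> ball 0 1" "q2 \<in> ball 0 1" using q1 q2 r by auto
  have "h1 constant_on ball 0 1"
  proof (cases "norm (h1 q1) = M")
    case True
    show ?thesis
      by (rule maximum_modulus_principle[OF h1, of "ball 0 1" q1]) (use bound True in_ball in auto)
  next
    case False
    then have "norm (h2 q2) = M" by (auto simp: M_def max_def split: if_splits)
    then have "h2 constant_on ball 0 1"
      by (intro maximum_modulus_principle[OF h2, of "ball 0 1" q2]) (use bound in_ball in auto)
    then obtain c where c: "\<And>q. q \<in> ball 0 1 \<Longrightarrow> h2 q = c" by (auto simp: constant_on_def)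
    have "h1 q = c" if "q \<in> ball 0 1 - {0}" for q
    proof -
      have "q \<noteq> 0" "norm q < 1" using that by auto
      then obtain \<tau> where t: "\<tau> \<in> UHP" "qq \<tau> = q" by (rule qq_surj)
      have "-1 / (of_nat N * (-1 / (of_nat N * \<tau>))) = \<tau>" using N UHP_nz[OF t(1)] by simp
      then have "h1 (qq \<tau>) = h2 (qq (-1 / (of_nat N * \<tau>)))"
        using W[OF UHP_fricke[OF t(1)], of N] N by simp
      then show ?thesis using c norm_qq_less_1[OF UHP_fricke[OF t(1)], of N] N t(2) by simp
    qed
    then have "h1 constant_on (ball 0 1 - {0})" by (auto simp: constant_on_def)
    moreover have "(0::complex) islimpt ball 0 1 - {0}"
      by (metis islimpt_punctured centre_in_ball interior_limit_point interior_open open_ball zero_less_one)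
    ultimately show ?thesis
      by (intro analytic_continuation'[OF h1, of "ball 0 1 - {0}" 0]) auto
  qed
  then show ?thesis using q by (auto simp: constant_on_def)
qed

lemma holomorphic_factor_zero:
  assumes "f holomorphic_on ball 0 1" "f 0 = 0"
  obtains g where "g holomorphic_on ball 0 1" "\<And>q. f q = q * g q" "g 0 = deriv f 0"
proof
  show "(\<lambda>q. if q = 0 then deriv f 0 else (f q - f 0) / (q - 0)) holomorphic_on ball 0 1"
    by (rule pole_lemma[OF assms(1)]) auto
qed (use assms in auto)

lemma fricke_zero:
  fixes N :: nat
  assumes "1 \<le> N" "N \<le> 3" "h1 holomorphic_on ball 0 1" "h2 holomorphic_on ball 0 1"
    "\<And>\<tau>. \<tau> \<in> UHP \<Longrightarrow> h1 (qq (-1 / (of_nat N * \<tau>))) = h2 (qq \<tau>)" "h1 0 = 0" "norm q < 1"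
  shows "h1 q = 0"
  using fricke_liouville[OF assms(1-5,7)] assms(6) by simp

section \<open>The derivation q d/dq = (2 pi i)^(-1) d/d\<tau> and Ramanujan's equation for
  E2\<close>

definition Dq :: "(complex \<Rightarrow> complex) \<Rightarrow> complex \<Rightarrow> complex" where
  "Dq f q = q * deriv f q"

lemma Dq_holomorphic: "f holomorphic_on ball 0 1 \<Longrightarrow> Dq f holomorphic_on ball 0 1"
  unfolding Dq_def[abs_def] by (intro holomorphic_intros) auto

lemma deriv_compose_qq:
  assumes "f holomorphic_on ball 0 1" "\<tau> \<in> UHP"
  shows "((\<lambda>\<tau>. f (qq \<tau>)) has_field_derivative c2pi * Dq f (qq \<tau>)) (at \<tau>)"
proof -
  have "(f has_field_derivative deriv f (qq \<tau>)) (at (qq \<tau>))"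
    by (rule holomorphic_derivI[OF assms(1)]) (use norm_qq_less_1[OF assms(2)] in auto)
  from DERIV_chain2[OF this qq_deriv] show ?thesis by (simp add: Dq_def mult_ac)
qed

text \<open>\<open>X\<close> transforms with weight 4, because the inhomogeneous terms of E2^2 and
  of its derivative cancel, and it vanishes at the cusp. Its cube divided by eta^24 has weight 0 and
  still vanishes at q = 0, so the case N = 1 of the Liouville theorem applies.\<close>

theorem Dq_e2:
  assumes "norm q < 1"
  shows "Dq e2 q = (e2 q ^ 2 - e4 q) / 12"
proof -
  define X where "X = (\<lambda>q. e2 q ^ 2 - e4 q - 12 * Dq e2 q)"
  have "X holomorphic_on ball 0 1"
    unfolding X_def by (intro holomorphic_intros e2_holomorphic e4_holomorphic Dq_holomorphic)
  moreover have "X 0 = 0" by (simp add: X_def e2_0 e4_0 Dq_def)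
  ultimately obtain Y where Y: "Y holomorphic_on ball 0 1" "\<And>q. X q = q * Y q"
    using holomorphic_factor_zero by blast
  have X_inv: "X (qq (-1 / \<tau>)) = \<tau> ^ 4 * X (qq \<tau>)" if "\<tau> \<in> UHP" for \<tau>
  proof -
    note T = UHP_inversion(1)[OF that] and nz = UHP_nz[OF that]
    \<comment> \<open>The law of the derivative of E2 is obtained by differentiating both sides of
      the inversion law of E2.\<close>
    have "((\<lambda>\<tau>. -1 / \<tau>) has_field_derivative 1 / \<tau> ^ 2) (at \<tau>)"
      using nz by (auto intro!: derivative_eq_intros simp: power2_eq_square)
    from DERIV_chain2[OF deriv_compose_qq[OF e2_holomorphic T] this]
    have 1: "((\<lambda>\<tau>. e2 (qq (-1 / \<tau>))) has_field_derivative c2pi * Dq e2 (qq (-1 / \<tau>)) * (1 / \<tau> ^ 2)) (at \<tau>)" .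
    have 2: "((\<lambda>\<tau>. \<tau> ^ 2 * e2 (qq \<tau>) + 12 * \<tau> / c2pi) has_field_derivative
        2 * \<tau> * e2 (qq \<tau>) + \<tau> ^ 2 * (c2pi * Dq e2 (qq \<tau>)) + 12 / c2pi) (at \<tau>)"
      by (rule derivative_eq_intros deriv_compose_qq[OF e2_holomorphic that] refl | simp)+
    have "((\<lambda>\<tau>. e2 (qq (-1 / \<tau>))) has_field_derivative
        2 * \<tau> * e2 (qq \<tau>) + \<tau> ^ 2 * (c2pi * Dq e2 (qq \<tau>)) + 12 / c2pi) (at \<tau>)"
      by (rule has_field_derivative_transform_within_open[OF 2 open_UHP that]) (simp only: e2_inversion)
    from DERIV_unique[OF 1 this]
    have D: "Dq e2 (qq (-1 / \<tau>)) = (2 * \<tau> * e2 (qq \<tau>) + \<tau> ^ 2 * (c2pi * Dq e2 (qq \<tau>)) + 12 / c2pi) * \<tau> ^ 2 / c2pi"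
      using nz by (simp add: field_simps)
    then show ?thesis
      unfolding X_def e2_inversion[OF that] e4_inversion[OF that] D using nz
      by (simp add: field_simps power2_eq_square eval_nat_numeral)
  qed
  \<comment> \<open>X^3 / eta^24 with one factor q cancelled: X = q Y contributes q^3 and eta^24
    only q. The cube is taken to match the weight 12 of eta^24.\<close>
  define h where "h = (\<lambda>q. q ^ 2 * Y q ^ 3 / euler_prod q ^ 24)"
  have h: "h holomorphic_on ball 0 1"
    unfolding h_def using euler_prod_nz by (intro holomorphic_intros Y euler_prod_holomorphic) auto
  have h_eq: "h (qq \<tau>) = X (qq \<tau>) ^ 3 / dedekind_eta \<tau> ^ 24" for \<tau>
    unfolding h_def eta_24 Y(2) by (simp add: power_mult_distrib eval_nat_numeral)
  have "h q = 0" if q: "norm q < 1" for q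
  proof (rule fricke_zero[of 1, OF _ _ h h _ _ q])
    fix \<tau> assume t: "\<tau> \<in> UHP"
    have "dedekind_eta (-1 / \<tau>) ^ 24 = (dedekind_eta (-1 / \<tau>) ^ 2) ^ 12" by (simp flip: power_mult)
    also have "\<dots> = \<tau> ^ 12 * dedekind_eta \<tau> ^ 24"
      unfolding eta_inversion[OF t] by (simp add: power_mult_distrib flip: power_mult)
    finally have "h (qq (-1 / \<tau>)) = (\<tau> ^ 4 * X (qq \<tau>)) ^ 3 / (\<tau> ^ 12 * dedekind_eta \<tau> ^ 24)"
      unfolding h_eq X_inv[OF t] by simp
    also have "\<dots> = h (qq \<tau>)" using UHP_nz[OF t] by (simp add: h_eq power_mult_distrib flip: power_mult)
    finally show "h (qq (-1 / (of_nat 1 * \<tau>))) = h (qq \<tau>)" by simp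
  qed (auto simp: h_def)
  then have "q = 0 \<or> Y q = 0" using assms euler_prod_nz[OF assms] by (auto simp: h_def)
  then have "X q = 0" using Y(2) by auto
  then show ?thesis by (simp add: X_def)
qed

section \<open>Identities of level 2 and 3\<close>

text \<open>A relation, since it asserts differentiability along with the value; its rules compose
  as those of \<open>has_field_derivative\<close> do.\<close>

definition has_Dq :: "(complex \<Rightarrow> complex) \<Rightarrow> complex \<Rightarrow> complex \<Rightarrow> bool" where
  "has_Dq f d q \<longleftrightarrow> (\<exists>f'. (f has_field_derivative f') (at q) \<and> q * f' = d)"

lemma has_Dq_imp_Dq: "has_Dq f d q \<Longrightarrow> Dq f q = d"
  unfolding has_Dq_def Dq_def using DERIV_imp_deriv by blast

lemma has_Dq_Dq:
  assumes "f holomorphic_on ball 0 1" "norm q < 1"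
  shows "has_Dq f (Dq f q) q"
  unfolding has_Dq_def Dq_def using holomorphic_derivI[OF assms(1), of q] assms(2) by auto

lemma has_Dq_const: "has_Dq (\<lambda>q. c) 0 q"
  unfolding has_Dq_def by (rule exI[of _ 0]) auto

lemma has_Dq_ident: "has_Dq (\<lambda>q. q) q q"
  unfolding has_Dq_def by (rule exI[of _ 1]) auto

lemma has_Dq_add: "has_Dq f a q \<Longrightarrow> has_Dq g b q \<Longrightarrow> has_Dq (\<lambda>q. f q + g q) (a + b) q"
  unfolding has_Dq_def using DERIV_add distrib_left by blast

lemma has_Dq_diff: "has_Dq f a q \<Longrightarrow> has_Dq g b q \<Longrightarrow> has_Dq (\<lambda>q. f q - g q) (a - b) q"
  unfolding has_Dq_def using DERIV_diff right_diff_distrib by blast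

lemma has_Dq_mult:
  assumes "has_Dq f a q" "has_Dq g b q" shows "has_Dq (\<lambda>q. f q * g q) (a * g q + b * f q) q"
proof -
  obtain f' g' where "(f has_field_derivative f') (at q)" "q * f' = a" "(g has_field_derivative g') (at q)" "q * g' = b"
    using assms unfolding has_Dq_def by blast
  then show ?thesis
    unfolding has_Dq_def by (intro exI[of _ "f' * g q + g' * f q"]) (auto intro: DERIV_mult simp: algebra_simps)
qed

lemma has_Dq_cmult: "has_Dq f a q \<Longrightarrow> has_Dq (\<lambda>q. c * f q) (c * a) q"
  using has_Dq_mult[OF has_Dq_const, of f a q c] by (simp add: mult_ac)

lemma has_Dq_power: "has_Dq f a q \<Longrightarrow> has_Dq (\<lambda>q. f q ^ n) (of_nat n * (a * f q ^ (n - Suc 0))) q"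
proof -
  assume "has_Dq f a q"
  then obtain f' where "(f has_field_derivative f') (at q)" "q * f' = a" unfolding has_Dq_def by blast
  then show ?thesis
    unfolding has_Dq_def by (intro exI[of _ "of_nat n * (f' * f q ^ (n - Suc 0))"]) (auto intro: DERIV_power)
qed

lemma has_Dq_divide:
  assumes "has_Dq f a q" "has_Dq g b q" "g q \<noteq> 0"
  shows "has_Dq (\<lambda>q. f q / g q) ((a * g q - f q * b) / g q ^ 2) q"
proof -
  obtain f' g' where "(f has_field_derivative f') (at q)" "q * f' = a" "(g has_field_derivative g') (at q)" "q * g' = b"
    using assms unfolding has_Dq_def by blast
  then show ?thesis
    unfolding has_Dq_def using assms(3)
    by (intro exI[of _ "(f' * g q - f q * g') / (g q * g q)"] conjI DERIV_divide)
      (auto simp: power2_eq_square algebra_simps)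
qed

lemma has_Dq_compose_power:
  assumes "has_Dq f a (q ^ n)" "0 < n"
  shows "has_Dq (\<lambda>q. f (q ^ n)) (of_nat n * a) q"
proof -
  obtain f' where f': "(f has_field_derivative f') (at (q ^ n))" "q ^ n * f' = a"
    using assms unfolding has_Dq_def by blast
  have "((\<lambda>q. q ^ n) has_field_derivative of_nat n * (1 * q ^ (n - Suc 0))) (at q)"
    by (rule DERIV_power[OF DERIV_ident])
  from DERIV_chain2[OF f'(1) this]
  have "((\<lambda>q. f (q ^ n)) has_field_derivative f' * (of_nat n * (1 * q ^ (n - Suc 0)))) (at q)" .
  moreover have "q * (f' * (of_nat n * (1 * q ^ (n - Suc 0)))) = of_nat n * a"
    using assms(2) by (cases n) (auto simp: f'(2)[symmetric] mult_ac)
  ultimately show ?thesis unfolding has_Dq_def by blast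
qed

lemma has_Dq_unique: "has_Dq f a q \<Longrightarrow> has_Dq f b q \<Longrightarrow> a = b"
  using has_Dq_imp_Dq by metis

lemma has_Dq_cong:
  assumes "has_Dq f a q" "norm q < 1" "\<And>q. norm q < 1 \<Longrightarrow> f q = g q"
  shows "has_Dq g a q"
proof -
  have "\<forall>\<^sub>F q in nhds q. f q = g q"
    unfolding eventually_nhds by (rule exI[of _ "ball 0 1"]) (use assms in auto)
  then show ?thesis
    using assms(1) DERIV_cong_ev[OF refl _ refl] unfolding has_Dq_def by blast
qed

lemma norm_power_less_1':
  fixes q :: complex
  shows "norm q < 1 \<Longrightarrow> 0 < n \<Longrightarrow> norm (q ^ n) < 1"
  using norm_power_less_1[of q "n - 1"] by simp

lemma holomorphic_compose_power [holomorphic_intros]: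
  assumes "f holomorphic_on ball 0 1" "0 < n"
  shows "(\<lambda>q. f (q ^ n)) holomorphic_on ball (0::complex) 1"
proof -
  have "(f \<circ> (\<lambda>q. q ^ n)) holomorphic_on ball 0 1"
    by (rule holomorphic_on_compose_gen[OF _ assms(1)])
      (use norm_power_less_1' assms(2) in \<open>auto intro!: holomorphic_intros\<close>)
  then show ?thesis by (simp add: o_def)
qed

lemma has_Dq_euler_prod: "norm q < 1 \<Longrightarrow> has_Dq euler_prod ((e2 q - 1) / 24 * euler_prod q) q"
  using has_Dq_Dq[OF euler_prod_holomorphic, of q] euler_prod_logderiv[of q] by (simp add: Dq_def e2_def)

lemma has_Dq_e2: "norm q < 1 \<Longrightarrow> has_Dq e2 ((e2 q ^ 2 - e4 q) / 12) q"
  using has_Dq_Dq[OF e2_holomorphic, of q] Dq_e2[of q] by simp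

lemma has_Dq_e2_power: "norm q < 1 \<Longrightarrow> 0 < n \<Longrightarrow> has_Dq (\<lambda>q. e2 (q ^ n)) (of_nat n * ((e2 (q ^ n) ^ 2 - e4 (q ^ n)) / 12)) q"
  by (intro has_Dq_compose_power has_Dq_e2 norm_power_less_1')

lemma has_Dq_euler_prod_power: "norm q < 1 \<Longrightarrow> 0 < n \<Longrightarrow>
    has_Dq (\<lambda>q. euler_prod (q ^ n)) (of_nat n * ((e2 (q ^ n) - 1) / 24 * euler_prod (q ^ n))) q"
  by (intro has_Dq_compose_power has_Dq_euler_prod norm_power_less_1')

lemma euler_prod_power_nz: "norm q < 1 \<Longrightarrow> 0 < n \<Longrightarrow> euler_prod (q ^ n) \<noteq> 0"
  by (rule euler_prod_nz[OF norm_power_less_1'])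

text \<open>These are the eta quotients eta(\<tau>)^16 / eta(2\<tau>)^8 and eta(2\<tau>)^16 /
  eta(\<tau>)^8 of weight 4, then eta(\<tau>)^9 / eta(3\<tau>)^3 and eta(3\<tau>)^9 / eta(\<tau>)^3
  of weight 3. None has a zero in the upper half-plane. The first of each pair is 1 at q = 0, the
  second has a simple zero there, and the Fricke involution exchanges the two up to elementary
  factors.\<close>

definition lev2a :: "complex \<Rightarrow> complex" where "lev2a q = euler_prod q ^ 16 / euler_prod (q ^ 2) ^ 8"
definition lev2b :: "complex \<Rightarrow> complex" where "lev2b q = q * euler_prod (q ^ 2) ^ 16 / euler_prod q ^ 8"
definition lev3a :: "complex \<Rightarrow> complex" where "lev3a q = euler_prod q ^ 9 / euler_prod (q ^ 3) ^ 3"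
definition lev3b :: "complex \<Rightarrow> complex" where "lev3b q = q * euler_prod (q ^ 3) ^ 9 / euler_prod q ^ 3"
definition eis_lev :: "nat \<Rightarrow> complex \<Rightarrow> complex" where "eis_lev n q = of_nat n * e2 (q ^ n) - e2 q"

lemma eis_lev_holomorphic: "0 < n \<Longrightarrow> eis_lev n holomorphic_on ball 0 1"
  unfolding eis_lev_def[abs_def] by (intro holomorphic_intros e2_holomorphic)

lemma lev_holomorphic:
  "lev2a holomorphic_on ball 0 1" "lev2b holomorphic_on ball 0 1" "lev3a holomorphic_on ball 0 1" "lev3b holomorphic_on ball 0 1"
  unfolding lev2a_def[abs_def] lev2b_def[abs_def] lev3a_def[abs_def] lev3b_def[abs_def]
  using euler_prod_nz euler_prod_power_nz by (auto intro!: holomorphic_intros euler_prod_holomorphic)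

lemma lev_nz:
  assumes "norm q < 1"
  shows "lev2a q \<noteq> 0" "lev3a q \<noteq> 0" "q \<noteq> 0 \<Longrightarrow> lev2b q \<noteq> 0" "q \<noteq> 0 \<Longrightarrow> lev3b q \<noteq> 0"
  using assms euler_prod_nz euler_prod_power_nz by (auto simp: lev2a_def lev2b_def lev3a_def lev3b_def)

lemma lev_0: "lev2a 0 = 1" "lev2b 0 = 0" "lev3a 0 = 1" "lev3b 0 = 0"
  by (simp_all add: lev2a_def lev2b_def lev3a_def lev3b_def euler_prod_0)

text \<open>The inversion formula is available for eta^2 only. The level 2 quotients have even
  exponents; those of level 3 have odd ones, so only quadratic monomials in them are expressed
  through eta^2.\<close>

lemma lev_eta:
  assumes "\<tau> \<in> UHP"
  shows "lev2a (qq \<tau>) = (dedekind_eta \<tau> ^ 2) ^ 8 / (dedekind_eta (of_nat 2 * \<tau>) ^ 2) ^ 4"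
    "lev2b (qq \<tau>) = (dedekind_eta (of_nat 2 * \<tau>) ^ 2) ^ 8 / (dedekind_eta \<tau> ^ 2) ^ 4"
    "lev3a (qq \<tau>) ^ 2 = (dedekind_eta \<tau> ^ 2) ^ 9 / (dedekind_eta (of_nat 3 * \<tau>) ^ 2) ^ 3"
    "lev3b (qq \<tau>) ^ 2 = (dedekind_eta (of_nat 3 * \<tau>) ^ 2) ^ 9 / (dedekind_eta \<tau> ^ 2) ^ 3"
    "lev3a (qq \<tau>) * lev3b (qq \<tau>) = (dedekind_eta \<tau> ^ 2) ^ 3 * (dedekind_eta (of_nat 3 * \<tau>) ^ 2) ^ 3"
proof -
  define x where "x = qpow (1/24) \<tau>"
  have x: "x \<noteq> 0" "qq \<tau> = x ^ 24" by (simp_all add: x_def qpow_24_power)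
  have n: "norm (qq \<tau>) < 1" by (rule norm_qq_less_1[OF assms])
  define P P2 P3 where "P = euler_prod (qq \<tau>)" and "P2 = euler_prod (qq \<tau> ^ 2)" and "P3 = euler_prod (qq \<tau> ^ 3)"
  have nz: "P \<noteq> 0" "P2 \<noteq> 0" "P3 \<noteq> 0" using euler_prod_nz[OF n] euler_prod_power_nz[OF n] by (auto simp: P_def P2_def P3_def)
  have eta: "dedekind_eta \<tau> = x * P" "dedekind_eta (of_nat 2 * \<tau>) = x ^ 2 * P2" "dedekind_eta (of_nat 3 * \<tau>) = x ^ 3 * P3"
    unfolding dedekind_eta_eq qpow_24_mult qq_mult_of_nat by (simp_all add: x_def P_def P2_def P3_def)
  note defs = lev2a_def lev2b_def lev3a_def lev3b_def P_def[symmetric] P2_def[symmetric] P3_def[symmetric]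
  show "lev2a (qq \<tau>) = (dedekind_eta \<tau> ^ 2) ^ 8 / (dedekind_eta (of_nat 2 * \<tau>) ^ 2) ^ 4"
    "lev2b (qq \<tau>) = (dedekind_eta (of_nat 2 * \<tau>) ^ 2) ^ 8 / (dedekind_eta \<tau> ^ 2) ^ 4"
    "lev3a (qq \<tau>) ^ 2 = (dedekind_eta \<tau> ^ 2) ^ 9 / (dedekind_eta (of_nat 3 * \<tau>) ^ 2) ^ 3"
    "lev3b (qq \<tau>) ^ 2 = (dedekind_eta (of_nat 3 * \<tau>) ^ 2) ^ 9 / (dedekind_eta \<tau> ^ 2) ^ 3"
    "lev3a (qq \<tau>) * lev3b (qq \<tau>) = (dedekind_eta \<tau> ^ 2) ^ 3 * (dedekind_eta (of_nat 3 * \<tau>) ^ 2) ^ 3"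
    unfolding eta defs unfolding x(2) using x(1) nz
    by (simp_all add: power_mult_distrib power_divide divide_simps flip: power_mult power_add) (simp add: eval_nat_numeral)
qed

lemma power_minus_i: "(- \<i>) ^ 4 = 1" "(- \<i>) ^ 8 = 1" "\<i> ^ 3 = - \<i>" "\<i> ^ 9 = \<i>"
  by (simp_all add: eval_nat_numeral)

text \<open>The constants are powers of the factor N in \<open>eta_fricke\<close>: 256 = 2^8, 19683
  = 3^9 and 27 = 3^3; the minus signs are (-i)^6.\<close>

lemma lev_fricke:
  assumes "\<tau> \<in> UHP"
  shows "lev2a (qq (-1 / (of_nat 2 * \<tau>))) = 256 * \<tau> ^ 4 * lev2b (qq \<tau>)"
    "lev2b (qq (-1 / (of_nat 2 * \<tau>))) = \<tau> ^ 4 / 16 * lev2a (qq \<tau>)"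
    "lev3a (qq (-1 / (of_nat 3 * \<tau>))) ^ 2 = - 19683 * \<tau> ^ 6 * lev3b (qq \<tau>) ^ 2"
    "lev3b (qq (-1 / (of_nat 3 * \<tau>))) ^ 2 = - (\<tau> ^ 6) / 27 * lev3a (qq \<tau>) ^ 2"
    "lev3a (qq (-1 / (of_nat 3 * \<tau>))) * lev3b (qq (-1 / (of_nat 3 * \<tau>))) = - 27 * \<tau> ^ 6 * (lev3a (qq \<tau>) * lev3b (qq \<tau>))"
proof -
  have W: "-1 / (of_nat n * \<tau>) \<in> UHP" if "0 < n" for n :: nat using UHP_fricke[OF assms that] .
  have nz: "\<tau> \<noteq> 0" "dedekind_eta \<tau> \<noteq> 0" "0 < n \<Longrightarrow> dedekind_eta (of_nat n * \<tau>) \<noteq> 0" for n :: nat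
    using UHP_nz[OF assms] dedekind_eta_nz[OF assms] dedekind_eta_nz[OF UHP_mult_nat[OF assms]] by auto
  show "lev2a (qq (-1 / (of_nat 2 * \<tau>))) = 256 * \<tau> ^ 4 * lev2b (qq \<tau>)"
    "lev2b (qq (-1 / (of_nat 2 * \<tau>))) = \<tau> ^ 4 / 16 * lev2a (qq \<tau>)"
    unfolding lev_eta[OF assms] lev_eta[OF W[of 2], simplified] lev_eta[OF W[of 2, OF zero_less_numeral]] eta_fricke[OF assms zero_less_numeral]
    using nz(1,2) nz(3)[of 2] by (simp_all add: power_mult_distrib power_minus_i divide_simps flip: power_mult power_add)
  show "lev3a (qq (-1 / (of_nat 3 * \<tau>))) ^ 2 = - 19683 * \<tau> ^ 6 * lev3b (qq \<tau>) ^ 2"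
    "lev3b (qq (-1 / (of_nat 3 * \<tau>))) ^ 2 = - (\<tau> ^ 6) / 27 * lev3a (qq \<tau>) ^ 2"
    "lev3a (qq (-1 / (of_nat 3 * \<tau>))) * lev3b (qq (-1 / (of_nat 3 * \<tau>))) = - 27 * \<tau> ^ 6 * (lev3a (qq \<tau>) * lev3b (qq \<tau>))"
    unfolding lev_eta[OF assms] lev_eta[OF W[of 3, OF zero_less_numeral]] eta_fricke[OF assms zero_less_numeral]
    using nz(1,2) nz(3)[of 3] by (simp_all add: power_mult_distrib power_minus_i divide_simps flip: power_mult power_add)
qed

lemma eis_lev_fricke:
  assumes "\<tau> \<in> UHP" "0 < n"
  shows "eis_lev n (qq (-1 / (of_nat n * \<tau>))) = - of_nat n * \<tau> ^ 2 * eis_lev n (qq \<tau>)"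
  unfolding eis_lev_def by (rule e2_fricke[OF assms])

lemma eis_lev_0: "0 < n \<Longrightarrow> eis_lev n 0 = of_nat n - 1"
  by (simp add: eis_lev_def e2_0 zero_power)

text \<open>\<open>lev2a\<close> has no zero on the disc, so f1 / \<open>lev2a\<close> is
  holomorphic. Its Fricke image is f2 / \<open>lev2b\<close> up to a constant, where the zero of
  \<open>f2\<close> at 0 cancels the simple zero of \<open>lev2b\<close>. So a form of weight 4 is
  determined by its values at the two cusps.\<close>

lemma lev2_liouville:
  assumes f1: "f1 holomorphic_on ball 0 1" "f1 0 = 0" and f2: "f2 holomorphic_on ball 0 1" "f2 0 = 0"
    and W: "\<And>\<tau>. \<tau> \<in> UHP \<Longrightarrow> f1 (qq (-1 / (of_nat 2 * \<tau>))) = c * \<tau> ^ 4 * f2 (qq \<tau>)"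
    and q: "norm q < 1"
  shows "f1 q = 0"
proof -
  obtain g where g: "g holomorphic_on ball 0 1" "\<And>q. f2 q = q * g q"
    using holomorphic_factor_zero[OF f2] by blast
  define h1 where "h1 = (\<lambda>q. f1 q / lev2a q)"
  define h2 where "h2 = (\<lambda>q. c / 256 * g q * euler_prod q ^ 8 / euler_prod (q ^ 2) ^ 16)"
  have "h1 q = 0"
  proof (rule fricke_zero[of 2, OF _ _ _ _ _ _ q])
    show "h1 holomorphic_on ball 0 1"
      unfolding h1_def using lev_nz(1) by (intro holomorphic_intros f1 lev_holomorphic) auto
    show "h2 holomorphic_on ball 0 1"
      unfolding h2_def using euler_prod_power_nz by (intro holomorphic_intros g euler_prod_holomorphic) auto
    show "h1 0 = 0" using f1 by (simp add: h1_def)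
    fix \<tau> assume t: "\<tau> \<in> UHP"
    have n: "norm (qq \<tau>) < 1" by (rule norm_qq_less_1[OF t])
    have "lev2b (qq \<tau>) \<noteq> 0" using lev_nz(3)[OF n] by simp
    have "h1 (qq (-1 / (of_nat 2 * \<tau>))) = (c * \<tau> ^ 4 * f2 (qq \<tau>)) / (256 * \<tau> ^ 4 * lev2b (qq \<tau>))"
      unfolding h1_def W[OF t] lev_fricke[OF t] ..
    also have "\<dots> = h2 (qq \<tau>)"
      using UHP_nz[OF t] euler_prod_nz[OF n] euler_prod_power_nz[OF n, of 2]
      by (simp add: h2_def lev2b_def g(2))
    finally show "h1 (qq (-1 / (of_nat 2 * \<tau>))) = h2 (qq \<tau>)" .
  qed auto
  then show ?thesis using lev_nz(1)[OF q] by (simp add: h1_def)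
qed

text \<open>The cusp infinity gives the coefficient 1 of \<open>lev2a\<close>. The Fricke involution
  turns 256 \<open>lev2b\<close> and 16 \<open>lev2b\<close> into 16 \<tau>^4 \<open>lev2a\<close>
  and \<tau>^4 \<open>lev2a\<close>, to be matched with the images 16 \<tau>^4 E4(2\<tau>) and
  \<tau>^4 E4(\<tau>) of the left sides.\<close>

lemma lev2_e4:
  assumes "norm q < 1"
  shows "e4 q = lev2a q + 256 * lev2b q" "e4 (q ^ 2) = lev2a q + 16 * lev2b q"
proof -
  let ?f1 = "\<lambda>q. e4 q - (lev2a q + 256 * lev2b q)" and ?f2 = "\<lambda>q. e4 (q ^ 2) - (lev2a q + 16 * lev2b q)"
  have h: "?f1 holomorphic_on ball 0 1" "?f2 holomorphic_on ball 0 1"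
    by (intro holomorphic_intros e4_holomorphic lev_holomorphic; simp)+
  have z: "?f1 0 = 0" "?f2 0 = 0" by (simp_all add: e4_0 lev_0)
  have "?f1 q = 0"
  proof (rule lev2_liouville[OF h(1) z(1) h(2) z(2) _ assms, of 16])
    fix \<tau> assume t: "\<tau> \<in> UHP"
    show "?f1 (qq (-1 / (of_nat 2 * \<tau>))) = 16 * \<tau> ^ 4 * ?f2 (qq \<tau>)"
      unfolding lev_fricke[OF t] e4_fricke[OF t zero_less_numeral] by (simp add: algebra_simps power_mult_distrib)
  qed
  then show "e4 q = lev2a q + 256 * lev2b q" by simp
  have "?f2 q = 0"
  proof (rule lev2_liouville[OF h(2) z(2) h(1) z(1) _ assms, of 1])
    fix \<tau> assume t: "\<tau> \<in> UHP"
    show "?f2 (qq (-1 / (of_nat 2 * \<tau>))) = 1 * \<tau> ^ 4 * ?f1 (qq \<tau>)"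
      unfolding lev_fricke[OF t] e4_fricke[OF t zero_less_numeral] by (simp add: algebra_simps)
  qed
  then show "e4 (q ^ 2) = lev2a q + 16 * lev2b q" by simp
qed

text \<open>The coefficient 64 is fixed at the cusp 0: the square of -2 \<tau>^2 is 4 \<tau>^4 = 64
  \<tau>^4 / 16.\<close>

lemma eis_lev2_sq:
  assumes "norm q < 1"
  shows "eis_lev 2 q ^ 2 = lev2a q + 64 * lev2b q"
proof -
  let ?f = "\<lambda>q. eis_lev 2 q ^ 2 - (lev2a q + 64 * lev2b q)"
  have h: "?f holomorphic_on ball 0 1"
    by (intro holomorphic_intros eis_lev_holomorphic lev_holomorphic) simp
  have z: "?f 0 = 0" by (simp add: eis_lev_0 lev_0)
  have "?f q = 0"
  proof (rule lev2_liouville[OF h z h z _ assms, of 4])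
    fix \<tau> assume t: "\<tau> \<in> UHP"
    show "?f (qq (-1 / (of_nat 2 * \<tau>))) = 4 * \<tau> ^ 4 * ?f (qq \<tau>)"
      unfolding lev_fricke[OF t] eis_lev_fricke[OF t zero_less_numeral] by (simp add: algebra_simps power_mult_distrib)
  qed
  then show ?thesis by simp
qed

text \<open>In weight 6 the divisor is \<open>lev3a\<close>^2, and its Fricke image
  \<open>lev3b\<close>^2 vanishes doubly at q = 0; hence the condition on the first derivative of
  \<open>f2\<close>.\<close>

lemma lev3_liouville:
  assumes f1: "f1 holomorphic_on ball 0 1" "f1 0 = 0"
    and f2: "f2 holomorphic_on ball 0 1" "f2 0 = 0" "deriv f2 0 = 0"
    and W: "\<And>\<tau>. \<tau> \<in> UHP \<Longrightarrow> f1 (qq (-1 / (of_nat 3 * \<tau>))) = c * \<tau> ^ 6 * f2 (qq \<tau>)"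
    and q: "norm q < 1"
  shows "f1 q = 0"
proof -
  obtain g0 where g0: "g0 holomorphic_on ball 0 1" "\<And>q. f2 q = q * g0 q" "g0 0 = 0"
    using holomorphic_factor_zero[OF f2(1,2)] f2(3) by metis
  obtain g where g: "g holomorphic_on ball 0 1" "\<And>q. g0 q = q * g q"
    using holomorphic_factor_zero[OF g0(1,3)] by blast
  define h1 where "h1 = (\<lambda>q. f1 q / lev3a q ^ 2)"
  define h2 where "h2 = (\<lambda>q. - c / 19683 * g q * euler_prod q ^ 6 / euler_prod (q ^ 3) ^ 18)"
  have "h1 q = 0"
  proof (rule fricke_zero[of 3, OF _ _ _ _ _ _ q])
    show "h1 holomorphic_on ball 0 1"
      unfolding h1_def using lev_nz(2) by (intro holomorphic_intros f1 lev_holomorphic) auto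
    show "h2 holomorphic_on ball 0 1"
      unfolding h2_def using euler_prod_power_nz by (intro holomorphic_intros g euler_prod_holomorphic) auto
    show "h1 0 = 0" using f1 by (simp add: h1_def)
    fix \<tau> assume t: "\<tau> \<in> UHP"
    have n: "norm (qq \<tau>) < 1" by (rule norm_qq_less_1[OF t])
    have "h1 (qq (-1 / (of_nat 3 * \<tau>))) = (c * \<tau> ^ 6 * f2 (qq \<tau>)) / (- 19683 * \<tau> ^ 6 * lev3b (qq \<tau>) ^ 2)"
      unfolding h1_def W[OF t] lev_fricke(3)[OF t] ..
    also have "\<dots> = h2 (qq \<tau>)"
      using UHP_nz[OF t] euler_prod_nz[OF n] euler_prod_power_nz[OF n, of 3]
      by (simp add: h2_def lev3b_def g0(2) g(2) power_divide power_mult_distrib power2_eq_square divide_simps flip: power_mult)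
    finally show "h1 (qq (-1 / (of_nat 3 * \<tau>))) = h2 (qq \<tau>)" .
  qed auto
  then show ?thesis using lev_nz(2)[OF q] by (simp add: h1_def)
qed

lemma deriv_lambert_0: "(lambert k has_field_derivative 1) (at 0)"
proof -
  have "(lambert' k has_field_derivative deriv (lambert' k) 0) (at 0)"
    by (rule holomorphic_derivI[OF lambert'_holomorphic]) auto
  from DERIV_mult[OF DERIV_ident this] have "((\<lambda>q. q * lambert' k q) has_field_derivative 1) (at 0)"
    by (simp add: lambert'_0)
  then show ?thesis
    by (rule has_field_derivative_transform_within_open[of _ _ _ "ball 0 1"]) (auto simp: lambert_eq)
qed

text \<open>The logarithmic derivative with respect to q d/dq says nothing at q = 0. With
  \<open>q\<close> cancelled it becomes a relation between \<open>euler_prod\<close> and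
  \<open>lambert'\<close> on the punctured disc, which extends to 0 by the identity theorem.\<close>

lemma deriv_euler_prod_0: "(euler_prod has_field_derivative -1) (at 0)"
proof -
  have d: "(euler_prod has_field_derivative deriv euler_prod 0) (at 0)"
    by (rule holomorphic_derivI[OF euler_prod_holomorphic]) auto
  have "deriv euler_prod 0 + lambert' 1 0 * euler_prod 0 = 0"
  proof (rule analytic_continuation[of "\<lambda>q. deriv euler_prod q + lambert' 1 q * euler_prod q" "ball 0 1" "ball 0 1 - {0}" 0])
    show "(\<lambda>q. deriv euler_prod q + lambert' 1 q * euler_prod q) holomorphic_on ball 0 1"
      by (intro holomorphic_intros euler_prod_holomorphic lambert'_holomorphic) auto
    show "(0::complex) islimpt ball 0 1 - {0}"
      by (metis islimpt_punctured centre_in_ball interior_limit_point interior_open open_ball zero_less_one)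
    fix q :: complex assume "q \<in> ball 0 1 - {0}"
    then have "q * (deriv euler_prod q + lambert' 1 q * euler_prod q) = 0" "q \<noteq> 0"
      using euler_prod_logderiv[of q] lambert_eq[of q 1] by (auto simp: algebra_simps)
    then show "deriv euler_prod q + lambert' 1 q * euler_prod q = 0" by simp
  qed auto
  then have "deriv euler_prod 0 = -1" by (simp add: lambert'_0 euler_prod_0 eq_neg_iff_add_eq_0)
  then show ?thesis using d by simp
qed

lemma deriv_compose_power_0:
  assumes "(f has_field_derivative f') (at 0)" "1 < n"
  shows "((\<lambda>q. f (q ^ n)) has_field_derivative 0) (at (0::complex))"
proof -
  have "((\<lambda>q. q ^ n) has_field_derivative of_nat n * (1 * 0 ^ (n - Suc 0))) (at (0::complex))"
    by (rule DERIV_power[OF DERIV_ident])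
  then have "((\<lambda>q. q ^ n) has_field_derivative 0) (at (0::complex))" using assms(2) by (simp add: zero_power)
  moreover have "(f has_field_derivative f') (at (0 ^ n))" using assms by (simp add: zero_power)
  ultimately show ?thesis using DERIV_chain2[of f f' "\<lambda>q. q ^ n" 0 0 UNIV] by simp
qed

lemma deriv_e_0: "(e2 has_field_derivative -24) (at 0)" "(e4 has_field_derivative 240) (at 0)"
  unfolding e2_def[abs_def] e4_def[abs_def]
  by (auto intro!: derivative_eq_intros deriv_lambert_0)

lemma deriv_eis_lev_0: "1 < n \<Longrightarrow> (eis_lev n has_field_derivative 24) (at 0)"
  unfolding eis_lev_def[abs_def]
  by (auto intro!: derivative_eq_intros deriv_e_0 deriv_compose_power_0[OF deriv_e_0(1)])

lemma deriv_lev3_0: "(lev3a has_field_derivative -9) (at 0)" "(lev3b has_field_derivative 1) (at 0)"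
proof -
  note e = DERIV_power[OF deriv_euler_prod_0] DERIV_power[OF deriv_compose_power_0[OF deriv_euler_prod_0, of 3]]
  show "(lev3a has_field_derivative -9) (at 0)"
    unfolding lev3a_def[abs_def] using DERIV_divide[OF e(1)[of 9] e(2)[of 3]] by (simp add: euler_prod_0)
  show "(lev3b has_field_derivative 1) (at 0)"
    unfolding lev3b_def[abs_def] using DERIV_divide[OF DERIV_mult[OF DERIV_ident e(2)[of 9]] e(1)[of 3]] by (simp add: euler_prod_0)
qed

text \<open>In terms of the cubic theta functions a, b, c of the Borweins, \<open>lev3a\<close> is
  b^3, 27 \<open>lev3b\<close> is c^3, \<open>lev3c\<close> is a^3 and
  \<open>eis_lev 3 q / 2\<close> is a^2. The function a, of weight 1, appears only as the quotient
  of the last two.\<close>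

abbreviation lev3c :: "complex \<Rightarrow> complex" where "lev3c q \<equiv> lev3a q + 27 * lev3b q"

text \<open>Agreement of the coefficients of q; for instance (1 + 12q)^3 and (1 + 18q)^2 both begin
  with 1 + 36q.\<close>

lemma lev3_deriv_zero:
  "deriv (\<lambda>q. (eis_lev 3 q / 2) ^ 3 - lev3c q ^ 2) 0 = 0"
  "deriv (\<lambda>q. eis_lev 3 q / 2 * e4 (q ^ 3) - lev3c q * (lev3a q + 3 * lev3b q)) 0 = 0"
  "deriv (\<lambda>q. eis_lev 3 q / 2 * e4 q - lev3c q * (lev3a q + 243 * lev3b q)) 0 = 0"
proof -
  note d = deriv_eis_lev_0[of 3] deriv_lev3_0 deriv_e_0 deriv_compose_power_0[OF deriv_e_0(2), of 3]
  note z = eis_lev_0 lev_0 e4_0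
  show "deriv (\<lambda>q. (eis_lev 3 q / 2) ^ 3 - lev3c q ^ 2) 0 = 0"
    by (rule DERIV_imp_deriv) (auto intro!: derivative_eq_intros d simp: z)
  show "deriv (\<lambda>q. eis_lev 3 q / 2 * e4 (q ^ 3) - lev3c q * (lev3a q + 3 * lev3b q)) 0 = 0"
    by (rule DERIV_imp_deriv) (auto intro!: derivative_eq_intros d simp: z)
  show "deriv (\<lambda>q. eis_lev 3 q / 2 * e4 q - lev3c q * (lev3a q + 243 * lev3b q)) 0 = 0"
    by (rule DERIV_imp_deriv) (auto intro!: derivative_eq_intros d simp: z)
qed

lemma lev3_fricke_quadratic:
  assumes "\<tau> \<in> UHP"
  shows "x * lev3a (qq (-1 / (of_nat 3 * \<tau>))) ^ 2 + y * (lev3a (qq (-1 / (of_nat 3 * \<tau>))) * lev3b (qq (-1 / (of_nat 3 * \<tau>))))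
     + z * lev3b (qq (-1 / (of_nat 3 * \<tau>))) ^ 2 =
    - (\<tau> ^ 6) * (19683 * x * lev3b (qq \<tau>) ^ 2 + 27 * y * (lev3a (qq \<tau>) * lev3b (qq \<tau>)) + z / 27 * lev3a (qq \<tau>) ^ 2)"
  unfolding lev_fricke(3-5)[OF assms] by (simp add: algebra_simps)

text \<open>E4 has weight 4 and the eta quotients have weight 3, so E4 is multiplied by a form of
  weight 2 to reach weight 6. The last two identities are exchanged by the Fricke involution: each
  serves as the image function in the proof of the other.\<close>

lemma lev3_identities:
  assumes "norm q < 1"
  shows "(eis_lev 3 q / 2) ^ 3 = lev3c q ^ 2"
    "eis_lev 3 q / 2 * e4 q = lev3c q * (lev3a q + 243 * lev3b q)"
    "eis_lev 3 q / 2 * e4 (q ^ 3) = lev3c q * (lev3a q + 3 * lev3b q)"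
proof -
  let ?f = "\<lambda>q. (eis_lev 3 q / 2) ^ 3 - lev3c q ^ 2"
  let ?f1 = "\<lambda>q. eis_lev 3 q / 2 * e4 q - lev3c q * (lev3a q + 243 * lev3b q)"
  let ?f2 = "\<lambda>q. eis_lev 3 q / 2 * e4 (q ^ 3) - lev3c q * (lev3a q + 3 * lev3b q)"
  have h: "?f holomorphic_on ball 0 1" "?f1 holomorphic_on ball 0 1" "?f2 holomorphic_on ball 0 1"
    by (intro holomorphic_intros eis_lev_holomorphic lev_holomorphic e4_holomorphic; simp)+
  have z: "?f 0 = 0" "?f1 0 = 0" "?f2 0 = 0" by (simp_all add: eis_lev_0 lev_0 e4_0)
  note ef = eis_lev_fricke[OF _ zero_less_numeral, of _ "num.Bit1 num.One"] e4_fricke[OF _ zero_less_numeral, of _ "num.Bit1 num.One"]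
  have "?f q = 0"
  proof (rule lev3_liouville[OF h(1) z(1) h(1) z(1) lev3_deriv_zero(1) _ assms, of "-27"])
    fix \<tau> assume t: "\<tau> \<in> UHP"
    show "?f (qq (-1 / (of_nat 3 * \<tau>))) = -27 * \<tau> ^ 6 * ?f (qq \<tau>)"
    proof -
      have c: "lev3c w ^ 2 = 1 * lev3a w ^ 2 + 54 * (lev3a w * lev3b w) + 729 * lev3b w ^ 2" for w
        by (simp add: algebra_simps power2_eq_square)
      show ?thesis
        unfolding c lev3_fricke_quadratic[OF t] ef[OF t] by (simp add: algebra_simps power_mult_distrib power_divide)
    qed
  qed
  then show "(eis_lev 3 q / 2) ^ 3 = lev3c q ^ 2" by simp
  have "?f1 q = 0"
  proof (rule lev3_liouville[OF h(2) z(2) h(3) z(3) lev3_deriv_zero(2) _ assms, of "-243"])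
    fix \<tau> assume t: "\<tau> \<in> UHP"
    show "?f1 (qq (-1 / (of_nat 3 * \<tau>))) = -243 * \<tau> ^ 6 * ?f2 (qq \<tau>)"
    proof -
      have c: "lev3c w * (lev3a w + 243 * lev3b w) = 1 * lev3a w ^ 2 + 270 * (lev3a w * lev3b w) + 6561 * lev3b w ^ 2" for w
        by (simp add: algebra_simps power2_eq_square)
      have c': "lev3c w * (lev3a w + 3 * lev3b w) = 1 * lev3a w ^ 2 + 30 * (lev3a w * lev3b w) + 81 * lev3b w ^ 2" for w
        by (simp add: algebra_simps power2_eq_square)
      show ?thesis
        unfolding c c' lev3_fricke_quadratic[OF t] ef[OF t]
        by (simp add: algebra_simps power_mult_distrib power2_eq_square eval_nat_numeral)
    qed
  qed
  then show "eis_lev 3 q / 2 * e4 q = lev3c q * (lev3a q + 243 * lev3b q)" by simp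
  have "?f2 q = 0"
  proof (rule lev3_liouville[OF h(3) z(3) h(2) z(2) lev3_deriv_zero(3) _ assms, of "-3"])
    fix \<tau> assume t: "\<tau> \<in> UHP"
    show "?f2 (qq (-1 / (of_nat 3 * \<tau>))) = -3 * \<tau> ^ 6 * ?f1 (qq \<tau>)"
    proof -
      have c: "lev3c w * (lev3a w + 3 * lev3b w) = 1 * lev3a w ^ 2 + 30 * (lev3a w * lev3b w) + 81 * lev3b w ^ 2" for w
        by (simp add: algebra_simps power2_eq_square)
      have c': "lev3c w * (lev3a w + 243 * lev3b w) = 1 * lev3a w ^ 2 + 270 * (lev3a w * lev3b w) + 6561 * lev3b w ^ 2" for w
        by (simp add: algebra_simps power2_eq_square)
      show ?thesis
        unfolding c c' lev3_fricke_quadratic[OF t] ef[OF t]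
        by (simp add: algebra_simps power_mult_distrib power2_eq_square eval_nat_numeral)
    qed
  qed
  then show "eis_lev 3 q / 2 * e4 (q ^ 3) = lev3c q * (lev3a q + 3 * lev3b q)" by simp
qed

section \<open>Logarithmic derivatives of eta quotients and the differential ring of level 2\<close>

lemma has_Dq_log_mult:
  "has_Dq f (a * f q) q \<Longrightarrow> has_Dq g (b * g q) q \<Longrightarrow> has_Dq (\<lambda>q. f q * g q) ((a + b) * (f q * g q)) q"
  using has_Dq_mult[of f "a * f q" q g "b * g q"] by (simp add: algebra_simps)

lemma has_Dq_log_power:
  assumes "has_Dq f (a * f q) q"
  shows "has_Dq (\<lambda>q. f q ^ n) (of_nat n * a * f q ^ n) q"
proof (cases n)
  case (Suc m)
  then show ?thesis using has_Dq_power[OF assms, of n] by (simp add: mult_ac)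
qed (simp add: has_Dq_const)

lemma has_Dq_log_divide:
  assumes "has_Dq f (a * f q) q" "has_Dq g (b * g q) q" "g q \<noteq> 0"
  shows "has_Dq (\<lambda>q. f q / g q) ((a - b) * (f q / g q)) q"
proof -
  have "(a * f q * g q - f q * (b * g q)) / g q ^ 2 = (a - b) * (f q / g q)"
    using assms(3) by (simp add: power2_eq_square field_simps)
  then show ?thesis using has_Dq_divide[OF assms] by simp
qed

lemma has_Dq_log_euler_prod_power: "norm q < 1 \<Longrightarrow> 0 < n \<Longrightarrow>
    has_Dq (\<lambda>q. euler_prod (q ^ n)) ((of_nat n * (e2 (q ^ n) - 1) / 24) * euler_prod (q ^ n)) q"
  using has_Dq_euler_prod_power[of q n] by (simp add: mult_ac)

lemma has_Dq_eq: "has_Dq f a q \<Longrightarrow> a = b \<Longrightarrow> has_Dq f b q"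
  by simp

lemma has_Dq_lev:
  assumes q: "norm q < 1"
  shows "has_Dq lev2a (2/3 * (e2 q - e2 (q ^ 2)) * lev2a q) q"
    "has_Dq lev2b ((4 * e2 (q ^ 2) - e2 q) / 3 * lev2b q) q"
    "has_Dq lev3a (3/8 * (e2 q - e2 (q ^ 3)) * lev3a q) q"
    "has_Dq lev3b ((9 * e2 (q ^ 3) - e2 q) / 8 * lev3b q) q"
proof -
  note P = has_Dq_euler_prod[OF q] and Pn = has_Dq_log_euler_prod_power[OF q]
  have i: "has_Dq (\<lambda>q. q) (1 * q) q" using has_Dq_ident[of q] by simp
  have nz: "euler_prod q ^ k \<noteq> 0" "euler_prod (q ^ 2) ^ k \<noteq> 0" "euler_prod (q ^ 3) ^ k \<noteq> 0" for k
    using euler_prod_nz[OF q] euler_prod_power_nz[OF q] by auto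
  show "has_Dq lev2a (2/3 * (e2 q - e2 (q ^ 2)) * lev2a q) q"
    unfolding lev2a_def[abs_def]
    by (rule has_Dq_eq[OF has_Dq_log_divide[OF has_Dq_log_power[OF P] has_Dq_log_power[OF Pn[OF zero_less_numeral]] nz(2)]])
      (rule arg_cong[of _ _ "\<lambda>c. c * _"], simp add: field_simps)
  show "has_Dq lev2b ((4 * e2 (q ^ 2) - e2 q) / 3 * lev2b q) q"
    unfolding lev2b_def[abs_def]
    by (rule has_Dq_eq[OF has_Dq_log_divide[OF has_Dq_log_mult[OF i has_Dq_log_power[OF Pn[OF zero_less_numeral]]] has_Dq_log_power[OF P] nz(1)]])
      (rule arg_cong[of _ _ "\<lambda>c. c * _"], simp add: field_simps)
  show "has_Dq lev3a (3/8 * (e2 q - e2 (q ^ 3)) * lev3a q) q"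
    unfolding lev3a_def[abs_def]
    by (rule has_Dq_eq[OF has_Dq_log_divide[OF has_Dq_log_power[OF P] has_Dq_log_power[OF Pn[OF zero_less_numeral]] nz(3)]])
      (rule arg_cong[of _ _ "\<lambda>c. c * _"], simp add: field_simps)
  show "has_Dq lev3b ((9 * e2 (q ^ 3) - e2 q) / 8 * lev3b q) q"
    unfolding lev3b_def[abs_def]
    by (rule has_Dq_eq[OF has_Dq_log_divide[OF has_Dq_log_mult[OF i has_Dq_log_power[OF Pn[OF zero_less_numeral]]] has_Dq_log_power[OF P] nz(1)]])
      (rule arg_cong[of _ _ "\<lambda>c. c * _"], simp add: field_simps)
qed

text \<open>E2(2\<tau>), \<open>eis_lev 2\<close> and \<open>lev2b\<close> generate a ring closed
  under the derivation. Identities of level 2 are verified there, after eliminating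
  \<open>lev2a\<close> and E2(\<tau>).\<close>

lemma lev2a_elim:
  assumes "norm q < 1" shows "lev2a q = eis_lev 2 q ^ 2 - 64 * lev2b q"
  using eis_lev2_sq[OF assms] by simp

lemma e2_elim: "e2 q = 2 * e2 (q ^ 2) - eis_lev 2 q"
  by (simp add: eis_lev_def)

lemma has_Dq_e2_sq:
  assumes q: "norm q < 1"
  shows "has_Dq (\<lambda>q. e2 (q ^ 2)) ((e2 (q ^ 2) ^ 2 - eis_lev 2 q ^ 2 + 48 * lev2b q) / 6) q"
  by (rule has_Dq_eq[OF has_Dq_e2_power[OF q, of 2]])
    (simp_all add: lev2_e4[OF q] lev2a_elim[OF q])

lemma has_Dq_lev2b:
  assumes q: "norm q < 1"
  shows "has_Dq lev2b ((2 * e2 (q ^ 2) + eis_lev 2 q) / 3 * lev2b q) q"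
  by (rule has_Dq_eq[OF has_Dq_lev(2)[OF q]]) (simp add: e2_elim[of q])

lemma has_Dq_eis_lev2:
  assumes q: "norm q < 1"
  shows "has_Dq (eis_lev 2) ((e2 (q ^ 2) * eis_lev 2 q + 96 * lev2b q - eis_lev 2 q ^ 2) / 3) q"
proof -
  define x E B where "x = e2 (q ^ 2)" and "E = eis_lev 2 q" and "B = lev2b q"
  have "has_Dq (eis_lev 2) (of_nat 2 * ((x ^ 2 - E ^ 2 + 48 * B) / 6) - ((2 * x - E) ^ 2 - (E ^ 2 - 64 * B + 256 * B)) / 12) q"
    unfolding eis_lev_def[abs_def]
    by (rule has_Dq_eq[OF has_Dq_diff[OF has_Dq_cmult[OF has_Dq_e2_sq[OF q]] has_Dq_e2[OF q]]])
      (simp add: x_def E_def B_def e2_elim[of q] lev2_e4[OF q] lev2a_elim[OF q])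
  then show ?thesis
    by (rule has_Dq_eq) (simp add: x_def E_def B_def field_simps power2_eq_square)
qed

section \<open>Schwarzian equations\<close>

text \<open>A Rankin-Cohen bracket: for f of weight 2 it is a modular form of weight 8, although the
  derivatives of f are not modular. This is why it can be a product of eta quotients.\<close>

definition schwarz :: "(complex \<Rightarrow> complex) \<Rightarrow> complex \<Rightarrow> complex" where
  "schwarz f q = 2 * f q * Dq (Dq f) q - 3 * Dq f q ^ 2"

lemma schwarzI:
  assumes "\<And>q. norm q < 1 \<Longrightarrow> has_Dq f (g q) q" "has_Dq g d q" "norm q < 1"
  shows "schwarz f q = 2 * f q * d - 3 * g q ^ 2"
proof -
  have 1: "Dq f q = g q" if "norm q < 1" for q using has_Dq_imp_Dq[OF assms(1)[OF that]] .
  then have "has_Dq (Dq f) d q" by (intro has_Dq_cong[OF assms(2,3)]) simp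
  then show ?thesis using has_Dq_imp_Dq 1[OF assms(3)] by (simp add: schwarz_def)
qed

text \<open>A cusp form of weight 8 and level 2 must be a multiple of \<open>lev2a\<close> times
  \<open>lev2b\<close>; the factor 48 = 2 * 24 comes from the expansion 1 + 24q. The calculation
  takes place in the ring above, where E2(2\<tau>) drops out.\<close>

theorem schwarz_eis_lev2:
  assumes q: "norm q < 1"
  shows "schwarz (eis_lev 2) q = 48 * lev2a q * lev2b q"
proof -
  define x E B where "x = e2 (q ^ 2)" and "E = eis_lev 2 q" and "B = lev2b q"
  define E' where "E' = (x * E + 96 * B - E ^ 2) / 3"
  have "has_Dq (\<lambda>q. 1/3 * (e2 (q ^ 2) * eis_lev 2 q + 96 * lev2b q - eis_lev 2 q * eis_lev 2 q))
    (1/3 * ((x ^ 2 - E ^ 2 + 48 * B) / 6 * E + E' * x + 96 * ((2 * x + E) / 3 * B) - (E' * E + E' * E))) q"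
    unfolding x_def E_def B_def E'_def
    by (intro has_Dq_cmult has_Dq_diff has_Dq_add has_Dq_mult has_Dq_e2_sq has_Dq_eis_lev2 has_Dq_lev2b q)
  moreover have "has_Dq (eis_lev 2) (1/3 * (e2 (q ^ 2) * eis_lev 2 q + 96 * lev2b q - eis_lev 2 q * eis_lev 2 q)) q"
    if "norm q < 1" for q
    by (rule has_Dq_eq[OF has_Dq_eis_lev2[OF that]]) (simp add: power2_eq_square)
  ultimately have "schwarz (eis_lev 2) q = 2 * E * (1/3 * ((x ^ 2 - E ^ 2 + 48 * B) / 6 * E + E' * x + 96 * ((2 * x + E) / 3 * B) - (E' * E + E' * E)))
    - 3 * (1/3 * (x * E + 96 * B - E * E)) ^ 2"
    unfolding x_def E_def B_def by (intro schwarzI q) auto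
  also have "\<dots> = 48 * (E ^ 2 - 64 * B) * B"
    unfolding E'_def by (simp add: field_simps power2_eq_square)
  finally show ?thesis by (simp add: lev2a_elim[OF q] E_def B_def)
qed

text \<open>The Eisenstein series of weight 6 in terms of level 2, which spares its own Lambert series.\<close>

definition e6 :: "complex \<Rightarrow> complex" where
  "e6 q = eis_lev 2 q * (lev2a q - 512 * lev2b q)"

definition disc_form :: "complex \<Rightarrow> complex" where
  "disc_form q = q * euler_prod q ^ 24"

lemma disc_form_eq:
  assumes "norm q < 1" shows "disc_form q = lev2a q ^ 2 * lev2b q"
  using euler_prod_nz[OF assms] euler_prod_power_nz[OF assms, of 2]
  by (simp add: disc_form_def lev2a_def lev2b_def power_divide divide_simps flip: power_mult power_add)

text \<open>E4 and E6 lie in the ring of level 2, so the other two of Ramanujan's equations are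
  polynomial identities there.\<close>

lemma has_Dq_e4:
  assumes q: "norm q < 1"
  shows "has_Dq e4 ((e2 q * e4 q - e6 q) / 3) q"
proof -
  define x E B where "x = e2 (q ^ 2)" and "E = eis_lev 2 q" and "B = lev2b q"
  have "has_Dq (\<lambda>q. eis_lev 2 q * eis_lev 2 q + 192 * lev2b q)
    ((x * E + 96 * B - E ^ 2) / 3 * E + (x * E + 96 * B - E ^ 2) / 3 * E + 192 * ((2 * x + E) / 3 * B)) q"
    unfolding x_def E_def B_def
    by (intro has_Dq_cmult has_Dq_add has_Dq_mult has_Dq_eis_lev2 has_Dq_lev2b q)
  then have "has_Dq e4 ((x * E + 96 * B - E ^ 2) / 3 * E + (x * E + 96 * B - E ^ 2) / 3 * E + 192 * ((2 * x + E) / 3 * B)) q"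
    by (rule has_Dq_cong[OF _ q]) (simp add: lev2_e4 lev2a_elim power2_eq_square)
  then show ?thesis
    by (rule has_Dq_eq) (simp add: e2_elim[of q] lev2_e4[OF q] e6_def lev2a_elim[OF q] x_def E_def B_def field_simps power2_eq_square)
qed

lemma e4_e6_disc:
  assumes q: "norm q < 1"
  shows "e4 q ^ 3 - e6 q ^ 2 = 1728 * disc_form q"
  unfolding e6_def disc_form_eq[OF q] lev2_e4[OF q] lev2a_elim[OF q]
  by (simp add: field_simps power2_eq_square power3_eq_cube)

lemma has_Dq_e6:
  assumes q: "norm q < 1"
  shows "has_Dq e6 ((e2 q * e6 q - e4 q ^ 2) / 2) q"
proof -
  define x E B where "x = e2 (q ^ 2)" and "E = eis_lev 2 q" and "B = lev2b q"
  define E' where "E' = (x * E + 96 * B - E ^ 2) / 3"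
  have "has_Dq (\<lambda>q. eis_lev 2 q * (eis_lev 2 q * eis_lev 2 q - 576 * lev2b q))
    (E' * (E * E - 576 * B) + (E' * E + E' * E - 576 * ((2 * x + E) / 3 * B)) * E) q"
    unfolding x_def E_def B_def E'_def
    by (intro has_Dq_cmult has_Dq_add has_Dq_diff has_Dq_mult has_Dq_eis_lev2 has_Dq_lev2b q)
  then have "has_Dq e6 (E' * (E * E - 576 * B) + (E' * E + E' * E - 576 * ((2 * x + E) / 3 * B)) * E) q"
    by (rule has_Dq_cong[OF _ q]) (simp add: e6_def lev2a_elim power2_eq_square)
  then show ?thesis
    by (rule has_Dq_eq) (simp add: E'_def e2_elim[of q] lev2_e4[OF q] e6_def lev2a_elim[OF q] x_def E_def B_def field_simps power2_eq_square)
qed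

text \<open>The Rankin-Cohen bracket for weight 4, a cusp form of weight 12 and so a multiple of the
  discriminant; 960 = 4 * 240.\<close>

theorem e4_ode:
  assumes q: "norm q < 1"
  shows "4 * e4 q * Dq (Dq e4) q - 5 * Dq e4 q ^ 2 = 960 * disc_form q"
proof -
  define P Q R where "P = e2 q" and "Q = e4 q" and "R = e6 q"
  have 1: "Dq e4 q = 1/3 * (e2 q * e4 q - e6 q)" if "norm q < 1" for q
    using has_Dq_imp_Dq[OF has_Dq_e4[OF that]] by simp
  have "has_Dq (\<lambda>q. 1/3 * (e2 q * e4 q - e6 q)) (1/3 * ((P ^ 2 - Q) / 12 * Q + (P * Q - R) / 3 * P - (P * R - Q ^ 2) / 2)) q"
    unfolding P_def Q_def R_def
    by (intro has_Dq_cmult has_Dq_diff has_Dq_mult has_Dq_e2 has_Dq_e4 has_Dq_e6 q)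
  then have "has_Dq (Dq e4) (1/3 * ((P ^ 2 - Q) / 12 * Q + (P * Q - R) / 3 * P - (P * R - Q ^ 2) / 2)) q"
    by (rule has_Dq_cong[OF _ q]) (simp add: 1)
  from has_Dq_imp_Dq[OF this] have 2: "Dq (Dq e4) q = 1/3 * ((P ^ 2 - Q) / 12 * Q + (P * Q - R) / 3 * P - (P * R - Q ^ 2) / 2)" .
  have d: "disc_form q = (Q ^ 3 - R ^ 2) / 1728" using e4_e6_disc[OF q] by (simp add: Q_def R_def)
  then show ?thesis
    unfolding d 2 1[OF q] P_def[symmetric] Q_def[symmetric] R_def[symmetric]
    by (simp add: field_simps power2_eq_square power3_eq_cube)
qed

text \<open>With e for \<open>ff\<close>, De = e E2(3\<tau>)/2 + w, where w is modular of weight 4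
  and only the product e w, of weight 6, is known in terms of the eta quotients. So e Dw comes from
  differentiating e w, and w^2 from squaring it and cancelling e^2, which is possible where e does
  not vanish.\<close>

theorem schwarz_eis_lev3:
  assumes q: "norm q < 1" and nz: "eis_lev 3 q \<noteq> 0"
  shows "schwarz (\<lambda>q. eis_lev 3 q / 2) q = 24 * lev3a q * lev3b q * (eis_lev 3 q / 2)"
proof -
  define ff where "ff = (\<lambda>q. eis_lev 3 q / 2)"
  define w where "w = (\<lambda>q. 1/24 * (e4 q - 9 * e4 (q ^ 3) - 4 * (ff q * ff q)))"
  have P: "e2 q = 3 * e2 (q ^ 3) - 2 * ff q" for q by (simp add: ff_def eis_lev_def field_simps)
  have D3: "has_Dq (\<lambda>q. e2 (q ^ 3)) (1/4 * (e2 (q ^ 3) ^ 2 - e4 (q ^ 3))) q" if "norm q < 1" for q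
    by (rule has_Dq_eq[OF has_Dq_e2_power[OF that, of 3]]) simp_all
  have Df: "has_Dq ff (1/2 * (ff q * e2 (q ^ 3)) + w q) q" if "norm q < 1" for q
  proof -
    have "has_Dq (\<lambda>q. 1/2 * (3 * e2 (q ^ 3) - e2 q)) (1/2 * (3 * (1/4 * (e2 (q ^ 3) ^ 2 - e4 (q ^ 3))) - (e2 q ^ 2 - e4 q) / 12)) q"
      by (intro has_Dq_cmult has_Dq_diff D3 has_Dq_e2 that)
    then have "has_Dq ff (1/2 * (3 * (1/4 * (e2 (q ^ 3) ^ 2 - e4 (q ^ 3))) - (e2 q ^ 2 - e4 q) / 12)) q"
      by (rule has_Dq_cong[OF _ that]) (simp add: ff_def eis_lev_def)
    then show ?thesis
      by (rule has_Dq_eq) (simp add: w_def P[of q] ff_def[symmetric] field_simps power2_eq_square)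
  qed
  have w_holo: "w holomorphic_on ball 0 1"
    unfolding w_def ff_def by (intro holomorphic_intros e4_holomorphic eis_lev_holomorphic) simp_all
  define W' where "W' = Dq w q"
  have Dw: "has_Dq w W' q" unfolding W'_def by (rule has_Dq_Dq[OF w_holo q])
  have fw: "ff q * w q = 1/2 * (lev3c q * (9 * lev3b q - lev3a q))" if "norm q < 1" for q
  proof -
    have "ff q * w q = 1/24 * (ff q * e4 q - 9 * (ff q * e4 (q ^ 3)) - 4 * ff q ^ 3)"
      unfolding w_def by (simp add: algebra_simps power3_eq_cube)
    also have "\<dots> = 1/2 * (lev3c q * (9 * lev3b q - lev3a q))"
      unfolding ff_def lev3_identities[OF that] by (simp add: field_simps power2_eq_square)
    finally show ?thesis .
  qed
  define e x a b W where "e = ff q" and "x = e2 (q ^ 3)" and "a = lev3a q" and "b = lev3b q" and "W = w q"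
  have D1: "has_Dq (\<lambda>q. ff q * w q) ((1/2 * (e * x) + W) * W + W' * e) q"
    unfolding e_def x_def W_def by (intro has_Dq_mult Df Dw q)
  have D2: "has_Dq (\<lambda>q. ff q * w q) (1/2 * ((3/4 * (x - e) * a + 27 * (3/4 * x + e/4) * b) * (9 * b - a)
      + (9 * ((3/4 * x + e/4) * b) - 3/4 * (x - e) * a) * (a + 27 * b))) q"
  proof -
    have Da: "has_Dq lev3a (3/4 * (x - e) * a) q"
      by (rule has_Dq_eq[OF has_Dq_lev(3)[OF q]]) (simp add: P[of q] x_def e_def a_def field_simps)
    have Db: "has_Dq lev3b ((3/4 * x + e/4) * b) q"
      by (rule has_Dq_eq[OF has_Dq_lev(4)[OF q]]) (simp add: P[of q] x_def e_def b_def field_simps)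
    have "has_Dq (\<lambda>q. 1/2 * (lev3c q * (9 * lev3b q - lev3a q)))
      (1/2 * ((3/4 * (x - e) * a + 27 * ((3/4 * x + e/4) * b)) * (9 * lev3b q - lev3a q)
      + (9 * ((3/4 * x + e/4) * b) - 3/4 * (x - e) * a) * lev3c q)) q"
      by (intro has_Dq_cmult has_Dq_mult has_Dq_add has_Dq_diff Da Db)
    then have "has_Dq (\<lambda>q. ff q * w q) (1/2 * ((3/4 * (x - e) * a + 27 * ((3/4 * x + e/4) * b)) * (9 * lev3b q - lev3a q)
      + (9 * ((3/4 * x + e/4) * b) - 3/4 * (x - e) * a) * lev3c q)) q"
      by (rule has_Dq_cong[OF _ q]) (simp add: fw)
    then show ?thesis by (rule has_Dq_eq) (simp add: a_def b_def mult.assoc)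
  qed
  have W'e: "W' * e = 1/2 * ((3/4 * (x - e) * a + 27 * (3/4 * x + e/4) * b) * (9 * b - a)
      + (9 * ((3/4 * x + e/4) * b) - 3/4 * (x - e) * a) * (a + 27 * b)) - (1/2 * (e * x) + W) * W"
    unfolding has_Dq_unique[OF D2 D1] by simp
  have e0: "e \<noteq> 0" using nz by (simp add: e_def ff_def)
  have eW: "e * W = 1/2 * ((a + 27 * b) * (9 * b - a))" using fw[OF q] by (simp add: e_def W_def a_def b_def)
  have e3: "e ^ 3 = (a + 27 * b) ^ 2" using lev3_identities(1)[OF q] by (simp add: e_def ff_def a_def b_def)
  \<comment> \<open>Squaring e W and rewriting (a + 27b)^2 as e^3 leaves e^2 as a common
    factor.\<close>
  have WW: "W ^ 2 = e * (9 * b - a) ^ 2 / 4"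
  proof -
    have "e ^ 2 * W ^ 2 = (1/2 * ((a + 27 * b) * (9 * b - a))) ^ 2"
      unfolding eW[symmetric] by (simp add: power_mult_distrib)
    also have "\<dots> = e ^ 3 * (9 * b - a) ^ 2 / 4" unfolding e3 by (simp add: power_mult_distrib power2_eq_square)
    finally have "e ^ 2 * W ^ 2 = e ^ 2 * (e * (9 * b - a) ^ 2 / 4)" by (simp add: power2_eq_square power3_eq_cube)
    then show ?thesis using e0 by simp
  qed
  have eQ3: "e * e4 (q ^ 3) = (a + 27 * b) * (a + 3 * b)"
    using lev3_identities(3)[OF q] by (simp add: e_def ff_def a_def b_def)
  have "has_Dq (\<lambda>q. 1/2 * (ff q * e2 (q ^ 3)) + w q)
      (1/2 * ((1/2 * (e * x) + W) * x + (1/4 * (x ^ 2 - e4 (q ^ 3))) * e) + W') q"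
    unfolding e_def x_def W_def by (intro has_Dq_add has_Dq_cmult has_Dq_mult Df D3 Dw q)
  then have "schwarz ff q = 2 * ff q * (1/2 * ((1/2 * (e * x) + W) * x + (1/4 * (x ^ 2 - e4 (q ^ 3))) * e) + W')
    - 3 * (1/2 * (ff q * e2 (q ^ 3)) + w q) ^ 2"
    by (intro schwarzI Df q)
  also have "\<dots> = e * (1/2 * (e * x) + W) * x + 1/4 * e * (e * x ^ 2 - e * e4 (q ^ 3)) + 2 * (W' * e) - 3 * (1/2 * (e * x) + W) ^ 2"
    by (simp add: e_def[symmetric] x_def[symmetric] W_def[symmetric] algebra_simps)
  also have "\<dots> = e * (1/2 * (e * x) + W) * x + 1/4 * e * (e * x ^ 2 - (a + 27 * b) * (a + 3 * b))
    + ((3/4 * (x - e) * a + 27 * (3/4 * x + e/4) * b) * (9 * b - a)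
      + (9 * ((3/4 * x + e/4) * b) - 3/4 * (x - e) * a) * (a + 27 * b)) - 2 * (1/2 * (e * x) + W) * W - 3 * (1/2 * (e * x) + W) ^ 2"
    unfolding W'e eQ3 by (simp add: algebra_simps)
  also have "\<dots> = 1/4 * e * (- (a + 27 * b) * (a + 3 * b))
    + ((3/4 * (x - e) * a + 27 * (3/4 * x + e/4) * b) * (9 * b - a)
      + (9 * ((3/4 * x + e/4) * b) - 3/4 * (x - e) * a) * (a + 27 * b)) - 3 * x * (e * W) - 5 * W ^ 2"
    by (simp add: field_simps power2_eq_square)
  also have "\<dots> = 24 * a * b * e"
    unfolding eW WW by (simp add: field_simps power2_eq_square)
  finally show ?thesis by (simp add: ff_def a_def b_def e_def)
qed

section \<open>Theta functions\<close>

definition qpoch :: "complex \<Rightarrow> nat \<Rightarrow> complex" where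
  "qpoch q n = (\<Prod>k<n. 1 - q ^ Suc k)"

definition qbinom :: "complex \<Rightarrow> nat \<Rightarrow> nat \<Rightarrow> complex" where
  "qbinom q n j = (if j \<le> n then qpoch q n / (qpoch q j * qpoch q (n - j)) else 0)"

lemma qpoch_nz: "norm q < 1 \<Longrightarrow> qpoch q n \<noteq> 0"
  unfolding qpoch_def using one_minus_power_nz by auto

lemma qpoch_Suc: "qpoch q (Suc n) = qpoch q n * (1 - q ^ Suc n)"
  by (simp add: qpoch_def)

lemma qpoch_0 [simp]: "qpoch q 0 = 1" by (simp add: qpoch_def)

text \<open>The q-Pascal rule, from 1 - q^(n+1) = (1 - q^(n-j)) + q^(n-j) (1 - q^(j+1)).\<close>

lemma qbinom_Suc:
  assumes "norm q < 1" "j \<le> n"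
  shows "qbinom q (Suc n) (Suc j) = qbinom q n (Suc j) + q ^ (n - j) * qbinom q n j"
proof (cases "j = n")
  case True
  then show ?thesis using qpoch_nz[OF assms(1)] by (simp add: qbinom_def)
next
  case False
  define b where "b = n - Suc j"
  have n: "n = j + Suc b" using False assms(2) by (simp add: b_def)
  have nz: "1 - q ^ Suc j \<noteq> 0" "1 - q ^ Suc b \<noteq> 0" "qpoch q j \<noteq> 0" "qpoch q b \<noteq> 0" "qpoch q n \<noteq> 0"
    using one_minus_power_nz qpoch_nz assms by auto
  have 1: "qbinom q (Suc n) (Suc j) = qpoch q n * (1 - q ^ Suc n) / (qpoch q j * (1 - q ^ Suc j) * (qpoch q b * (1 - q ^ Suc b)))"
    unfolding qbinom_def n by (simp add: qpoch_Suc)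
  have 2: "qbinom q n (Suc j) = qpoch q n / (qpoch q j * (1 - q ^ Suc j) * qpoch q b)"
    unfolding qbinom_def n by (simp add: qpoch_Suc)
  have 3: "qbinom q n j = qpoch q n / (qpoch q j * (qpoch q b * (1 - q ^ Suc b)))"
    unfolding qbinom_def n by (simp add: qpoch_Suc)
  have "q ^ Suc n = q ^ Suc j * q ^ Suc b" by (simp add: n power_add)
  then have 4: "1 - q ^ Suc n = (1 - q ^ Suc b) + q ^ Suc b * (1 - q ^ Suc j)"
    by (simp only: right_diff_distrib mult_1_right mult.commute) simp
  have 5: "n - j = Suc b" using n by simp
  define S T r where "S = 1 - q ^ Suc b" and "T = 1 - q ^ Suc j" and "r = q ^ Suc b"
  show ?thesis
    unfolding 1 2 3 4 5 using nz unfolding S_def[symmetric] T_def[symmetric] unfolding r_def[symmetric]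
    by (simp add: divide_simps) (simp add: algebra_simps)
qed

text \<open>The q-binomial theorem in base q^2, by induction with the q-Pascal rule; the exponents
  fit because 2(n - j) + (j + 1)^2 = j^2 + 2n + 1.\<close>

lemma rothe:
  assumes "norm q < 1"
  shows "(\<Prod>k<n. 1 + x * q ^ (2 * k + 1)) = (\<Sum>j\<le>n. qbinom (q ^ 2) n j * q ^ (j ^ 2) * x ^ j)"
proof (induction n)
  case 0
  show ?case by (simp add: qbinom_def)
next
  case (Suc n)
  let ?b = "qbinom (q ^ 2)"
  have q2: "norm (q ^ 2) < 1" using norm_power_less_1'[OF assms] by simp
  have z: "?b n (Suc n) = 0" by (simp add: qbinom_def)
  have b0: "?b m 0 = 1" for m using qpoch_nz[OF q2] by (simp add: qbinom_def)
  have "(\<Sum>j\<le>Suc n. ?b (Suc n) j * q ^ (j ^ 2) * x ^ j) =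
    1 + (\<Sum>j\<le>n. ?b (Suc n) (Suc j) * q ^ (Suc j ^ 2) * x ^ Suc j)"
    by (subst sum.atMost_Suc_shift) (simp add: b0)
  also have "(\<Sum>j\<le>n. ?b (Suc n) (Suc j) * q ^ (Suc j ^ 2) * x ^ Suc j) =
    (\<Sum>j\<le>n. ?b n (Suc j) * q ^ (Suc j ^ 2) * x ^ Suc j) +
    (\<Sum>j\<le>n. (?b n j * q ^ (j ^ 2) * x ^ j) * (x * q ^ (2 * n + 1)))"
    unfolding sum.distrib[symmetric]
  proof (rule sum.cong)
    fix j assume "j \<in> {..n}"
    then have j: "j \<le> n" by simp
    have "(q ^ 2) ^ (n - j) * q ^ (Suc j ^ 2) = q ^ (2 * (n - j) + Suc j ^ 2)"
      by (simp add: power_add power_mult)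
    also have "2 * (n - j) + Suc j ^ 2 = j ^ 2 + (2 * n + 1)"
      using j by (simp add: power2_eq_square)
    finally have e: "(q ^ 2) ^ (n - j) * q ^ (Suc j ^ 2) = q ^ (j ^ 2) * q ^ (2 * n + 1)"
      by (simp add: power_add)
    have "?b (Suc n) (Suc j) * q ^ (Suc j ^ 2) * x ^ Suc j =
      ?b n (Suc j) * q ^ (Suc j ^ 2) * x ^ Suc j + ?b n j * ((q ^ 2) ^ (n - j) * q ^ (Suc j ^ 2)) * x ^ Suc j"
      unfolding qbinom_Suc[OF q2 j] by (simp add: algebra_simps)
    then show "?b (Suc n) (Suc j) * q ^ (Suc j ^ 2) * x ^ Suc j =
      ?b n (Suc j) * q ^ (Suc j ^ 2) * x ^ Suc j + ?b n j * q ^ (j ^ 2) * x ^ j * (x * q ^ (2 * n + 1))"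
      unfolding e by (simp add: mult_ac)
  qed simp
  also have "1 + ((\<Sum>j\<le>n. ?b n (Suc j) * q ^ (Suc j ^ 2) * x ^ Suc j) +
    (\<Sum>j\<le>n. (?b n j * q ^ (j ^ 2) * x ^ j) * (x * q ^ (2 * n + 1)))) =
    (1 + (\<Sum>j\<le>n. ?b n (Suc j) * q ^ (Suc j ^ 2) * x ^ Suc j)) +
    (\<Sum>j\<le>n. (?b n j * q ^ (j ^ 2) * x ^ j)) * (x * q ^ (2 * n + 1))"
    by (simp add: sum_distrib_right)
  also have "1 + (\<Sum>j\<le>n. ?b n (Suc j) * q ^ (Suc j ^ 2) * x ^ Suc j) = (\<Sum>j\<le>Suc n. ?b n j * q ^ (j ^ 2) * x ^ j)"
    by (subst sum.atMost_Suc_shift) (simp add: b0)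
  also have "\<dots> = (\<Sum>j\<le>n. ?b n j * q ^ (j ^ 2) * x ^ j)" by (simp add: z)
  finally show ?case
    by (simp only: prod.lessThan_Suc Suc.IH) (simp add: algebra_simps)
qed

text \<open>\<open>rothe\<close> with 2n factors, centred by x = w / q^(2n): the upper half of the
  factors is 1 + q^(2k+1) w, and from each factor of the lower half w / q^(2k+1) is pulled out to
  leave 1 + q^(2k+1) / w.\<close>

lemma finite_triple_product:
  assumes "norm q < 1" "q \<noteq> 0" "w \<noteq> 0"
  shows "(\<Prod>k<n. (1 + q ^ (2 * k + 1) * w) * (1 + q ^ (2 * k + 1) / w)) =
    (\<Sum>m\<in>{- int n..int n}. qbinom (q ^ 2) (2 * n) (nat (m + int n)) * (q powi (m ^ 2) * w powi m))"
proof -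
  define x where "x = w / q ^ (2 * n)"
  have prod1: "(\<Prod>k<n. w / q ^ (2 * k + 1)) = w ^ n / q ^ (n ^ 2)" for n
  proof (induction n)
    case (Suc n)
    have "Suc n ^ 2 = n ^ 2 + (2 * n + 1)" by (simp add: power2_eq_square)
    then show ?case using Suc assms by (simp add: power_add mult_ac)
  qed simp
  have "(\<Prod>k<2 * n. 1 + x * q ^ (2 * k + 1)) = (\<Prod>k<n. 1 + x * q ^ (2 * k + 1)) * (\<Prod>k<n. 1 + x * q ^ (2 * (k + n) + 1))"
  proof -
    have "(\<Prod>k<n + n. f k) = (\<Prod>k<n. f k) * (\<Prod>k<n. f (k + n))" for f :: "nat \<Rightarrow> complex"
      using prod.atLeastLessThan_concat[of 0 n "n + n" f] prod.shift_bounds_nat_ivl[of f 0 n n]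
      by (simp add: lessThan_atLeast0)
    from this[of "\<lambda>k. 1 + x * q ^ (2 * k + 1)"] show ?thesis by (simp add: mult_2)
  qed
  also have "(\<Prod>k<n. 1 + x * q ^ (2 * (k + n) + 1)) = (\<Prod>k<n. 1 + q ^ (2 * k + 1) * w)"
    using assms by (intro prod.cong refl) (simp add: x_def distrib_left power_add)
  also have "(\<Prod>k<n. 1 + x * q ^ (2 * k + 1)) = (\<Prod>k<n. 1 + x * q ^ (2 * (n - Suc k) + 1))"
    by (rule prod.nat_diff_reindex[symmetric])
  also have "\<dots> = (\<Prod>k<n. (w / q ^ (2 * k + 1)) * (1 + q ^ (2 * k + 1) / w))"
  proof (intro prod.cong refl)
    fix k assume "k \<in> {..<n}"
    then have "2 * n = (2 * (n - Suc k) + 1) + (2 * k + 1)" by auto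
    then have "q ^ (2 * n) = q ^ (2 * (n - Suc k) + 1) * q ^ (2 * k + 1)" by (metis power_add)
    then have "x * q ^ (2 * (n - Suc k) + 1) = w / q ^ (2 * k + 1)"
      using assms by (simp add: x_def)
    moreover have "1 + w / q ^ (2 * k + 1) = (w / q ^ (2 * k + 1)) * (1 + q ^ (2 * k + 1) / w)"
      using assms by (simp add: divide_simps)
    ultimately show "1 + x * q ^ (2 * (n - Suc k) + 1) = (w / q ^ (2 * k + 1)) * (1 + q ^ (2 * k + 1) / w)" by simp
  qed
  also have "\<dots> = w ^ n / q ^ (n ^ 2) * (\<Prod>k<n. 1 + q ^ (2 * k + 1) / w)"
    unfolding prod.distrib prod1 ..
  finally have 1: "w ^ n / q ^ (n ^ 2) * (\<Prod>k<n. (1 + q ^ (2 * k + 1) * w) * (1 + q ^ (2 * k + 1) / w)) =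
    (\<Prod>k<2 * n. 1 + x * q ^ (2 * k + 1))"
    by (simp add: prod.distrib mult_ac)
  have "(\<Prod>k<2 * n. 1 + x * q ^ (2 * k + 1)) = (\<Sum>j\<le>2 * n. qbinom (q ^ 2) (2 * n) j * q ^ (j ^ 2) * x ^ j)"
    by (rule rothe[OF assms(1)])
  also have "\<dots> = (\<Sum>j\<le>2 * n. w ^ n / q ^ (n ^ 2) * (qbinom (q ^ 2) (2 * n) j * (q powi ((int j - int n) ^ 2) * w powi (int j - int n))))"
  proof (intro sum.cong refl)
    fix j
    have "q powi ((int j - int n) ^ 2) * q powi (int (2 * n * j)) = q powi ((int j - int n) ^ 2 + int (2 * n * j))"
      using assms(2) by (subst power_int_add) auto
    also have "(int j - int n) ^ 2 + int (2 * n * j) = int (j ^ 2) + int (n ^ 2)" by (simp add: power2_eq_square algebra_simps)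
    also have "q powi \<dots> = q ^ (j ^ 2) * q ^ (n ^ 2)" using assms(2) by (subst power_int_add) (auto simp only: power_int_of_nat)
    finally have "q powi ((int j - int n) ^ 2) = q ^ (j ^ 2) * q ^ (n ^ 2) / q ^ (2 * n * j)"
      using assms by (simp only: power_int_of_nat) (simp add: field_simps)
    moreover have "w powi (int j - int n) = w ^ j / w ^ n" using assms by (simp add: power_int_diff)
    moreover have "x ^ j = w ^ j / q ^ (2 * n * j)" by (simp add: x_def power_divide power_mult)
    ultimately show "qbinom (q ^ 2) (2 * n) j * q ^ (j ^ 2) * x ^ j =
      w ^ n / q ^ (n ^ 2) * (qbinom (q ^ 2) (2 * n) j * (q powi ((int j - int n) ^ 2) * w powi (int j - int n)))"
      using assms by simp
  qed
  also have "\<dots> = w ^ n / q ^ (n ^ 2) * (\<Sum>j\<le>2 * n. qbinom (q ^ 2) (2 * n) j * (q powi ((int j - int n) ^ 2) * w powi (int j - int n)))"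
    by (simp only: sum_distrib_left)
  also have "(\<Sum>j\<le>2 * n. qbinom (q ^ 2) (2 * n) j * (q powi ((int j - int n) ^ 2) * w powi (int j - int n))) =
    (\<Sum>m\<in>{- int n..int n}. qbinom (q ^ 2) (2 * n) (nat (m + int n)) * (q powi (m ^ 2) * w powi m))"
    by (rule sum.reindex_bij_witness[of _ "\<lambda>m. nat (m + int n)" "\<lambda>j. int j - int n"]) auto
  finally have 2: "(\<Prod>k<2 * n. 1 + x * q ^ (2 * k + 1)) = w ^ n / q ^ (n ^ 2) *
     (\<Sum>m\<in>{- int n..int n}. qbinom (q ^ 2) (2 * n) (nat (m + int n)) * (q powi (m ^ 2) * w powi m))" .
  show ?thesis using 1[unfolded 2] assms by simp
qed

text \<open>The sequence has no zero term and converges to a nonzero limit, so its inverses are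
  bounded too; this bounds all Gaussian coefficients uniformly.\<close>

lemma qpoch_bounds:
  assumes "norm q < 1"
  obtains c C where "0 < c" "\<And>n. c \<le> norm (qpoch q n)" "\<And>n. norm (qpoch q n) \<le> C"
proof -
  have lim: "(\<lambda>n. qpoch q n) \<longlonglongrightarrow> euler_prod q"
    unfolding qpoch_def by (rule euler_prod_has_prod(2)[OF assms])
  then have "Bseq (\<lambda>n. qpoch q n)" using convergentI convergent_imp_Bseq by blast
  then obtain C where C: "\<And>n. norm (qpoch q n) \<le> C" unfolding Bseq_def by blast
  have "(\<lambda>n. inverse (qpoch q n)) \<longlonglongrightarrow> inverse (euler_prod q)"
    using lim euler_prod_nz[OF assms] by (rule tendsto_inverse)
  then have "Bseq (\<lambda>n. inverse (qpoch q n))" using convergentI convergent_imp_Bseq by blast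
  then obtain K where K: "K > 0" "\<And>n. norm (inverse (qpoch q n)) \<le> K" unfolding Bseq_def by blast
  have "1 / K \<le> norm (qpoch q n)" for n
  proof -
    have "0 < norm (qpoch q n)" "1 / norm (qpoch q n) \<le> K"
      using K(2)[of n] qpoch_nz[OF assms, of n] by (simp_all add: norm_inverse inverse_eq_divide norm_divide)
    then show ?thesis using K(1) by (simp add: field_simps)
  qed
  with C K(1) that[of "1 / K" C] show ?thesis by simp
qed

text \<open>Limit of the finite version by Tannery's theorem: the Gaussian coefficients are
  uniformly bounded and each tends to 1 / \<open>euler_prod (q ^ 2)\<close>.\<close>

theorem jacobi_triple:
  fixes q w :: complex
  assumes q: "norm q < 1" "q \<noteq> 0" and w: "w \<noteq> 0"
    and s: "(\<lambda>m::int. norm (q powi (m ^ 2) * w powi m)) summable_on UNIV"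
  shows "(\<lambda>n. \<Prod>k<n. (1 + q ^ (2 * k + 1) * w) * (1 + q ^ (2 * k + 1) / w)) \<longlonglongrightarrow>
    (\<Sum>\<^sub>\<infinity>m\<in>(UNIV::int set). q powi (m ^ 2) * w powi m) / euler_prod (q ^ 2)"
proof -
  define t where "t = (\<lambda>m::int. q powi (m ^ 2) * w powi m)"
  have q2: "norm (q ^ 2) < 1" using norm_power_less_1'[OF q(1)] by simp
  define P where "P = euler_prod (q ^ 2)"
  have P: "P \<noteq> 0" "(\<lambda>n. qpoch (q ^ 2) n) \<longlonglongrightarrow> P"
    unfolding P_def qpoch_def using euler_prod_nz[OF q2] euler_prod_has_prod(2)[OF q2] by auto
  obtain c C where cC: "0 < c" "\<And>n. c \<le> norm (qpoch (q ^ 2) n)" "\<And>n. norm (qpoch (q ^ 2) n) \<le> C"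
    using qpoch_bounds[OF q2] by blast
  \<comment> \<open>Extended by 0, so that the sum over |m| <= n becomes a sum over all integers;
    these are enumerated by \<open>int_decode\<close>, as Tannery's theorem concerns series over the
    naturals.\<close>
  define a where "a = (\<lambda>n m. if m \<in> {- int n..int n} then qbinom (q ^ 2) (2 * n) (nat (m + int n)) else 0)"
  have bij: "bij int_decode" by (rule bij_int_decode)
  have a_bound: "norm (a n m) \<le> C / (c * c)" for n m
  proof (cases "m \<in> {- int n..int n}")
    case True
    then have "nat (m + int n) \<le> 2 * n" by auto
    then have "norm (a n m) = norm (qpoch (q ^ 2) (2 * n)) / (norm (qpoch (q ^ 2) (nat (m + int n))) * norm (qpoch (q ^ 2) (2 * n - nat (m + int n))))"
      using True by (simp add: a_def qbinom_def norm_divide norm_mult)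
    also have "\<dots> \<le> C / (c * c)" using cC by (intro frac_le mult_mono) (auto intro: order_trans[OF norm_ge_zero])
    finally show ?thesis .
  next
    case False
    then show ?thesis using cC order_trans[OF norm_ge_zero cC(3)] by (auto simp: a_def)
  qed
  have a_lim: "(\<lambda>n. a n m) \<longlonglongrightarrow> 1 / P" for m
  proof -
    have l: "(\<lambda>n. qpoch (q ^ 2) (f n)) \<longlonglongrightarrow> P" if "filterlim f at_top sequentially" for f :: "nat \<Rightarrow> nat"
      using filterlim_compose[OF P(2) that] .
    have f1: "filterlim (\<lambda>n. 2 * n :: nat) at_top sequentially"
      unfolding filterlim_at_top eventually_sequentially
    proof
      fix Z show "\<exists>N. \<forall>n\<ge>N. Z \<le> (2 * n :: nat)" by (rule exI[of _ Z]) auto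
    qed
    have f2: "filterlim (\<lambda>n. nat (m + int n)) at_top sequentially"
      unfolding filterlim_at_top eventually_sequentially
    proof
      fix Z show "\<exists>N. \<forall>n\<ge>N. Z \<le> nat (m + int n)" by (rule exI[of _ "Z + nat \<bar>m\<bar>"]) auto
    qed
    have f3: "filterlim (\<lambda>n. 2 * n - nat (m + int n)) at_top sequentially"
      unfolding filterlim_at_top eventually_sequentially
    proof
      fix Z show "\<exists>N. \<forall>n\<ge>N. Z \<le> 2 * n - nat (m + int n)" by (rule exI[of _ "Z + nat \<bar>m\<bar>"]) auto
    qed
    have "(\<lambda>n. qpoch (q ^ 2) (2 * n) / (qpoch (q ^ 2) (nat (m + int n)) * qpoch (q ^ 2) (2 * n - nat (m + int n)))) \<longlonglongrightarrow> P / (P * P)"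
      using P(1) by (intro tendsto_divide tendsto_mult l f1 f2 f3) simp
    moreover have "\<forall>\<^sub>F n in sequentially. qpoch (q ^ 2) (2 * n) / (qpoch (q ^ 2) (nat (m + int n)) * qpoch (q ^ 2) (2 * n - nat (m + int n))) = a n m"
      unfolding eventually_sequentially by (rule exI[of _ "nat \<bar>m\<bar>"]) (auto simp: a_def qbinom_def)
    ultimately show ?thesis using P(1) by (simp add: Lim_transform_eventually)
  qed
  have sum_decode: "summable (\<lambda>i. norm (t (int_decode i)))"
  proof -
    have "((\<lambda>m. norm (t m)) \<circ> int_decode) summable_on UNIV"
      using s summable_on_reindex_bij_betw[OF bij, of "\<lambda>m. norm (t m)"] by (simp add: t_def o_def)
    then show ?thesis by (auto dest: summable_on_imp_summable simp: o_def)
  qed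
  have tl: "(\<lambda>n. \<Sum>i. a n (int_decode i) * t (int_decode i)) \<longlonglongrightarrow> (\<Sum>i. 1 / P * t (int_decode i))"
  proof -
    have "((\<lambda>n. a n (int_decode i) * t (int_decode i)) \<longlongrightarrow> 1 / P * t (int_decode i)) sequentially" for i
      by (intro tendsto_mult a_lim tendsto_const)
    moreover have "\<forall>\<^sub>F (i, n) in at_top \<times>\<^sub>F sequentially.
        norm (a n (int_decode i) * t (int_decode i)) \<le> C / (c * c) * norm (t (int_decode i))"
      by (rule always_eventually) (auto simp only: norm_mult intro!: mult_right_mono a_bound norm_ge_zero)
    moreover have "summable (\<lambda>i. C / (c * c) * norm (t (int_decode i)))"
      using sum_decode by (rule summable_mult)
    ultimately show ?thesis
      using tannerys_theorem[of "\<lambda>i n. a n (int_decode i) * t (int_decode i)" _ sequentially] by simp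
  qed
  have fin: "(\<Sum>i. a n (int_decode i) * t (int_decode i)) = (\<Prod>k<n. (1 + q ^ (2 * k + 1) * w) * (1 + q ^ (2 * k + 1) / w))" for n
  proof -
    have f: "finite (int_decode -` {- int n..int n})" by (intro finite_vimageI inj_int_decode) auto
    have "(\<Sum>i. a n (int_decode i) * t (int_decode i)) = (\<Sum>i\<in>int_decode -` {- int n..int n}. a n (int_decode i) * t (int_decode i))"
      by (rule suminf_finite[OF f]) (auto simp: a_def)
    also have "\<dots> = (\<Sum>m\<in>{- int n..int n}. a n m * t m)"
      by (rule sum.reindex_bij_witness[of _ int_encode int_decode]) auto
    also have "\<dots> = (\<Sum>m\<in>{- int n..int n}. qbinom (q ^ 2) (2 * n) (nat (m + int n)) * (q powi (m ^ 2) * w powi m))"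
      by (intro sum.cong refl) (simp add: a_def t_def)
    finally show ?thesis using finite_triple_product[OF q w, of n] by simp
  qed
  have "(\<Sum>i. 1 / P * t (int_decode i)) = 1 / P * (\<Sum>i. t (int_decode i))"
    by (rule suminf_mult[OF summable_norm_cancel[OF sum_decode]])
  also have "(\<Sum>i. t (int_decode i)) = (\<Sum>\<^sub>\<infinity>i. t (int_decode i))"
    using norm_summable_imp_has_sum[OF sum_decode] summable_norm_cancel[OF sum_decode]
    by (metis infsumI summable_sums)
  also have "\<dots> = (\<Sum>\<^sub>\<infinity>m. t m)" using infsum_reindex_bij_betw[OF bij, of t] by simp
  finally show ?thesis using tl unfolding fin unfolding t_def P_def by simp
qed

section \<open>Theta constants as Euler products\<close>

lemma norm_summable_on_int:
  fixes f :: "int \<Rightarrow> complex"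
  assumes "summable (\<lambda>n. norm (f (int n)))" "summable (\<lambda>n. norm (f (- int n)))"
  shows "(\<lambda>m. norm (f m)) summable_on UNIV"
proof -
  have "(\<lambda>m. norm (f m)) summable_on (range int)" "(\<lambda>m. norm (f m)) summable_on (range (\<lambda>n. - int n))"
    using assms by (simp_all add: summable_on_reindex inj_def o_def summable_on_UNIV_nonneg_real_iff)
  then have "(\<lambda>m. norm (f m)) summable_on (range int \<union> range (\<lambda>n. - int n))" by (rule summable_on_union)
  moreover have "range int \<union> range (\<lambda>n. - int n) = UNIV"
  proof -
    have "m \<in> range int \<union> range (\<lambda>n. - int n)" for m
      by (cases "0 \<le> m") (auto intro: image_eqI[of _ _ "nat m"] image_eqI[of _ _ "nat (- m)"])
    then show ?thesis by blast
  qed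
  ultimately show ?thesis by simp
qed

lemma theta_summable_1:
  fixes q w :: complex
  assumes "norm q < 1" "norm w = 1"
  shows "(\<lambda>m::int. norm (q powi (m ^ 2) * w powi m)) summable_on UNIV"
proof -
  have le: "norm q ^ (n ^ 2) \<le> norm q ^ n" for n
    using assms(1) by (intro power_decreasing) (auto simp: power2_eq_square)
  have "summable (\<lambda>n. norm q ^ (n ^ 2))"
    by (rule summable_comparison_test'[of "\<lambda>n. norm q ^ n"]) (use assms(1) le in \<open>auto intro: summable_geometric\<close>)
  moreover have "q powi (int n ^ 2) = q ^ (n ^ 2)" for n by (simp flip: of_nat_power)
  ultimately show ?thesis
    using assms(2) by (intro norm_summable_on_int) (simp_all add: norm_mult norm_power norm_power_int)
qed

text \<open>At m = -n the exponent is n^2 - n, which is only at least n - 1; hence the factor 1/|q|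
  in the majorant.\<close>

lemma theta_summable_2:
  fixes q :: complex
  assumes "norm q < 1" "q \<noteq> 0"
  shows "(\<lambda>m::int. norm (q powi (m ^ 2) * q powi m)) summable_on UNIV"
proof -
  have e: "q powi (m ^ 2) * q powi m = q powi (m ^ 2 + m)" for m :: int
    using assms(2) by (subst power_int_add) auto
  have 1: "q powi (int n ^ 2 + int n) = q ^ (n ^ 2 + n)" for n
    by (simp flip: of_nat_power of_nat_add)
  have 2: "q powi ((- int n) ^ 2 + - int n) = q ^ (n ^ 2 - n)" for n
  proof -
    have "(- int n) ^ 2 + - int n = int (n ^ 2 - n)"
      by (simp add: of_nat_diff power2_eq_square)
    then show ?thesis by (simp only: power_int_of_nat)
  qed
  have g: "summable (\<lambda>n. norm q ^ n)" using assms by (intro summable_geometric) auto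
  show ?thesis
  proof (rule norm_summable_on_int)
    show "summable (\<lambda>n. norm (q powi (int n ^ 2) * q powi int n))"
      unfolding e 1 norm_power by (rule summable_comparison_test'[OF g, of 0]) (use assms in \<open>auto intro!: power_decreasing\<close>)
    have "norm q ^ (n ^ 2 - n) \<le> norm q ^ n * (1 / norm q)" for n
    proof (cases n)
      case 0
      then show ?thesis using assms by (simp add: field_simps)
    next
      case (Suc k)
      have "norm q ^ (n ^ 2 - n) \<le> norm q ^ k"
        using assms by (intro power_decreasing) (auto simp: Suc power2_eq_square)
      then show ?thesis using assms by (simp add: Suc)
    qed
    then show "summable (\<lambda>n. norm (q powi ((- int n) ^ 2) * q powi (- int n)))"
      unfolding e 2 norm_power
      by (intro summable_comparison_test'[OF summable_mult2[OF g], of 0 _ "1 / norm q"]) auto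
  qed
qed

text \<open>Partial Euler products of even length split by the parity of the exponent, and the even
  part is the Euler product at q^2.\<close>

lemma prod_odd_tendsto:
  assumes q: "norm q < 1"
  shows "(\<lambda>n. \<Prod>k<n. 1 - q ^ (2 * k + 1)) \<longlonglongrightarrow> euler_prod q / euler_prod (q ^ 2)"
    and prod_even_tendsto: "(\<lambda>n. \<Prod>k<n. 1 - q ^ (2 * k + 2)) \<longlonglongrightarrow> euler_prod (q ^ 2)"
proof -
  have q2: "norm (q ^ 2) < 1" using norm_power_less_1'[OF q] by simp
  have "(\<Prod>k<n. 1 - (q ^ 2) ^ Suc k) = (\<Prod>k<n. 1 - q ^ (2 * k + 2))" for n
    by (simp add: power_mult power2_eq_square power_mult_distrib mult_ac)
  then show even: "(\<lambda>n. \<Prod>k<n. 1 - q ^ (2 * k + 2)) \<longlonglongrightarrow> euler_prod (q ^ 2)"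
    using euler_prod_has_prod(2)[OF q2] by simp
  have split: "(\<Prod>k<2 * n. 1 - q ^ Suc k) = (\<Prod>k<n. 1 - q ^ (2 * k + 1)) * (\<Prod>k<n. 1 - q ^ (2 * k + 2))" for n
    by (induction n) (simp_all add: mult_ac)
  have nz: "(\<Prod>k<n. 1 - q ^ (2 * k + 2)) \<noteq> 0" for n
  proof -
    have "1 - q ^ (2 * k + 2) \<noteq> 0" for k using one_minus_power_nz[OF q, of "2 * k + 1"] by simp
    then show ?thesis unfolding prod_zero_iff[OF finite_lessThan] by blast
  qed
  have "filterlim (\<lambda>n. 2 * n :: nat) at_top sequentially"
    unfolding filterlim_at_top eventually_sequentially
  proof
    fix Z show "\<exists>N. \<forall>n\<ge>N. Z \<le> (2 * n :: nat)" by (rule exI[of _ Z]) auto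
  qed
  from filterlim_compose[OF euler_prod_has_prod(2)[OF q] this]
  have "(\<lambda>n. (\<Prod>k<n. 1 - q ^ (2 * k + 1)) * (\<Prod>k<n. 1 - q ^ (2 * k + 2))) \<longlonglongrightarrow> euler_prod q"
    unfolding split .
  from tendsto_divide[OF this even euler_prod_nz[OF q2]] show "(\<lambda>n. \<Prod>k<n. 1 - q ^ (2 * k + 1)) \<longlonglongrightarrow> euler_prod q / euler_prod (q ^ 2)"
    using nz by simp
qed

text \<open>1 + x = (1 - x^2) / (1 - x) reduces these products to the previous ones at q and
  q^2.\<close>

lemma prod_plus_tendsto:
  assumes q: "norm q < 1"
  shows "(\<lambda>n. \<Prod>k<n. 1 + q ^ (2 * k + 1)) \<longlonglongrightarrow> euler_prod (q ^ 2) ^ 2 / (euler_prod q * euler_prod (q ^ 4))"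
    "(\<lambda>n. \<Prod>k<n. 1 + q ^ (2 * k + 2)) \<longlonglongrightarrow> euler_prod (q ^ 4) / euler_prod (q ^ 2)"
proof -
  have q2: "norm (q ^ 2) < 1" using norm_power_less_1'[OF q] by simp
  have q4: "(q ^ 2) ^ 2 = q ^ 4" by (simp flip: power_mult)
  have nz: "euler_prod q \<noteq> 0" "euler_prod (q ^ 2) \<noteq> 0" "euler_prod (q ^ 4) \<noteq> 0"
    using euler_prod_nz[OF q] euler_prod_power_nz[OF q] by auto
  have pm: "1 + x = (1 - x ^ 2) / (1 - x)" if "1 - x \<noteq> 0" for x :: complex
    using that by (simp add: field_simps power2_eq_square)
  have "(\<Prod>k<n. 1 + q ^ (2 * k + 1)) = (\<Prod>k<n. 1 - (q ^ 2) ^ (2 * k + 1)) / (\<Prod>k<n. 1 - q ^ (2 * k + 1))" for n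
    unfolding prod_dividef[symmetric]
  proof (intro prod.cong refl)
    fix k
    have "(q ^ 2) ^ (2 * k + 1) = (q ^ (2 * k + 1)) ^ 2" by (simp only: power_mult[symmetric] mult.commute)
    then show "1 + q ^ (2 * k + 1) = (1 - (q ^ 2) ^ (2 * k + 1)) / (1 - q ^ (2 * k + 1))"
      using pm[of "q ^ (2 * k + 1)"] one_minus_power_nz[OF q, of "2 * k"] by simp
  qed
  moreover have "(\<lambda>n. (\<Prod>k<n. 1 - (q ^ 2) ^ (2 * k + 1)) / (\<Prod>k<n. 1 - q ^ (2 * k + 1))) \<longlonglongrightarrow>
     (euler_prod (q ^ 2) / euler_prod (q ^ 4)) / (euler_prod q / euler_prod (q ^ 2))"
    using nz by (intro tendsto_divide prod_odd_tendsto[OF q] prod_odd_tendsto[OF q2, unfolded q4]) auto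
  ultimately show "(\<lambda>n. \<Prod>k<n. 1 + q ^ (2 * k + 1)) \<longlonglongrightarrow> euler_prod (q ^ 2) ^ 2 / (euler_prod q * euler_prod (q ^ 4))"
    by (simp add: power2_eq_square mult.commute)
  have "(\<Prod>k<n. 1 + q ^ (2 * k + 2)) = (\<Prod>k<n. 1 - (q ^ 2) ^ (2 * k + 2)) / (\<Prod>k<n. 1 - q ^ (2 * k + 2))" for n
    unfolding prod_dividef[symmetric]
  proof (intro prod.cong refl)
    fix k
    have "(q ^ 2) ^ (2 * k + 2) = (q ^ (2 * k + 2)) ^ 2" by (simp only: power_mult[symmetric] mult.commute)
    then show "1 + q ^ (2 * k + 2) = (1 - (q ^ 2) ^ (2 * k + 2)) / (1 - q ^ (2 * k + 2))"
      using pm[of "q ^ (2 * k + 2)"] one_minus_power_nz[OF q, of "2 * k + 1"] by simp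
  qed
  moreover have "(\<lambda>n. (\<Prod>k<n. 1 - (q ^ 2) ^ (2 * k + 2)) / (\<Prod>k<n. 1 - q ^ (2 * k + 2))) \<longlonglongrightarrow>
     euler_prod (q ^ 4) / euler_prod (q ^ 2)"
    using nz by (intro tendsto_divide prod_even_tendsto[OF q] prod_even_tendsto[OF q2, unfolded q4]) auto
  ultimately show "(\<lambda>n. \<Prod>k<n. 1 + q ^ (2 * k + 2)) \<longlonglongrightarrow> euler_prod (q ^ 4) / euler_prod (q ^ 2)"
    by simp
qed

text \<open>The triple product at w = -1, w = 1 and w = q.\<close>

theorem theta_products:
  assumes "\<tau> \<in> UHP"
  defines "q \<equiv> qq \<tau>"
  shows "theta4 \<tau> = euler_prod q ^ 2 / euler_prod (q ^ 2)"
    "theta3 \<tau> = euler_prod (q ^ 2) ^ 5 / (euler_prod q ^ 2 * euler_prod (q ^ 4) ^ 2)"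
    "theta2 \<tau> = 2 * qpow (1/4) \<tau> * (euler_prod (q ^ 4) ^ 2 / euler_prod (q ^ 2))"
proof -
  have q: "norm q < 1" "q \<noteq> 0" using norm_qq_less_1[OF assms(1)] by (auto simp: q_def)
  have nz: "euler_prod q \<noteq> 0" "euler_prod (q ^ 2) \<noteq> 0" "euler_prod (q ^ 4) \<noteq> 0"
    using euler_prod_nz[OF q(1)] euler_prod_power_nz[OF q(1)] by auto
  have "(\<lambda>n. (\<Prod>k<n. 1 - q ^ (2 * k + 1)) ^ 2) \<longlonglongrightarrow> (euler_prod q / euler_prod (q ^ 2)) ^ 2"
    by (intro tendsto_power prod_odd_tendsto q)
  moreover have "(\<Prod>k<n. (1 + q ^ (2 * k + 1) * -1) * (1 + q ^ (2 * k + 1) / -1)) = (\<Prod>k<n. 1 - q ^ (2 * k + 1)) ^ 2" for n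
    by (simp add: prod.distrib power2_eq_square)
  ultimately have "(euler_prod q / euler_prod (q ^ 2)) ^ 2 = (\<Sum>\<^sub>\<infinity>m\<in>(UNIV::int set). q powi (m ^ 2) * (-1) powi m) / euler_prod (q ^ 2)"
    using jacobi_triple[OF q _ theta_summable_1[OF q(1)], of "-1"] LIMSEQ_unique by simp
  then show "theta4 \<tau> = euler_prod q ^ 2 / euler_prod (q ^ 2)"
    using nz by (simp add: theta4_def q_def[symmetric] field_simps power2_eq_square)
  have "(\<lambda>n. (\<Prod>k<n. 1 + q ^ (2 * k + 1)) ^ 2) \<longlonglongrightarrow> (euler_prod (q ^ 2) ^ 2 / (euler_prod q * euler_prod (q ^ 4))) ^ 2"
    by (intro tendsto_power prod_plus_tendsto q)
  moreover have "(\<Prod>k<n. (1 + q ^ (2 * k + 1) * 1) * (1 + q ^ (2 * k + 1) / 1)) = (\<Prod>k<n. 1 + q ^ (2 * k + 1)) ^ 2" for n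
    by (simp add: prod.distrib power2_eq_square)
  ultimately have "(euler_prod (q ^ 2) ^ 2 / (euler_prod q * euler_prod (q ^ 4))) ^ 2 = (\<Sum>\<^sub>\<infinity>m\<in>(UNIV::int set). q powi (m ^ 2) * 1 powi m) / euler_prod (q ^ 2)"
    using jacobi_triple[OF q _ theta_summable_1[OF q(1)], of 1] LIMSEQ_unique by simp
  then show "theta3 \<tau> = euler_prod (q ^ 2) ^ 5 / (euler_prod q ^ 2 * euler_prod (q ^ 4) ^ 2)"
    using nz by (simp add: theta3_def q_def[symmetric] field_simps eval_nat_numeral)
  have "(\<lambda>n. (\<Prod>k<Suc n. (1 + q ^ (2 * k + 1) * q) * (1 + q ^ (2 * k + 1) / q))) \<longlonglongrightarrow>
     (\<Sum>\<^sub>\<infinity>m\<in>(UNIV::int set). q powi (m ^ 2) * q powi m) / euler_prod (q ^ 2)"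
    using jacobi_triple[OF q q(2) theta_summable_2[OF q]] by (rule LIMSEQ_Suc)
  \<comment> \<open>For w = q the factor k = 0 of the second family is 1 + 1 and gives the 2 in
    theta2. The rest repeats the first family with the index shifted by one, hence products of
    lengths \<open>Suc n\<close> and \<open>n\<close>.\<close>
  moreover have "(\<Prod>k<Suc n. (1 + q ^ (2 * k + 1) * q) * (1 + q ^ (2 * k + 1) / q)) =
     2 * (\<Prod>k<Suc n. 1 + q ^ (2 * k + 2)) * (\<Prod>k<n. 1 + q ^ (2 * k + 2))" for n
  proof -
    have "(\<Prod>k<Suc n. 1 + q ^ (2 * k + 1) / q) = (\<Prod>k<Suc n. 1 + q ^ (2 * k))" using q by simp
    also have "\<dots> = 2 * (\<Prod>k<n. 1 + q ^ (2 * k + 2))" by (subst prod.lessThan_Suc_shift) simp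
    finally show ?thesis by (simp only: prod.distrib) (simp add: mult_ac)
  qed
  moreover have "(\<lambda>n. 2 * (\<Prod>k<Suc n. 1 + q ^ (2 * k + 2)) * (\<Prod>k<n. 1 + q ^ (2 * k + 2))) \<longlonglongrightarrow>
     2 * (euler_prod (q ^ 4) / euler_prod (q ^ 2)) * (euler_prod (q ^ 4) / euler_prod (q ^ 2))"
    by (intro tendsto_mult tendsto_const prod_plus_tendsto q LIMSEQ_Suc[OF prod_plus_tendsto(2)])
  ultimately have "(\<Sum>\<^sub>\<infinity>m\<in>(UNIV::int set). q powi (m ^ 2) * q powi m) / euler_prod (q ^ 2) =
     2 * (euler_prod (q ^ 4) / euler_prod (q ^ 2)) * (euler_prod (q ^ 4) / euler_prod (q ^ 2))"
    using LIMSEQ_unique by auto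
  moreover have "q powi (m ^ 2) * q powi m = q powi (m * (m + 1))" for m :: int
    using q(2) by (subst power_int_add[symmetric]) (auto simp: power2_eq_square algebra_simps)
  ultimately show "theta2 \<tau> = 2 * qpow (1/4) \<tau> * (euler_prod (q ^ 4) ^ 2 / euler_prod (q ^ 2))"
    using nz by (simp add: theta2_def q_def[symmetric] field_simps power2_eq_square)
qed

text \<open>\<open>f\<close> is nonzero near 0, so \<open>g\<close> vanishes there and by
  continuation everywhere. This selects the correct factor, or the correct sign of a root, from
  values at q = 0.\<close>

lemma disc_mult_eq_0:
  assumes "f holomorphic_on ball 0 1" "g holomorphic_on ball 0 1" "f 0 \<noteq> 0"
    "\<And>q. norm q < 1 \<Longrightarrow> f q * g q = 0" "norm (q::complex) < 1"
  shows "g q = 0"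
proof -
  have "isCont f 0"
    using assms(1) by (intro continuous_on_interior[OF holomorphic_on_imp_continuous_on[OF assms(1)]]) auto
  then obtain e where e: "e > 0" "\<And>q. dist 0 q < e \<Longrightarrow> f q \<noteq> 0"
    using continuous_at_avoid[of 0 f 0] assms(3) by auto
  define S where "S = ball (0::complex) e"
  have S: "open S" "0 \<in> S" "\<And>q. q \<in> S \<Longrightarrow> f q \<noteq> 0" using e by (auto simp: S_def)
  show ?thesis
  proof (rule analytic_continuation_open[of "S \<inter> ball 0 1" "ball 0 1" g "\<lambda>_. 0"])
    fix z assume "z \<in> S \<inter> ball 0 1"
    then show "g z = 0" using S(3)[of z] assms(4)[of z] by auto
  qed (use S assms in auto)
qed

text \<open>Fourth powers of the theta constants as functions of the nome; the fractional power of q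
  in theta2 disappears in the fourth power.\<close>

definition th2q :: "complex \<Rightarrow> complex" where "th2q q = 16 * (q * euler_prod (q ^ 4) ^ 8 / euler_prod (q ^ 2) ^ 4)"
definition th3q :: "complex \<Rightarrow> complex" where "th3q q = euler_prod (q ^ 2) ^ 20 / (euler_prod q ^ 8 * euler_prod (q ^ 4) ^ 8)"
definition th4q :: "complex \<Rightarrow> complex" where "th4q q = euler_prod q ^ 8 / euler_prod (q ^ 2) ^ 4"

lemma thq_theta:
  assumes "\<tau> \<in> UHP"
  shows "theta2 \<tau> ^ 4 = th2q (qq \<tau>)" "theta3 \<tau> ^ 4 = th3q (qq \<tau>)" "theta4 \<tau> ^ 4 = th4q (qq \<tau>)"
proof -
  have "qpow (1/4) \<tau> ^ 4 = qq \<tau>" by (simp add: qpow_def exp_of_nat_mult[symmetric] mult_ac)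
  then show "theta2 \<tau> ^ 4 = th2q (qq \<tau>)" "theta3 \<tau> ^ 4 = th3q (qq \<tau>)" "theta4 \<tau> ^ 4 = th4q (qq \<tau>)"
    unfolding theta_products[OF assms] th2q_def th3q_def th4q_def
    by (simp_all add: power_mult_distrib power_divide flip: power_mult)
qed

lemma thq_holomorphic: "th2q holomorphic_on ball 0 1" "th3q holomorphic_on ball 0 1" "th4q holomorphic_on ball 0 1"
  unfolding th2q_def[abs_def] th3q_def[abs_def] th4q_def[abs_def]
  using euler_prod_nz euler_prod_power_nz by (auto intro!: holomorphic_intros euler_prod_holomorphic)

lemma thq_nz:
  assumes "norm q < 1"
  shows "th3q q \<noteq> 0" "th4q q \<noteq> 0" "q \<noteq> 0 \<Longrightarrow> th2q q \<noteq> 0"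
  using euler_prod_nz[OF assms] euler_prod_power_nz[OF assms] by (auto simp: th2q_def th3q_def th4q_def)

lemma thq_0: "th2q 0 = 0" "th3q 0 = 1" "th4q 0 = 1"
  by (simp_all add: th2q_def th3q_def th4q_def euler_prod_0)

text \<open>Quadratic monomials in these forms of weight 2 and level 4 are the eta quotients of
  level 2 at q and at q^2. This bridge carries the identities of level 2 over to level 4.\<close>

lemma thq_lev2:
  assumes q: "norm q < 1"
  shows "th4q q ^ 2 = lev2a q" "th2q q * th3q q = 16 * lev2b q"
    "th3q q * th4q q = lev2a (q ^ 2)" "th2q q ^ 2 = 256 * lev2b (q ^ 2)"
proof -
  have q4: "(q ^ 2) ^ 2 = q ^ 4" by (simp flip: power_mult)
  have nz: "euler_prod q \<noteq> 0" "euler_prod (q ^ 2) \<noteq> 0" "euler_prod (q ^ 4) \<noteq> 0"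
    using euler_prod_nz[OF q] euler_prod_power_nz[OF q] by auto
  show "th4q q ^ 2 = lev2a q" "th2q q * th3q q = 16 * lev2b q"
    "th3q q * th4q q = lev2a (q ^ 2)" "th2q q ^ 2 = 256 * lev2b (q ^ 2)"
    unfolding th2q_def th3q_def th4q_def lev2a_def lev2b_def q4
    using nz by (simp_all add: power_mult_distrib power_divide divide_simps flip: power_mult power_add)
qed

text \<open>E4 at q^2 is expressed in two ways by \<open>lev2_e4\<close>, through level 2 forms in q
  and in q^2. Equality of the two factors as shown, and the first factor is 1 at q = 0.\<close>

theorem jacobi_quartic:
  assumes q: "norm q < 1"
  shows "th3q q = th2q q + th4q q"
proof -
  have "(th4q q - th2q q) * (th4q q + th2q q - th3q q) = 0" if q: "norm q < 1" for q
  proof -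
    have q2: "norm (q ^ 2) < 1" using norm_power_less_1'[OF q] by simp
    have "lev2a q + 16 * lev2b q = lev2a (q ^ 2) + 256 * lev2b (q ^ 2)"
      using lev2_e4(2)[OF q] lev2_e4(1)[OF q2] by simp
    then have "th4q q ^ 2 + th2q q * th3q q = th3q q * th4q q + th2q q ^ 2"
      unfolding thq_lev2[OF q] .
    then show ?thesis by (simp add: algebra_simps power2_eq_square)
  qed
  then have "th4q q + th2q q - th3q q = 0"
    by (intro disc_mult_eq_0[of "\<lambda>q. th4q q - th2q q" "\<lambda>q. th4q q + th2q q - th3q q", OF _ _ _ _ q] holomorphic_intros thq_holomorphic)
      (auto simp: thq_0)
  then show ?thesis by (simp add: algebra_simps)
qed

text \<open>The squares agree because Jacobi's identity gives (\<open>th2q\<close> +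
  \<open>th3q\<close>)^2 - 4 \<open>th2q\<close> \<open>th3q\<close> = \<open>th4q\<close>^2. The
  sign is decided at q = 0, where the sum of both sides is 2.\<close>

lemma eis_lev2_theta:
  assumes q: "norm q < 1"
  shows "eis_lev 2 q = th2q q + th3q q"
proof -
  have "(eis_lev 2 q + (th2q q + th3q q)) * (eis_lev 2 q - (th2q q + th3q q)) = 0" if q: "norm q < 1" for q
  proof -
    have "eis_lev 2 q ^ 2 = th4q q ^ 2 + 4 * (th2q q * th3q q)"
      unfolding eis_lev2_sq[OF q] thq_lev2[OF q] by simp
    also have "\<dots> = (th2q q + th3q q) ^ 2"
      unfolding jacobi_quartic[OF q] by (simp add: algebra_simps power2_eq_square)
    finally show ?thesis by (simp add: algebra_simps power2_eq_square)
  qed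
  then have "eis_lev 2 q - (th2q q + th3q q) = 0"
    by (intro disc_mult_eq_0[of "\<lambda>q. eis_lev 2 q + (th2q q + th3q q)" "\<lambda>q. eis_lev 2 q - (th2q q + th3q q)", OF _ _ _ _ q]
       holomorphic_intros thq_holomorphic eis_lev_holomorphic)
      (auto simp: thq_0 eis_lev_0)
  then show ?thesis by simp
qed

lemma has_Dq_thq:
  assumes q: "norm q < 1"
  shows "has_Dq th2q ((4 * e2 (q ^ 4) - e2 (q ^ 2)) / 3 * th2q q) q"
    "has_Dq th3q ((5 * e2 (q ^ 2) - e2 q - 4 * e2 (q ^ 4)) / 3 * th3q q) q"
    "has_Dq th4q ((e2 q - e2 (q ^ 2)) / 3 * th4q q) q"
proof -
  note P = has_Dq_log_power[OF has_Dq_euler_prod[OF q]] and Pn = has_Dq_log_power[OF has_Dq_log_euler_prod_power[OF q zero_less_numeral]]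
  have i: "has_Dq (\<lambda>q. q) (1 * q) q" using has_Dq_ident[of q] by simp
  have nz: "euler_prod q ^ k \<noteq> 0" "euler_prod (q ^ 2) ^ k \<noteq> 0" "euler_prod (q ^ 4) ^ k \<noteq> 0"
    "euler_prod q ^ k * euler_prod (q ^ 4) ^ k \<noteq> 0" for k
    using euler_prod_nz[OF q] euler_prod_power_nz[OF q] by auto
  show "has_Dq th2q ((4 * e2 (q ^ 4) - e2 (q ^ 2)) / 3 * th2q q) q"
    unfolding th2q_def[abs_def]
    by (rule has_Dq_eq[OF has_Dq_cmult[OF has_Dq_log_divide[OF has_Dq_log_mult[OF i Pn] Pn nz(2)]]])
      (subst mult.left_commute, rule arg_cong[of _ _ "\<lambda>c. c * _"], simp add: field_simps)
  show "has_Dq th3q ((5 * e2 (q ^ 2) - e2 q - 4 * e2 (q ^ 4)) / 3 * th3q q) q"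
    unfolding th3q_def[abs_def]
    by (rule has_Dq_eq[OF has_Dq_log_divide[OF Pn has_Dq_log_mult[OF P Pn] nz(4)]])
      (rule arg_cong[of _ _ "\<lambda>c. c * _"], simp add: field_simps)
  show "has_Dq th4q ((e2 q - e2 (q ^ 2)) / 3 * th4q q) q"
    unfolding th4q_def[abs_def]
    by (rule has_Dq_eq[OF has_Dq_log_divide[OF P Pn nz(2)]])
      (rule arg_cong[of _ _ "\<lambda>c. c * _"], simp add: field_simps)
qed

text \<open>Let x, y, z be the logarithmic derivatives of \<open>th2q\<close>, \<open>th3q\<close>,
  \<open>th4q\<close>. Differentiating Jacobi's identity gives y (\<open>th2q\<close> +
  \<open>th4q\<close>) = x \<open>th2q\<close> + z \<open>th4q\<close>, and \<open>th2q\<close> +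
  \<open>th3q\<close> = x + y - 2z. Together these show that \<open>th4q\<close> is x - y, the
  logarithmic derivative of \<open>th2q\<close> / \<open>th3q\<close>.\<close>

lemma th4q_log_derivative:
  assumes q: "norm q < 1"
  shows "th4q q = (e2 q + 8 * e2 (q ^ 4) - 6 * e2 (q ^ 2)) / 3"
proof -
  define k where "k = (\<lambda>q. (e2 q + 8 * e2 (q ^ 4) - 6 * e2 (q ^ 2)) / 3)"
  have "(th2q q + th3q q) * (th4q q - k q) = 0" if q: "norm q < 1" for q
  proof -
    define x y z where "x = (4 * e2 (q ^ 4) - e2 (q ^ 2)) / 3" and "y = (5 * e2 (q ^ 2) - e2 q - 4 * e2 (q ^ 4)) / 3"
      and "z = (e2 q - e2 (q ^ 2)) / 3"
    have "has_Dq (\<lambda>q. th2q q + th4q q) (x * th2q q + z * th4q q) q"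
      unfolding x_def z_def by (intro has_Dq_add has_Dq_thq q)
    then have "has_Dq th3q (x * th2q q + z * th4q q) q"
      by (rule has_Dq_cong[OF _ q]) (simp add: jacobi_quartic)
    from has_Dq_unique[OF has_Dq_thq(2)[OF q] this]
    have 1: "y * (th2q q + th4q q) = x * th2q q + z * th4q q" by (simp only: y_def jacobi_quartic[OF q])
    have 2: "th2q q + th3q q = x + y - 2 * z"
      unfolding eis_lev2_theta[OF q, symmetric] by (simp add: eis_lev_def x_def y_def z_def field_simps)
    have 3: "k q = x - y" by (simp add: k_def x_def y_def field_simps)
    have "(th2q q + th3q q) * th4q q = (x - y) * th4q q + 2 * (y * th4q q - z * th4q q)"
      unfolding 2 by (simp add: algebra_simps)
    also have "y * th4q q - z * th4q q = (x - y) * th2q q" using 1 by (simp add: algebra_simps)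
    also have "(x - y) * th4q q + 2 * ((x - y) * th2q q) = (x - y) * (th2q q + th3q q)"
      unfolding jacobi_quartic[OF q] by (simp add: algebra_simps)
    finally show ?thesis unfolding 3 by (simp add: algebra_simps)
  qed
  then have "th4q q - k q = 0"
    unfolding k_def
    by (intro disc_mult_eq_0[of "\<lambda>q. th2q q + th3q q" "\<lambda>q. th4q q - (e2 q + 8 * e2 (q ^ 4) - 6 * e2 (q ^ 2)) / 3", OF _ _ _ _ q]
       holomorphic_intros thq_holomorphic e2_holomorphic)
      (auto simp: thq_0)
  then show ?thesis by (simp add: k_def)
qed

text \<open>The factor -16 is twice the coefficient of q in \<open>th4q\<close> = 1 - 8q + ...; the
  derivation stays in the ring of level 2 because the logarithmic derivative of \<open>th4q\<close>
  lies in it.\<close>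

theorem schwarz_th4q:
  assumes q: "norm q < 1"
  shows "schwarz th4q q = - 16 * lev2a q * lev2b q"
proof -
  define x E B where "x = e2 (q ^ 2)" and "E = eis_lev 2 q" and "B = lev2b q"
  have D: "has_Dq th4q (1/3 * (e2 (q ^ 2) - eis_lev 2 q) * th4q q) q" if "norm q < 1" for q
    by (rule has_Dq_eq[OF has_Dq_thq(3)[OF that]]) (simp add: e2_elim[of q])
  have "has_Dq (\<lambda>q. 1/3 * (e2 (q ^ 2) - eis_lev 2 q) * th4q q)
    (1/3 * ((x ^ 2 - E ^ 2 + 48 * B) / 6 - (x * E + 96 * B - E ^ 2) / 3) * th4q q + (1/3 * (x - E) * th4q q) * (1/3 * (x - E))) q"
    unfolding x_def E_def B_def
    by (intro has_Dq_mult has_Dq_cmult has_Dq_diff has_Dq_e2_sq has_Dq_eis_lev2 D q)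
  then have "schwarz th4q q = 2 * th4q q * (1/3 * ((x ^ 2 - E ^ 2 + 48 * B) / 6 - (x * E + 96 * B - E ^ 2) / 3) * th4q q + (1/3 * (x - E) * th4q q) * (1/3 * (x - E)))
    - 3 * (1/3 * (x - E) * th4q q) ^ 2"
    unfolding x_def E_def by (intro schwarzI D q)
  also have "\<dots> = - 16 * th4q q ^ 2 * B"
    by (simp add: field_simps power2_eq_square)
  finally show ?thesis unfolding thq_lev2(1)[OF q] B_def .
qed

section \<open>The system in logarithmic coordinates\<close>

text \<open>\<open>a\<close> and \<open>b\<close> are \<open>\<theta>\<^sub>1 \<phi>\<close> and \<open>\<theta>\<^sub>2 \<phi>\<close> when \<open>\<kappa> = t' / t\<close>.\<close>

definition has_theta :: "(complex \<Rightarrow> complex) \<Rightarrow> (complex \<times> complex \<Rightarrow> complex) \<Rightarrow> complex \<Rightarrow> complex \<Rightarrow> complex \<times> complex \<Rightarrow> bool" where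
  "has_theta \<kappa> \<phi> a b z \<longleftrightarrow> (\<phi> has_derivative (\<lambda>(h, k). \<kappa> (fst z) * a * h + \<kappa> (snd z) * b * k)) (at z)"

lemma has_theta_const: "has_theta \<kappa> (\<lambda>z. c) 0 0 z"
  unfolding has_theta_def by (rule has_derivative_eq_rhs[OF has_derivative_const]) auto

lemma has_theta_add:
  "has_theta \<kappa> f a b z \<Longrightarrow> has_theta \<kappa> g c d z \<Longrightarrow> has_theta \<kappa> (\<lambda>z. f z + g z) (a + c) (b + d) z"
  unfolding has_theta_def by (rule has_derivative_eq_rhs[OF has_derivative_add]) (auto simp: algebra_simps fun_eq_iff)

lemma has_theta_diff:
  "has_theta \<kappa> f a b z \<Longrightarrow> has_theta \<kappa> g c d z \<Longrightarrow> has_theta \<kappa> (\<lambda>z. f z - g z) (a - c) (b - d) z"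
  unfolding has_theta_def by (rule has_derivative_eq_rhs[OF has_derivative_diff]) (auto simp: algebra_simps fun_eq_iff)

lemma has_theta_mult:
  "has_theta \<kappa> f a b z \<Longrightarrow> has_theta \<kappa> g c d z \<Longrightarrow> has_theta \<kappa> (\<lambda>z. f z * g z) (a * g z + f z * c) (b * g z + f z * d) z"
  unfolding has_theta_def by (rule has_derivative_eq_rhs[OF has_derivative_mult]) (auto simp: algebra_simps fun_eq_iff)

lemma has_theta_divide:
  "has_theta \<kappa> f a b z \<Longrightarrow> has_theta \<kappa> g c d z \<Longrightarrow> g z \<noteq> 0 \<Longrightarrow>
   has_theta \<kappa> (\<lambda>z. f z / g z) ((a * g z - f z * c) / (g z) ^ 2) ((b * g z - f z * d) / (g z) ^ 2) z"
  unfolding has_theta_def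
  by (rule has_derivative_eq_rhs[OF has_derivative_divide']) (auto simp: divide_simps power2_eq_square fun_eq_iff algebra_simps)

lemma has_theta_fst:
  assumes "(f has_field_derivative \<kappa> (fst z) * a) (at (fst z))"
  shows "has_theta \<kappa> (\<lambda>z. f (fst z)) a 0 z"
proof -
  have "((\<lambda>z. f (fst z)) has_derivative (\<lambda>h. \<kappa> (fst z) * a * fst h)) (at z)"
    by (rule has_derivative_compose[OF has_derivative_fst[OF has_derivative_ident] assms[unfolded has_field_derivative_def]])
  then show ?thesis unfolding has_theta_def by (rule has_derivative_eq_rhs) auto
qed

lemma has_theta_snd:
  assumes "(f has_field_derivative \<kappa> (snd z) * b) (at (snd z))"
  shows "has_theta \<kappa> (\<lambda>z. f (snd z)) 0 b z"
proof -
  have "((\<lambda>z. f (snd z)) has_derivative (\<lambda>h. \<kappa> (snd z) * b * snd h)) (at z)"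
    by (rule has_derivative_compose[OF has_derivative_snd[OF has_derivative_ident] assms[unfolded has_field_derivative_def]])
  then show ?thesis unfolding has_theta_def by (rule has_derivative_eq_rhs) auto
qed

lemma has_theta_eq: "has_theta \<kappa> f a b z \<Longrightarrow> a = a' \<Longrightarrow> b = b' \<Longrightarrow> has_theta \<kappa> f a' b' z"
  by simp

lemma has_derivative2_partial:
  assumes "(\<phi> has_derivative (\<lambda>(h, k). A * h + B * k)) (at (x, y))"
  shows "((\<lambda>u. \<phi> (u, y)) has_field_derivative A) (at x)" "((\<lambda>v. \<phi> (x, v)) has_field_derivative B) (at y)"
proof -
  have "((\<lambda>u. (u, y)) has_derivative (\<lambda>h. (h, 0))) (at x)"
    by (intro has_derivative_Pair has_derivative_ident has_derivative_const)
  from has_derivative_compose[OF this assms]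
  show "((\<lambda>u. \<phi> (u, y)) has_field_derivative A) (at x)"
    unfolding has_field_derivative_def by (rule has_derivative_eq_rhs) auto
  have "((\<lambda>v. (x, v)) has_derivative (\<lambda>h. (0, h))) (at y)"
    by (intro has_derivative_Pair has_derivative_ident has_derivative_const)
  from has_derivative_compose[OF this assms]
  show "((\<lambda>v. \<phi> (x, v)) has_field_derivative B) (at y)"
    unfolding has_field_derivative_def by (rule has_derivative_eq_rhs) auto
qed

lemma Dx_Dy_eq:
  assumes "(\<phi> has_derivative (\<lambda>(h, k). A * h + B * k)) (at w)"
  shows "Dx \<phi> w = fst w * A" "Dy \<phi> w = snd w * B"
  using has_derivative2_partial[of \<phi> A B "fst w" "snd w", THEN DERIV_imp_deriv] assms
  by (auto simp: Dx_def Dy_def split: prod.splits)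

text \<open>\<open>deriv\<close> depends on germs only, so inside a nested operator the inner
  derivatives may be replaced by explicit formulas valid on the open set \<open>V\<close>.\<close>

lemma Dx_Dy_cong:
  assumes "open V" "w \<in> V" "\<And>w. w \<in> V \<Longrightarrow> f w = g w"
  shows "Dx f w = Dx g w" "Dy f w = Dy g w"
proof -
  obtain x y where w: "w = (x, y)" by (cases w)
  have "open ((\<lambda>u. (u, y)) -` V)" "open ((\<lambda>v. (x, v)) -` V)"
    using assms(1) by (auto intro!: open_vimage continuous_intros)
  then have "\<forall>\<^sub>F u in nhds x. f (u, y) = g (u, y)" "\<forall>\<^sub>F v in nhds y. f (x, v) = g (x, v)"
    unfolding eventually_nhds using assms(2,3) w by blast+
  then show "Dx f w = Dx g w" "Dy f w = Dy g w"
    unfolding w Dx_def Dy_def by (auto intro: deriv_cong_ev)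
qed

text \<open>\<open>\<theta>\<^sub>j x = xi\<^sub>j x\<close> and \<open>\<theta>\<^sub>1 y = eta1 y = - \<theta>\<^sub>2 y\<close>; inverting, \<open>D\<^sub>x = cX (\<theta>\<^sub>1 + \<theta>\<^sub>2)\<close> and
  \<open>D\<^sub>y = cY1 \<theta>\<^sub>1 + cY2 \<theta>\<^sub>2\<close>, where \<open>s = t\<^sub>1\<close> and \<open>t = t\<^sub>2\<close>.\<close>

definition xi1 :: "complex \<Rightarrow> complex \<Rightarrow> complex" where "xi1 s t = - s * (1 + t) / ((s + t) * (s - 1))"
definition xi2 :: "complex \<Rightarrow> complex \<Rightarrow> complex" where "xi2 s t = - t * (1 + s) / ((s + t) * (t - 1))"
definition eta1 :: "complex \<Rightarrow> complex \<Rightarrow> complex" where "eta1 s t = (t - s) / (s + t)"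
definition cX :: "complex \<Rightarrow> complex \<Rightarrow> complex" where "cX s t = (s - 1) * (t - 1) / (1 - s * t)"
definition cY1 :: "complex \<Rightarrow> complex \<Rightarrow> complex" where "cY1 s t = t * (s ^ 2 - 1) / ((s - t) * (1 - s * t))"
definition cY2 :: "complex \<Rightarrow> complex \<Rightarrow> complex" where "cY2 s t = - s * (t ^ 2 - 1) / ((s - t) * (1 - s * t))"

lemma xi_sum:
  assumes "s \<noteq> 1" "t \<noteq> 1" "s + t \<noteq> 0"
  shows "xi1 s t + xi2 s t = (1 - s * t) / ((s - 1) * (t - 1))"
  unfolding xi1_def xi2_def using assms by (simp add: divide_simps) (simp add: algebra_simps)

text \<open>Two matrices are inverse to each other: the first three equations say so for one order
  of the product, the last four for the other.\<close>

lemma chart_matrix: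
  assumes "s \<noteq> 1" "t \<noteq> 1" "s + t \<noteq> 0" "s \<noteq> t" "s * t \<noteq> 1"
  shows "(xi1 s t + xi2 s t) * cX s t = 1" "xi1 s t * cY1 s t + xi2 s t * cY2 s t = 0"
    "eta1 s t * cY1 s t - eta1 s t * cY2 s t = 1"
    "cX s t * xi1 s t + cY1 s t * eta1 s t = 1" "cX s t * xi2 s t - cY1 s t * eta1 s t = 0"
    "cX s t * xi1 s t + cY2 s t * eta1 s t = 0" "cX s t * xi2 s t - cY2 s t * eta1 s t = 1"
proof -
  have nz: "s - 1 \<noteq> 0" "t - 1 \<noteq> 0" "s + t \<noteq> 0" "s - t \<noteq> 0" "1 - s * t \<noteq> 0" using assms by auto
  show a: "(xi1 s t + xi2 s t) * cX s t = 1"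
    unfolding xi_sum[OF assms(1-3)] cX_def using nz by simp
  show b: "xi1 s t * cY1 s t + xi2 s t * cY2 s t = 0"
    unfolding xi1_def xi2_def cY1_def cY2_def using nz by (simp add: divide_simps) (simp add: algebra_simps power2_eq_square)
  show c: "eta1 s t * cY1 s t - eta1 s t * cY2 s t = 1"
    unfolding eta1_def cY1_def cY2_def using nz by (simp add: divide_simps) (simp add: algebra_simps power2_eq_square)
  show d: "cX s t * xi1 s t + cY1 s t * eta1 s t = 1"
    unfolding xi1_def eta1_def cX_def cY1_def using nz by (simp add: divide_simps) (simp add: algebra_simps power2_eq_square)
  have "cX s t * xi2 s t - cY1 s t * eta1 s t = (xi1 s t + xi2 s t) * cX s t - (cX s t * xi1 s t + cY1 s t * eta1 s t)"
    by (simp add: algebra_simps)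
  then show "cX s t * xi2 s t - cY1 s t * eta1 s t = 0" unfolding a d by simp
  have "cX s t * xi1 s t + cY2 s t * eta1 s t = (cX s t * xi1 s t + cY1 s t * eta1 s t) - (eta1 s t * cY1 s t - eta1 s t * cY2 s t)"
    by (simp add: algebra_simps)
  then show e: "cX s t * xi1 s t + cY2 s t * eta1 s t = 0" unfolding c d by simp
  have "cX s t * xi2 s t - cY2 s t * eta1 s t = (xi1 s t + xi2 s t) * cX s t - (cX s t * xi1 s t + cY2 s t * eta1 s t)"
    by (simp add: algebra_simps)
  then show "cX s t * xi2 s t - cY2 s t * eta1 s t = 1" unfolding a e by simp
qed

text \<open>The coordinate y is homogeneous of degree 0 in (t1, t2), whence by Euler's relation its
  two derivatives are opposite.\<close>

lemma xy_has_theta: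
  assumes "(t has_field_derivative \<kappa> (fst z) * t (fst z)) (at (fst z))" "(t has_field_derivative \<kappa> (snd z) * t (snd z)) (at (snd z))"
    "t (fst z) \<noteq> 1" "t (snd z) \<noteq> 1" "t (fst z) + t (snd z) \<noteq> 0"
  shows "has_theta \<kappa> (xcoord t) (xcoord t z * xi1 (t (fst z)) (t (snd z))) (xcoord t z * xi2 (t (fst z)) (t (snd z))) z"
    "has_theta \<kappa> (ycoord t) (ycoord t z * eta1 (t (fst z)) (t (snd z))) (- (ycoord t z * eta1 (t (fst z)) (t (snd z)))) z"
proof -
  note f = has_theta_fst[of t \<kappa> z, OF assms(1)] and s = has_theta_snd[of t \<kappa> z, OF assms(2)]
  define x y where "x = t (fst z)" and "y = t (snd z)"
  have nz: "x - 1 \<noteq> 0" "y - 1 \<noteq> 0" "x + y \<noteq> 0" using assms(3-5) by (auto simp: x_def y_def)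
  have X: "xcoord t = (\<lambda>z. (t (fst z) + t (snd z)) / ((t (fst z) - 1) * (t (snd z) - 1)))"
    by (auto simp: xcoord_def)
  have Y: "ycoord t = (\<lambda>z. t (fst z) * t (snd z) / ((t (fst z) + t (snd z)) * (t (fst z) + t (snd z))))"
    by (auto simp: ycoord_def power2_eq_square)
  show "has_theta \<kappa> (xcoord t) (xcoord t z * xi1 (t (fst z)) (t (snd z))) (xcoord t z * xi2 (t (fst z)) (t (snd z))) z"
    unfolding X
    by (rule has_theta_eq[OF has_theta_divide[OF has_theta_add[OF f s] has_theta_mult[OF has_theta_diff[OF f has_theta_const] has_theta_diff[OF s has_theta_const]]]])
      (use nz in \<open>simp_all add: x_def[symmetric] y_def[symmetric] xi1_def xi2_def divide_simps\<close>, (simp_all add: algebra_simps power2_eq_square)?)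
  show "has_theta \<kappa> (ycoord t) (ycoord t z * eta1 (t (fst z)) (t (snd z))) (- (ycoord t z * eta1 (t (fst z)) (t (snd z)))) z"
    unfolding Y
    by (rule has_theta_eq[OF has_theta_divide[OF has_theta_mult[OF f s] has_theta_mult[OF has_theta_add[OF f s] has_theta_add[OF f s]]]])
      (use nz in \<open>simp_all add: x_def[symmetric] y_def[symmetric] eta1_def divide_simps\<close>, (simp_all add: algebra_simps power2_eq_square power4_eq_xxxx)?)
qed

lemma jacobian_eq:
  assumes "(t has_field_derivative \<kappa> \<tau>1 * t \<tau>1) (at \<tau>1)" "(t has_field_derivative \<kappa> \<tau>2 * t \<tau>2) (at \<tau>2)"
    "t \<tau>1 \<noteq> 1" "t \<tau>2 \<noteq> 1" "t \<tau>1 + t \<tau>2 \<noteq> 0"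
  shows "jacobian (xcoord t) (ycoord t) (\<tau>1, \<tau>2) =
    - (\<kappa> \<tau>1 * \<kappa> \<tau>2 * xcoord t (\<tau>1, \<tau>2) * ycoord t (\<tau>1, \<tau>2) * eta1 (t \<tau>1) (t \<tau>2) * ((1 - t \<tau>1 * t \<tau>2) / ((t \<tau>1 - 1) * (t \<tau>2 - 1))))"
proof -
  note h = xy_has_theta[of t \<kappa> "(\<tau>1, \<tau>2)", simplified, OF assms, unfolded has_theta_def]
  note dx = has_derivative2_partial[OF h(1)[simplified], THEN DERIV_imp_deriv]
  have "((ycoord t) has_derivative (\<lambda>(h, k). (\<kappa> \<tau>1 * (ycoord t (\<tau>1, \<tau>2) * eta1 (t \<tau>1) (t \<tau>2))) * h +
     (\<kappa> \<tau>2 * - (ycoord t (\<tau>1, \<tau>2) * eta1 (t \<tau>1) (t \<tau>2))) * k)) (at (\<tau>1, \<tau>2))"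
    by (rule has_derivative_eq_rhs[OF h(2)]) (auto simp: fun_eq_iff)
  note dy = has_derivative2_partial[OF this, THEN DERIV_imp_deriv]
  have "jacobian (xcoord t) (ycoord t) (\<tau>1, \<tau>2) =
    - (\<kappa> \<tau>1 * \<kappa> \<tau>2 * xcoord t (\<tau>1, \<tau>2) * ycoord t (\<tau>1, \<tau>2) * eta1 (t \<tau>1) (t \<tau>2) * (xi1 (t \<tau>1) (t \<tau>2) + xi2 (t \<tau>1) (t \<tau>2)))"
    unfolding jacobian_def by (simp add: dx dy algebra_simps)
  then show ?thesis unfolding xi_sum[OF assms(3-5)] .
qed

text \<open>\<open>dX\<^sub>j = \<theta>\<^sub>j cX\<close> and \<open>dY\<^sub>j = \<theta>\<^sub>j cY1\<close>.\<close>

definition dX1 :: "complex \<Rightarrow> complex \<Rightarrow> complex" where "dX1 s t = - s * (t - 1) ^ 2 / (1 - s * t) ^ 2"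
definition dX2 :: "complex \<Rightarrow> complex \<Rightarrow> complex" where "dX2 s t = - t * (s - 1) ^ 2 / (1 - s * t) ^ 2"
definition dY1 :: "complex \<Rightarrow> complex \<Rightarrow> complex" where
  "dY1 s t = (2 * s ^ 2 * t * ((s - t) * (1 - s * t)) - t * (s ^ 2 - 1) * (s * (1 - s * t) - (s - t) * s * t)) / ((s - t) * (1 - s * t)) ^ 2"
definition dY2 :: "complex \<Rightarrow> complex \<Rightarrow> complex" where
  "dY2 s t = t * (s ^ 2 - 1) * (s * (1 - s * t) + (s - t) * s * t) / ((s - t) * (1 - s * t)) ^ 2"

text \<open>The exchange of the two variables fixes x and y and so exchanges the coefficients; half
  of the rational identities follow from the other half.\<close>

lemma cY2_swap: "cY2 s t = cY1 t s"
proof -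
  have "(s - t) * (1 - s * t) = - ((t - s) * (1 - t * s))" by (simp add: algebra_simps)
  then show ?thesis unfolding cY1_def cY2_def by simp
qed

lemma cX_swap: "cX s t = cX t s" by (simp add: cX_def mult.commute)
lemma dX_swap: "dX2 s t = dX1 t s" by (simp add: dX1_def dX2_def mult.commute)

lemma coeff_has_theta:
  assumes "(t has_field_derivative \<kappa> (fst z) * t (fst z)) (at (fst z))" "(t has_field_derivative \<kappa> (snd z) * t (snd z)) (at (snd z))"
    "t (fst z) \<noteq> t (snd z)" "t (fst z) * t (snd z) \<noteq> 1"
  shows "has_theta \<kappa> (\<lambda>z. cX (t (fst z)) (t (snd z))) (dX1 (t (fst z)) (t (snd z))) (dX2 (t (fst z)) (t (snd z))) z" (is ?A)
    "has_theta \<kappa> (\<lambda>z. cY1 (t (fst z)) (t (snd z))) (dY1 (t (fst z)) (t (snd z))) (dY2 (t (fst z)) (t (snd z))) z" (is ?B)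
    "has_theta \<kappa> (\<lambda>z. cY2 (t (fst z)) (t (snd z))) (dY2 (t (snd z)) (t (fst z))) (dY1 (t (snd z)) (t (fst z))) z" (is ?C)
proof -
  note f = has_theta_fst[of t \<kappa> z, OF assms(1)] and s = has_theta_snd[of t \<kappa> z, OF assms(2)]
  define x y where "x = t (fst z)" and "y = t (snd z)"
  have nz: "x - y \<noteq> 0" "1 - x * y \<noteq> 0" "y - x \<noteq> 0" "1 - y * x \<noteq> 0" using assms(3,4) by (auto simp: x_def y_def mult.commute)
  note c = has_theta_const[of \<kappa> _ z]
  note d = has_theta_diff
  note m = has_theta_mult
  show ?A
    unfolding cX_def
    by (rule has_theta_eq[OF has_theta_divide[OF m[OF d[OF f c] d[OF s c]] d[OF c m[OF f s]]]])
      (use nz in \<open>simp_all add: x_def[symmetric] y_def[symmetric] dX1_def dX2_def divide_simps\<close>, (simp_all add: algebra_simps power2_eq_square)?)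
  show ?B
    unfolding cY1_def power2_eq_square[of "t _"]
    by (rule has_theta_eq[OF has_theta_divide[OF m[OF s d[OF m[OF f f] c]] m[OF d[OF f s] d[OF c m[OF f s]]]]])
      (use nz in \<open>simp_all add: x_def[symmetric] y_def[symmetric] dY1_def dY2_def divide_simps\<close>, (simp_all add: algebra_simps power2_eq_square)?)
  show ?C
    unfolding cY2_swap cY1_def power2_eq_square[of "t _"]
    by (rule has_theta_eq[OF has_theta_divide[OF m[OF f d[OF m[OF s s] c]] m[OF d[OF s f] d[OF c m[OF s f]]]]])
      (use nz in \<open>simp_all add: x_def[symmetric] y_def[symmetric] dY1_def dY2_def divide_simps\<close>, (simp_all add: algebra_simps power2_eq_square)?)
qed

section \<open>Coefficient identities behind the two equations\<close>

definition cx :: "complex \<Rightarrow> complex \<Rightarrow> complex" where "cx s t = (s + t) / ((s - 1) * (t - 1))"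
definition cy :: "complex \<Rightarrow> complex \<Rightarrow> complex" where "cy s t = s * t / (s + t) ^ 2"

text \<open>The coefficient of theta1 in 2 D_y - D_x. Its factored form keeps the rational
  identities for the second equation small.\<close>

lemma cL:
  assumes "s - t \<noteq> 0" "1 - s * t \<noteq> 0"
  shows "2 * cY1 s t - cX s t = (s - 1) * (s + t) * (1 + t) / ((s - t) * (1 - s * t))"
  unfolding cY1_def cX_def using assms by (simp add: divide_simps) (simp add: algebra_simps power2_eq_square)

text \<open>Applied to a product n of solutions of the ordinary equation, the first equation is
  linear in n, theta1 n, theta2 n and theta1 theta2 n. Up to common factors the three identities say
  that the coefficients of theta1 n, of theta1 theta2 n and of n vanish; that of theta2 n is the
  first with \<open>s\<close> and \<open>t\<close> exchanged.\<close>

lemma pde1_coeffs: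
  assumes "s - 1 \<noteq> 0" "t - 1 \<noteq> 0" "s + t \<noteq> 0" "s - t \<noteq> 0" "1 - s * t \<noteq> 0"
  shows "(dX1 s t + dX2 s t) - 2 * (dY1 s t + dY2 s t) + cx s t * (dX1 s t + dX2 s t + 1) = 0"
    "cX s t - (cY1 s t + cY2 s t) + cx s t * cX s t = 0"
    "cX s t * (cX s t * (- s / (s - 1) ^ 2 - t / (t - 1) ^ 2) - 2 * (cY1 s t * (- s / (s - 1) ^ 2) + cY2 s t * (- t / (t - 1) ^ 2))
      + cx s t * cX s t * (- s / (s - 1) ^ 2 - t / (t - 1) ^ 2)) + cx s t = 0"
proof -
  show "(dX1 s t + dX2 s t) - 2 * (dY1 s t + dY2 s t) + cx s t * (dX1 s t + dX2 s t + 1) = 0"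
    unfolding dX1_def dX2_def dY1_def dY2_def cx_def using assms
    by (simp add: divide_simps) (simp add: algebra_simps power2_eq_square)
  show "cX s t - (cY1 s t + cY2 s t) + cx s t * cX s t = 0"
    unfolding cX_def cY1_def cY2_def cx_def using assms
    by (simp add: divide_simps) (simp add: algebra_simps power2_eq_square)
  show "cX s t * (cX s t * (- s / (s - 1) ^ 2 - t / (t - 1) ^ 2) - 2 * (cY1 s t * (- s / (s - 1) ^ 2) + cY2 s t * (- t / (t - 1) ^ 2))
      + cx s t * cX s t * (- s / (s - 1) ^ 2 - t / (t - 1) ^ 2)) + cx s t = 0"
    unfolding cX_def cY1_def cY2_def cx_def using assms
    by (simp add: divide_simps) (simp add: algebra_simps power2_eq_square)
qed

text \<open>The same for the second equation, with the coefficients in the same order;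
  \<open>L1\<close> and \<open>L2\<close> belong to the operator 2 D_y - D_x.\<close>

lemma pde2_coeffs:
  assumes "s - 1 \<noteq> 0" "t - 1 \<noteq> 0" "s + t \<noteq> 0" "s - t \<noteq> 0" "1 - s * t \<noteq> 0"
  defines "L1 \<equiv> 2 * cY1 s t - cX s t" and "L2 \<equiv> 2 * cY2 s t - cX s t"
  shows "cY1 s t * dY1 s t + cY2 s t * dY2 s t - cy s t * (L1 * (2 * dY1 s t - dX1 s t) + L2 * (2 * dY2 s t - dX2 s t) + L1) = 0"
    "cY1 s t * cY2 s t - cy s t * (L1 * L2) = 0"
    "cY1 s t ^ 2 * (- s / (s - 1) ^ 2) + cY2 s t ^ 2 * (- t / (t - 1) ^ 2)
      - cy s t * (L1 ^ 2 * (- s / (s - 1) ^ 2) + L2 ^ 2 * (- t / (t - 1) ^ 2)) = 0"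
proof -
  have L1: "L1 = (s - 1) * (s + t) * (1 + t) / ((s - t) * (1 - s * t))" unfolding L1_def by (rule cL[OF assms(4,5)])
  have "L2 = (t - 1) * (t + s) * (1 + s) / ((t - s) * (1 - t * s))"
    unfolding L2_def cY2_swap cX_swap[of s t] by (rule cL) (use assms(4,5) in \<open>auto simp: mult.commute\<close>)
  moreover have "(t - s) * (1 - t * s) = - ((s - t) * (1 - s * t))" by (simp add: algebra_simps)
  ultimately have L2: "L2 = - ((t - 1) * (s + t) * (1 + s)) / ((s - t) * (1 - s * t))" by (simp add: add.commute)
  show "cY1 s t * dY1 s t + cY2 s t * dY2 s t - cy s t * (L1 * (2 * dY1 s t - dX1 s t) + L2 * (2 * dY2 s t - dX2 s t) + L1) = 0"
    unfolding L1 L2 dX1_def dX2_def dY1_def dY2_def cY1_def cY2_def cy_def using assms(1-5)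
    by (simp add: divide_simps) (simp add: algebra_simps power2_eq_square)
  show "cY1 s t * cY2 s t - cy s t * (L1 * L2) = 0"
    unfolding L1 L2 cY1_def cY2_def cy_def using assms(1-5)
    by (simp add: divide_simps) (simp add: algebra_simps power2_eq_square)
  show "cY1 s t ^ 2 * (- s / (s - 1) ^ 2) + cY2 s t ^ 2 * (- t / (t - 1) ^ 2)
      - cy s t * (L1 ^ 2 * (- s / (s - 1) ^ 2) + L2 ^ 2 * (- t / (t - 1) ^ 2)) = 0"
    unfolding L1 L2 cY1_def cY2_def cy_def using assms(1-5)
    by (simp add: divide_simps) (simp add: algebra_simps power2_eq_square)
qed

text \<open>x and y are unchanged if t1 and t2 are exchanged, and also if both are inverted. The
  chart degenerates on t1 = t2, fixed by the exchange, on t1 t2 = 1, fixed by the exchange combined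
  with inversion, and at critical points of t.\<close>

lemma chart_points_iff:
  assumes "open \<Omega>" "\<And>\<tau>. \<tau> \<in> \<Omega> \<Longrightarrow> (t has_field_derivative \<kappa> \<tau> * t \<tau>) (at \<tau>)" "\<And>\<tau>. \<tau> \<in> \<Omega> \<Longrightarrow> t \<tau> \<noteq> 0"
  shows "(\<tau>1, \<tau>2) \<in> chart_points t \<Omega> \<longleftrightarrow> \<tau>1 \<in> \<Omega> \<and> \<tau>2 \<in> \<Omega> \<and> t \<tau>1 \<noteq> 1 \<and> t \<tau>2 \<noteq> 1 \<and> t \<tau>1 + t \<tau>2 \<noteq> 0 \<and>
    t \<tau>1 \<noteq> t \<tau>2 \<and> t \<tau>1 * t \<tau>2 \<noteq> 1 \<and> \<kappa> \<tau>1 \<noteq> 0 \<and> \<kappa> \<tau>2 \<noteq> 0"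
proof (cases "\<tau>1 \<in> \<Omega> \<and> \<tau>2 \<in> \<Omega> \<and> t \<tau>1 \<noteq> 1 \<and> t \<tau>2 \<noteq> 1 \<and> t \<tau>1 + t \<tau>2 \<noteq> 0")
  case True
  then have "jacobian (xcoord t) (ycoord t) (\<tau>1, \<tau>2) =
    - (\<kappa> \<tau>1 * \<kappa> \<tau>2 * xcoord t (\<tau>1, \<tau>2) * ycoord t (\<tau>1, \<tau>2) * eta1 (t \<tau>1) (t \<tau>2) * ((1 - t \<tau>1 * t \<tau>2) / ((t \<tau>1 - 1) * (t \<tau>2 - 1))))"
    using assms by (intro jacobian_eq) auto
  then show ?thesis
    using True assms(3) by (auto simp: chart_points_def xcoord_def ycoord_def eta1_def)
qed (auto simp: chart_points_def)

section \<open>The local inverse of the chart\<close>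

lemma continuous_on_fst_snd:
  assumes "continuous_on \<Omega> f" "U \<subseteq> \<Omega> \<times> \<Omega>"
  shows "continuous_on U (\<lambda>z. f (fst z))" "continuous_on U (\<lambda>z. f (snd z))"
  using assms by (auto intro!: continuous_on_compose2[OF assms(1)] continuous_intros)

lemma open_chart_points:
  assumes "open \<Omega>" "\<And>\<tau>. \<tau> \<in> \<Omega> \<Longrightarrow> (t has_field_derivative \<kappa> \<tau> * t \<tau>) (at \<tau>)" "\<And>\<tau>. \<tau> \<in> \<Omega> \<Longrightarrow> t \<tau> \<noteq> 0"
    "continuous_on \<Omega> t" "continuous_on \<Omega> \<kappa>"
  shows "open (chart_points t \<Omega>)"
proof -
  note t = continuous_on_fst_snd[OF assms(4) subset_refl] and k = continuous_on_fst_snd[OF assms(5) subset_refl]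
  define h where "h = (\<lambda>z. (t (fst z) - 1) * (t (snd z) - 1) * (t (fst z) + t (snd z)) * (t (fst z) - t (snd z)) * (t (fst z) * t (snd z) - 1)
    * \<kappa> (fst z) * \<kappa> (snd z))"
  have "continuous_on (\<Omega> \<times> \<Omega>) h" unfolding h_def by (intro continuous_intros t k)
  then have "open (h -` (- {0}) \<inter> \<Omega> \<times> \<Omega>)"
    using continuous_on_open_vimage[OF open_Times[OF assms(1,1)], of h] by auto
  moreover have "h -` (- {0}) \<inter> \<Omega> \<times> \<Omega> = chart_points t \<Omega>"
    using chart_points_iff[OF assms(1-3)] by (auto simp: h_def)
  ultimately show ?thesis by simp
qed

text \<open>The matrix of the derivative of the inverse chart at \<open>(x, y)\<close>; its columns are the vector
  fields \<open>D\<^sub>x\<close> and \<open>D\<^sub>y\<close> divided by \<open>x\<close> and \<open>y\<close>.\<close>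

definition inv_chart_deriv :: "(complex \<Rightarrow> complex) \<Rightarrow> (complex \<Rightarrow> complex) \<Rightarrow> complex \<times> complex \<Rightarrow> complex \<times> complex \<Rightarrow> complex \<times> complex" where
  "inv_chart_deriv \<kappa> t z = (\<lambda>(v, w).
     ((cX (t (fst z)) (t (snd z)) * v / xcoord t z + cY1 (t (fst z)) (t (snd z)) * w / ycoord t z) / \<kappa> (fst z),
      (cX (t (fst z)) (t (snd z)) * v / xcoord t z + cY2 (t (fst z)) (t (snd z)) * w / ycoord t z) / \<kappa> (snd z)))"

definition chart_deriv :: "(complex \<Rightarrow> complex) \<Rightarrow> (complex \<Rightarrow> complex) \<Rightarrow> complex \<times> complex \<Rightarrow> complex \<times> complex \<Rightarrow> complex \<times> complex" where
  "chart_deriv \<kappa> t z = (\<lambda>(h, k).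
     (\<kappa> (fst z) * (xcoord t z * xi1 (t (fst z)) (t (snd z))) * h + \<kappa> (snd z) * (xcoord t z * xi2 (t (fst z)) (t (snd z))) * k,
      \<kappa> (fst z) * (ycoord t z * eta1 (t (fst z)) (t (snd z))) * h - \<kappa> (snd z) * (ycoord t z * eta1 (t (fst z)) (t (snd z))) * k))"

lemma chart_deriv_inverse:
  assumes "t (fst z) \<noteq> 0" "t (snd z) \<noteq> 0" "t (fst z) \<noteq> 1" "t (snd z) \<noteq> 1" "t (fst z) + t (snd z) \<noteq> 0" "t (fst z) \<noteq> t (snd z)"
    "t (fst z) * t (snd z) \<noteq> 1" "\<kappa> (fst z) \<noteq> 0" "\<kappa> (snd z) \<noteq> 0"
  shows "chart_deriv \<kappa> t z (inv_chart_deriv \<kappa> t z p) = p" "inv_chart_deriv \<kappa> t z (chart_deriv \<kappa> t z p) = p"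
proof -
  obtain v w where p: "p = (v, w)" by (cases p)
  define x y e a b X Y1 Y2 K L where "x = xcoord t z" and "y = ycoord t z" and "e = eta1 (t (fst z)) (t (snd z))"
    and "a = xi1 (t (fst z)) (t (snd z))" and "b = xi2 (t (fst z)) (t (snd z))" and "X = cX (t (fst z)) (t (snd z))"
    and "Y1 = cY1 (t (fst z)) (t (snd z))" and "Y2 = cY2 (t (fst z)) (t (snd z))" and "K = \<kappa> (fst z)" and "L = \<kappa> (snd z)"
  note d = x_def[symmetric] y_def[symmetric] e_def[symmetric] a_def[symmetric] b_def[symmetric] X_def[symmetric]
     Y1_def[symmetric] Y2_def[symmetric] K_def[symmetric] L_def[symmetric]
  note M = chart_matrix[OF assms(3-7), unfolded d]
  have nz: "x \<noteq> 0" "y \<noteq> 0" "K \<noteq> 0" "L \<noteq> 0"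
    using assms by (auto simp: x_def y_def K_def L_def xcoord_def ycoord_def case_prod_unfold)
  have 1: "K * (x * a) * ((X * v / x + Y1 * w / y) / K) + L * (x * b) * ((X * v / x + Y2 * w / y) / L) =
    ((a + b) * X) * v + (a * Y1 + b * Y2) * (x * w / y)"
    using nz by (simp add: divide_simps) (simp add: algebra_simps)
  have 2: "K * (y * e) * ((X * v / x + Y1 * w / y) / K) - L * (y * e) * ((X * v / x + Y2 * w / y) / L) =
    (e * Y1 - e * Y2) * w"
    using nz by (simp add: divide_simps) (simp add: algebra_simps)
  show "chart_deriv \<kappa> t z (inv_chart_deriv \<kappa> t z p) = p"
    unfolding chart_deriv_def inv_chart_deriv_def p d by (simp only: prod.case 1 2 M) simp
  have 3: "(X * (K * (x * a) * v + L * (x * b) * w) / x + Y * (K * (y * e) * v - L * (y * e) * w) / y) =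
     (X * a + Y * e) * (K * v) + (X * b - Y * e) * (L * w)" for Y
    using nz by (simp add: divide_simps) (simp add: algebra_simps)
  show "inv_chart_deriv \<kappa> t z (chart_deriv \<kappa> t z p) = p"
    unfolding chart_deriv_def inv_chart_deriv_def p d by (simp only: prod.case 3 M) (use nz in simp)
qed

lemma linear_inv_chart_deriv: "linear (inv_chart_deriv \<kappa> t z)"
  by (rule linearI) (auto simp: inv_chart_deriv_def algebra_simps add_divide_distrib scaleR_conv_of_real split: prod.splits)

lemma linear_chart_deriv: "linear (chart_deriv \<kappa> t z)"
  by (rule linearI) (auto simp: chart_deriv_def algebra_simps scaleR_conv_of_real split: prod.splits)

lemma has_derivative_chart:
  assumes "(t has_field_derivative \<kappa> (fst z) * t (fst z)) (at (fst z))" "(t has_field_derivative \<kappa> (snd z) * t (snd z)) (at (snd z))"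
    "t (fst z) \<noteq> 1" "t (snd z) \<noteq> 1" "t (fst z) + t (snd z) \<noteq> 0"
  shows "((\<lambda>z. (xcoord t z, ycoord t z)) has_derivative chart_deriv \<kappa> t z) (at z)"
  by (rule has_derivative_eq_rhs[OF has_derivative_Pair[OF xy_has_theta[where \<kappa>=\<kappa>, OF assms, unfolded has_theta_def]]])
    (auto simp: chart_deriv_def fun_eq_iff)

text \<open>The inverse function theorem combined with the explicit inverse matrix: the derivative
  of \<open>g\<close> is then known at every point of \<open>V\<close>, as is needed to apply D_x
  and D_y twice.\<close>

lemma local_inverse_chart:
  assumes "open \<Omega>" "\<And>\<tau>. \<tau> \<in> \<Omega> \<Longrightarrow> (t has_field_derivative \<kappa> \<tau> * t \<tau>) (at \<tau>)" "\<And>\<tau>. \<tau> \<in> \<Omega> \<Longrightarrow> t \<tau> \<noteq> 0"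
    "continuous_on \<Omega> t" "continuous_on \<Omega> \<kappa>" "open U0" "p \<in> U0" "U0 \<subseteq> chart_points t \<Omega>"
  obtains U V g where "open U" "p \<in> U" "U \<subseteq> U0" "open V" "bij_betw (\<lambda>z. (xcoord t z, ycoord t z)) U V"
    "\<And>w. w \<in> V \<Longrightarrow> g w \<in> U \<and> (xcoord t (g w), ycoord t (g w)) = w" "\<And>z. z \<in> U \<Longrightarrow> g (xcoord t z, ycoord t z) = z"
    "\<And>w. w \<in> V \<Longrightarrow> (g has_derivative inv_chart_deriv \<kappa> t (g w)) (at w)"
proof -
  define f where "f = (\<lambda>z. (xcoord t z, ycoord t z))"
  have ch: "fst z \<in> \<Omega>" "snd z \<in> \<Omega>" "t (fst z) \<noteq> 0" "t (snd z) \<noteq> 0" "t (fst z) \<noteq> 1" "t (snd z) \<noteq> 1"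
    "t (fst z) + t (snd z) \<noteq> 0" "t (fst z) \<noteq> t (snd z)" "t (fst z) * t (snd z) \<noteq> 1" "\<kappa> (fst z) \<noteq> 0" "\<kappa> (snd z) \<noteq> 0"
    if "z \<in> U0" for z
    using chart_points_iff[OF assms(1-3), of "fst z" "snd z"] that assms(3,8) by auto
  have bl: "bounded_linear (chart_deriv \<kappa> t z)" "bounded_linear (inv_chart_deriv \<kappa> t z)" for z
    using linear_chart_deriv linear_inv_chart_deriv linear_conv_bounded_linear by blast+
  define f' where "f' = (\<lambda>z. Blinfun (chart_deriv \<kappa> t z))"
  have f'_apply: "blinfun_apply (f' z) = chart_deriv \<kappa> t z" for z
    unfolding f'_def by (rule bounded_linear_Blinfun_apply[OF bl(1)])
  have derf: "(f has_derivative blinfun_apply (f' z)) (at z)" if "z \<in> U0" for z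
    unfolding f'_apply f_def using ch[OF that] assms(2) by (intro has_derivative_chart) auto
  have sub: "U0 \<subseteq> \<Omega> \<times> \<Omega>" using ch(1,2) by (auto simp: mem_Times_iff)
  note ct = continuous_on_fst_snd[OF assms(4) sub] and ck = continuous_on_fst_snd[OF assms(5) sub]
  have contf: "continuous_on U0 f'"
  proof (rule continuous_on_blinfun_componentwise)
    fix i :: "complex \<times> complex"
    show "continuous_on U0 (\<lambda>z. blinfun_apply (f' z) i)"
      unfolding f'_apply chart_deriv_def xcoord_def ycoord_def xi1_def xi2_def eta1_def case_prod_unfold
      using ch by (intro continuous_intros ct ck) auto
  qed
  have inv: "Blinfun (inv_chart_deriv \<kappa> t p) o\<^sub>L f' p = id_blinfun"
    by (rule blinfun_eqI) (use ch[OF assms(7)] chart_deriv_inverse(2)[of t p \<kappa>] in \<open>simp add: f'_apply bounded_linear_Blinfun_apply[OF bl(2)]\<close>)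
  obtain U V g g' where g: "open U" "U \<subseteq> U0" "p \<in> U" "open V" "homeomorphism U V f g"
    "\<And>y. y \<in> V \<Longrightarrow> (g has_derivative (g' y)) (at y)" "\<And>y. y \<in> V \<Longrightarrow> g' y = inv (blinfun_apply (f' (g y)))"
    using inverse_function_theorem[OF assms(6) derf contf assms(7) inv] by metis
  have gU: "g w \<in> U \<and> f (g w) = w" if "w \<in> V" for w
    using g(5) that by (auto simp: homeomorphism_def)
  show ?thesis
  proof (rule that[OF g(1,3,2,4)])
    show "bij_betw (\<lambda>z. (xcoord t z, ycoord t z)) U V"
      unfolding f_def[symmetric] using g(5) by (auto simp: homeomorphism_def bij_betw_def intro: inj_on_inverseI)
    show "g w \<in> U \<and> (xcoord t (g w), ycoord t (g w)) = w" if "w \<in> V" for w using gU[OF that] by (simp add: f_def)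
    show "g (xcoord t z, ycoord t z) = z" if "z \<in> U" for z using g(5) that by (auto simp: homeomorphism_def f_def)
    show "(g has_derivative inv_chart_deriv \<kappa> t (g w)) (at w)" if "w \<in> V" for w
    proof -
      have "g w \<in> U0" using gU[OF that] g(2) by auto
      note c = ch[OF this]
      have "inv (chart_deriv \<kappa> t (g w)) = inv_chart_deriv \<kappa> t (g w)"
        by (rule inv_equality) (use chart_deriv_inverse[OF c(3-11)] in auto)
      then show ?thesis using g(6)[OF that] g(7)[OF that] by (simp add: f'_apply)
    qed
  qed
qed

lemma linear_combination_zero:
  fixes n p r w :: complex
  assumes "cn = 0" "cp = 0" "cr = 0" "cw = 0"
  shows "n * cn + p * cp + r * cr + w * cw = 0"
  using assms by simp

text \<open>\<open>n\<close>, \<open>p\<close>, \<open>r\<close>, \<open>w\<close> stand for the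
  product u1 u2 and its derivatives by theta1, theta2 and theta1 theta2; \<open>m1\<close> and
  \<open>m2\<close> replace the pure second derivatives by means of the ordinary equation.
  \<open>a1\<close>, \<open>b1\<close> are the theta-derivatives of D_x F, and \<open>a2\<close>,
  \<open>b2\<close> those of D_y F.\<close>

lemma pde_algebra:
  fixes s t A n p r w :: complex
  assumes "s - 1 \<noteq> 0" "t - 1 \<noteq> 0" "s + t \<noteq> 0" "s - t \<noteq> 0" "1 - s * t \<noteq> 0"
  defines "X \<equiv> cX s t" and "Y1 \<equiv> cY1 s t" and "Y2 \<equiv> cY2 s t" and "m1 \<equiv> - A * s / (s - 1) ^ 2" and "m2 \<equiv> - A * t / (t - 1) ^ 2"
  defines "a1 \<equiv> dX1 s t * (p + r) + X * (m1 * n + w)" and "b1 \<equiv> dX2 s t * (p + r) + X * (w + m2 * n)"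
  defines "a2 \<equiv> (dY1 s t * p + Y1 * (m1 * n)) + (dY2 t s * r + Y2 * w)"
    and "b2 \<equiv> (dY2 s t * p + Y1 * w) + (dY1 t s * r + Y2 * (m2 * n))"
  shows "X * ((a1 - 2 * a2) + (b1 - 2 * b2)) + cx s t * (X * (a1 + b1) + X * (p + r) + A * n) = 0"
    "Y1 * a2 + Y2 * b2 - cy s t * (2 * (Y1 * (2 * a2 - a1) + Y2 * (2 * b2 - b1)) - X * ((2 * a2 - a1) + (2 * b2 - b1))
      + (2 * (Y1 * p + Y2 * r) - X * (p + r))) = 0"
proof -
  have nz': "t - s \<noteq> 0" "1 - t * s \<noteq> 0" "t + s \<noteq> 0" using assms(3-5) by (auto simp: mult.commute add.commute)
  note c1 = pde1_coeffs[OF assms(1-5)] and c1' = pde1_coeffs(1)[OF assms(2,1) nz'(3,1,2)]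
  note c2 = pde2_coeffs[OF assms(1-5)] and c2' = pde2_coeffs(1)[OF assms(2,1) nz'(3,1,2)]
  have sw: "dX1 t s = dX2 s t" "dX2 t s = dX1 s t" "cx t s = cx s t" "cy t s = cy s t" "cY1 t s = Y2" "cY2 t s = Y1" "cX t s = X"
    by (simp_all add: dX_swap cx_def cy_def cY2_swap Y1_def Y2_def X_def cX_swap[of t s] add.commute mult.commute)
  define \<mu> \<nu> where "\<mu> = - s / (s - 1) ^ 2" and "\<nu> = - t / (t - 1) ^ 2"
  have m: "m1 = A * \<mu>" "m2 = A * \<nu>" by (simp_all add: m1_def m2_def \<mu>_def \<nu>_def)
  have "X * ((a1 - 2 * a2) + (b1 - 2 * b2)) + cx s t * (X * (a1 + b1) + X * (p + r) + A * n) =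
    n * (A * (X * (X * (\<mu> + \<nu>) - 2 * (Y1 * \<mu> + Y2 * \<nu>) + cx s t * X * (\<mu> + \<nu>)) + cx s t))
    + p * (X * ((dX1 s t + dX2 s t) - 2 * (dY1 s t + dY2 s t) + cx s t * (dX1 s t + dX2 s t + 1)))
    + r * (X * ((dX1 s t + dX2 s t) - 2 * (dY1 t s + dY2 t s) + cx s t * (dX1 s t + dX2 s t + 1)))
    + w * (2 * X * (X - (Y1 + Y2) + cx s t * X))"
    unfolding a1_def b1_def a2_def b2_def m by (simp add: algebra_simps)
  also have "\<dots> = 0"
    by (rule linear_combination_zero)
      (use c1 c1' in \<open>simp_all add: X_def[symmetric] Y1_def[symmetric] Y2_def[symmetric] \<mu>_def \<nu>_def sw add.commute[of "dX2 s t"]\<close>)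
  finally show "X * ((a1 - 2 * a2) + (b1 - 2 * b2)) + cx s t * (X * (a1 + b1) + X * (p + r) + A * n) = 0" .
  define L1 L2 where "L1 = 2 * Y1 - X" and "L2 = 2 * Y2 - X"
  have "Y1 * a2 + Y2 * b2 - cy s t * (2 * (Y1 * (2 * a2 - a1) + Y2 * (2 * b2 - b1)) - X * ((2 * a2 - a1) + (2 * b2 - b1))
      + (2 * (Y1 * p + Y2 * r) - X * (p + r))) =
    n * (A * (Y1 ^ 2 * \<mu> + Y2 ^ 2 * \<nu> - cy s t * (L1 ^ 2 * \<mu> + L2 ^ 2 * \<nu>)))
    + p * (Y1 * dY1 s t + Y2 * dY2 s t - cy s t * (L1 * (2 * dY1 s t - dX1 s t) + L2 * (2 * dY2 s t - dX2 s t) + L1))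
    + r * (Y2 * dY1 t s + Y1 * dY2 t s - cy s t * (L2 * (2 * dY1 t s - dX2 s t) + L1 * (2 * dY2 t s - dX1 s t) + L2))
    + w * (2 * (Y1 * Y2 - cy s t * (L1 * L2)))"
    unfolding a1_def b1_def a2_def b2_def m L1_def L2_def by (simp add: algebra_simps power2_eq_square)
  also have "\<dots> = 0"
    by (rule linear_combination_zero)
      (use c2 c2' in \<open>simp_all add: X_def[symmetric] Y1_def[symmetric] Y2_def[symmetric] \<mu>_def \<nu>_def sw L1_def L2_def\<close>)
  finally show "Y1 * a2 + Y2 * b2 - cy s t * (2 * (Y1 * (2 * a2 - a1) + Y2 * (2 * b2 - b1)) - X * ((2 * a2 - a1) + (2 * b2 - b1))
      + (2 * (Y1 * p + Y2 * r) - X * (p + r))) = 0" .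
qed

lemma Dx_Dy_compose:
  assumes g: "(g has_derivative inv_chart_deriv \<kappa> t (g w)) (at w)" "(xcoord t (g w), ycoord t (g w)) = w"
    and \<phi>: "has_theta \<kappa> \<phi> a b (g w)"
    and nz: "\<kappa> (fst (g w)) \<noteq> 0" "\<kappa> (snd (g w)) \<noteq> 0" "fst w \<noteq> 0" "snd w \<noteq> 0"
  shows "\<exists>A B. ((\<lambda>w. \<phi> (g w)) has_derivative (\<lambda>(h, k). A * h + B * k)) (at w)"
    "Dx (\<lambda>w. \<phi> (g w)) w = cX (t (fst (g w))) (t (snd (g w))) * (a + b)"
    "Dy (\<lambda>w. \<phi> (g w)) w = cY1 (t (fst (g w))) (t (snd (g w))) * a + cY2 (t (fst (g w))) (t (snd (g w))) * b"
proof -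
  define X Y1 Y2 where "X = cX (t (fst (g w))) (t (snd (g w)))" and "Y1 = cY1 (t (fst (g w))) (t (snd (g w)))"
    and "Y2 = cY2 (t (fst (g w))) (t (snd (g w)))"
  have xy: "xcoord t (g w) = fst w" "ycoord t (g w) = snd w" using g(2) by (auto simp: prod_eq_iff)
  have "((\<lambda>w. \<phi> (g w)) has_derivative (\<lambda>(h, k). (X * (a + b) / fst w) * h + ((Y1 * a + Y2 * b) / snd w) * k)) (at w)"
    by (rule has_derivative_eq_rhs[OF has_derivative_compose[OF g(1) \<phi>[unfolded has_theta_def]]])
      (use nz in \<open>auto simp: inv_chart_deriv_def fun_eq_iff xy X_def[symmetric] Y1_def[symmetric] Y2_def[symmetric] add_divide_distrib algebra_simps\<close>)
  note d = this Dx_Dy_eq[OF this]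
  show "\<exists>A B. ((\<lambda>w. \<phi> (g w)) has_derivative (\<lambda>(h, k). A * h + B * k)) (at w)"
    by (intro exI) (rule d(1))
  show "Dx (\<lambda>w. \<phi> (g w)) w = cX (t (fst (g w))) (t (snd (g w))) * (a + b)"
    "Dy (\<lambda>w. \<phi> (g w)) w = cY1 (t (fst (g w))) (t (snd (g w))) * a + cY2 (t (fst (g w))) (t (snd (g w))) * b"
    unfolding d using nz by (simp_all add: X_def Y1_def Y2_def)
qed

text \<open>\<open>v1\<close> and \<open>v2\<close> are the theta-derivatives of \<open>u1\<close>
  and \<open>u2\<close>, so that each pair of first-order equations is the second-order equation for
  one factor.\<close>

lemma pde_local:
  fixes a :: real
  assumes \<Omega>: "open \<Omega>" "\<And>\<tau>. \<tau> \<in> \<Omega> \<Longrightarrow> (t has_field_derivative \<kappa> \<tau> * t \<tau>) (at \<tau>)" "\<And>\<tau>. \<tau> \<in> \<Omega> \<Longrightarrow> t \<tau> \<noteq> 0"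
    "continuous_on \<Omega> t" "continuous_on \<Omega> \<kappa>"
    and p: "(\<tau>1, \<tau>2) \<in> chart_points t \<Omega>" and B: "open B1" "open B2" "\<tau>1 \<in> B1" "\<tau>2 \<in> B2"
    and u1: "\<And>\<tau>. \<tau> \<in> B1 \<Longrightarrow> (u1 has_field_derivative \<kappa> \<tau> * v1 \<tau>) (at \<tau>)"
      "\<And>\<tau>. \<tau> \<in> B1 \<Longrightarrow> (v1 has_field_derivative \<kappa> \<tau> * (- of_real (a * (1 - a)) * t \<tau> / (t \<tau> - 1) ^ 2 * u1 \<tau>)) (at \<tau>)"
    and u2: "\<And>\<tau>. \<tau> \<in> B2 \<Longrightarrow> (u2 has_field_derivative \<kappa> \<tau> * v2 \<tau>) (at \<tau>)"
      "\<And>\<tau>. \<tau> \<in> B2 \<Longrightarrow> (v2 has_field_derivative \<kappa> \<tau> * (- of_real (a * (1 - a)) * t \<tau> / (t \<tau> - 1) ^ 2 * u2 \<tau>)) (at \<tau>)"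
    and F: "\<And>z. z \<in> B1 \<times> B2 \<Longrightarrow> F z = u1 (fst z) * u2 (snd z)"
  shows "\<exists>U V G. open U \<and> (\<tau>1, \<tau>2) \<in> U \<and> U \<subseteq> chart_points t \<Omega> \<and> open V \<and>
       bij_betw (\<lambda>z. (xcoord t z, ycoord t z)) U V \<and> holomorphic2_on G V \<and>
       (\<forall>z\<in>U. F z = G (xcoord t z, ycoord t z)) \<and> (\<forall>w\<in>V. pde_system a G w)"
proof -
  define U0 where "U0 = chart_points t \<Omega> \<inter> B1 \<times> B2"
  have U0: "open U0" "(\<tau>1, \<tau>2) \<in> U0" "U0 \<subseteq> chart_points t \<Omega>"
    unfolding U0_def using open_chart_points[OF \<Omega>] B p by (auto intro!: open_Int open_Times)
  obtain U V g where UV: "open U" "(\<tau>1, \<tau>2) \<in> U" "U \<subseteq> U0" "open V" "bij_betw (\<lambda>z. (xcoord t z, ycoord t z)) U V"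
    and gV: "\<And>w. w \<in> V \<Longrightarrow> g w \<in> U \<and> (xcoord t (g w), ycoord t (g w)) = w" and gU: "\<And>z. z \<in> U \<Longrightarrow> g (xcoord t z, ycoord t z) = z"
    and dg: "\<And>w. w \<in> V \<Longrightarrow> (g has_derivative inv_chart_deriv \<kappa> t (g w)) (at w)"
    using local_inverse_chart[OF \<Omega> U0] by blast
  have ch: "fst z \<in> \<Omega>" "snd z \<in> \<Omega>" "fst z \<in> B1" "snd z \<in> B2" "t (fst z) \<noteq> 0" "t (snd z) \<noteq> 0" "t (fst z) \<noteq> 1" "t (snd z) \<noteq> 1"
    "t (fst z) + t (snd z) \<noteq> 0" "t (fst z) \<noteq> t (snd z)" "t (fst z) * t (snd z) \<noteq> 1" "\<kappa> (fst z) \<noteq> 0" "\<kappa> (snd z) \<noteq> 0"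
    if "z \<in> U" for z
    using chart_points_iff[OF \<Omega>(1-3), of "fst z" "snd z"] that UV(3) \<Omega>(3) by (auto simp: U0_def)
  define A :: complex where "A = of_real (a * (1 - a))"
  define fn where "fn = (\<lambda>z :: complex \<times> complex. u1 (fst z) * u2 (snd z))"
  define fp where "fp = (\<lambda>z :: complex \<times> complex. v1 (fst z) * u2 (snd z))"
  define fr where "fr = (\<lambda>z :: complex \<times> complex. u1 (fst z) * v2 (snd z))"
  define fw where "fw = (\<lambda>z :: complex \<times> complex. v1 (fst z) * v2 (snd z))"
  define m1 where "m1 = (\<lambda>z :: complex \<times> complex. - A * t (fst z) / (t (fst z) - 1) ^ 2)"
  define m2 where "m2 = (\<lambda>z :: complex \<times> complex. - A * t (snd z) / (t (snd z) - 1) ^ 2)"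
  define X where "X = (\<lambda>z :: complex \<times> complex. cX (t (fst z)) (t (snd z)))"
  define Y1 where "Y1 = (\<lambda>z :: complex \<times> complex. cY1 (t (fst z)) (t (snd z)))"
  define Y2 where "Y2 = (\<lambda>z :: complex \<times> complex. cY2 (t (fst z)) (t (snd z)))"
  define f1 where "f1 = (\<lambda>z :: complex \<times> complex. X z * (fp z + fr z))"
  define f2 where "f2 = (\<lambda>z :: complex \<times> complex. Y1 z * fp z + Y2 z * fr z)"
  define a1 where "a1 = (\<lambda>z :: complex \<times> complex. dX1 (t (fst z)) (t (snd z)) * (fp z + fr z) + X z * (m1 z * fn z + fw z))"
  define b1 where "b1 = (\<lambda>z :: complex \<times> complex. dX2 (t (fst z)) (t (snd z)) * (fp z + fr z) + X z * (fw z + m2 z * fn z))"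
  define a2 where "a2 = (\<lambda>z :: complex \<times> complex. (dY1 (t (fst z)) (t (snd z)) * fp z + Y1 z * (m1 z * fn z)) + (dY2 (t (snd z)) (t (fst z)) * fr z + Y2 z * fw z))"
  define b2 where "b2 = (\<lambda>z :: complex \<times> complex. (dY2 (t (fst z)) (t (snd z)) * fp z + Y1 z * fw z) + (dY1 (t (snd z)) (t (fst z)) * fr z + Y2 z * (m2 z * fn z)))"
  have th: "has_theta \<kappa> fn (fp z) (fr z) z" "has_theta \<kappa> f1 (a1 z) (b1 z) z" "has_theta \<kappa> f2 (a2 z) (b2 z) z" if "z \<in> U" for z
  proof -
    note c = ch[OF that]
    have U1: "has_theta \<kappa> (\<lambda>z. u1 (fst z)) (v1 (fst z)) 0 z" by (rule has_theta_fst[where f=u1 and \<kappa>=\<kappa> and z=z, OF u1(1)[OF c(3)]])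
    have V1: "has_theta \<kappa> (\<lambda>z. v1 (fst z)) (m1 z * u1 (fst z)) 0 z"
      using has_theta_fst[where f=v1 and \<kappa>=\<kappa> and z=z, OF u1(2)[OF c(3)]] by (simp add: m1_def A_def)
    have U2: "has_theta \<kappa> (\<lambda>z. u2 (snd z)) 0 (v2 (snd z)) z" by (rule has_theta_snd[where f=u2 and \<kappa>=\<kappa> and z=z, OF u2(1)[OF c(4)]])
    have V2: "has_theta \<kappa> (\<lambda>z. v2 (snd z)) 0 (m2 z * u2 (snd z)) z"
      using has_theta_snd[where f=v2 and \<kappa>=\<kappa> and z=z, OF u2(2)[OF c(4)]] by (simp add: m2_def A_def)
    note C = coeff_has_theta[OF \<Omega>(2)[OF c(1)] \<Omega>(2)[OF c(2)] c(10,11), folded X_def Y1_def Y2_def]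
    show N: "has_theta \<kappa> fn (fp z) (fr z) z"
      unfolding fn_def by (rule has_theta_eq[OF has_theta_mult[OF U1 U2]]) (simp_all add: fp_def fr_def)
    have Pt: "has_theta \<kappa> fp (m1 z * fn z) (fw z) z"
      unfolding fp_def by (rule has_theta_eq[OF has_theta_mult[OF V1 U2]]) (simp_all add: fn_def fw_def)
    have Rt: "has_theta \<kappa> fr (fw z) (m2 z * fn z) z"
      unfolding fr_def by (rule has_theta_eq[OF has_theta_mult[OF U1 V2]]) (simp_all add: fn_def fw_def)
    show "has_theta \<kappa> f1 (a1 z) (b1 z) z"
      unfolding f1_def by (rule has_theta_eq[OF has_theta_mult[OF C(1) has_theta_add[OF Pt Rt]]]) (simp_all add: a1_def b1_def)
    show "has_theta \<kappa> f2 (a2 z) (b2 z) z"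
      unfolding f2_def by (rule has_theta_eq[OF has_theta_add[OF has_theta_mult[OF C(2) Pt] has_theta_mult[OF C(3) Rt]]]) (simp_all add: a2_def b2_def)
  qed
  define G where "G = (\<lambda>w. fn (g w))"
  have comp: "\<exists>A B. ((\<lambda>w. \<phi> (g w)) has_derivative (\<lambda>(h, k). A * h + B * k)) (at w)"
      "Dx (\<lambda>w. \<phi> (g w)) w = X (g w) * (\<alpha> + \<beta>)" "Dy (\<lambda>w. \<phi> (g w)) w = Y1 (g w) * \<alpha> + Y2 (g w) * \<beta>"
    if "w \<in> V" "has_theta \<kappa> \<phi> \<alpha> \<beta> (g w)" for w \<phi> \<alpha> \<beta>
  proof -
    have gw: "g w \<in> U" "(xcoord t (g w), ycoord t (g w)) = w" using gV[OF that(1)] by auto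
    note c = ch[OF gw(1)]
    have "fst w = xcoord t (g w)" "snd w = ycoord t (g w)" using gw(2) by (metis fst_conv, metis snd_conv)
    then have "fst w \<noteq> 0" "snd w \<noteq> 0" using c by (auto simp: xcoord_def ycoord_def case_prod_unfold)
    from Dx_Dy_compose[OF dg[OF that(1)] gw(2) that(2) c(12,13) this]
    show "\<exists>A B. ((\<lambda>w. \<phi> (g w)) has_derivative (\<lambda>(h, k). A * h + B * k)) (at w)"
      "Dx (\<lambda>w. \<phi> (g w)) w = X (g w) * (\<alpha> + \<beta>)" "Dy (\<lambda>w. \<phi> (g w)) w = Y1 (g w) * \<alpha> + Y2 (g w) * \<beta>"
      by (auto simp: X_def Y1_def Y2_def)
  qed
  have DG: "Dx G w = f1 (g w)" "Dy G w = f2 (g w)" if "w \<in> V" for w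
    using comp(2,3)[OF that th(1)] gV[OF that] unfolding G_def f1_def f2_def by auto
  have pde: "pde_system a G w" if wV: "w \<in> V" for w
  proof -
    define z where "z = g w"
    have z: "z \<in> U" "(xcoord t z, ycoord t z) = w" using gV[OF wV] by (auto simp: z_def)
    note c = ch[OF z(1)] and h = th[OF z(1)]
    note cmp = comp(2,3)[OF wV, folded z_def]
    note con = has_theta_const[of \<kappa> _ z]
    \<comment> \<open>An inner derivative is an explicit function of \<open>g w\<close> on all of
      \<open>V\<close>; so the outer D_x or D_y is computed from the theta-derivatives of that
      function.\<close>
    have Dcong: "Dx f w = X z * (\<alpha> + \<beta>)" "Dy f w = Y1 z * \<alpha> + Y2 z * \<beta>"
      if "\<And>w. w \<in> V \<Longrightarrow> f w = \<phi> (g w)" "has_theta \<kappa> \<phi> \<alpha> \<beta> z" for f \<phi> \<alpha> \<beta>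
      using Dx_Dy_cong[OF UV(4) wV that(1)] cmp[OF that(2)] by auto
    have 1: "Dx (\<lambda>w. Dx G w - 2 * Dy G w) w = X z * ((a1 z - 2 * a2 z) + (b1 z - 2 * b2 z))"
      by (rule Dcong(1)[of _ "\<lambda>z. f1 z - 2 * f2 z"])
        (use DG in simp, rule has_theta_eq[OF has_theta_diff[OF h(2) has_theta_mult[OF con h(3)]]], simp_all)
    have 2: "Dx (\<lambda>w. Dx G w + (1 - of_real a) * G w) w = X z * ((a1 z + (1 - of_real a) * fp z) + (b1 z + (1 - of_real a) * fr z))"
      by (rule Dcong(1)[of _ "\<lambda>z. f1 z + (1 - of_real a) * fn z"])
        (use DG in \<open>simp add: G_def\<close>, rule has_theta_eq[OF has_theta_add[OF h(2) has_theta_mult[OF con h(1)]]], simp_all)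
    have 3: "Dy (Dy G) w = Y1 z * a2 z + Y2 z * b2 z"
      by (rule Dcong(2)[of _ f2]) (use DG h in simp_all)
    have K: "has_theta \<kappa> (\<lambda>z. 2 * f2 z - f1 z) (2 * a2 z - a1 z) (2 * b2 z - b1 z) z"
      by (rule has_theta_eq[OF has_theta_diff[OF has_theta_mult[OF con h(3)] h(2)]]) simp_all
    have 4: "Dx (\<lambda>w. 2 * Dy G w - Dx G w) w = X z * ((2 * a2 z - a1 z) + (2 * b2 z - b1 z))"
       "Dy (\<lambda>w. 2 * Dy G w - Dx G w) w = Y1 z * (2 * a2 z - a1 z) + Y2 z * (2 * b2 z - b1 z)"
      by (rule Dcong[OF _ K], use DG in simp)+
    have w: "fst w = cx (t (fst z)) (t (snd z))" "snd w = cy (t (fst z)) (t (snd z))"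
      using z(2) by (auto simp: prod_eq_iff cx_def cy_def xcoord_def ycoord_def case_prod_unfold)
    have nz: "t (fst z) - 1 \<noteq> 0" "t (snd z) - 1 \<noteq> 0" "t (fst z) + t (snd z) \<noteq> 0" "t (fst z) - t (snd z) \<noteq> 0" "1 - t (fst z) * t (snd z) \<noteq> 0"
      using c by auto
    note alg = pde_algebra[OF nz, where A=A and n="fn z" and p="fp z" and r="fr z" and w="fw z"]
    have Aeq: "A = of_real a * (1 - of_real a)" by (simp add: A_def)
    have e1: "X z * ((a1 z - 2 * a2 z) + (b1 z - 2 * b2 z)) + fst w * (X z * (a1 z + b1 z) + X z * (fp z + fr z) + A * fn z) = 0"
      unfolding w using alg(1) by (simp only: X_def Y1_def Y2_def m1_def m2_def a1_def b1_def a2_def b2_def)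
    have e2: "Y1 z * a2 z + Y2 z * b2 z - snd w * (2 * (Y1 z * (2 * a2 z - a1 z) + Y2 z * (2 * b2 z - b1 z)) - X z * ((2 * a2 z - a1 z) + (2 * b2 z - b1 z))
      + (2 * (Y1 z * fp z + Y2 z * fr z) - X z * (fp z + fr z))) = 0"
      unfolding w using alg(2) by (simp only: X_def Y1_def Y2_def m1_def m2_def a1_def b1_def a2_def b2_def)
    show ?thesis
      unfolding pde_system_def Let_def
    proof
      \<comment> \<open>(D_x + a)(D_x + 1 - a) = D_x^2 + D_x + a(1 - a), so \<open>a\<close> enters
        only through \<open>A\<close>.\<close>
      have "X z * ((a1 z + (1 - of_real a) * fp z) + (b1 z + (1 - of_real a) * fr z)) + of_real a * (f1 z + (1 - of_real a) * fn z) =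
        X z * (a1 z + b1 z) + X z * (fp z + fr z) + A * fn z"
        by (simp add: Aeq f1_def algebra_simps)
      then show "Dx (\<lambda>w. Dx G w - 2 * Dy G w) w + fst w * (Dx (\<lambda>w. Dx G w + (1 - of_real a) * G w) w + of_real a * (Dx G w + (1 - of_real a) * G w)) = 0"
        using e1 unfolding 1 2 DG[OF wV] by (simp add: G_def z_def[symmetric])
      show "Dy (Dy G) w - snd w * (2 * Dy (\<lambda>w. 2 * Dy G w - Dx G w) w - Dx (\<lambda>w. 2 * Dy G w - Dx G w) w + (2 * Dy G w - Dx G w)) = 0"
        using e2 unfolding 3 4 DG[OF wV] by (simp add: z_def[symmetric] f1_def f2_def)
    qed
  qed
  have hol: "holomorphic2_on G V"
    unfolding holomorphic2_on_def G_def
    using comp(1) th(1) gV by (meson has_derivative_at_withinI)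
  have FG: "F z = G (xcoord t z, ycoord t z)" if "z \<in> U" for z
    using gU[OF that] F[of z] UV(3) that by (auto simp: G_def fn_def U0_def)
  show ?thesis
    by (rule exI[of _ U], rule exI[of _ V], rule exI[of _ G]) (use UV U0 hol FG pde in auto)
qed

text \<open>\<open>\<kappa>\<close> vanishes on no nonempty open subset, so close to
  \<open>\<tau>\<close> there is a disc free of its zeros. There t' = \<open>\<kappa>\<close> t is
  nonzero, so \<open>t\<close> is not constant; being continuous on a connected set, it cannot have
  finite range.\<close>

lemma holomorphic_nonconstant_avoid:
  assumes \<Omega>: "open \<Omega>" "connected \<Omega>" and t: "\<And>\<tau>. \<tau> \<in> \<Omega> \<Longrightarrow> (t has_field_derivative \<kappa> \<tau> * t \<tau>) (at \<tau>)"
    "\<And>\<tau>. \<tau> \<in> \<Omega> \<Longrightarrow> t \<tau> \<noteq> 0" and \<kappa>: "\<kappa> holomorphic_on \<Omega>" "\<tau>0 \<in> \<Omega>" "\<kappa> \<tau>0 \<noteq> 0"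
    and S: "finite S" and \<tau>: "\<tau> \<in> \<Omega>" "e > 0"
  shows "\<exists>\<tau>'\<in>\<Omega>. dist \<tau>' \<tau> < e \<and> \<kappa> \<tau>' \<noteq> 0 \<and> t \<tau>' \<notin> S"
proof -
  define W where "W = \<Omega> \<inter> ball \<tau> e"
  have W: "open W" "\<tau> \<in> W" "W \<subseteq> \<Omega>" using \<Omega> \<tau> by (auto simp: W_def)
  obtain \<tau>1 where t1: "\<tau>1 \<in> W" "\<kappa> \<tau>1 \<noteq> 0"
  proof (rule ccontr)
    assume "\<not> thesis"
    then have 0: "\<And>x. x \<in> W \<Longrightarrow> \<kappa> x = 0" using that by blast
    have "W \<noteq> {}" using W(2) by blast
    have "\<kappa> \<tau>0 = 0"
      by (rule analytic_continuation_open[OF W(1) \<Omega>(1) \<open>W \<noteq> {}\<close> \<Omega>(2) W(3) \<kappa>(1) holomorphic_on_const 0 \<kappa>(2)])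
    with \<kappa> show False by simp
  qed
  have "continuous_on W \<kappa>" using holomorphic_on_imp_continuous_on[OF \<kappa>(1)] W(3) continuous_on_subset by blast
  then have "open (\<kappa> -` (- {0}) \<inter> W)" using continuous_on_open_vimage[OF W(1)] by blast
  moreover have "\<tau>1 \<in> \<kappa> -` (- {0}) \<inter> W" using t1 by simp
  ultimately obtain r where r: "r > 0" "ball \<tau>1 r \<subseteq> \<kappa> -` (- {0}) \<inter> W" by (meson open_contains_ball)
  have "\<exists>\<tau>'\<in>ball \<tau>1 r. t \<tau>' \<notin> S"
  proof (rule ccontr)
    assume "\<not> ?thesis"
    then have "t ` ball \<tau>1 r \<subseteq> S" by auto
    then have "finite (t ` ball \<tau>1 r)" using S finite_subset by blast
    moreover have "continuous_on (ball \<tau>1 r) t"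
    proof -
      have "t holomorphic_on \<Omega>" using t(1) \<Omega>(1) by (auto simp: holomorphic_on_open)
      moreover have "ball \<tau>1 r \<subseteq> \<Omega>" using r(2) W(3) by blast
      ultimately show ?thesis using holomorphic_on_imp_continuous_on continuous_on_subset by metis
    qed
    ultimately have "t constant_on ball \<tau>1 r" by (intro continuous_finite_range_constant) auto
    then obtain c where c: "\<And>x. x \<in> ball \<tau>1 r \<Longrightarrow> t x = c" by (auto simp: constant_on_def)
    have "(t has_field_derivative 0) (at \<tau>1)"
      by (rule has_field_derivative_transform_within_open[of "\<lambda>_. c" _ _ "ball \<tau>1 r"]) (use r c in auto)
    moreover have "\<tau>1 \<in> \<Omega>" using t1(1) W(3) by blast
    ultimately have "\<kappa> \<tau>1 * t \<tau>1 = 0" using DERIV_unique[OF t(1)[of \<tau>1]] by simp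
    then show False using t1(2) t(2)[OF \<open>\<tau>1 \<in> \<Omega>\<close>] by simp
  qed
  then obtain \<tau>' where t': "\<tau>' \<in> ball \<tau>1 r" "t \<tau>' \<notin> S" by blast
  then have "\<tau>' \<in> W" "\<kappa> \<tau>' \<noteq> 0" using r(2) by auto
  then show ?thesis using t'(2) by (auto simp: W_def dist_commute)
qed

text \<open>The first point is moved so that t differs from 1, then the second so that its value
  avoids 1, -t, t and 1/t, where t is the value at the first.\<close>

lemma chart_points_dense:
  assumes \<Omega>: "open \<Omega>" "connected \<Omega>" and t: "\<And>\<tau>. \<tau> \<in> \<Omega> \<Longrightarrow> (t has_field_derivative \<kappa> \<tau> * t \<tau>) (at \<tau>)"
    "\<And>\<tau>. \<tau> \<in> \<Omega> \<Longrightarrow> t \<tau> \<noteq> 0" and \<kappa>: "\<kappa> holomorphic_on \<Omega>" "\<tau>0 \<in> \<Omega>" "\<kappa> \<tau>0 \<noteq> 0"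
  shows "\<Omega> \<times> \<Omega> \<subseteq> closure (chart_points t \<Omega>)"
proof
  fix z assume "z \<in> \<Omega> \<times> \<Omega>"
  then obtain \<tau>1 \<tau>2 where z: "z = (\<tau>1, \<tau>2)" "\<tau>1 \<in> \<Omega>" "\<tau>2 \<in> \<Omega>" by auto
  show "z \<in> closure (chart_points t \<Omega>)"
    unfolding closure_approachable
  proof (intro allI impI)
    fix e :: real assume e: "e > 0"
    note av = holomorphic_nonconstant_avoid[where t=t and \<kappa>=\<kappa> and \<Omega>=\<Omega>, OF \<Omega> t \<kappa>]
    obtain s1 where s1: "s1 \<in> \<Omega>" "dist s1 \<tau>1 < e / 2" "\<kappa> s1 \<noteq> 0" "t s1 \<notin> {1}"
      using av[of "{1}" \<tau>1 "e / 2"] z e by auto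
    obtain s2 where s2: "s2 \<in> \<Omega>" "dist s2 \<tau>2 < e / 2" "\<kappa> s2 \<noteq> 0" "t s2 \<notin> {1, - t s1, t s1, 1 / t s1}"
      using av[of "{1, - t s1, t s1, 1 / t s1}" \<tau>2 "e / 2"] z e by auto
    have "t s1 \<noteq> 0" using t(2) s1 by blast
    then have "t s1 * t s2 \<noteq> 1" "t s1 + t s2 \<noteq> 0" using s2(4) by (auto simp: field_simps eq_neg_iff_add_eq_0 add.commute)
    then have "(s1, s2) \<in> chart_points t \<Omega>"
      using chart_points_iff[where t=t and \<kappa>=\<kappa> and \<Omega>=\<Omega>, OF \<Omega>(1) t] s1 s2 by auto
    moreover have "dist (s1, s2) z < e"
    proof -
      have "dist (s1, s2) (\<tau>1, \<tau>2) \<le> dist s1 \<tau>1 + dist s2 \<tau>2"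
        unfolding dist_Pair_Pair by (rule sqrt_sum_squares_le_sum) auto
      then show ?thesis using s1 s2 z by simp
    qed
    ultimately show "\<exists>y\<in>chart_points t \<Omega>. dist y z < e" by blast
  qed
qed

text \<open>With \<open>\<kappa>\<close> = u^2 the left side of the Schwarzian equation is 4 u^2 (u
  u'' - 2 u'^2), while v = u'/\<open>\<kappa>\<close> has derivative (u u'' - 2 u'^2) / u^3; so the
  equation says exactly that v' = \<open>\<kappa>\<close> m u.\<close>

lemma local_solution:
  fixes m t :: "complex \<Rightarrow> complex"
  assumes \<Omega>: "open \<Omega>" and \<kappa>: "\<kappa> holomorphic_on \<Omega>" and t: "continuous_on \<Omega> t"
    and S: "\<And>\<tau>. \<tau> \<in> \<Omega> \<Longrightarrow> t \<tau> \<noteq> 1 \<Longrightarrow> \<kappa> \<tau> \<noteq> 0 \<Longrightarrow> 2 * \<kappa> \<tau> * deriv (deriv \<kappa>) \<tau> - 3 * deriv \<kappa> \<tau> ^ 2 = 4 * m \<tau> * \<kappa> \<tau> ^ 4"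
    and p: "\<tau>0 \<in> \<Omega>" "t \<tau>0 \<noteq> 1" "\<kappa> \<tau>0 \<noteq> 0"
  obtains B u v where "open B" "convex B" "\<tau>0 \<in> B" "B \<subseteq> \<Omega>" "continuous_on B u"
    "\<And>\<tau>. \<tau> \<in> B \<Longrightarrow> u \<tau> ^ 2 = \<kappa> \<tau> \<and> u \<tau> \<noteq> 0" "\<And>\<tau>. \<tau> \<in> B \<Longrightarrow> (u has_field_derivative \<kappa> \<tau> * v \<tau>) (at \<tau>)"
    "\<And>\<tau>. \<tau> \<in> B \<Longrightarrow> (v has_field_derivative \<kappa> \<tau> * (m \<tau> * u \<tau>)) (at \<tau>)"
proof -
  define h where "h = (\<lambda>\<tau>. (t \<tau> - 1) * \<kappa> \<tau>)"
  have "continuous_on \<Omega> h"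
    unfolding h_def by (intro continuous_intros t holomorphic_on_imp_continuous_on[OF \<kappa>])
  then have "open (h -` (- {0}) \<inter> \<Omega>)" using continuous_on_open_vimage[OF \<Omega>] by blast
  moreover have "\<tau>0 \<in> h -` (- {0}) \<inter> \<Omega>" using p by (simp add: h_def)
  ultimately obtain r where r: "r > 0" "ball \<tau>0 r \<subseteq> h -` (- {0}) \<inter> \<Omega>" by (meson open_contains_ball)
  define B where "B = ball \<tau>0 r"
  have B: "\<tau> \<in> \<Omega>" "t \<tau> \<noteq> 1" "\<kappa> \<tau> \<noteq> 0" if "\<tau> \<in> B" for \<tau>
    using r(2) that by (auto simp: B_def h_def)
  have BO: "open B" "B \<subseteq> \<Omega>" using B by (auto simp: B_def)
  have \<kappa>B: "\<kappa> holomorphic_on B" using \<kappa> BO(2) by (rule holomorphic_on_subset)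
  obtain u where u: "u holomorphic_on B" "\<And>z. z \<in> B \<Longrightarrow> \<kappa> z = u z ^ 2"
    by (rule contractible_imp_holomorphic_sqrt[OF \<kappa>B]) (use B in \<open>auto simp: B_def intro: convex_imp_contractible\<close>)
  have unz: "u \<tau> \<noteq> 0" if "\<tau> \<in> B" for \<tau> using u(2)[OF that] B[OF that] by auto
  define u' where "u' = deriv u"
  define v where "v = (\<lambda>\<tau>. u' \<tau> / \<kappa> \<tau>)"
  have du: "(u has_field_derivative u' \<tau>) (at \<tau>)" if "\<tau> \<in> B" for \<tau>
    unfolding u'_def by (rule holomorphic_derivI[OF u(1) BO(1) that])
  have u'h: "u' holomorphic_on B" unfolding u'_def by (rule holomorphic_deriv[OF u(1) BO(1)])
  have du': "(u' has_field_derivative deriv u' \<tau>) (at \<tau>)" if "\<tau> \<in> B" for \<tau>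
    by (rule holomorphic_derivI[OF u'h BO(1) that])
  have dk: "(\<kappa> has_field_derivative 2 * u \<tau> * u' \<tau>) (at \<tau>)" if "\<tau> \<in> B" for \<tau>
  proof -
    have "((\<lambda>\<tau>. u \<tau> ^ 2) has_field_derivative 2 * u \<tau> * u' \<tau>) (at \<tau>)"
      using du[OF that] by (auto intro!: derivative_eq_intros)
    then show ?thesis
      by (rule has_field_derivative_transform_within_open[OF _ BO(1) that]) (simp add: u(2))
  qed
  have dk_eq: "deriv \<kappa> \<tau> = 2 * u \<tau> * u' \<tau>" if "\<tau> \<in> B" for \<tau> using DERIV_imp_deriv[OF dk[OF that]] .
  have ddk: "deriv (deriv \<kappa>) \<tau> = 2 * u' \<tau> ^ 2 + 2 * u \<tau> * deriv u' \<tau>" if "\<tau> \<in> B" for \<tau>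
  proof -
    have "((\<lambda>\<tau>. 2 * u \<tau> * u' \<tau>) has_field_derivative 2 * u' \<tau> ^ 2 + 2 * u \<tau> * deriv u' \<tau>) (at \<tau>)"
      using du[OF that] du'[OF that] by (auto intro!: derivative_eq_intros simp: power2_eq_square)
    then have "(deriv \<kappa> has_field_derivative 2 * u' \<tau> ^ 2 + 2 * u \<tau> * deriv u' \<tau>) (at \<tau>)"
      by (rule has_field_derivative_transform_within_open[OF _ BO(1) that]) (simp add: dk_eq)
    then show ?thesis by (rule DERIV_imp_deriv)
  qed
  have dv: "(v has_field_derivative \<kappa> \<tau> * (m \<tau> * u \<tau>)) (at \<tau>)" if "\<tau> \<in> B" for \<tau>
  proof -
    have "(v has_field_derivative (deriv u' \<tau> * \<kappa> \<tau> - u' \<tau> * (2 * u \<tau> * u' \<tau>)) / (\<kappa> \<tau> * \<kappa> \<tau>)) (at \<tau>)"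
      unfolding v_def by (rule DERIV_divide[OF du'[OF that] dk[OF that] B(3)[OF that]])
    moreover have "(deriv u' \<tau> * \<kappa> \<tau> - u' \<tau> * (2 * u \<tau> * u' \<tau>)) / (\<kappa> \<tau> * \<kappa> \<tau>) = \<kappa> \<tau> * (m \<tau> * u \<tau>)"
    proof -
      define x y w M where "x = u \<tau>" and "y = u' \<tau>" and "w = deriv u' \<tau>" and "M = m \<tau>"
      have x: "x \<noteq> 0" using unz[OF that] by (simp add: x_def)
      have "2 * x ^ 2 * (2 * y ^ 2 + 2 * x * w) - 3 * (2 * x * y) ^ 2 = 4 * M * (x ^ 2) ^ 4"
        using S[OF B[OF that]] unfolding ddk[OF that] dk_eq[OF that] u(2)[OF that] x_def y_def w_def M_def .
      then have "4 * x ^ 2 * (w * x - 2 * y ^ 2) = 4 * x ^ 2 * (M * x ^ 6)"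
        by (simp add: algebra_simps power2_eq_square eval_nat_numeral)
      then have "w * x - 2 * y ^ 2 = M * x ^ 6" using x by simp
      moreover have "w * x ^ 2 - y * (2 * x * y) = x * (w * x - 2 * y ^ 2)"
        by (simp add: algebra_simps power2_eq_square)
      ultimately have "(w * x ^ 2 - y * (2 * x * y)) = x * (M * x ^ 6)" by simp
      then show ?thesis
        unfolding u(2)[OF that] x_def[symmetric] y_def[symmetric] w_def[symmetric] M_def[symmetric] using x
        by (simp add: divide_simps eval_nat_numeral)
    qed
    ultimately show ?thesis by simp
  qed
  show ?thesis
  proof (rule that[of B u v])
    show "convex B" "\<tau>0 \<in> B" using r(1) by (auto simp: B_def)
    show "continuous_on B u" using u(1) by (rule holomorphic_on_imp_continuous_on)
    show "(u has_field_derivative \<kappa> \<tau> * v \<tau>) (at \<tau>)" if "\<tau> \<in> B" for \<tau>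
      using du[OF that] B(3)[OF that] by (simp add: v_def)
    show "u \<tau> ^ 2 = \<kappa> \<tau> \<and> u \<tau> \<noteq> 0" if "\<tau> \<in> B" for \<tau> using u(2)[OF that] unz[OF that] by simp
  qed (fact BO dv)+
qed

theorem solves_in_xyI:
  fixes a :: real
  assumes \<Omega>: "open \<Omega>" "connected \<Omega>" and t: "\<And>\<tau>. \<tau> \<in> \<Omega> \<Longrightarrow> (t has_field_derivative \<kappa> \<tau> * t \<tau>) (at \<tau>)"
    "\<And>\<tau>. \<tau> \<in> \<Omega> \<Longrightarrow> t \<tau> \<noteq> 0" and \<kappa>: "\<kappa> holomorphic_on \<Omega>" "\<tau>0 \<in> \<Omega>" "\<kappa> \<tau>0 \<noteq> 0"
    and S: "\<And>\<tau>. \<tau> \<in> \<Omega> \<Longrightarrow> t \<tau> \<noteq> 1 \<Longrightarrow> \<kappa> \<tau> \<noteq> 0 \<Longrightarrow> 2 * \<kappa> \<tau> * deriv (deriv \<kappa>) \<tau> - 3 * deriv \<kappa> \<tau> ^ 2 =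
        4 * (- of_real (a * (1 - a)) * t \<tau> / (t \<tau> - 1) ^ 2) * \<kappa> \<tau> ^ 4"
    and F: "continuous_on (\<Omega> \<times> \<Omega>) F" "\<And>\<tau>1 \<tau>2. \<tau>1 \<in> \<Omega> \<Longrightarrow> \<tau>2 \<in> \<Omega> \<Longrightarrow> F (\<tau>1, \<tau>2) ^ 4 = C * (\<kappa> \<tau>1 * \<kappa> \<tau>2) ^ 2"
  shows "solves_in_xy a t \<Omega> F"
  unfolding solves_in_xy_def
proof (intro conjI ballI)
  show th: "t holomorphic_on \<Omega>" using t(1) \<Omega>(1) by (auto simp: holomorphic_on_open)
  have tc: "continuous_on \<Omega> t" using th by (rule holomorphic_on_imp_continuous_on)
  have kc: "continuous_on \<Omega> \<kappa>" using \<kappa>(1) by (rule holomorphic_on_imp_continuous_on)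
  show "\<Omega> \<times> \<Omega> \<subseteq> closure (chart_points t \<Omega>)" by (rule chart_points_dense[where t=t and \<kappa>=\<kappa> and \<Omega>=\<Omega>, OF \<Omega> t \<kappa>])
  fix p assume pc: "p \<in> chart_points t \<Omega>"
  obtain \<tau>1 \<tau>2 where p: "p = (\<tau>1, \<tau>2)" by (cases p)
  have ch: "\<tau>1 \<in> \<Omega>" "\<tau>2 \<in> \<Omega>" "t \<tau>1 \<noteq> 1" "t \<tau>2 \<noteq> 1" "\<kappa> \<tau>1 \<noteq> 0" "\<kappa> \<tau>2 \<noteq> 0"
    using pc chart_points_iff[where t=t and \<kappa>=\<kappa> and \<Omega>=\<Omega>, OF \<Omega>(1) t] unfolding p by auto
  note loc = local_solution[where t=t and \<kappa>=\<kappa> and \<Omega>=\<Omega> and m="\<lambda>\<tau>. - of_real (a * (1 - a)) * t \<tau> / (t \<tau> - 1) ^ 2", OF \<Omega>(1) \<kappa>(1) tc S]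
  obtain B1 u1 v1 where B1: "open B1" "convex B1" "\<tau>1 \<in> B1" "B1 \<subseteq> \<Omega>" "continuous_on B1 u1"
    "\<And>\<tau>. \<tau> \<in> B1 \<Longrightarrow> u1 \<tau> ^ 2 = \<kappa> \<tau> \<and> u1 \<tau> \<noteq> 0" "\<And>\<tau>. \<tau> \<in> B1 \<Longrightarrow> (u1 has_field_derivative \<kappa> \<tau> * v1 \<tau>) (at \<tau>)"
    "\<And>\<tau>. \<tau> \<in> B1 \<Longrightarrow> (v1 has_field_derivative \<kappa> \<tau> * (- of_real (a * (1 - a)) * t \<tau> / (t \<tau> - 1) ^ 2 * u1 \<tau>)) (at \<tau>)"
    using loc[OF _ _ _ ch(1,3,5)] by blast
  obtain B2 u2 v2 where B2: "open B2" "convex B2" "\<tau>2 \<in> B2" "B2 \<subseteq> \<Omega>" "continuous_on B2 u2"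
    "\<And>\<tau>. \<tau> \<in> B2 \<Longrightarrow> u2 \<tau> ^ 2 = \<kappa> \<tau> \<and> u2 \<tau> \<noteq> 0" "\<And>\<tau>. \<tau> \<in> B2 \<Longrightarrow> (u2 has_field_derivative \<kappa> \<tau> * v2 \<tau>) (at \<tau>)"
    "\<And>\<tau>. \<tau> \<in> B2 \<Longrightarrow> (v2 has_field_derivative \<kappa> \<tau> * (- of_real (a * (1 - a)) * t \<tau> / (t \<tau> - 1) ^ 2 * u2 \<tau>)) (at \<tau>)"
    using loc[OF _ _ _ ch(2,4,6)] by blast
  define R where "R = (\<lambda>z. F z / (u1 (fst z) * u2 (snd z)))"
  have nz: "u1 (fst z) * u2 (snd z) \<noteq> 0" if "z \<in> B1 \<times> B2" for z using that B1(6) B2(6) by auto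
  have "continuous_on (B1 \<times> B2) R"
    unfolding R_def using nz B1(4) B2(4)
    by (intro continuous_on_divide continuous_on_mult continuous_on_subset[OF F(1)]
        continuous_on_compose2[OF B1(5)] continuous_on_compose2[OF B2(5)] continuous_intros) auto
  \<comment> \<open>A continuous function on a convex set with finitely many possible values is
    constant; this absorbs every choice of root in \<open>F\<close>.\<close>
  moreover have "R ` (B1 \<times> B2) \<subseteq> {z. z ^ 4 = C}"
  proof safe
    fix x y assume xy: "x \<in> B1" "y \<in> B2"
    have "R (x, y) ^ 4 = C * (\<kappa> x * \<kappa> y) ^ 2 / (u1 x * u2 y) ^ 4"
      using F(2)[of x y] xy B1(4) B2(4) by (auto simp: R_def power_divide)
    also have "(u1 x * u2 y) ^ 4 = (\<kappa> x * \<kappa> y) ^ 2"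
      using B1(6)[OF xy(1)] B2(6)[OF xy(2)] by (metis power_mult_distrib power_mult mult_2 numeral_Bit0 power_add)
    also have "C * (\<kappa> x * \<kappa> y) ^ 2 / (\<kappa> x * \<kappa> y) ^ 2 = C"
      using B1(6)[OF xy(1)] B2(6)[OF xy(2)] by auto
    finally show "R (x, y) ^ 4 = C" .
  qed
  then have "finite (R ` (B1 \<times> B2))" using finite_subset finite_nth_roots[of 4 C] by auto
  moreover have "connected (B1 \<times> B2)" using B1(2) B2(2) by (intro convex_connected convex_Times)
  ultimately have "R constant_on (B1 \<times> B2)" by (intro continuous_finite_range_constant)
  then obtain c where c: "\<And>z. z \<in> B1 \<times> B2 \<Longrightarrow> R z = c" by (auto simp: constant_on_def)
  have F_eq: "F z = (c * u1 (fst z)) * u2 (snd z)" if "z \<in> B1 \<times> B2" for z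
    using c[OF that] nz[OF that] by (simp add: R_def field_simps)
  show "\<exists>U V G. open U \<and> p \<in> U \<and> U \<subseteq> chart_points t \<Omega> \<and> open V \<and>
       bij_betw (\<lambda>z. (xcoord t z, ycoord t z)) U V \<and> holomorphic2_on G V \<and>
       (\<forall>z\<in>U. F z = G (xcoord t z, ycoord t z)) \<and> (\<forall>w\<in>V. pde_system a G w)"
    unfolding p
  proof (rule pde_local[where ?B1.0=B1 and ?B2.0=B2 and ?u1.0="\<lambda>\<tau>. c * u1 \<tau>" and ?v1.0="\<lambda>\<tau>. c * v1 \<tau>" and ?u2.0=u2 and ?v2.0=v2 and \<kappa>=\<kappa>])
    show "((\<lambda>\<tau>. c * u1 \<tau>) has_field_derivative \<kappa> \<tau> * (c * v1 \<tau>)) (at \<tau>)" if "\<tau> \<in> B1" for \<tau>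
      using DERIV_cmult[OF B1(7)[OF that], of c] by (simp add: mult_ac)
    show "((\<lambda>\<tau>. c * v1 \<tau>) has_field_derivative \<kappa> \<tau> * (- of_real (a * (1 - a)) * t \<tau> / (t \<tau> - 1) ^ 2 * (c * u1 \<tau>))) (at \<tau>)" if "\<tau> \<in> B1" for \<tau>
      using DERIV_cmult[OF B1(8)[OF that], of c] by (simp add: mult_ac)
    show "F z = c * u1 (fst z) * u2 (snd z)" if "z \<in> B1 \<times> B2" for z by (rule F_eq[OF that])
  qed (fact \<Omega>(1) t tc kc pc[unfolded p] B1(1,3) B2(1,3,7,8))+
qed

section \<open>Hecke congruence subgroups\<close>

lemma moebius_UHP:
  fixes a b c d :: int
  assumes "a * d - b * c = 1" "\<tau> \<in> UHP"
  shows "of_int c * \<tau> + of_int d \<noteq> 0" "(of_int a * \<tau> + of_int b) / (of_int c * \<tau> + of_int d) \<in> UHP"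
proof -
  have im: "Im \<tau> > 0" using assms(2) by (simp add: UHP_def)
  show nz: "of_int c * \<tau> + of_int d \<noteq> 0"
  proof
    assume 0: "of_int c * \<tau> + of_int d = 0"
    then have "Im (of_int c * \<tau> + of_int d) = 0" "Re (of_int c * \<tau> + of_int d) = 0" by simp_all
    then have "c = 0" "d = 0" using im by auto
    then show False using assms(1) by simp
  qed
  have "Im ((of_int a * \<tau> + of_int b) / (of_int c * \<tau> + of_int d)) =
    (of_int (a * d - b * c)) * Im \<tau> / norm (of_int c * \<tau> + of_int d) ^ 2"
    by (simp add: Im_divide cmod_power2) (simp add: algebra_simps)
  then show "(of_int a * \<tau> + of_int b) / (of_int c * \<tau> + of_int d) \<in> UHP"
    using assms(1) im nz by (simp add: UHP_def)
qed

lemma UHP_add_int: "\<tau> \<in> UHP \<Longrightarrow> \<tau> + of_int n \<in> UHP" "\<tau> \<in> UHP \<Longrightarrow> \<tau> - of_int n \<in> UHP"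
  by (simp_all add: UHP_def)

lemma transform_T_int:
  assumes "\<And>\<tau>. \<tau> \<in> UHP \<Longrightarrow> f (\<tau> + 1) = f \<tau>" "\<tau> \<in> UHP"
  shows "f (\<tau> - of_int j) = (f \<tau> :: complex)"
proof -
  have "\<forall>\<tau>\<in>UHP. f (\<tau> + of_int j) = f \<tau>" for j
  proof (induction j rule: int_induct[where k=0])
    case (step1 i)
    show ?case
    proof
      fix \<tau> assume t: "\<tau> \<in> UHP"
      have "f (\<tau> + of_int (i + 1)) = f ((\<tau> + of_int i) + 1)" by (simp add: add.assoc)
      then show "f (\<tau> + of_int (i + 1)) = f \<tau>" using assms(1)[OF UHP_add_int(1)[OF t]] step1 t by simp
    qed
  next
    case (step2 i)
    show ?case
    proof
      fix \<tau> assume t: "\<tau> \<in> UHP"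
      have "f (\<tau> + of_int (i - 1)) = f ((\<tau> + of_int (i - 1)) + 1)"
        by (rule assms(1)[OF UHP_add_int(1)[OF t], symmetric])
      also have "(\<tau> + of_int (i - 1)) + 1 = \<tau> + of_int i" by simp
      finally show "f (\<tau> + of_int (i - 1)) = f \<tau>" using step2 t by simp
    qed
  qed simp
  from this[of "- j"] show ?thesis using assms(2) by simp
qed

text \<open>The factors N j \<tau> + 1 satisfy the cocycle relation, so the law for one step
  iterates; for negative \<open>j\<close> it is solved for the earlier point, the factor being
  nonzero.\<close>

lemma transform_U_int:
  fixes N :: int
  assumes U: "\<And>\<tau>. \<tau> \<in> UHP \<Longrightarrow> f (\<tau> / (of_int N * \<tau> + 1)) = (of_int N * \<tau> + 1) ^ k * (f \<tau> :: complex)" and t: "\<tau> \<in> UHP"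
  shows "f (\<tau> / (of_int (N * j) * \<tau> + 1)) = (of_int (N * j) * \<tau> + 1) ^ k * f \<tau>"
proof -
  have m: "of_int (N * j) * \<tau> + 1 \<noteq> 0" "\<tau> / (of_int (N * j) * \<tau> + 1) \<in> UHP" if "\<tau> \<in> UHP" for j \<tau>
    using moebius_UHP[of 1 1 0 "N * j" \<tau>] that by simp_all
  define S where "S = (\<lambda>j \<tau>. \<tau> / (of_int (N * j) * \<tau> + 1 :: complex))"
  have shift: "S j \<tau> / (of_int N * S j \<tau> + 1) = S (j + 1) \<tau>" "(of_int N * S j \<tau> + 1) * (of_int (N * j) * \<tau> + 1) = of_int (N * (j + 1)) * \<tau> + 1"
    if "\<tau> \<in> UHP" for j \<tau>
  proof -
    define D where "D = of_int (N * j) * \<tau> + 1"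
    have D: "D \<noteq> 0" using m[OF that, of j] by (simp add: D_def)
    have E: "of_int N * S j \<tau> + 1 = (of_int (N * (j + 1)) * \<tau> + 1) / D"
      using D unfolding S_def D_def[symmetric] by (simp add: field_simps) (simp add: D_def algebra_simps)
    show "S j \<tau> / (of_int N * S j \<tau> + 1) = S (j + 1) \<tau>"
      unfolding E using D m(1)[OF that, of "j + 1"] by (simp add: S_def D_def)
    show "(of_int N * S j \<tau> + 1) * (of_int (N * j) * \<tau> + 1) = of_int (N * (j + 1)) * \<tau> + 1"
      unfolding E D_def[symmetric] using D by simp
  qed
  have "\<forall>\<tau>\<in>UHP. f (S j \<tau>) = (of_int (N * j) * \<tau> + 1) ^ k * f \<tau>" for j
  proof (induction j rule: int_induct[where k=0])
    case base
    show ?case by (simp add: S_def)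
  next
    case (step1 i)
    show ?case
    proof
      fix \<tau> assume t: "\<tau> \<in> UHP"
      have "S i \<tau> \<in> UHP" unfolding S_def by (rule m(2)[OF t])
      then have "f (S (i + 1) \<tau>) = (of_int N * S i \<tau> + 1) ^ k * f (S i \<tau>)"
        unfolding shift(1)[OF t, of i, symmetric] by (rule U)
      also have "\<dots> = (of_int (N * (i + 1)) * \<tau> + 1) ^ k * f \<tau>"
        unfolding shift(2)[OF t, symmetric] using step1 t by (simp add: power_mult_distrib mult_ac)
      finally show "f (S (i + 1) \<tau>) = (of_int (N * (i + 1)) * \<tau> + 1) ^ k * f \<tau>" .
    qed
  next
    case (step2 i)
    show ?case
    proof
      fix \<tau> assume t: "\<tau> \<in> UHP"
      have sh: "S (i - 1) \<tau> / (of_int N * S (i - 1) \<tau> + 1) = S i \<tau>"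
        "(of_int N * S (i - 1) \<tau> + 1) * (of_int (N * (i - 1)) * \<tau> + 1) = of_int (N * i) * \<tau> + 1"
        using shift[OF t, of "i - 1"] by simp_all
      have nz: "of_int N * S (i - 1) \<tau> + 1 \<noteq> 0" using sh(2) m(1)[OF t, of i] by auto
      have "(of_int N * S (i - 1) \<tau> + 1) ^ k * f (S (i - 1) \<tau>) = f (S i \<tau>)"
        unfolding sh(1)[symmetric] by (rule U[symmetric]) (simp only: S_def m(2)[OF t])
      also have "\<dots> = (of_int (N * i) * \<tau> + 1) ^ k * f \<tau>" using step2 t by blast
      also have "\<dots> = (of_int N * S (i - 1) \<tau> + 1) ^ k * ((of_int (N * (i - 1)) * \<tau> + 1) ^ k * f \<tau>)"
        by (simp only: sh(2)[symmetric] power_mult_distrib mult.assoc)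
      finally show "f (S (i - 1) \<tau>) = (of_int (N * (i - 1)) * \<tau> + 1) ^ k * f \<tau>" using nz by simp
    qed
  qed
  then show ?thesis using t by (simp add: S_def)
qed

text \<open>The remainder of least absolute value, obtained by rounding -d/c. The gain of a factor 2
  drives the descent that follows.\<close>

lemma exists_small_remainder:
  fixes c d :: int
  assumes "c \<noteq> 0"
  shows "\<exists>j. 2 * \<bar>d + j * c\<bar> \<le> \<bar>c\<bar>"
proof -
  define x where "x = - (of_int d / of_int c :: real)"
  have "\<bar>of_int (round x) - x\<bar> \<le> 1/2" by (rule of_int_round_abs_le)
  then have "\<bar>of_int (round x) - x\<bar> * \<bar>of_int c\<bar> \<le> 1/2 * \<bar>of_int c :: real\<bar>" by (intro mult_right_mono) auto
  moreover have "\<bar>of_int (round x) - x\<bar> * \<bar>of_int c\<bar> = \<bar>of_int (d + round x * c)\<bar>"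
    unfolding abs_mult[symmetric] using assms by (simp add: x_def algebra_simps)
  ultimately have "of_int (2 * \<bar>d + round x * c\<bar>) \<le> (of_int \<bar>c\<bar> :: real)" by simp
  then show ?thesis using of_int_le_iff by blast
qed

text \<open>For \<open>2 \<le> N \<le> 4\<close> the group \<open>\<Gamma>\<^sub>0(N)\<close> is generated by \<open>-I\<close>, the translation and
  \<open>\<tau> \<mapsto> \<tau> / (N \<tau> + 1)\<close>: Euclid's algorithm on the bottom row \<open>(c, d)\<close>, alternately reducing \<open>d\<close>
  modulo \<open>c\<close> and \<open>c\<close> modulo \<open>N d\<close>, terminates with \<open>c = 0\<close>.\<close>

theorem Gamma0_transform:
  fixes N :: int
  assumes N: "2 \<le> N" "N \<le> 4" and k: "even k"
    and T: "\<And>\<tau>. \<tau> \<in> UHP \<Longrightarrow> f (\<tau> + 1) = f \<tau>"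
    and U: "\<And>\<tau>. \<tau> \<in> UHP \<Longrightarrow> f (\<tau> / (of_int N * \<tau> + 1)) = (of_int N * \<tau> + 1) ^ k * (f \<tau> :: complex)"
    and det: "a * d - b * c = 1" "N dvd c" and \<tau>: "\<tau> \<in> UHP"
  shows "f ((of_int a * \<tau> + of_int b) / (of_int c * \<tau> + of_int d)) = (of_int c * \<tau> + of_int d) ^ k * f \<tau>"
  using det \<tau>
proof (induction "nat \<bar>c\<bar>" arbitrary: a b c d \<tau> rule: less_induct)
  case less
  have Tj: "f (\<tau> - of_int j) = f \<tau>" for j
    using less.prems(3) by (intro transform_T_int) (auto intro: T)
  show ?case
  proof (cases "c = 0")
    case True
    then have "a * d = 1" using less.prems by simp
    then have ad: "a = 1 \<and> d = 1 \<or> a = -1 \<and> d = -1" by (simp add: zmult_eq_1_iff)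
    have "f (\<tau> - of_int (- b)) = f \<tau>" "f (\<tau> - of_int b) = f \<tau>"
      by (rule Tj)+
    \<comment> \<open>-I acts trivially on the half-plane, so its automorphy factor must be
      1.\<close>
    moreover have "(-1 :: complex) ^ k = 1" using k by simp
    ultimately show ?thesis using ad True by (elim disjE) (auto simp: minus_divide_left[symmetric])
  next
    case False
    obtain j where j: "2 * \<bar>d + j * c\<bar> \<le> \<bar>c\<bar>" using exists_small_remainder[OF False] by blast
    define d' b' where "d' = d + j * c" and "b' = b + j * a"
    have det': "a * d' - b' * c = 1" using less.prems(1) by (simp add: d'_def b'_def algebra_simps)
    \<comment> \<open>Otherwise c, and with it N, would divide the determinant 1.\<close>
    have d'0: "d' \<noteq> 0"
    proof
      assume "d' = 0"
      then have "c dvd 1" using det' by (metis dvd_minus_iff dvd_triv_right mult_zero_right diff_0)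
      then have "N dvd 1" using less.prems(2) dvd_trans by blast
      then show False using N by auto
    qed
    have "N * d' \<noteq> 0" using d'0 N by auto
    then obtain l where l: "2 * \<bar>c + l * (N * d')\<bar> \<le> \<bar>N * d'\<bar>" using exists_small_remainder by blast
    define c' a' where "c' = c + l * (N * d')" and "a' = a + l * (N * b')"
    have det'': "a' * d' - b' * c' = 1" using det' by (simp add: a'_def c'_def algebra_simps)
    have dvd: "N dvd c'" using less.prems(2) by (simp add: c'_def)
    have "\<bar>N * d'\<bar> = N * \<bar>d'\<bar>" using N by (simp add: abs_mult)
    also have "N * \<bar>d'\<bar> \<le> 4 * \<bar>d'\<bar>" using N by (intro mult_right_mono) auto
    finally have le: "\<bar>N * d'\<bar> \<le> 4 * \<bar>d'\<bar>" .
    \<comment> \<open>|c'| <= N |d'| / 2 <= 2 |d'| <= |c|. Equality throughout forces N = 4 and |c|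
      = 2 |d'|; then d' divides the determinant, so |c| = 2, which is not divisible by 4.\<close>
    have "\<bar>c'\<bar> < \<bar>c\<bar>"
    proof (rule ccontr)
      assume "\<not> \<bar>c'\<bar> < \<bar>c\<bar>"
      then have eq: "2 * \<bar>d'\<bar> = \<bar>c\<bar>" "\<bar>N * d'\<bar> = 4 * \<bar>d'\<bar>" using l j le unfolding c'_def[symmetric] d'_def[symmetric] by linarith+
      then have "N = 4" using d'0 N by (simp add: abs_mult)
      have "d' dvd c" using eq(1) by (metis abs_dvd_iff dvd_abs_iff dvd_triv_right)
      then have "d' dvd 1" using det' by (metis dvd_diff dvd_mult dvd_triv_right)
      then have "\<bar>c\<bar> = 2" using eq(1) by auto
      then show False using less.prems(2) \<open>N = 4\<close> by (metis abs_dvd_iff dvd_abs_iff zdvd_imp_le numeral_le_iff semiring_norm(69) semiring_norm(71) zero_less_numeral)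
    qed
    then have lt: "nat \<bar>c'\<bar> < nat \<bar>c\<bar>" by simp
    define \<rho> where "\<rho> = \<tau> - of_int j"
    have \<rho>: "\<rho> \<in> UHP" unfolding \<rho>_def by (rule UHP_add_int(2)[OF less.prems(3)])
    define D where "D = of_int (N * (- l)) * \<rho> + 1"
    define \<sigma> where "\<sigma> = \<rho> / D"
    have D: "D \<noteq> 0" "\<sigma> \<in> UHP"
      using moebius_UHP[of 1 1 0 "N * (- l)" \<rho>] \<rho> by (simp_all add: D_def \<sigma>_def)
    have IH: "f ((of_int a' * \<sigma> + of_int b') / (of_int c' * \<sigma> + of_int d')) = (of_int c' * \<sigma> + of_int d') ^ k * f \<sigma>"
      by (rule less.hyps[OF lt det'' dvd D(2)])
    have fs: "f \<sigma> = D ^ k * f \<tau>"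
      using transform_U_int[where f=f and N=N and k=k and j="- l", OF U \<rho>] Tj[of j]
      unfolding D_def[symmetric] \<sigma>_def[symmetric] by (simp add: \<rho>_def)
    have den: "(of_int c' * \<sigma> + of_int d') * D = of_int c * \<tau> + of_int d"
    proof -
      have "(of_int c' * \<sigma> + of_int d') * D = of_int c' * \<rho> + of_int d' * D" using D(1) by (simp add: \<sigma>_def algebra_simps)
      also have "\<dots> = of_int c * \<rho> + of_int d'" by (simp add: D_def c'_def algebra_simps)
      also have "\<dots> = of_int c * \<tau> + of_int d" by (simp add: \<rho>_def d'_def algebra_simps)
      finally show ?thesis .
    qed
    have num: "(of_int a' * \<sigma> + of_int b') * D = of_int a * \<tau> + of_int b"
    proof -
      have "(of_int a' * \<sigma> + of_int b') * D = of_int a' * \<rho> + of_int b' * D" using D(1) by (simp add: \<sigma>_def algebra_simps)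
      also have "\<dots> = of_int a * \<rho> + of_int b'" by (simp add: D_def a'_def algebra_simps)
      also have "\<dots> = of_int a * \<tau> + of_int b" by (simp add: \<rho>_def b'_def algebra_simps)
      finally show ?thesis .
    qed
    have "(of_int a * \<tau> + of_int b) / (of_int c * \<tau> + of_int d) = (of_int a' * \<sigma> + of_int b') / (of_int c' * \<sigma> + of_int d')"
      unfolding num[symmetric] den[symmetric] using D(1) by simp
    then have "f ((of_int a * \<tau> + of_int b) / (of_int c * \<tau> + of_int d)) = (of_int c' * \<sigma> + of_int d') ^ k * (D ^ k * f \<tau>)"
      using IH fs by simp
    also have "\<dots> = (of_int c * \<tau> + of_int d) ^ k * f \<tau>"
      unfolding den[symmetric] by (simp add: power_mult_distrib)
    finally show ?thesis .
  qed
qed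

text \<open>The translation \<open>\<tau> \<mapsto> \<tau> + 1\<close> conjugated by the Fricke involution is \<open>\<tau> \<mapsto> \<tau> / (1 - N \<tau>)\<close>.\<close>

lemma fricke_imp_U:
  fixes N :: nat and f g :: "complex \<Rightarrow> complex"
  assumes N: "0 < N" and W: "\<And>\<tau>. \<tau> \<in> UHP \<Longrightarrow> f (-1 / (of_nat N * \<tau>)) = \<tau> ^ k * g \<tau>"
    and T: "\<And>\<tau>. \<tau> \<in> UHP \<Longrightarrow> g (\<tau> + 1) = g \<tau>" and t: "\<tau> \<in> UHP"
  shows "f (\<tau> / (of_int (int N) * \<tau> + 1)) = (of_int (int N) * \<tau> + 1) ^ k * f \<tau>"
proof -
  define \<sigma> where "\<sigma> = -1 / (of_nat N * \<tau>)"
  have s: "\<sigma> \<in> UHP" unfolding \<sigma>_def by (rule UHP_fricke[OF t N])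
  have s1: "\<sigma> - 1 \<in> UHP" using s by (simp add: UHP_def)
  have nz: "\<tau> \<noteq> 0" "of_nat N * \<tau> + 1 \<noteq> 0" "of_nat N \<noteq> (0 :: complex)"
    using UHP_nz[OF t] moebius_UHP(1)[of 1 1 0 "int N" \<tau>] t N by simp_all
  have 1: "\<tau> = -1 / (of_nat N * \<sigma>)" using nz by (simp add: \<sigma>_def)
  have 2: "\<tau> / (of_nat N * \<tau> + 1) = -1 / (of_nat N * (\<sigma> - 1))"
  proof -
    define w where "w = of_nat N * \<tau> + 1"
    have "of_nat N * (\<sigma> - 1) = - (w / \<tau>)" using nz by (simp add: \<sigma>_def w_def field_simps)
    then show ?thesis unfolding w_def[symmetric] by simp
  qed
  have "f (\<tau> / (of_nat N * \<tau> + 1)) = (\<sigma> - 1) ^ k * g \<sigma>" unfolding 2 W[OF s1] using T[OF s1] by simp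
  moreover have "f \<tau> = \<sigma> ^ k * g \<sigma>" using W[OF s] 1 by simp
  moreover have "\<sigma> - 1 = (of_nat N * \<tau> + 1) * \<sigma>" using nz by (simp add: \<sigma>_def field_simps)
  ultimately show ?thesis by (simp add: power_mult_distrib)
qed

section \<open>Cocycle relations, congruence groups and their cusps\<close>

lemma mact_autj_cocycle:
  assumes "A \<in> SL2Z" "B \<in> SL2Z" "\<tau> \<in> UHP"
  shows "autj A \<tau> \<noteq> 0" "mact A \<tau> \<in> UHP" "autj (A ** B) \<tau> = autj A (mact B \<tau>) * autj B \<tau>" "mact (A ** B) \<tau> = mact A (mact B \<tau>)"
proof -
  have dA: "A $ 1 $ 1 * A $ 2 $ 2 - A $ 1 $ 2 * A $ 2 $ 1 = 1" and dB: "B $ 1 $ 1 * B $ 2 $ 2 - B $ 1 $ 2 * B $ 2 $ 1 = 1"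
    using assms by (auto simp: SL2Z_def det_2)
  show "autj A \<tau> \<noteq> 0" "mact A \<tau> \<in> UHP" using moebius_UHP[OF dA assms(3)] by (simp_all add: autj_def mact_def)
  have jB: "of_int (B $ 2 $ 1) * \<tau> + of_int (B $ 2 $ 2) \<noteq> 0" using moebius_UHP[OF dB assms(3)] by simp
  have mB: "mact B \<tau> \<in> UHP" using moebius_UHP[OF dB assms(3)] by (simp add: mact_def)
  have jA: "of_int (A $ 2 $ 1) * mact B \<tau> + of_int (A $ 2 $ 2) \<noteq> 0" using moebius_UHP[OF dA mB] by simp
  have e: "(A ** B) $ i $ j = A $ i $ 1 * B $ 1 $ j + A $ i $ 2 * B $ 2 $ j" for i j
    by (simp add: matrix_matrix_mult_def sum_2)
  show c: "autj (A ** B) \<tau> = autj A (mact B \<tau>) * autj B \<tau>"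
    using jB by (simp add: autj_def mact_def e field_simps)
  have n: "of_int ((A ** B) $ 1 $ 1) * \<tau> + of_int ((A ** B) $ 1 $ 2) = (of_int (A $ 1 $ 1) * mact B \<tau> + of_int (A $ 1 $ 2)) * autj B \<tau>"
    using jB by (simp add: autj_def mact_def e field_simps)
  have "mact (A ** B) \<tau> = (of_int (A $ 1 $ 1) * mact B \<tau> + of_int (A $ 1 $ 2)) * autj B \<tau> / (autj A (mact B \<tau>) * autj B \<tau>)"
    unfolding mact_def[of "A ** B"] n using c by (simp add: autj_def)
  then show "mact (A ** B) \<tau> = mact A (mact B \<tau>)"
    using jB by (simp add: mact_def[of A] autj_def)
qed

lemma SL2Z_mult: "A \<in> SL2Z \<Longrightarrow> B \<in> SL2Z \<Longrightarrow> A ** B \<in> SL2Z"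
  by (simp add: SL2Z_def det_mul)

lemma Gamma0_mult: "A \<in> Gamma0 N \<Longrightarrow> B \<in> Gamma0 N \<Longrightarrow> A ** B \<in> Gamma0 N"
proof -
  assume *: "A \<in> Gamma0 N" "B \<in> Gamma0 N"
  have "(A ** B) $ 2 $ 1 = A $ 2 $ 1 * B $ 1 $ 1 + A $ 2 $ 2 * B $ 2 $ 1"
    by (simp add: matrix_matrix_mult_def sum_2)
  then show ?thesis using * SL2Z_mult by (simp add: Gamma0_def)
qed

lemma Gamma0_SL2Z: "A \<in> Gamma0 N \<Longrightarrow> A \<in> SL2Z"
  by (simp add: Gamma0_def)

lemma Gamma0_mono: "M dvd N \<Longrightarrow> A \<in> Gamma0 N \<Longrightarrow> A \<in> Gamma0 M"
  by (auto simp: Gamma0_def intro: dvd_trans[OF _ _ ] of_nat_dvd_iff[THEN iffD2])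

definition transforms :: "nat \<Rightarrow> nat \<Rightarrow> (complex \<Rightarrow> complex) \<Rightarrow> bool" where
  "transforms N k f \<longleftrightarrow> (\<forall>A\<in>Gamma0 N. \<forall>\<tau>\<in>UHP. f (mact A \<tau>) = autj A \<tau> ^ k * f \<tau>)"

text \<open>Both \<open>f\<close> and its Fricke partner \<open>g\<close> are 1-periodic; the period
  of \<open>g\<close> yields the second generator by \<open>fricke_imp_U\<close>.\<close>

lemma transformsI:
  fixes N :: nat
  assumes N: "2 \<le> N" "N \<le> 4" and k: "even k"
    and T: "\<And>\<tau>. \<tau> \<in> UHP \<Longrightarrow> f (\<tau> + 1) = f \<tau>" "\<And>\<tau>. \<tau> \<in> UHP \<Longrightarrow> g (\<tau> + 1) = g \<tau>"
    and W: "\<And>\<tau>. \<tau> \<in> UHP \<Longrightarrow> f (-1 / (of_nat N * \<tau>)) = \<tau> ^ k * g \<tau>"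
  shows "transforms N k f"
  unfolding transforms_def
proof (intro ballI)
  fix A \<tau> assume A: "A \<in> Gamma0 N" and t: "\<tau> \<in> UHP"
  have "A $ 1 $ 1 * A $ 2 $ 2 - A $ 1 $ 2 * A $ 2 $ 1 = 1" "int N dvd A $ 2 $ 1"
    using A by (auto simp: Gamma0_def SL2Z_def det_2)
  moreover have N0: "0 < N" using N by simp
  ultimately show "f (mact A \<tau>) = autj A \<tau> ^ k * f \<tau>"
    unfolding mact_def autj_def
    by (intro Gamma0_transform[of "int N", OF _ _ k T(1) fricke_imp_U[OF N0 W T(2)] _ _ t]) (use N in auto)
qed

text \<open>The two alternatives are the cusps \<open>\<infinity>\<close> and \<open>0\<close> of \<open>\<Gamma>\<^sub>0(p)\<close>.\<close>

lemma transforms_cusps: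
  fixes p :: nat
  assumes p: "p = 2 \<or> p = 3" and f: "transforms p k f" and A: "A \<in> SL2Z"
  shows "(\<forall>\<tau>\<in>UHP. f (mact A \<tau>) = autj A \<tau> ^ k * f \<tau>) \<or>
    (\<exists>j::int. \<forall>\<tau>\<in>UHP. f (mact A \<tau>) = autj A \<tau> ^ k * (f (-1 / (\<tau> + of_int j)) / (\<tau> + of_int j) ^ k))"
proof (cases "int p dvd A $ 2 $ 1")
  case True
  then have "A \<in> Gamma0 p" using A by (simp add: Gamma0_def)
  then show ?thesis using f by (simp add: transforms_def)
next
  case False
  define a b c d where "a = A $ 1 $ 1" and "b = A $ 1 $ 2" and "c = A $ 2 $ 1" and "d = A $ 2 $ 2"
  have det: "a * d - b * c = 1" using A by (simp add: SL2Z_def det_2 a_def b_def c_def d_def)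
  \<comment> \<open>c is invertible modulo p and is its own inverse for p = 2 and p = 3; so j = d c
    solves this for p = 3, and j = d for p = 2.\<close>
  have "\<exists>j. int p dvd j * c - d"
  proof (cases "p = 2")
    case True
    then have "odd c" using False by (simp add: c_def)
    then have "int p dvd d * c - d" using True by simp
    then show ?thesis by blast
  next
    case 3: False
    then have p3: "p = 3" using p by simp
    have "\<not> 3 dvd c" using False p3 by (simp add: c_def)
    then have "c mod 3 = 1 \<or> c mod 3 = 2" by presburger
    then have "(c * c) mod 3 = 1" by (auto simp: mod_mult_eq[symmetric, of c c])
    then have "3 dvd c * c - 1" by (simp add: mod_eq_dvd_iff[symmetric])
    then have "3 dvd d * (c * c - 1)" by simp
    also have "d * (c * c - 1) = (d * c) * c - d" by (simp add: algebra_simps)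
    finally show ?thesis using p3 by auto
  qed
  then obtain j where j: "int p dvd j * c - d" by blast
  \<comment> \<open>Chosen to map -1/(\<tau> + j) to the image of \<tau> under \<open>A\<close>; its
    lower left entry is divisible by p by the choice of \<open>j\<close>.\<close>
  define B :: "int ^ 2 ^ 2" where "B = (\<chi> r s. if r = 1 then (if s = 1 then j * a - b else a) else (if s = 1 then j * c - d else c))"
  have B_el: "B $ 1 $ 1 = j * a - b" "B $ 1 $ 2 = a" "B $ 2 $ 1 = j * c - d" "B $ 2 $ 2 = c" by (simp_all add: B_def)
  have "det B = 1" using det by (simp add: det_2 B_el algebra_simps)
  then have BG: "B \<in> Gamma0 p" using j by (simp add: Gamma0_def SL2Z_def B_el)
  have "f (mact A \<tau>) = autj A \<tau> ^ k * (f (-1 / (\<tau> + of_int j)) / (\<tau> + of_int j) ^ k)" if t: "\<tau> \<in> UHP" for \<tau>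
  proof -
    define x where "x = \<tau> + of_int j"
    have x: "x \<in> UHP" "x \<noteq> 0" using UHP_add_int(1)[OF t] UHP_nz by (auto simp: x_def)
    have s: "-1 / x \<in> UHP" by (rule UHP_inversion(1)[OF x(1)])
    have jB: "autj B (-1 / x) = autj A \<tau> / x"
      using x(2) by (simp add: autj_def B_el c_def[symmetric] d_def[symmetric] field_simps) (simp add: x_def algebra_simps)
    have nB: "of_int (B $ 1 $ 1) * (-1 / x) + of_int (B $ 1 $ 2) = (of_int a * \<tau> + of_int b) / x"
      using x(2) by (simp add: B_el field_simps) (simp add: x_def algebra_simps)
    have "mact B (-1 / x) = ((of_int a * \<tau> + of_int b) / x) / (autj A \<tau> / x)"
      unfolding jB[symmetric] nB[symmetric] by (simp add: mact_def autj_def)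
    then have "mact B (-1 / x) = mact A \<tau>" using x(2) by (simp add: mact_def autj_def a_def b_def)
    then have "f (mact A \<tau>) = autj B (-1 / x) ^ k * f (-1 / x)" using f BG s unfolding transforms_def by metis
    then show ?thesis unfolding jB x_def[symmetric] by (simp add: power_divide)
  qed
  then show ?thesis by blast
qed

lemma disc_bounded:
  assumes "h holomorphic_on ball 0 1" "Y > 0"
  shows "\<exists>C. \<forall>\<tau>. Im \<tau> \<ge> Y \<longrightarrow> norm (h (qq \<tau>)) \<le> (C::real)"
proof -
  define r where "r = exp (- 2 * pi * Y)"
  have r: "r < 1" using assms(2) by (simp add: r_def)
  have "cball 0 r \<subseteq> ball (0::complex) 1" using r by auto
  then have "compact (h ` cball 0 r)"
    by (intro compact_continuous_image holomorphic_on_imp_continuous_on holomorphic_on_subset[OF assms(1)]) auto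
  then obtain C where C: "\<And>x. x \<in> h ` cball 0 r \<Longrightarrow> norm x \<le> C" using compact_imp_bounded bounded_iff by metis
  have "qq \<tau> \<in> cball 0 r" if "Im \<tau> \<ge> Y" for \<tau> using that by (simp add: norm_qq r_def)
  then show ?thesis using C by blast
qed

section \<open>Holomorphic functions of two variables and modular forms on products\<close>

lemma holomorphic2_onI:
  assumes "\<And>z. z \<in> V \<Longrightarrow> \<exists>A B. (G has_derivative (\<lambda>(h, k). A * h + B * k)) (at z)"
  shows "holomorphic2_on G V"
  unfolding holomorphic2_on_def using assms has_derivative_at_withinI by blast

lemma holomorphic2_onD:
  assumes "holomorphic2_on G V" "open V" "z \<in> V"
  obtains A B where "(G has_derivative (\<lambda>(h, k). A * h + B * k)) (at z)"
  using assms by (metis holomorphic2_on_def at_within_open)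

lemma holomorphic2_on_const: "holomorphic2_on (\<lambda>z. c) V"
  by (rule holomorphic2_onI, rule exI[of _ 0], rule exI[of _ 0], rule has_derivative_eq_rhs[OF has_derivative_const]) auto

lemma holomorphic2_on_add:
  assumes "open V" "holomorphic2_on f V" "holomorphic2_on g V"
  shows "holomorphic2_on (\<lambda>z. f z + g z) V"
proof (rule holomorphic2_onI)
  fix z assume "z \<in> V"
  then obtain A B C D where *: "(f has_derivative (\<lambda>(h, k). A * h + B * k)) (at z)" "(g has_derivative (\<lambda>(h, k). C * h + D * k)) (at z)"
    using assms holomorphic2_onD by metis
  have "((\<lambda>z. f z + g z) has_derivative (\<lambda>(h, k). (A + C) * h + (B + D) * k)) (at z)"
    by (rule has_derivative_eq_rhs[OF has_derivative_add[OF *]]) (auto simp: algebra_simps)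
  then show "\<exists>A B. ((\<lambda>z. f z + g z) has_derivative (\<lambda>(h, k). A * h + B * k)) (at z)" by blast
qed

lemma holomorphic2_on_mult:
  assumes "open V" "holomorphic2_on f V" "holomorphic2_on g V"
  shows "holomorphic2_on (\<lambda>z. f z * g z) V"
proof (rule holomorphic2_onI)
  fix z assume "z \<in> V"
  then obtain A B C D where *: "(f has_derivative (\<lambda>(h, k). A * h + B * k)) (at z)" "(g has_derivative (\<lambda>(h, k). C * h + D * k)) (at z)"
    using assms holomorphic2_onD by metis
  have "((\<lambda>z. f z * g z) has_derivative (\<lambda>(h, k). (f z * C + A * g z) * h + (f z * D + B * g z) * k)) (at z)"
    by (rule has_derivative_eq_rhs[OF has_derivative_mult[OF *]]) (auto simp: algebra_simps)
  then show "\<exists>A B. ((\<lambda>z. f z * g z) has_derivative (\<lambda>(h, k). A * h + B * k)) (at z)" by blast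
qed

lemma holomorphic2_on_fst_snd:
  assumes "f holomorphic_on \<Omega>" "open \<Omega>"
  shows "holomorphic2_on (\<lambda>z. f (fst z)) (\<Omega> \<times> \<Omega>)" "holomorphic2_on (\<lambda>z. f (snd z)) (\<Omega> \<times> \<Omega>)"
proof -
  show "holomorphic2_on (\<lambda>z. f (fst z)) (\<Omega> \<times> \<Omega>)"
  proof (rule holomorphic2_onI)
    fix z assume "z \<in> \<Omega> \<times> \<Omega>"
    then have "(f has_field_derivative deriv f (fst z)) (at (fst z))" by (intro holomorphic_derivI[OF assms]) auto
    from has_theta_fst[of f "\<lambda>_. 1" z, simplified, OF this] show "\<exists>A B. ((\<lambda>z. f (fst z)) has_derivative (\<lambda>(h, k). A * h + B * k)) (at z)"
      unfolding has_theta_def by blast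
  qed
  show "holomorphic2_on (\<lambda>z. f (snd z)) (\<Omega> \<times> \<Omega>)"
  proof (rule holomorphic2_onI)
    fix z assume "z \<in> \<Omega> \<times> \<Omega>"
    then have "(f has_field_derivative deriv f (snd z)) (at (snd z))" by (intro holomorphic_derivI[OF assms]) auto
    from has_theta_snd[of f "\<lambda>_. 1" z, simplified, OF this] show "\<exists>A B. ((\<lambda>z. f (snd z)) has_derivative (\<lambda>(h, k). A * h + B * k)) (at z)"
      unfolding has_theta_def by blast
  qed
qed

lemma holomorphic2_on_continuous: "holomorphic2_on F V \<Longrightarrow> continuous_on V F"
  unfolding holomorphic2_on_def continuous_on_eq_continuous_within using has_derivative_continuous by blast

lemma open_UHP2: "open (UHP \<times> UHP)" by (intro open_Times open_UHP)

text \<open>The m-th powers of both sides agree, so near a point where \<open>f\<close> is nonzero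
  the quotient is a continuous m-th root of unity, hence constant; the identity theorem carries the
  relation across the zeros of \<open>f\<close>.\<close>

lemma root_transforms:
  assumes f: "f holomorphic_on UHP" "\<And>\<tau>. \<tau> \<in> UHP \<Longrightarrow> f \<tau> ^ m = \<phi> \<tau>" "0 < m" and \<phi>: "transforms p (k * m) \<phi>"
    and nz: "\<tau>0 \<in> UHP" "f \<tau>0 \<noteq> 0" and A: "A \<in> Gamma0 p"
  shows "\<exists>\<epsilon>. \<epsilon> ^ m = 1 \<and> (\<forall>\<tau>\<in>UHP. f (mact A \<tau>) = \<epsilon> * autj A \<tau> ^ k * f \<tau>)"
proof -
  note M = mact_autj_cocycle[OF Gamma0_SL2Z[OF A] Gamma0_SL2Z[OF A]]
  have eq: "f (mact A \<tau>) ^ m = (autj A \<tau> ^ k * f \<tau>) ^ m" if "\<tau> \<in> UHP" for \<tau>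
    using \<phi> A that f(2)[OF that] f(2)[OF M(2)[OF that]] unfolding transforms_def by (simp add: power_mult power_mult_distrib)
  have hm: "mact A holomorphic_on UHP"
    unfolding mact_def[abs_def] using M(1) by (intro holomorphic_intros) (auto simp: autj_def)
  have hj: "autj A holomorphic_on UHP" unfolding autj_def[abs_def] by (intro holomorphic_intros)
  have hf: "(\<lambda>\<tau>. f (mact A \<tau>)) holomorphic_on UHP"
    using holomorphic_on_compose_gen[OF hm f(1)] M(2) by (auto simp: o_def)
  define B where "B = f -` (- {0}) \<inter> UHP"
  have "open B" unfolding B_def
    using continuous_on_open_vimage[OF open_UHP] holomorphic_on_imp_continuous_on[OF f(1)] by blast
  moreover have "\<tau>0 \<in> B" using nz by (simp add: B_def)
  ultimately obtain r where r: "r > 0" "ball \<tau>0 r \<subseteq> B" by (meson open_contains_ball)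
  have b: "\<tau> \<in> UHP" "f \<tau> \<noteq> 0" if "\<tau> \<in> ball \<tau>0 r" for \<tau> using r(2) that by (auto simp: B_def)
  define R where "R = (\<lambda>\<tau>. f (mact A \<tau>) / (autj A \<tau> ^ k * f \<tau>))"
  have nzb: "autj A \<tau> ^ k * f \<tau> \<noteq> 0" if "\<tau> \<in> ball \<tau>0 r" for \<tau> using b[OF that] M(1) by auto
  have sub: "ball \<tau>0 r \<subseteq> UHP" using b by blast
  have "continuous_on (ball \<tau>0 r) R"
    unfolding R_def using nzb
    by (intro holomorphic_on_imp_continuous_on holomorphic_intros holomorphic_on_subset[OF hf sub] holomorphic_on_subset[OF hj sub]
        holomorphic_on_subset[OF f(1) sub]) auto
  moreover have R1: "R \<tau> ^ m = 1" if "\<tau> \<in> ball \<tau>0 r" for \<tau>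
    using eq[OF b(1)[OF that]] nzb[OF that] by (simp add: R_def power_divide)
  then have "R ` ball \<tau>0 r \<subseteq> {z. z ^ m = 1}" by auto
  then have "finite (R ` ball \<tau>0 r)" using finite_subset finite_nth_roots[OF f(3), of 1] by blast
  ultimately have "R constant_on ball \<tau>0 r" by (intro continuous_finite_range_constant) auto
  then obtain \<epsilon> where e: "\<And>\<tau>. \<tau> \<in> ball \<tau>0 r \<Longrightarrow> R \<tau> = \<epsilon>" by (auto simp: constant_on_def)
  have e1: "\<epsilon> ^ m = 1" using R1[of \<tau>0] e[of \<tau>0] r(1) by simp
  have e2: "f (mact A \<tau>) = \<epsilon> * autj A \<tau> ^ k * f \<tau>" if "\<tau> \<in> ball \<tau>0 r" for \<tau>
    using e[OF that] nzb[OF that] by (simp add: R_def field_simps)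
  have ne: "ball \<tau>0 r \<noteq> {}" using r(1) by simp
  have h2: "(\<lambda>\<tau>. \<epsilon> * autj A \<tau> ^ k * f \<tau>) holomorphic_on UHP" by (intro holomorphic_intros hj f)
  have "f (mact A \<tau>) = \<epsilon> * autj A \<tau> ^ k * f \<tau>" if "\<tau> \<in> UHP" for \<tau>
    by (rule analytic_continuation_open[OF open_ball open_UHP ne connected_UHP sub hf h2 e2 that])
  with e1 show ?thesis by blast
qed

text \<open>\<open>f\<close> is an m-th root of a form \<open>\<phi>\<close> on the group
  \<open>Gamma0 p\<close>, which contains \<open>Gamma0 N\<close> and has just two cusps, with
  expansions \<open>h1\<close> and \<open>h2\<close>. The multiplier of \<open>f\<close> is a
  character by the cocycle relation, and bounds for \<open>\<phi>\<close> pass to its root.\<close>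

theorem bimodular_formI:
  assumes p: "p = 2 \<or> p = 3" "p dvd N"
    and f: "f holomorphic_on UHP" "\<And>\<tau>. \<tau> \<in> UHP \<Longrightarrow> f \<tau> ^ m = \<phi> \<tau>" "0 < m" and \<phi>: "transforms p (k * m) \<phi>"
    and nz: "\<tau>0 \<in> UHP" "f \<tau>0 \<noteq> 0"
    and h1: "h1 holomorphic_on ball 0 1" "\<And>\<tau>. \<tau> \<in> UHP \<Longrightarrow> \<phi> \<tau> = h1 (qq \<tau>)"
    and h2: "h2 holomorphic_on ball 0 1" "\<And>\<tau>. \<tau> \<in> UHP \<Longrightarrow> \<phi> (-1 / \<tau>) = \<tau> ^ (k * m) * h2 (qq (\<tau> / of_nat p))"
  shows "bimodular_form (Gamma0 N) (Gamma0 N) k k (\<lambda>(\<tau>1, \<tau>2). K * f \<tau>1 * f \<tau>2)"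
proof -
  have ex: "\<exists>\<epsilon>. \<epsilon> ^ m = 1 \<and> (\<forall>\<tau>\<in>UHP. f (mact A \<tau>) = \<epsilon> * autj A \<tau> ^ k * f \<tau>)" if "A \<in> Gamma0 N" for A
    by (rule root_transforms[OF f \<phi> nz Gamma0_mono[OF p(2) that]])
  \<comment> \<open>Read off at one point where \<open>f\<close> is nonzero, which turns the root of
    unity into a function of the matrix.\<close>
  define \<epsilon> where "\<epsilon> = (\<lambda>A. f (mact A \<tau>0) / (autj A \<tau>0 ^ k * f \<tau>0))"
  have eps: "\<epsilon> A ^ m = 1" "\<And>\<tau>. \<tau> \<in> UHP \<Longrightarrow> f (mact A \<tau>) = \<epsilon> A * autj A \<tau> ^ k * f \<tau>" if A: "A \<in> Gamma0 N" for A
  proof -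
    obtain e where e: "e ^ m = 1" "\<forall>\<tau>\<in>UHP. f (mact A \<tau>) = e * autj A \<tau> ^ k * f \<tau>" using ex[OF A] by blast
    have "\<epsilon> A = e"
      using e(2) nz mact_autj_cocycle(1)[OF Gamma0_SL2Z[OF A] Gamma0_SL2Z[OF A] nz(1)] by (simp add: \<epsilon>_def)
    with e show "\<epsilon> A ^ m = 1" "\<And>\<tau>. \<tau> \<in> UHP \<Longrightarrow> f (mact A \<tau>) = \<epsilon> A * autj A \<tau> ^ k * f \<tau>" by auto
  qed
  have mult: "\<epsilon> (A ** A') = \<epsilon> A * \<epsilon> A'" if A: "A \<in> Gamma0 N" "A' \<in> Gamma0 N" for A A'
  proof -
    note M = mact_autj_cocycle[OF Gamma0_SL2Z[OF A(1)] Gamma0_SL2Z[OF A(2)] nz(1)]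
      and M' = mact_autj_cocycle[OF Gamma0_SL2Z[OF A(2)] Gamma0_SL2Z[OF A(2)] nz(1)]
    have "\<epsilon> (A ** A') * autj (A ** A') \<tau>0 ^ k * f \<tau>0 = f (mact A (mact A' \<tau>0))"
      using eps(2)[OF Gamma0_mult[OF A] nz(1)] M(4) by simp
    also have "\<dots> = \<epsilon> A * autj A (mact A' \<tau>0) ^ k * (\<epsilon> A' * autj A' \<tau>0 ^ k * f \<tau>0)"
      using eps(2)[OF A(1) M'(2)] eps(2)[OF A(2) nz(1)] by simp
    finally have "\<epsilon> (A ** A') * (autj (A ** A') \<tau>0 ^ k * f \<tau>0) = \<epsilon> A * \<epsilon> A' * (autj (A ** A') \<tau>0 ^ k * f \<tau>0)"
      unfolding M(3) by (simp add: power_mult_distrib mult_ac)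
    moreover have "autj (A ** A') \<tau>0 ^ k * f \<tau>0 \<noteq> 0"
      using nz(2) M(3) mact_autj_cocycle(1)[OF Gamma0_SL2Z[OF A(1)] Gamma0_SL2Z[OF A(1)] M'(2)] M'(1) by simp
    ultimately show ?thesis using mult_right_cancel by blast
  qed
  have bound: "\<exists>C\<ge>0. \<forall>\<tau>. Im \<tau> \<ge> Y \<longrightarrow> norm (f (mact A \<tau>) / autj A \<tau> ^ k) \<le> C" if A: "A \<in> SL2Z" and Y: "Y > 0" for A Y
  proof -
    obtain C1 where C1: "\<And>\<tau>. Im \<tau> \<ge> Y \<Longrightarrow> norm (h1 (qq \<tau>)) \<le> C1" using disc_bounded[OF h1(1) Y] by blast
    have "Y / real p > 0" using Y p by auto
    then obtain C2 where C2: "\<And>\<tau>. Im \<tau> \<ge> Y / real p \<Longrightarrow> norm (h2 (qq \<tau>)) \<le> C2" using disc_bounded[OF h2(1)] by blast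
    have "norm (f (mact A \<tau>) / autj A \<tau> ^ k) \<le> 1 + max C1 C2" if t: "Im \<tau> \<ge> Y" for \<tau>
    proof -
      have tU: "\<tau> \<in> UHP" using t Y by (simp add: UHP_def)
      note M = mact_autj_cocycle[OF A A tU]
      have "norm (\<phi> (mact A \<tau>) / autj A \<tau> ^ (k * m)) \<le> max C1 C2"
        using transforms_cusps[OF p(1) \<phi> A]
      proof (elim disjE exE)
        assume "\<forall>\<tau>\<in>UHP. \<phi> (mact A \<tau>) = autj A \<tau> ^ (k * m) * \<phi> \<tau>"
        then have "\<phi> (mact A \<tau>) / autj A \<tau> ^ (k * m) = h1 (qq \<tau>)" using tU M(1) h1(2)[OF tU] by simp
        then show ?thesis using C1[OF t] by simp
      next
        fix j :: int
        assume *: "\<forall>\<tau>\<in>UHP. \<phi> (mact A \<tau>) = autj A \<tau> ^ (k * m) * (\<phi> (-1 / (\<tau> + of_int j)) / (\<tau> + of_int j) ^ (k * m))"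
        have x: "\<tau> + of_int j \<in> UHP" "\<tau> + of_int j \<noteq> 0" using UHP_add_int(1)[OF tU] UHP_nz by auto
        have "\<phi> (mact A \<tau>) / autj A \<tau> ^ (k * m) = h2 (qq ((\<tau> + of_int j) / of_nat p))"
          using * tU M(1) h2(2)[OF x(1)] x(2) by simp
        moreover have "Im ((\<tau> + of_int j) / of_nat p) \<ge> Y / real p" using t p(1) by (auto simp: divide_right_mono)
        ultimately show ?thesis using C2 by (metis max.coboundedI2)
      qed
      also have "\<phi> (mact A \<tau>) / autj A \<tau> ^ (k * m) = (f (mact A \<tau>) / autj A \<tau> ^ k) ^ m"
        using f(2)[OF M(2)] by (simp add: power_divide power_mult)
      finally have le: "norm (f (mact A \<tau>) / autj A \<tau> ^ k) ^ m \<le> max C1 C2" by (simp only: norm_power)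
      \<comment> \<open>From y^m <= M follows y <= 1 + M: either y <= 1, or y <= y^m.\<close>
      show ?thesis
      proof (cases "norm (f (mact A \<tau>) / autj A \<tau> ^ k) \<le> 1")
        case True
        have "0 \<le> max C1 C2" using le by (rule order_trans[rotated]) simp
        with True show ?thesis by linarith
      next
        case False
        then have "norm (f (mact A \<tau>) / autj A \<tau> ^ k) ^ 1 \<le> norm (f (mact A \<tau>) / autj A \<tau> ^ k) ^ m"
          using f(3) by (intro power_increasing) auto
        then show ?thesis using le by simp
      qed
    qed
    then show ?thesis by (intro exI[of _ "max 0 (1 + max C1 C2)"]) (auto simp: le_max_iff_disj simp del: max.bounded_iff)
  qed
  show ?thesis
    unfolding bimodular_form_def
  proof (intro conjI ballI allI impI)
    have "holomorphic2_on (\<lambda>z. (K * f (fst z)) * f (snd z)) (UHP \<times> UHP)"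
      by (intro holomorphic2_on_mult holomorphic2_on_const holomorphic2_on_fst_snd f open_UHP open_UHP2)
    then show "holomorphic2_on (\<lambda>(\<tau>1, \<tau>2). K * f \<tau>1 * f \<tau>2) (UHP \<times> UHP)" by (simp add: case_prod_unfold)
    show "\<exists>\<rho>. finite_character (Gamma0 N) (Gamma0 N) \<rho> \<and> (\<forall>A\<in>Gamma0 N. \<forall>B\<in>Gamma0 N. \<forall>\<tau>1\<in>UHP. \<forall>\<tau>2\<in>UHP.
        (case (mact A \<tau>1, mact B \<tau>2) of (\<tau>1, \<tau>2) \<Rightarrow> K * f \<tau>1 * f \<tau>2) =
        \<rho> A B * autj A \<tau>1 ^ k * autj B \<tau>2 ^ k * (case (\<tau>1, \<tau>2) of (\<tau>1, \<tau>2) \<Rightarrow> K * f \<tau>1 * f \<tau>2))"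
    proof (intro exI[of _ "\<lambda>A B. \<epsilon> A * \<epsilon> B"] conjI ballI)
      show "finite_character (Gamma0 N) (Gamma0 N) (\<lambda>A B. \<epsilon> A * \<epsilon> B)"
        unfolding finite_character_def
        by (intro conjI exI[of _ m]) (auto simp: mult eps(1) f(3) power_mult_distrib)
    qed (auto simp: eps(2))
    fix A B :: "int ^ 2 ^ 2" and Y :: real assume AB: "A \<in> SL2Z" "B \<in> SL2Z" "Y > 0"
    obtain C where C: "C \<ge> 0" "\<And>\<tau>. Im \<tau> \<ge> Y \<Longrightarrow> norm (f (mact A \<tau>) / autj A \<tau> ^ k) \<le> C" using bound[OF AB(1,3)] by blast
    obtain D where D: "D \<ge> 0" "\<And>\<tau>. Im \<tau> \<ge> Y \<Longrightarrow> norm (f (mact B \<tau>) / autj B \<tau> ^ k) \<le> D" using bound[OF AB(2,3)] by blast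
    show "\<exists>C. \<forall>\<tau>1 \<tau>2. Im \<tau>1 \<ge> Y \<longrightarrow> Im \<tau>2 \<ge> Y \<longrightarrow>
      norm ((case (mact A \<tau>1, mact B \<tau>2) of (\<tau>1, \<tau>2) \<Rightarrow> K * f \<tau>1 * f \<tau>2) / (autj A \<tau>1 ^ k * autj B \<tau>2 ^ k)) \<le> C"
    proof (intro exI[of _ "norm K * (C * D)"] allI impI)
      fix \<tau>1 \<tau>2 assume t: "Im \<tau>1 \<ge> Y" "Im \<tau>2 \<ge> Y"
      have "norm ((case (mact A \<tau>1, mact B \<tau>2) of (\<tau>1, \<tau>2) \<Rightarrow> K * f \<tau>1 * f \<tau>2) / (autj A \<tau>1 ^ k * autj B \<tau>2 ^ k)) =
        norm K * (norm (f (mact A \<tau>1) / autj A \<tau>1 ^ k) * norm (f (mact B \<tau>2) / autj B \<tau>2 ^ k))"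
        by (simp add: norm_mult norm_divide)
      also have "\<dots> \<le> norm K * (C * D)" using C D t by (intro mult_left_mono mult_mono) auto
      finally show "norm ((case (mact A \<tau>1, mact B \<tau>2) of (\<tau>1, \<tau>2) \<Rightarrow> K * f \<tau>1 * f \<tau>2) / (autj A \<tau>1 ^ k * autj B \<tau>2 ^ k)) \<le> norm K * (C * D)" .
    qed
  qed
qed

section \<open>Growth at the cusps and modularity of the coordinates\<close>

definition cusp_growth :: "(complex \<Rightarrow> complex) \<Rightarrow> bool" where
  "cusp_growth f \<longleftrightarrow> (\<forall>A\<in>SL2Z. \<forall>Y>0. \<exists>C\<ge>0. \<exists>K\<ge>0. \<forall>\<tau>. Im \<tau> \<ge> Y \<longrightarrow> norm (f (mact A \<tau>)) \<le> C * exp (K * Im \<tau>))"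

text \<open>Unlike in \<open>weakly_bimodular_function\<close> the constants are nonnegative, so
  that bounds can be added and multiplied.\<close>

definition cusp_growth2 :: "(complex \<times> complex \<Rightarrow> complex) \<Rightarrow> bool" where
  "cusp_growth2 P \<longleftrightarrow> (\<forall>A\<in>SL2Z. \<forall>B\<in>SL2Z. \<forall>Y>0. \<exists>C\<ge>0. \<exists>K\<ge>0. \<forall>\<tau>1 \<tau>2. Im \<tau>1 \<ge> Y \<longrightarrow> Im \<tau>2 \<ge> Y \<longrightarrow>
      norm (P (mact A \<tau>1, mact B \<tau>2)) \<le> C * exp (K * (Im \<tau>1 + Im \<tau>2)))"

definition wbf :: "(int ^ 2 ^ 2) set \<Rightarrow> (complex \<times> complex \<Rightarrow> complex) \<Rightarrow> bool" where
  "wbf \<Gamma> P \<longleftrightarrow> holomorphic2_on P (UHP \<times> UHP) \<and>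
    (\<forall>A\<in>\<Gamma>. \<forall>B\<in>\<Gamma>. \<forall>\<tau>1\<in>UHP. \<forall>\<tau>2\<in>UHP. P (mact A \<tau>1, mact B \<tau>2) = P (\<tau>1, \<tau>2)) \<and> cusp_growth2 P"

lemma wbf_imp: "wbf \<Gamma> P \<Longrightarrow> weakly_bimodular_function \<Gamma> \<Gamma> P"
  unfolding wbf_def weakly_bimodular_function_def cusp_growth2_def by blast

lemma cusp_growth2_const: "cusp_growth2 (\<lambda>z. c)"
  unfolding cusp_growth2_def by (intro ballI allI impI exI[of _ "norm c"] exI[of _ 0] conjI) auto

lemma cusp_growth2_mult:
  assumes "cusp_growth2 P" "cusp_growth2 Q" shows "cusp_growth2 (\<lambda>z. P z * Q z)"
  unfolding cusp_growth2_def
proof (intro ballI allI impI)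
  fix A B :: "int ^ 2 ^ 2" and Y :: real assume AB: "A \<in> SL2Z" "B \<in> SL2Z" "Y > 0"
  obtain C K where 1: "C \<ge> 0" "K \<ge> 0" "\<And>\<tau>1 \<tau>2. Im \<tau>1 \<ge> Y \<Longrightarrow> Im \<tau>2 \<ge> Y \<Longrightarrow> norm (P (mact A \<tau>1, mact B \<tau>2)) \<le> C * exp (K * (Im \<tau>1 + Im \<tau>2))"
    using assms(1) AB unfolding cusp_growth2_def by meson
  obtain D L where 2: "D \<ge> 0" "L \<ge> 0" "\<And>\<tau>1 \<tau>2. Im \<tau>1 \<ge> Y \<Longrightarrow> Im \<tau>2 \<ge> Y \<Longrightarrow> norm (Q (mact A \<tau>1, mact B \<tau>2)) \<le> D * exp (L * (Im \<tau>1 + Im \<tau>2))"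
    using assms(2) AB unfolding cusp_growth2_def by meson
  have "norm (P (mact A \<tau>1, mact B \<tau>2) * Q (mact A \<tau>1, mact B \<tau>2)) \<le> (C * D) * exp ((K + L) * (Im \<tau>1 + Im \<tau>2))"
    if "Im \<tau>1 \<ge> Y" "Im \<tau>2 \<ge> Y" for \<tau>1 \<tau>2
  proof -
    have "norm (P (mact A \<tau>1, mact B \<tau>2)) * norm (Q (mact A \<tau>1, mact B \<tau>2)) \<le> (C * exp (K * (Im \<tau>1 + Im \<tau>2))) * (D * exp (L * (Im \<tau>1 + Im \<tau>2)))"
      using 1 2 that by (intro mult_mono) auto
    then show ?thesis by (simp add: norm_mult distrib_right exp_add mult_ac)
  qed
  then show "\<exists>C\<ge>0. \<exists>K\<ge>0. \<forall>\<tau>1 \<tau>2. Im \<tau>1 \<ge> Y \<longrightarrow> Im \<tau>2 \<ge> Y \<longrightarrow> norm (P (mact A \<tau>1, mact B \<tau>2) * Q (mact A \<tau>1, mact B \<tau>2)) \<le> C * exp (K * (Im \<tau>1 + Im \<tau>2))"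
    using 1 2 by (intro exI[of _ "C * D"] exI[of _ "K + L"] conjI) auto
qed

lemma cusp_growth2_add:
  assumes "cusp_growth2 P" "cusp_growth2 Q" shows "cusp_growth2 (\<lambda>z. P z + Q z)"
  unfolding cusp_growth2_def
proof (intro ballI allI impI)
  fix A B :: "int ^ 2 ^ 2" and Y :: real assume AB: "A \<in> SL2Z" "B \<in> SL2Z" "Y > 0"
  obtain C K where 1: "C \<ge> 0" "K \<ge> 0" "\<And>\<tau>1 \<tau>2. Im \<tau>1 \<ge> Y \<Longrightarrow> Im \<tau>2 \<ge> Y \<Longrightarrow> norm (P (mact A \<tau>1, mact B \<tau>2)) \<le> C * exp (K * (Im \<tau>1 + Im \<tau>2))"
    using assms(1) AB unfolding cusp_growth2_def by meson
  obtain D L where 2: "D \<ge> 0" "L \<ge> 0" "\<And>\<tau>1 \<tau>2. Im \<tau>1 \<ge> Y \<Longrightarrow> Im \<tau>2 \<ge> Y \<Longrightarrow> norm (Q (mact A \<tau>1, mact B \<tau>2)) \<le> D * exp (L * (Im \<tau>1 + Im \<tau>2))"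
    using assms(2) AB unfolding cusp_growth2_def by meson
  have "norm (P (mact A \<tau>1, mact B \<tau>2) + Q (mact A \<tau>1, mact B \<tau>2)) \<le> (C + D) * exp ((K + L) * (Im \<tau>1 + Im \<tau>2))"
    if "Im \<tau>1 \<ge> Y" "Im \<tau>2 \<ge> Y" for \<tau>1 \<tau>2
  proof -
    have s: "0 \<le> Im \<tau>1 + Im \<tau>2" using that AB(3) by simp
    have "norm (P (mact A \<tau>1, mact B \<tau>2) + Q (mact A \<tau>1, mact B \<tau>2)) \<le> C * exp (K * (Im \<tau>1 + Im \<tau>2)) + D * exp (L * (Im \<tau>1 + Im \<tau>2))"
      by (intro norm_triangle_le add_mono 1(3) 2(3) that)
    also have "\<dots> \<le> C * exp ((K + L) * (Im \<tau>1 + Im \<tau>2)) + D * exp ((K + L) * (Im \<tau>1 + Im \<tau>2))"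
      using 1(1,2) 2(1,2) s by (intro add_mono mult_left_mono) (auto intro!: mult_right_mono)
    finally show ?thesis by (simp add: distrib_right)
  qed
  then show "\<exists>C\<ge>0. \<exists>K\<ge>0. \<forall>\<tau>1 \<tau>2. Im \<tau>1 \<ge> Y \<longrightarrow> Im \<tau>2 \<ge> Y \<longrightarrow> norm (P (mact A \<tau>1, mact B \<tau>2) + Q (mact A \<tau>1, mact B \<tau>2)) \<le> C * exp (K * (Im \<tau>1 + Im \<tau>2))"
    using 1 2 by (intro exI[of _ "C + D"] exI[of _ "K + L"] conjI) auto
qed

lemma cusp_growth2_fst_snd:
  assumes "cusp_growth t" shows "cusp_growth2 (\<lambda>z. t (fst z))" "cusp_growth2 (\<lambda>z. t (snd z))"
proof -
  have le: "C * exp (K * x) \<le> C * exp (K * (x + y))" "C * exp (K * x) \<le> C * exp (K * (y + x))"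
    if "0 \<le> C" "0 \<le> K" "0 \<le> y" for C K x y :: real
    using that by (auto intro!: mult_left_mono)
  show "cusp_growth2 (\<lambda>z. t (fst z))"
    unfolding cusp_growth2_def
  proof (intro ballI allI impI)
    fix A B :: "int ^ 2 ^ 2" and Y :: real assume AB: "A \<in> SL2Z" "B \<in> SL2Z" "Y > 0"
    obtain C K where 1: "C \<ge> 0" "K \<ge> 0" "\<And>\<tau>. Im \<tau> \<ge> Y \<Longrightarrow> norm (t (mact A \<tau>)) \<le> C * exp (K * Im \<tau>)"
      using assms AB unfolding cusp_growth_def by meson
    have "norm (t (fst (mact A \<tau>1, mact B \<tau>2))) \<le> C * exp (K * (Im \<tau>1 + Im \<tau>2))" if "Im \<tau>1 \<ge> Y" "Im \<tau>2 \<ge> Y" for \<tau>1 \<tau>2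
      using 1(3)[OF that(1)] le(1)[OF 1(1,2), of "Im \<tau>2" "Im \<tau>1"] that AB(3) by simp
    then show "\<exists>C\<ge>0. \<exists>K\<ge>0. \<forall>\<tau>1 \<tau>2. Im \<tau>1 \<ge> Y \<longrightarrow> Im \<tau>2 \<ge> Y \<longrightarrow> norm (t (fst (mact A \<tau>1, mact B \<tau>2))) \<le> C * exp (K * (Im \<tau>1 + Im \<tau>2))"
      using 1(1,2) by blast
  qed
  show "cusp_growth2 (\<lambda>z. t (snd z))"
    unfolding cusp_growth2_def
  proof (intro ballI allI impI)
    fix A B :: "int ^ 2 ^ 2" and Y :: real assume AB: "A \<in> SL2Z" "B \<in> SL2Z" "Y > 0"
    obtain C K where 1: "C \<ge> 0" "K \<ge> 0" "\<And>\<tau>. Im \<tau> \<ge> Y \<Longrightarrow> norm (t (mact B \<tau>)) \<le> C * exp (K * Im \<tau>)"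
      using assms AB unfolding cusp_growth_def by meson
    have "norm (t (snd (mact A \<tau>1, mact B \<tau>2))) \<le> C * exp (K * (Im \<tau>1 + Im \<tau>2))" if "Im \<tau>1 \<ge> Y" "Im \<tau>2 \<ge> Y" for \<tau>1 \<tau>2
      using 1(3)[OF that(2)] le(2)[OF 1(1,2), of "Im \<tau>1" "Im \<tau>2"] that AB(3) by simp
    then show "\<exists>C\<ge>0. \<exists>K\<ge>0. \<forall>\<tau>1 \<tau>2. Im \<tau>1 \<ge> Y \<longrightarrow> Im \<tau>2 \<ge> Y \<longrightarrow> norm (t (snd (mact A \<tau>1, mact B \<tau>2))) \<le> C * exp (K * (Im \<tau>1 + Im \<tau>2))"
      using 1(1,2) by blast
  qed
qed

lemma wbf_const: "wbf \<Gamma> (\<lambda>z. c)"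
  by (simp add: wbf_def holomorphic2_on_const cusp_growth2_const)

lemma wbf_add: "wbf \<Gamma> P \<Longrightarrow> wbf \<Gamma> Q \<Longrightarrow> wbf \<Gamma> (\<lambda>z. P z + Q z)"
  by (simp add: wbf_def holomorphic2_on_add[OF open_UHP2] cusp_growth2_add)

lemma wbf_mult: "wbf \<Gamma> P \<Longrightarrow> wbf \<Gamma> Q \<Longrightarrow> wbf \<Gamma> (\<lambda>z. P z * Q z)"
  by (simp add: wbf_def holomorphic2_on_mult[OF open_UHP2] cusp_growth2_mult)

text \<open>Both coordinates are quotients of polynomials in t1 and t2. At the diagonal point
  (\<open>\<tau>0\<close>, \<open>\<tau>0\<close>) their denominators are (t - 1)^2 and (2t)^2,
  nonzero by the choice of \<open>\<tau>0\<close>.\<close>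

theorem coordinates_modularI:
  assumes t: "t holomorphic_on UHP" "\<And>A \<tau>. A \<in> \<Gamma> \<Longrightarrow> \<tau> \<in> UHP \<Longrightarrow> t (mact A \<tau>) = t \<tau>" "cusp_growth t"
    and nz: "\<tau>0 \<in> UHP" "t \<tau>0 \<noteq> 0" "t \<tau>0 \<noteq> 1"
  shows "coordinates_modular \<Gamma> t"
proof -
  have b: "wbf \<Gamma> (\<lambda>z. t (fst z))" "wbf \<Gamma> (\<lambda>z. t (snd z))"
    using t holomorphic2_on_fst_snd[OF t(1) open_UHP] cusp_growth2_fst_snd[OF t(3)] by (auto simp: wbf_def)
  have d: "wbf \<Gamma> (\<lambda>z. t (fst z) - 1)" "wbf \<Gamma> (\<lambda>z. t (snd z) - 1)"
    using wbf_add[OF b(1) wbf_const[of _ "-1"]] wbf_add[OF b(2) wbf_const[of _ "-1"]] by simp_all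
  note w = wbf_const wbf_add wbf_mult b
  have I: "bimodular_function \<Gamma> \<Gamma> F" if "wbf \<Gamma> P" "wbf \<Gamma> Q" "Q (\<tau>0, \<tau>0) \<noteq> 0" "\<And>z. F z = P z / Q z" for F P Q
    unfolding bimodular_function_def using that wbf_imp nz(1) by (intro exI[of _ P] exI[of _ Q]) auto
  show ?thesis
    unfolding coordinates_modular_def
  proof (intro conjI)
    show "bimodular_function \<Gamma> \<Gamma> (\<lambda>(\<tau>1, \<tau>2). t \<tau>1)" "bimodular_function \<Gamma> \<Gamma> (\<lambda>(\<tau>1, \<tau>2). t \<tau>2)"
      by (rule I[OF w(4) w(1)[of _ 1]], auto) (rule I[OF w(5) w(1)[of _ 1]], auto)
    show "bimodular_function \<Gamma> \<Gamma> (xcoord t)"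
      by (rule I[where P = "\<lambda>z. t (fst z) + t (snd z)" and Q = "\<lambda>z. (t (fst z) - 1) * (t (snd z) - 1)"])
        (use nz in \<open>auto intro!: wbf_add wbf_mult b d simp: xcoord_def case_prod_unfold\<close>)
    show "bimodular_function \<Gamma> \<Gamma> (ycoord t)"
      by (rule I[where P = "\<lambda>z. t (fst z) * t (snd z)" and Q = "\<lambda>z. (t (fst z) + t (snd z)) * (t (fst z) + t (snd z))"])
        (use nz in \<open>auto intro!: wbf_const wbf_add wbf_mult b simp: ycoord_def case_prod_unfold power2_eq_square\<close>)
  qed
qed

section \<open>The four solutions\<close>

lemma filterlim_Im_at_i_inf: "filterlim Im at_top at_i_inf"
  unfolding at_i_inf_def by (rule filterlim_filtercomap)

lemma qq_at_i_inf: "(qq \<longlongrightarrow> 0) at_i_inf"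
proof (rule tendsto_norm_zero_cancel)
  have "filterlim (\<lambda>\<tau>. - (2 * pi) * Im \<tau>) at_bot at_i_inf"
    by (rule filterlim_tendsto_neg_mult_at_bot[OF tendsto_const _ filterlim_Im_at_i_inf]) simp
  then show "((\<lambda>\<tau>. norm (qq \<tau>)) \<longlongrightarrow> 0) at_i_inf"
    unfolding norm_qq using filterlim_compose[OF exp_at_bot] by simp
qed

lemma tendsto_at_i_inf_qq:
  assumes "f holomorphic_on ball 0 1"
  shows "((\<lambda>\<tau>. f (qq \<tau>)) \<longlongrightarrow> f 0) at_i_inf"
proof -
  have "isCont f 0"
    using assms by (intro continuous_on_interior[OF holomorphic_on_imp_continuous_on[OF assms]]) auto
  then show ?thesis using isCont_tendsto_compose[OF _ qq_at_i_inf] by blast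
qed

lemma eventually_at_i_inf_iff: "eventually P at_i_inf \<longleftrightarrow> (\<exists>Y>0. \<forall>\<tau>. Im \<tau> > Y \<longrightarrow> P \<tau>)"
proof
  assume "eventually P at_i_inf"
  then obtain Q where "eventually Q at_top" "\<And>\<tau>. Q (Im \<tau>) \<Longrightarrow> P \<tau>"
    unfolding at_i_inf_def eventually_filtercomap by blast
  then obtain N where "\<And>\<tau>. Im \<tau> \<ge> N \<Longrightarrow> P \<tau>" by (auto simp: eventually_at_top_linorder)
  then show "\<exists>Y>0. \<forall>\<tau>. Im \<tau> > Y \<longrightarrow> P \<tau>" by (intro exI[of _ "max 1 N"]) auto
next
  assume "\<exists>Y>0. \<forall>\<tau>. Im \<tau> > Y \<longrightarrow> P \<tau>"
  then obtain Y where "\<And>\<tau>. Im \<tau> > Y \<Longrightarrow> P \<tau>" by blast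
  then show "eventually P at_i_inf"
    unfolding at_i_inf_def eventually_filtercomap by (intro exI[of _ "\<lambda>y. y > Y"]) auto
qed

lemma eventually_UHP: "\<forall>\<^sub>F \<tau> in at_i_inf. \<tau> \<in> UHP"
  unfolding eventually_at_i_inf_iff by (intro exI[of _ 1]) (auto simp: UHP_def)

lemma at_i_inf_nz: "at_i_inf \<noteq> bot"
proof
  assume "at_i_inf = bot"
  then have "eventually (\<lambda>_. False) at_i_inf" by simp
  then obtain Y where "\<And>\<tau>. Im \<tau> > Y \<Longrightarrow> False" unfolding eventually_at_i_inf_iff by blast
  from this[of "Complex 0 (Y + 1)"] show False by simp
qed

lemma cusp_region_eventually: "cusp_region \<Omega> \<Longrightarrow> \<forall>\<^sub>F \<tau> in at_i_inf. \<tau> \<in> \<Omega>"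
proof -
  assume "cusp_region \<Omega>"
  then obtain Y where "{\<tau>. Im \<tau> > Y} \<subseteq> \<Omega>" unfolding cusp_region_def by blast
  then show ?thesis unfolding eventually_at_i_inf_iff by (intro exI[of _ "max 1 Y"]) auto
qed

lemma cusp_region_nz:
  assumes "cusp_region \<Omega>" "f holomorphic_on ball 0 1" "f 0 \<noteq> 0"
  obtains \<tau> where "\<tau> \<in> \<Omega>" "f (qq \<tau>) \<noteq> 0"
proof -
  have "\<forall>\<^sub>F \<tau> in at_i_inf. f (qq \<tau>) \<noteq> 0"
    using tendsto_imp_eventually_ne[OF tendsto_at_i_inf_qq[OF assms(2)] assms(3)] .
  from eventually_conj[OF cusp_region_eventually[OF assms(1)] this] show ?thesis
    using that eventually_happens'[OF at_i_inf_nz] by blast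
qed

lemma cusp_region_upper: "0 \<le> Y \<Longrightarrow> cusp_region {\<tau>. Im \<tau> > Y}"
  unfolding cusp_region_def
  by (auto simp: UHP_def open_halfspace_Im_gt convex_halfspace_Im_gt intro!: convex_connected)

lemma cusp_region_UHP: "cusp_region UHP"
  using cusp_region_upper[of 0] by (simp add: UHP_def)

lemma schwarz_compose_qq:
  assumes f: "f holomorphic_on ball 0 1" and \<Omega>: "open \<Omega>" "\<Omega> \<subseteq> UHP" and \<tau>: "\<tau> \<in> \<Omega>"
  defines "\<kappa> \<equiv> \<lambda>\<tau>. c2pi * f (qq \<tau>)"
  shows "2 * \<kappa> \<tau> * deriv (deriv \<kappa>) \<tau> - 3 * deriv \<kappa> \<tau> ^ 2 = c2pi ^ 4 * schwarz f (qq \<tau>)"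
proof -
  have d1: "deriv \<kappa> \<sigma> = c2pi * (c2pi * Dq f (qq \<sigma>))" if "\<sigma> \<in> \<Omega>" for \<sigma>
    unfolding \<kappa>_def using that \<Omega>(2) by (intro DERIV_imp_deriv DERIV_cmult deriv_compose_qq f) auto
  have "((\<lambda>\<sigma>. c2pi * (c2pi * Dq f (qq \<sigma>))) has_field_derivative c2pi * (c2pi * (c2pi * Dq (Dq f) (qq \<tau>)))) (at \<tau>)"
    using \<tau> \<Omega>(2) by (intro DERIV_cmult deriv_compose_qq Dq_holomorphic f) auto
  then have "(deriv \<kappa> has_field_derivative c2pi * (c2pi * (c2pi * Dq (Dq f) (qq \<tau>)))) (at \<tau>)"
    by (rule has_field_derivative_transform_within_open[OF _ \<Omega>(1) \<tau>]) (simp add: d1)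
  then have "deriv (deriv \<kappa>) \<tau> = c2pi * (c2pi * (c2pi * Dq (Dq f) (qq \<tau>)))" by (rule DERIV_imp_deriv)
  then show ?thesis
    unfolding schwarz_def d1[OF \<tau>] by (simp add: \<kappa>_def algebra_simps power2_eq_square eval_nat_numeral)
qed

lemma has_Dq_compose_qq:
  assumes "has_Dq r d (qq \<tau>)"
  shows "((\<lambda>\<tau>. r (qq \<tau>)) has_field_derivative c2pi * d) (at \<tau>)"
proof -
  obtain r' where r': "(r has_field_derivative r') (at (qq \<tau>))" "qq \<tau> * r' = d" using assms unfolding has_Dq_def by blast
  from DERIV_chain2[OF r'(1) qq_deriv] show ?thesis by (simp add: r'(2)[symmetric] mult_ac)
qed

text \<open>Here t = r(q) with q r' = f r, so \<open>\<kappa>\<close> = 2 pi i f(q). The powers of 2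
  pi i are absorbed by the constant \<open>C\<close> of \<open>solves_in_xyI\<close>, and both sides
  of the Schwarzian equation scale by the fourth power of 2 pi i.\<close>

theorem solves_in_xy_level:
  fixes a :: real
  assumes \<Omega>: "cusp_region \<Omega>" and f: "f holomorphic_on ball 0 1" "f 0 \<noteq> 0"
    and r: "\<And>q. norm q < 1 \<Longrightarrow> q \<noteq> 0 \<Longrightarrow> has_Dq r (f q * r q) q" "\<And>q. norm q < 1 \<Longrightarrow> q \<noteq> 0 \<Longrightarrow> r q \<noteq> 0"
      "\<And>\<tau>. \<tau> \<in> UHP \<Longrightarrow> t \<tau> = r (qq \<tau>)"
    and S: "\<And>q. norm q < 1 \<Longrightarrow> q \<noteq> 0 \<Longrightarrow> f q \<noteq> 0 \<Longrightarrow> r q \<noteq> 1 \<Longrightarrow>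
        schwarz f q = 4 * (- of_real (a * (1 - a)) * r q / (r q - 1) ^ 2) * f q ^ 4"
    and F: "continuous_on (\<Omega> \<times> \<Omega>) F"
      "\<And>\<tau>1 \<tau>2. \<tau>1 \<in> \<Omega> \<Longrightarrow> \<tau>2 \<in> \<Omega> \<Longrightarrow> F (\<tau>1, \<tau>2) ^ 4 = (f (qq \<tau>1) * f (qq \<tau>2)) ^ 2"
  shows "solves_in_xy a t \<Omega> F"
proof -
  have o: "open \<Omega>" "connected \<Omega>" "\<Omega> \<subseteq> UHP" using \<Omega> by (auto simp: cusp_region_def)
  obtain \<tau>0 where nz: "\<tau>0 \<in> \<Omega>" "f (qq \<tau>0) \<noteq> 0" using cusp_region_nz[OF \<Omega> f] .
  have u: "\<tau> \<in> UHP" "norm (qq \<tau>) < 1" if "\<tau> \<in> \<Omega>" for \<tau> using that o(3) norm_qq_less_1 by auto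
  have dt: "(t has_field_derivative c2pi * f (qq \<tau>) * t \<tau>) (at \<tau>)" if \<tau>: "\<tau> \<in> \<Omega>" for \<tau>
  proof -
    have "((\<lambda>\<tau>. r (qq \<tau>)) has_field_derivative c2pi * f (qq \<tau>) * t \<tau>) (at \<tau>)"
      using has_Dq_compose_qq[OF r(1)[OF u(2)[OF \<tau>] qq_nz]] r(3)[OF u(1)[OF \<tau>]] by (simp add: mult_ac)
    then show ?thesis by (rule has_field_derivative_transform_within_open[OF _ o(1) \<tau>]) (simp add: r(3) u)
  qed
  have "qq ` \<Omega> \<subseteq> ball 0 1" using u by auto
  then have h: "(\<lambda>\<tau>. c2pi * f (qq \<tau>)) holomorphic_on \<Omega>"
    using holomorphic_on_compose_gen[OF qq_holomorphic[OF holomorphic_on_ident] f(1)] by (auto simp: o_def intro!: holomorphic_intros)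
  show ?thesis
  proof (rule solves_in_xyI[where \<kappa> = "\<lambda>\<tau>. c2pi * f (qq \<tau>)" and C = "1 / c2pi ^ 4", OF o(1,2) dt _ h nz(1) _ _ F(1)])
    fix \<tau> assume \<tau>: "\<tau> \<in> \<Omega>" "t \<tau> \<noteq> 1" "c2pi * f (qq \<tau>) \<noteq> 0"
    note r' = r(3)[OF u(1)[OF \<tau>(1)]]
    show "2 * (c2pi * f (qq \<tau>)) * deriv (deriv (\<lambda>\<tau>. c2pi * f (qq \<tau>))) \<tau> - 3 * deriv (\<lambda>\<tau>. c2pi * f (qq \<tau>)) \<tau> ^ 2 =
      4 * (- of_real (a * (1 - a)) * t \<tau> / (t \<tau> - 1) ^ 2) * (c2pi * f (qq \<tau>)) ^ 4"
      unfolding schwarz_compose_qq[OF f(1) o(1,3) \<tau>(1)] r'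
      using S[OF u(2)[OF \<tau>(1)] qq_nz] \<tau> r' by (simp add: power_mult_distrib)
  qed (use r u nz F(2) in \<open>auto simp: power_mult_distrib eval_nat_numeral\<close>)
qed

lemma holomorphic_compose_qq:
  "f holomorphic_on ball 0 1 \<Longrightarrow> \<Omega> \<subseteq> UHP \<Longrightarrow> (\<lambda>\<tau>. f (qq \<tau>)) holomorphic_on \<Omega>"
  by (rule holomorphic_on_compose_gen[of qq \<Omega> f "ball 0 1", unfolded o_def])
    (auto intro!: qq_holomorphic norm_qq_less_1)

text \<open>A pole of order at most \<open>a\<close> or \<open>b\<close> in the nome gives
  exponential growth with that rate. The cusp 0 has width p, so there the expansion is evaluated at
  (\<tau> + j)/p.\<close>

lemma cusp_growth_transforms:
  assumes p: "p = 2 \<or> p = 3" and \<phi>: "transforms p 0 \<phi>"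
    and h1: "h1 holomorphic_on ball 0 1" "\<And>\<tau>. \<tau> \<in> UHP \<Longrightarrow> \<phi> \<tau> = h1 (qq \<tau>) / qq \<tau> ^ a"
    and h2: "h2 holomorphic_on ball 0 1" "\<And>\<tau>. \<tau> \<in> UHP \<Longrightarrow> \<phi> (-1 / (of_nat p * \<tau>)) = h2 (qq \<tau>) / qq \<tau> ^ b"
  shows "cusp_growth \<phi>"
  unfolding cusp_growth_def
proof (intro ballI allI impI)
  fix A :: "int ^ 2 ^ 2" and Y :: real assume A: "A \<in> SL2Z" "Y > 0"
  have *: "\<exists>C\<ge>0. \<forall>\<tau>. Im \<tau> \<ge> Y \<longrightarrow> norm (h (qq \<tau>) / qq \<tau> ^ c) \<le> C * exp (2 * pi * real c * Im \<tau>)"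
    if h: "h holomorphic_on ball 0 1" "Y > 0" for h Y c
  proof -
    obtain C where C: "\<And>\<tau>. Im \<tau> \<ge> Y \<Longrightarrow> norm (h (qq \<tau>)) \<le> C" using disc_bounded[OF h] by blast
    have "norm (h (qq \<tau>) / qq \<tau> ^ c) \<le> \<bar>C\<bar> * exp (2 * pi * real c * Im \<tau>)" if "Im \<tau> \<ge> Y" for \<tau>
    proof -
      have "norm (h (qq \<tau>) / qq \<tau> ^ c) = norm (h (qq \<tau>)) * exp (2 * pi * real c * Im \<tau>)"
        by (simp add: norm_divide norm_power norm_qq exp_of_nat_mult[symmetric] exp_minus field_simps)
      also have "\<dots> \<le> \<bar>C\<bar> * exp (2 * pi * real c * Im \<tau>)" using C[OF that] by (intro mult_right_mono) auto
      finally show ?thesis .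
    qed
    then show ?thesis by (intro exI[of _ "\<bar>C\<bar>"]) auto
  qed
  have u: "\<tau> \<in> UHP" if "Im \<tau> \<ge> Y" for \<tau> using that A(2) by (simp add: UHP_def)
  have p0: "0 < real p" using p by auto
  from transforms_cusps[OF p \<phi> A(1)] show "\<exists>C\<ge>0. \<exists>K\<ge>0. \<forall>\<tau>. Im \<tau> \<ge> Y \<longrightarrow> norm (\<phi> (mact A \<tau>)) \<le> C * exp (K * Im \<tau>)"
  proof
    assume t: "\<forall>\<tau>\<in>UHP. \<phi> (mact A \<tau>) = autj A \<tau> ^ 0 * \<phi> \<tau>"
    obtain C where C: "C \<ge> 0" "\<And>\<tau>. Im \<tau> \<ge> Y \<Longrightarrow> norm (h1 (qq \<tau>) / qq \<tau> ^ a) \<le> C * exp (2 * pi * real a * Im \<tau>)"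
      using *[OF h1(1) A(2)] by blast
    show ?thesis
      using C(2) t u h1(2) by (intro exI[of _ C] conjI C(1) exI[of _ "2 * pi * real a"]) auto
  next
    assume "\<exists>j::int. \<forall>\<tau>\<in>UHP. \<phi> (mact A \<tau>) = autj A \<tau> ^ 0 * (\<phi> (-1 / (\<tau> + of_int j)) / (\<tau> + of_int j) ^ 0)"
    then obtain j :: int where t: "\<And>\<tau>. \<tau> \<in> UHP \<Longrightarrow> \<phi> (mact A \<tau>) = \<phi> (-1 / (\<tau> + of_int j))" by auto
    obtain C where C: "C \<ge> 0" "\<And>\<tau>. Im \<tau> \<ge> Y / p \<Longrightarrow> norm (h2 (qq \<tau>) / qq \<tau> ^ b) \<le> C * exp (2 * pi * real b * Im \<tau>)"
      using *[OF h2(1), of "Y / p"] A(2) p0 by auto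
    have "norm (\<phi> (mact A \<tau>)) \<le> C * exp (2 * pi * real b / p * Im \<tau>)" if \<tau>: "Im \<tau> \<ge> Y" for \<tau>
    proof -
      define \<sigma> where "\<sigma> = (\<tau> + of_int j) / of_nat p"
      have im: "Im \<sigma> = Im \<tau> / p" by (simp add: \<sigma>_def)
      then have s: "\<sigma> \<in> UHP" "Im \<sigma> \<ge> Y / p" using \<tau> A(2) p0 by (auto simp: UHP_def divide_right_mono)
      have "of_nat p * \<sigma> = \<tau> + of_int j" using p0 by (simp add: \<sigma>_def)
      then have "\<phi> (mact A \<tau>) = h2 (qq \<sigma>) / qq \<sigma> ^ b" using t[OF u[OF \<tau>]] h2(2)[OF s(1)] by simp
      then show ?thesis using C(2)[OF s(2)] by (simp add: im)
    qed
    then show ?thesis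
      using C(1) p0 by (intro exI[of _ C] conjI exI[of _ "2 * pi * real b / p"]) auto
  qed
qed

lemma cusp_growth_dominated:
  assumes "cusp_growth \<phi>" "\<And>\<tau>. \<tau> \<in> UHP \<Longrightarrow> norm (t \<tau>) \<le> c + d * norm (\<phi> \<tau>)" "0 \<le> c" "0 \<le> d"
  shows "cusp_growth t"
  unfolding cusp_growth_def
proof (intro ballI allI impI)
  fix A :: "int ^ 2 ^ 2" and Y :: real assume A: "A \<in> SL2Z" "Y > 0"
  obtain C K where C: "C \<ge> 0" "K \<ge> 0" "\<And>\<tau>. Im \<tau> \<ge> Y \<Longrightarrow> norm (\<phi> (mact A \<tau>)) \<le> C * exp (K * Im \<tau>)"
    using assms(1) A unfolding cusp_growth_def by meson
  have "norm (t (mact A \<tau>)) \<le> (c + d * C) * exp (K * Im \<tau>)" if \<tau>: "Im \<tau> \<ge> Y" for \<tau>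
  proof -
    have u: "\<tau> \<in> UHP" using \<tau> A(2) by (simp add: UHP_def)
    have "1 \<le> exp (K * Im \<tau>)" using C(2) \<tau> A(2) by simp
    then have "c * 1 \<le> c * exp (K * Im \<tau>)" using assms(3) by (rule mult_left_mono)
    moreover have "d * norm (\<phi> (mact A \<tau>)) \<le> d * (C * exp (K * Im \<tau>))" using C(3)[OF \<tau>] assms(4) by (rule mult_left_mono)
    ultimately show ?thesis
      using assms(2)[OF mact_autj_cocycle(2)[OF A(1) A(1) u]] by (simp add: distrib_right mult.assoc)
  qed
  then show "\<exists>C\<ge>0. \<exists>K\<ge>0. \<forall>\<tau>. Im \<tau> \<ge> Y \<longrightarrow> norm (t (mact A \<tau>)) \<le> C * exp (K * Im \<tau>)"
    using C assms(3,4) by (intro exI[of _ "c + d * C"] exI[of _ K]) auto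
qed

section \<open>Ratios of eta quotients and level 4\<close>

lemma qq_periodic: "qq (\<tau> + 1) = qq \<tau>"
  by (simp add: qq_add)

lemma t_level4_eq:
  assumes "\<tau> \<in> UHP" shows "t_level4 \<tau> = th2q (qq \<tau>) / th3q (qq \<tau>)"
  by (simp add: t_level4_def thq_theta[OF assms])

lemma theta4_holomorphic: "theta4 holomorphic_on UHP"
proof -
  have "(\<lambda>q. euler_prod q ^ 2 / euler_prod (q ^ 2)) holomorphic_on ball 0 1"
    using euler_prod_power_nz by (auto intro!: holomorphic_intros euler_prod_holomorphic)
  from holomorphic_compose_qq[OF this order_refl] show ?thesis
    by (rule holomorphic_transform) (simp add: theta_products)
qed

lemma lev2_ratio_fricke:
  assumes "\<tau> \<in> UHP"
  shows "lev2b (qq (-1 / (of_nat 2 * \<tau>))) / lev2a (qq (-1 / (of_nat 2 * \<tau>))) = lev2a (qq \<tau>) / (4096 * lev2b (qq \<tau>))"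
  unfolding lev_fricke[OF assms] using UHP_nz[OF assms] by (simp add: field_simps)

text \<open>In level 3 only a b and a^2 have known transformation laws, so the ratio b/a is written
  as a b / a^2.\<close>

lemma lev3_ratio_fricke:
  assumes "\<tau> \<in> UHP"
  shows "lev3b (qq (-1 / (of_nat 3 * \<tau>))) / lev3a (qq (-1 / (of_nat 3 * \<tau>))) = lev3a (qq \<tau>) / (729 * lev3b (qq \<tau>))"
proof -
  define \<sigma> where "\<sigma> = -1 / (of_nat 3 * \<tau>)"
  have nz: "lev3a (qq \<sigma>) \<noteq> 0" "lev3b (qq \<tau>) \<noteq> 0" "\<tau> \<noteq> 0"
    using lev_nz[OF norm_qq_less_1] UHP_fricke[OF assms, of 3] assms UHP_nz[OF assms] by (auto simp: \<sigma>_def)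
  have "lev3b (qq \<sigma>) / lev3a (qq \<sigma>) = lev3a (qq \<sigma>) * lev3b (qq \<sigma>) / lev3a (qq \<sigma>) ^ 2"
    using nz by (simp add: power2_eq_square)
  also have "\<dots> = lev3a (qq \<tau>) / (729 * lev3b (qq \<tau>))"
    unfolding \<sigma>_def lev_fricke[OF assms] using nz by (simp add: field_simps power2_eq_square)
  finally show ?thesis by (simp add: \<sigma>_def)
qed

lemma lev_ratio_pole:
  obtains h2 h3 where "h2 holomorphic_on ball 0 1" "\<And>q. norm q < 1 \<Longrightarrow> q \<noteq> 0 \<Longrightarrow> lev2a q / lev2b q = h2 q / q"
    "h3 holomorphic_on ball 0 1" "\<And>q. norm q < 1 \<Longrightarrow> q \<noteq> 0 \<Longrightarrow> lev3a q / lev3b q = h3 q / q"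
proof
  show "(\<lambda>q. lev2a q * (euler_prod q ^ 8 / euler_prod (q ^ 2) ^ 16)) holomorphic_on ball 0 1"
    "(\<lambda>q. lev3a q * (euler_prod q ^ 3 / euler_prod (q ^ 3) ^ 9)) holomorphic_on ball 0 1"
    using euler_prod_power_nz by (auto intro!: holomorphic_intros euler_prod_holomorphic lev_holomorphic)
qed (simp_all add: lev2b_def lev3b_def)

text \<open>Bounds \<^const>\<open>t_level4\<close> at the three cusps of \<open>\<Gamma>\<^sub>0(4)\<close>: it is quadratic over the functions for
  \<open>\<Gamma>\<^sub>0(2)\<close>, which has only two cusps.\<close>

lemma norm_le_quadratic:
  fixes t u :: complex
  assumes "t * v = u * (t - 1) ^ 2" "u \<noteq> 0"
  shows "norm t \<le> 3 + 3 * norm (v / u)"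
proof (cases "norm t \<le> 3")
  case False
  have "norm t - 1 \<le> norm (t - 1)" using norm_triangle_ineq2[of t 1] by simp
  \<comment> \<open>For |t| > 3 one has |t - 1| >= 2|t|/3, so the quadratic relation bounds |t| by
    9/4 times |v/u|.\<close>
  then have "(2 / 3 * norm t) ^ 2 \<le> norm (t - 1) ^ 2" using False by (intro power_mono) auto
  moreover have "norm (t - 1) ^ 2 = norm t * norm (v / u)"
    using assms by (simp add: norm_mult[symmetric] norm_power[symmetric] field_simps)
  ultimately have "norm t * (4 / 9 * norm t) \<le> norm t * norm (v / u)" by (simp add: power2_eq_square)
  then have "4 / 9 * norm t \<le> norm (v / u)" using False by (subst (asm) mult_le_cancel_left_pos) auto
  then show ?thesis using norm_ge_zero[of "v / u"] by linarith
qed (use norm_ge_zero[of "v / u"] in linarith)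

text \<open>The function t / (t - 1)^2 from the ordinary equation is invariant under the larger
  group of level 2. By Jacobi's identity t - 1 = - theta4^4 / theta3^4, and the monomials that
  remain are those of \<open>thq_lev2\<close>.\<close>

lemma thq_ratio:
  assumes q: "norm q < 1"
  shows "th2q q / th3q q - 1 = - th4q q / th3q q"
    "th2q q / th3q q / (th2q q / th3q q - 1) ^ 2 = 16 * lev2b q / lev2a q"
proof -
  show 1: "th2q q / th3q q - 1 = - th4q q / th3q q"
    using thq_nz[OF q] jacobi_quartic[OF q] by (simp add: field_simps)
  have "x / y / (- z / y) ^ 2 = x * y / z ^ 2" if "y \<noteq> 0" for x y z :: complex
    using that by (cases "z = 0") (simp_all add: divide_simps power2_eq_square)
  from this[OF thq_nz(1)[OF q]] show "th2q q / th3q q / (th2q q / th3q q - 1) ^ 2 = 16 * lev2b q / lev2a q"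
    unfolding 1 thq_lev2(1,2)[OF q, symmetric] .
qed

lemma continuous_on_Times_mult:
  fixes f :: "complex \<Rightarrow> complex"
  assumes "continuous_on \<Omega> f"
  shows "continuous_on (\<Omega> \<times> \<Omega>) (\<lambda>(\<tau>1, \<tau>2). f \<tau>1 * f \<tau>2)"
proof -
  have "continuous_on (\<Omega> \<times> \<Omega>) (\<lambda>z. f (fst z))" "continuous_on (\<Omega> \<times> \<Omega>) (\<lambda>z. f (snd z))"
    by (rule continuous_on_compose2[OF assms]; (rule continuous_on_fst continuous_on_snd, rule continuous_on_id)?; force)+
  then show ?thesis unfolding case_prod_unfold by (rule continuous_on_mult)
qed

text \<open>For a = 1/2 the constants match as 4 * (1/4) * 16 = 16, up to the sign that
  \<open>schwarz_th4q\<close> carries as well; and theta4^8 = (theta4^4)^2 gives the condition on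
  F^4.\<close>

lemma solves_level4:
  "solves_in_xy (1/2) t_level4 UHP (\<lambda>(\<tau>1, \<tau>2). theta4 \<tau>1 ^ 2 * theta4 \<tau>2 ^ 2)"
proof (rule solves_in_xy_level[OF cusp_region_UHP, where f = th4q and r = "\<lambda>q. th2q q / th3q q"])
  have "continuous_on UHP (\<lambda>\<tau>. theta4 \<tau> ^ 2)" by (intro holomorphic_on_imp_continuous_on holomorphic_intros theta4_holomorphic)
  then show "continuous_on (UHP \<times> UHP) (\<lambda>(\<tau>1, \<tau>2). theta4 \<tau>1 ^ 2 * theta4 \<tau>2 ^ 2)" by (rule continuous_on_Times_mult)
  fix q :: complex assume q: "norm q < 1" "q \<noteq> 0"
  note nz = thq_nz[OF q(1)]
  show "th2q q / th3q q \<noteq> 0" using nz q by simp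
  show "has_Dq (\<lambda>q. th2q q / th3q q) (th4q q * (th2q q / th3q q)) q"
    by (rule has_Dq_eq[OF has_Dq_log_divide[OF has_Dq_thq(1,2)[OF q(1)] nz(1)]])
      (rule arg_cong[of _ _ "\<lambda>c. c * _"], simp add: th4q_log_derivative[OF q(1)] field_simps)
  have "th4q q ^ 4 = lev2a q ^ 2" unfolding thq_lev2(1)[OF q(1), symmetric] by (simp flip: power_mult)
  then show "schwarz th4q q = 4 * (- of_real (1/2 * (1 - 1/2)) * (th2q q / th3q q) / (th2q q / th3q q - 1) ^ 2) * th4q q ^ 4"
    using thq_ratio(2)[OF q(1)] lev_nz[OF q(1)] by (simp add: schwarz_th4q[OF q(1)] power2_eq_square)
next
  fix \<tau>1 \<tau>2 assume "\<tau>1 \<in> UHP" "\<tau>2 \<in> UHP"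
  then show "(case (\<tau>1, \<tau>2) of (\<tau>1, \<tau>2) \<Rightarrow> theta4 \<tau>1 ^ 2 * theta4 \<tau>2 ^ 2) ^ 4 = (th4q (qq \<tau>1) * th4q (qq \<tau>2)) ^ 2"
    by (simp add: thq_theta[symmetric] power_mult_distrib flip: power_mult)
qed (simp_all add: thq_holomorphic thq_0 t_level4_eq)

lemma transforms_lev2:
  "transforms 2 4 (\<lambda>\<tau>. lev2a (qq \<tau>))" "transforms 2 0 (\<lambda>\<tau>. lev2a (qq \<tau>) / lev2b (qq \<tau>))"
  "transforms 2 0 (\<lambda>\<tau>. lev2b (qq \<tau>) / lev2a (qq \<tau>))" "transforms 2 2 (\<lambda>\<tau>. eis_lev 2 (qq \<tau>))"
proof -
  show "transforms 2 4 (\<lambda>\<tau>. lev2a (qq \<tau>))"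
    by (rule transformsI[where g = "\<lambda>\<tau>. 256 * lev2b (qq \<tau>)"]) (simp_all only: lev_fricke qq_periodic, auto)
  show "transforms 2 0 (\<lambda>\<tau>. lev2a (qq \<tau>) / lev2b (qq \<tau>))"
    by (rule transformsI[where g = "\<lambda>\<tau>. 4096 * lev2b (qq \<tau>) / lev2a (qq \<tau>)"])
      (simp_all only: lev_fricke qq_periodic, auto simp: UHP_nz)
  show "transforms 2 0 (\<lambda>\<tau>. lev2b (qq \<tau>) / lev2a (qq \<tau>))"
    by (rule transformsI[where g = "\<lambda>\<tau>. lev2a (qq \<tau>) / (4096 * lev2b (qq \<tau>))"])
      (simp_all only: lev2_ratio_fricke qq_periodic, auto)
  show "transforms 2 2 (\<lambda>\<tau>. eis_lev 2 (qq \<tau>))"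
    by (rule transformsI[where g = "\<lambda>\<tau>. - 2 * eis_lev 2 (qq \<tau>)"])
      (simp_all only: eis_lev_fricke qq_periodic, auto)
qed

lemma transforms_lev3:
  "transforms 3 0 (\<lambda>\<tau>. lev3b (qq \<tau>) / lev3a (qq \<tau>))" "transforms 3 2 (\<lambda>\<tau>. eis_lev 3 (qq \<tau>))"
proof -
  show "transforms 3 0 (\<lambda>\<tau>. lev3b (qq \<tau>) / lev3a (qq \<tau>))"
    by (rule transformsI[where g = "\<lambda>\<tau>. lev3a (qq \<tau>) / (729 * lev3b (qq \<tau>))"])
      (simp_all only: lev3_ratio_fricke qq_periodic, auto)
  show "transforms 3 2 (\<lambda>\<tau>. eis_lev 3 (qq \<tau>))"
    by (rule transformsI[where g = "\<lambda>\<tau>. - 3 * eis_lev 3 (qq \<tau>)"])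
      (simp_all only: eis_lev_fricke qq_periodic, auto)
qed

text \<open>Inversion is the Fricke involution at \<tau>/p; expansions at the cusp 0 are therefore
  in q^(1/p).\<close>

lemma inversion_half:
  fixes p :: nat
  assumes "\<tau> \<in> UHP" "0 < p"
  shows "-1 / \<tau> = -1 / (of_nat p * (\<tau> / of_nat p))" "\<tau> / of_nat p \<in> UHP"
  using assms by (auto simp: UHP_def)

lemma i_UHP: "\<i> \<in> UHP"
  by (simp add: UHP_def)

lemma bimodular_level4:
  "bimodular_form (Gamma0 4) (Gamma0 4) 1 1 (\<lambda>(\<tau>1, \<tau>2). theta4 \<tau>1 ^ 2 * theta4 \<tau>2 ^ 2)"
proof -
  have "bimodular_form (Gamma0 4) (Gamma0 4) 1 1 (\<lambda>(\<tau>1, \<tau>2). 1 * (theta4 \<tau>1 ^ 2) * (theta4 \<tau>2 ^ 2))"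
  \<comment> \<open>The fourth power of theta4^2 is the level 2 form \<open>lev2a\<close>, so the
    form on \<open>Gamma0 4\<close> is treated as a root of a form on \<open>Gamma0 2\<close>; 16 =
    256 / 2^4 comes from the Fricke law at \<tau>/2.\<close>
  proof (rule bimodular_formI[where p = 2 and m = 4 and \<phi> = "\<lambda>\<tau>. lev2a (qq \<tau>)" and ?h1.0 = lev2a and ?h2.0 = "\<lambda>q. 16 * lev2b q" and ?\<tau>0.0 = \<i>])
    show "(theta4 \<tau> ^ 2) ^ 4 = lev2a (qq \<tau>)" if "\<tau> \<in> UHP" for \<tau>
      unfolding thq_lev2(1)[OF norm_qq_less_1[OF that], symmetric] thq_theta(3)[OF that, symmetric] by (simp flip: power_mult)
    then have "(theta4 \<i> ^ 2) ^ 4 \<noteq> 0" using lev_nz(1)[OF norm_qq_less_1[OF i_UHP]] i_UHP by simp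
    then show "theta4 \<i> ^ 2 \<noteq> 0" by auto
    show "lev2a (qq (-1 / \<tau>)) = \<tau> ^ (1 * 4) * (16 * lev2b (qq (\<tau> / of_nat 2)))" if "\<tau> \<in> UHP" for \<tau>
      unfolding inversion_half(1)[OF that, of 2, simplified zero_less_numeral, OF TrueI]
        lev_fricke(1)[OF inversion_half(2)[OF that, of 2, simplified zero_less_numeral, OF TrueI]]
      by (simp add: power_divide)
  qed (use transforms_lev2(1) in \<open>auto intro!: holomorphic_intros theta4_holomorphic lev_holomorphic i_UHP\<close>)
  then show ?thesis by simp
qed

lemma coordinates_level4: "coordinates_modular (Gamma0 4) t_level4"
proof (rule coordinates_modularI[of _ _ \<i>])
  have "(\<lambda>\<tau>. th2q (qq \<tau>) / th3q (qq \<tau>)) holomorphic_on UHP"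
    using thq_nz norm_qq_less_1 by (intro holomorphic_intros holomorphic_compose_qq thq_holomorphic) auto
  then show "t_level4 holomorphic_on UHP" by (rule holomorphic_transform) (simp add: t_level4_eq)
  \<comment> \<open>The involution of level 4 is composed of two of level 2: t is 16
    \<open>lev2b (q ^ 2) / lev2b q\<close>, and -1/(4\<tau>) and -1/(2\<tau>) are the level 2 images
    of 2\<tau> and \<tau>. The result is 1 - t.\<close>
  have W: "t_level4 (-1 / (of_nat 4 * \<tau>)) = \<tau> ^ 0 * (th4q (qq \<tau>) / th3q (qq \<tau>))" if \<tau>: "\<tau> \<in> UHP" for \<tau>
  proof -
    have r: "th2q q / th3q q = 16 * lev2b (q ^ 2) / lev2b q" if "norm q < 1" "q \<noteq> 0" for q
    proof -
      have "th2q q / th3q q = th2q q ^ 2 / (th2q q * th3q q)" using thq_nz[OF that(1)] that by (simp add: power2_eq_square)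
      then show ?thesis unfolding thq_lev2[OF that(1)] by simp
    qed
    have r': "th4q q / th3q q = lev2a q / lev2a (q ^ 2)" if "norm q < 1" "q \<noteq> 0" for q
    proof -
      have "th4q q / th3q q = th4q q ^ 2 / (th3q q * th4q q)" using thq_nz[OF that(1)] that by (simp add: power2_eq_square)
      then show ?thesis unfolding thq_lev2[OF that(1)] by simp
    qed
    have 2: "of_nat 2 * \<tau> \<in> UHP" by (rule UHP_mult_nat[OF \<tau>]) simp
    have e: "-1 / (of_nat 4 * \<tau>) = -1 / (of_nat 2 * (of_nat 2 * \<tau>))" by simp
    have e': "qq (-1 / (of_nat 4 * \<tau>)) ^ 2 = qq (-1 / (of_nat 2 * \<tau>))"
      unfolding qq_mult_of_nat[symmetric] by simp
    have "t_level4 (-1 / (of_nat 4 * \<tau>)) = 16 * lev2b (qq (-1 / (of_nat 4 * \<tau>)) ^ 2) / lev2b (qq (-1 / (of_nat 4 * \<tau>)))"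
      unfolding t_level4_eq[OF UHP_fricke[OF \<tau>, of 4, simplified zero_less_numeral, OF TrueI]]
      by (rule r) (use UHP_fricke[OF \<tau>, of 4] norm_qq_less_1 in auto)
    also have "\<dots> = lev2a (qq \<tau>) / lev2a (qq \<tau> ^ 2)"
      unfolding e' lev_fricke(2)[OF \<tau>] unfolding e lev_fricke(2)[OF 2] unfolding qq_mult_of_nat
      using UHP_nz[OF \<tau>] by (simp add: power_mult_distrib)
    finally show ?thesis using r'[OF norm_qq_less_1[OF \<tau>] qq_nz] by simp
  qed
  have "transforms 4 0 t_level4"
    by (rule transformsI[where g = "\<lambda>\<tau>. th4q (qq \<tau>) / th3q (qq \<tau>)", OF _ _ _ _ _ W])
      (use UHP_add_int(1)[of _ 1] in \<open>auto simp: qq_periodic t_level4_eq\<close>)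
  then show "t_level4 (mact A \<tau>) = t_level4 \<tau>" if "A \<in> Gamma0 4" "\<tau> \<in> UHP" for A \<tau>
    using that by (simp add: transforms_def)
  obtain h2 where h2: "h2 holomorphic_on ball 0 1" "\<And>q. norm q < 1 \<Longrightarrow> q \<noteq> 0 \<Longrightarrow> lev2a q / lev2b q = h2 q / q"
    using lev_ratio_pole by metis
  have c: "cusp_growth (\<lambda>\<tau>. lev2a (qq \<tau>) / lev2b (qq \<tau>))"
  proof (rule cusp_growth_transforms[OF disjI1[OF refl] transforms_lev2(2) h2(1), where a = 1 and b = 0 and ?h2.0 = "\<lambda>q. 4096 * lev2b q / lev2a q"])
    show "lev2a (qq \<tau>) / lev2b (qq \<tau>) = h2 (qq \<tau>) / qq \<tau> ^ 1" if "\<tau> \<in> UHP" for \<tau>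
      using h2(2)[OF norm_qq_less_1[OF that]] by simp
    show "lev2a (qq (-1 / (of_nat 2 * \<tau>))) / lev2b (qq (-1 / (of_nat 2 * \<tau>))) = 4096 * lev2b (qq \<tau>) / lev2a (qq \<tau>) / qq \<tau> ^ 0" if "\<tau> \<in> UHP" for \<tau>
      unfolding lev_fricke[OF that] using UHP_nz[OF that] by simp
  qed (use lev_nz in \<open>auto intro!: holomorphic_intros lev_holomorphic\<close>)
  show "cusp_growth t_level4"
  proof (rule cusp_growth_dominated[OF c, of _ 3 "3 / 16"])
    fix \<tau> assume \<tau>: "\<tau> \<in> UHP"
    define q where "q = qq \<tau>"
    have q: "norm q < 1" "q \<noteq> 0" using norm_qq_less_1[OF \<tau>] by (auto simp: q_def)
    have nz: "lev2a q \<noteq> 0" "lev2b q \<noteq> 0" using lev_nz[OF q(1)] q(2) by auto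
    have "th2q q / th3q q - 1 \<noteq> 0" unfolding thq_ratio(1)[OF q(1)] using thq_nz[OF q(1)] by simp
    moreover have "x * A = B * (x - 1) ^ 2" if "x / (x - 1) ^ 2 = B / A" "x - 1 \<noteq> 0" "A \<noteq> 0" for x A B :: complex
      using that by (simp add: frac_eq_eq)
    ultimately have "t_level4 \<tau> * lev2a q = (16 * lev2b q) * (t_level4 \<tau> - 1) ^ 2"
      using thq_ratio(2)[OF q(1)] nz unfolding t_level4_eq[OF \<tau>] q_def[symmetric] by blast
    from norm_le_quadratic[OF this] show "norm (t_level4 \<tau>) \<le> 3 + 3 / 16 * norm (lev2a (qq \<tau>) / lev2b (qq \<tau>))"
      using nz by (simp add: q_def norm_divide norm_mult)
  qed auto
  note q = norm_qq_less_1[OF i_UHP]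
  show "t_level4 \<i> \<noteq> 0" using thq_nz[OF q] by (simp add: t_level4_eq[OF i_UHP])
  show "t_level4 \<i> \<noteq> 1" using thq_ratio(1)[OF q] thq_nz[OF q] by (auto simp: t_level4_eq[OF i_UHP])
qed (rule i_UHP)

section \<open>Levels 3 and 2\<close>

lemma t_level_eq:
  assumes "\<tau> \<in> UHP"
  shows "t_level2 \<tau> = - 64 * (lev2b (qq \<tau>) / lev2a (qq \<tau>))" "t_level3 \<tau> = - 27 * (lev3b (qq \<tau>) / lev3a (qq \<tau>))"
proof -
  define x where "x = qpow (1/24) \<tau>"
  have x: "x \<noteq> 0" "x ^ 24 = qq \<tau>" by (simp_all add: x_def qpow_24_power)
  note n = norm_qq_less_1[OF assms]
  have nz: "euler_prod (qq \<tau>) \<noteq> 0" "euler_prod (qq \<tau> ^ 2) \<noteq> 0" "euler_prod (qq \<tau> ^ 3) \<noteq> 0"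
    using euler_prod_nz[OF n] euler_prod_power_nz[OF n] by auto
  have e: "dedekind_eta \<tau> = x * euler_prod (qq \<tau>)" "dedekind_eta (2 * \<tau>) = x ^ 2 * euler_prod (qq \<tau> ^ 2)"
    "dedekind_eta (3 * \<tau>) = x ^ 3 * euler_prod (qq \<tau> ^ 3)"
    using qpow_24_mult[of 2 \<tau>] qpow_24_mult[of 3 \<tau>] qq_mult_of_nat[of 2 \<tau>] qq_mult_of_nat[of 3 \<tau>]
    by (simp_all add: dedekind_eta_eq x_def)
  show "t_level2 \<tau> = - 64 * (lev2b (qq \<tau>) / lev2a (qq \<tau>))" "t_level3 \<tau> = - 27 * (lev3b (qq \<tau>) / lev3a (qq \<tau>))"
    unfolding t_level2_def t_level3_def e lev2a_def lev2b_def lev3a_def lev3b_def x(2)[symmetric]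
    using nz x(1) by (simp_all add: divide_simps power_mult_distrib flip: power_mult power_add)
qed

lemma E_level_eq:
  assumes "\<tau> \<in> UHP"
  shows "E_level2 \<tau> = eis_lev 2 (qq \<tau>)" "E_level3 \<tau> = eis_lev 3 (qq \<tau>)"
proof -
  have "2 * \<tau> \<in> UHP" "3 * \<tau> \<in> UHP" using assms by (auto simp: UHP_def)
  then show "E_level2 \<tau> = eis_lev 2 (qq \<tau>)" "E_level3 \<tau> = eis_lev 3 (qq \<tau>)"
    using qq_mult_of_nat[of 2 \<tau>] qq_mult_of_nat[of 3 \<tau>] assms
    by (simp_all add: E_level2_def E_level3_def eis_lev_def Eis2_eq)
qed

lemma lev_ratio:
  assumes q: "norm q < 1"
  shows "- 64 * (lev2b q / lev2a q) / (- 64 * (lev2b q / lev2a q) - 1) ^ 2 = - 64 * lev2a q * lev2b q / eis_lev 2 q ^ 4"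
    "- 27 * (lev3b q / lev3a q) / (- 27 * (lev3b q / lev3a q) - 1) ^ 2 = - 27 * lev3a q * lev3b q / (eis_lev 3 q / 2) ^ 3"
    "- 64 * (lev2b q / lev2a q) - 1 = - (eis_lev 2 q ^ 2) / lev2a q"
    "- 27 * (lev3b q / lev3a q) - 1 = - lev3c q / lev3a q"
proof -
  \<comment> \<open>For d = 0, which happens at the zeros of \<open>eis_lev\<close>, both sides are
    0 by division by zero.\<close>
  have *: "c * (b / a) / (- d / a) ^ 2 = c * a * b / d ^ 2" if "a \<noteq> 0" for a b c d :: complex
    using that by (cases "d = 0") (simp_all add: divide_simps power2_eq_square)
  show 2: "- 64 * (lev2b q / lev2a q) - 1 = - (eis_lev 2 q ^ 2) / lev2a q"
    unfolding eis_lev2_sq[OF q] using lev_nz(1)[OF q] by (simp add: field_simps)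
  show 3: "- 27 * (lev3b q / lev3a q) - 1 = - lev3c q / lev3a q"
    using lev_nz(2)[OF q] by (simp add: field_simps)
  show "- 64 * (lev2b q / lev2a q) / (- 64 * (lev2b q / lev2a q) - 1) ^ 2 = - 64 * lev2a q * lev2b q / eis_lev 2 q ^ 4"
    unfolding 2 *[OF lev_nz(1)[OF q]] by (simp flip: power_mult)
  show "- 27 * (lev3b q / lev3a q) / (- 27 * (lev3b q / lev3a q) - 1) ^ 2 = - 27 * lev3a q * lev3b q / (eis_lev 3 q / 2) ^ 3"
    unfolding 3 *[OF lev_nz(2)[OF q]] lev3_identities(1)[OF q] ..
qed

text \<open>The factor 1/2 in F is a product of two factors 2^(-1/2), because here
  \<open>\<kappa>\<close> / (2 pi i) is half of \<open>E_level3\<close>. The constants match as 4 *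
  (2/9) * 27 = 24, the factor in \<open>schwarz_eis_lev3\<close>.\<close>

lemma solves_level3:
  assumes g: "root_branch 2 E_level3 \<Omega> g"
  shows "solves_in_xy (1/3) t_level3 \<Omega> (\<lambda>(\<tau>1, \<tau>2). 1/2 * g \<tau>1 * g \<tau>2)"
proof -
  have \<Omega>: "cusp_region \<Omega>" "\<Omega> \<subseteq> UHP" and h: "g holomorphic_on \<Omega>" and sq: "\<And>\<tau>. \<tau> \<in> \<Omega> \<Longrightarrow> g \<tau> ^ 2 = E_level3 \<tau>"
    using g by (auto simp: root_branch_def cusp_region_def)
  show ?thesis
  proof (rule solves_in_xy_level[OF \<Omega>(1), where f = "\<lambda>q. eis_lev 3 q / 2" and r = "\<lambda>q. - 27 * (lev3b q / lev3a q)"])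
    show "continuous_on (\<Omega> \<times> \<Omega>) (\<lambda>(\<tau>1, \<tau>2). 1/2 * g \<tau>1 * g \<tau>2)"
      using continuous_on_mult_left[OF continuous_on_Times_mult[OF holomorphic_on_imp_continuous_on[OF h]], of "1/2"]
      by (simp add: case_prod_unfold mult_ac)
    fix q :: complex assume q: "norm q < 1" "q \<noteq> 0"
    show "- 27 * (lev3b q / lev3a q) \<noteq> 0" using lev_nz[OF q(1)] q(2) by simp
    have "has_Dq (\<lambda>q. lev3b q / lev3a q) (eis_lev 3 q / 2 * (lev3b q / lev3a q)) q"
      by (rule has_Dq_eq[OF has_Dq_log_divide[OF has_Dq_lev(4,3)[OF q(1)] lev_nz(2)[OF q(1)]]])
        (rule arg_cong[of _ _ "\<lambda>c. c * _"], simp add: eis_lev_def field_simps)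
    then show "has_Dq (\<lambda>q. - 27 * (lev3b q / lev3a q)) (eis_lev 3 q / 2 * (- 27 * (lev3b q / lev3a q))) q"
      by (rule has_Dq_eq[OF has_Dq_cmult]) (simp only: mult_ac)
    assume nz: "eis_lev 3 q / 2 \<noteq> 0"
    define a b e where "a = lev3a q" and "b = lev3b q" and "e = eis_lev 3 q / 2"
    have "schwarz (\<lambda>q. eis_lev 3 q / 2) q = 4 * (- (2/9) * (- 27 * a * b / e ^ 3)) * e ^ 4"
    proof -
      have e: "e \<noteq> 0" "eis_lev 3 q \<noteq> 0" using nz by (auto simp: e_def)
      have "schwarz (\<lambda>q. eis_lev 3 q / 2) q = 24 * a * b * e"
        unfolding schwarz_eis_lev3[OF q(1) e(2)] a_def b_def e_def ..
      also have "\<dots> = 4 * (- (2/9) * (- 27 * a * b / e ^ 3)) * e ^ 4"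
        using e(1) by (simp add: power3_eq_cube power4_eq_xxxx)
      finally show ?thesis .
    qed
    also have "\<dots> = 4 * (- of_real (1/3 * (1 - 1/3)) * (- 27 * (lev3b q / lev3a q)) / (- 27 * (lev3b q / lev3a q) - 1) ^ 2) * e ^ 4"
      unfolding a_def b_def e_def lev_ratio(2)[OF q(1), symmetric] by simp
    finally show "schwarz (\<lambda>q. eis_lev 3 q / 2) q =
        4 * (- of_real (1/3 * (1 - 1/3)) * (- 27 * (lev3b q / lev3a q)) / (- 27 * (lev3b q / lev3a q) - 1) ^ 2) * (eis_lev 3 q / 2) ^ 4"
      unfolding e_def .
  next
    fix \<tau>1 \<tau>2 assume t: "\<tau>1 \<in> \<Omega>" "\<tau>2 \<in> \<Omega>"
    have "(case (\<tau>1, \<tau>2) of (\<tau>1, \<tau>2) \<Rightarrow> 1/2 * g \<tau>1 * g \<tau>2) ^ 4 = (1/2) ^ 4 * (g \<tau>1 ^ 2) ^ 2 * (g \<tau>2 ^ 2) ^ 2"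
      by (simp add: power_mult_distrib power_divide flip: power_mult)
    also have "\<dots> = (1/2) ^ 4 * eis_lev 3 (qq \<tau>1) ^ 2 * eis_lev 3 (qq \<tau>2) ^ 2"
      unfolding sq[OF t(1)] sq[OF t(2)] using t \<Omega>(2) by (simp add: E_level_eq subsetD)
    finally show "(case (\<tau>1, \<tau>2) of (\<tau>1, \<tau>2) \<Rightarrow> 1/2 * g \<tau>1 * g \<tau>2) ^ 4 = (eis_lev 3 (qq \<tau>1) / 2 * (eis_lev 3 (qq \<tau>2) / 2)) ^ 2"
      by (simp add: power2_eq_square eval_nat_numeral)
  qed (auto simp: eis_lev_0 t_level_eq intro!: holomorphic_intros eis_lev_holomorphic)
qed

text \<open>Here a(1 - a) = 3/16, and 4 * (3/16) * 64 = 48 is the factor in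
  \<open>schwarz_eis_lev2\<close>.\<close>

lemma solves_level2:
  assumes g: "root_branch 2 E_level2 \<Omega> g"
  shows "solves_in_xy (1/4) t_level2 \<Omega> (\<lambda>(\<tau>1, \<tau>2). g \<tau>1 * g \<tau>2)"
proof -
  have \<Omega>: "cusp_region \<Omega>" "\<Omega> \<subseteq> UHP" and h: "g holomorphic_on \<Omega>" and sq: "\<And>\<tau>. \<tau> \<in> \<Omega> \<Longrightarrow> g \<tau> ^ 2 = E_level2 \<tau>"
    using g by (auto simp: root_branch_def cusp_region_def)
  show ?thesis
  proof (rule solves_in_xy_level[OF \<Omega>(1), where f = "eis_lev 2" and r = "\<lambda>q. - 64 * (lev2b q / lev2a q)"])
    show "continuous_on (\<Omega> \<times> \<Omega>) (\<lambda>(\<tau>1, \<tau>2). g \<tau>1 * g \<tau>2)"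
      by (rule continuous_on_Times_mult[OF holomorphic_on_imp_continuous_on[OF h]])
    fix q :: complex assume q: "norm q < 1" "q \<noteq> 0"
    show "- 64 * (lev2b q / lev2a q) \<noteq> 0" using lev_nz[OF q(1)] q(2) by simp
    have "has_Dq (\<lambda>q. lev2b q / lev2a q) (eis_lev 2 q * (lev2b q / lev2a q)) q"
      by (rule has_Dq_eq[OF has_Dq_log_divide[OF has_Dq_lev(2,1)[OF q(1)] lev_nz(1)[OF q(1)]]])
        (rule arg_cong[of _ _ "\<lambda>c. c * _"], simp add: eis_lev_def field_simps)
    then show "has_Dq (\<lambda>q. - 64 * (lev2b q / lev2a q)) (eis_lev 2 q * (- 64 * (lev2b q / lev2a q))) q"
      by (rule has_Dq_eq[OF has_Dq_cmult]) (simp only: mult_ac)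
    assume nz: "eis_lev 2 q \<noteq> 0"
    have "schwarz (eis_lev 2) q = 4 * (- (3/16) * (- 64 * lev2a q * lev2b q / eis_lev 2 q ^ 4)) * eis_lev 2 q ^ 4"
      using nz by (simp add: schwarz_eis_lev2[OF q(1)])
    also have "\<dots> = 4 * (- of_real (1/4 * (1 - 1/4)) * (- 64 * (lev2b q / lev2a q)) / (- 64 * (lev2b q / lev2a q) - 1) ^ 2) * eis_lev 2 q ^ 4"
      unfolding lev_ratio(1)[OF q(1), symmetric] by simp
    finally show "schwarz (eis_lev 2) q =
        4 * (- of_real (1/4 * (1 - 1/4)) * (- 64 * (lev2b q / lev2a q)) / (- 64 * (lev2b q / lev2a q) - 1) ^ 2) * eis_lev 2 q ^ 4" .
  next
    fix \<tau>1 \<tau>2 assume t: "\<tau>1 \<in> \<Omega>" "\<tau>2 \<in> \<Omega>"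
    have "(case (\<tau>1, \<tau>2) of (\<tau>1, \<tau>2) \<Rightarrow> g \<tau>1 * g \<tau>2) ^ 4 = (g \<tau>1 ^ 2) ^ 2 * (g \<tau>2 ^ 2) ^ 2"
      by (simp add: power_mult_distrib flip: power_mult)
    also have "\<dots> = eis_lev 2 (qq \<tau>1) ^ 2 * eis_lev 2 (qq \<tau>2) ^ 2"
      unfolding sq[OF t(1)] sq[OF t(2)] using t \<Omega>(2) by (simp add: E_level_eq subsetD)
    finally show "(case (\<tau>1, \<tau>2) of (\<tau>1, \<tau>2) \<Rightarrow> g \<tau>1 * g \<tau>2) ^ 4 = (eis_lev 2 (qq \<tau>1) * eis_lev 2 (qq \<tau>2)) ^ 2"
      by (simp add: power_mult_distrib)
  qed (auto simp: eis_lev_0 t_level_eq intro!: eis_lev_holomorphic)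
qed

lemma eis_lev_inversion:
  assumes "\<tau> \<in> UHP" "0 < p"
  shows "eis_lev p (qq (-1 / \<tau>)) = \<tau> ^ 2 * (- (1 / of_nat p) * eis_lev p (qq (\<tau> / of_nat p)))"
  unfolding inversion_half(1)[OF assms] eis_lev_fricke[OF inversion_half(2)[OF assms] assms(2)]
  using assms(2) by (simp add: power_divide power2_eq_square)

lemma Gamma0_UHP: "A \<in> Gamma0 N \<Longrightarrow> \<tau> \<in> UHP \<Longrightarrow> mact A \<tau> \<in> UHP"
  by (rule mact_autj_cocycle(2)[OF Gamma0_SL2Z Gamma0_SL2Z])

lemma E_level_transforms: "transforms 2 2 E_level2" "transforms 3 2 E_level3"
  using transforms_lev2(4) transforms_lev3(2) by (auto simp: transforms_def E_level_eq Gamma0_UHP)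

lemma E_level_holomorphic: "E_level2 holomorphic_on UHP" "E_level3 holomorphic_on UHP"
proof -
  have "(\<lambda>\<tau>. eis_lev 2 (qq \<tau>)) holomorphic_on UHP" "(\<lambda>\<tau>. eis_lev 3 (qq \<tau>)) holomorphic_on UHP"
    by (intro holomorphic_compose_qq eis_lev_holomorphic; simp)+
  then show "E_level2 holomorphic_on UHP" "E_level3 holomorphic_on UHP"
    by (auto intro: holomorphic_transform simp: E_level_eq)
qed

lemma bimodular_level3:
  assumes g: "root_branch 2 E_level3 UHP g"
  shows "bimodular_form (Gamma0 3) (Gamma0 3) 1 1 (\<lambda>(\<tau>1, \<tau>2). 1/2 * g \<tau>1 * g \<tau>2)"
proof -
  have h: "g holomorphic_on UHP" and sq: "\<And>\<tau>. \<tau> \<in> UHP \<Longrightarrow> g \<tau> ^ 2 = E_level3 \<tau>"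
    using g by (auto simp: root_branch_def cusp_region_def)
  have "eis_lev 3 0 \<noteq> 0" by (simp add: eis_lev_0)
  then obtain \<tau>0 where nz: "\<tau>0 \<in> UHP" "eis_lev 3 (qq \<tau>0) \<noteq> 0"
    using cusp_region_nz[OF cusp_region_UHP eis_lev_holomorphic[of 3]] by auto
  then have nz': "g \<tau>0 \<noteq> 0" using sq[OF nz(1)] by (auto simp: E_level_eq)
  show ?thesis
    by (rule bimodular_formI[where p = 3 and m = 2 and \<phi> = E_level3 and ?h1.0 = "eis_lev 3" and ?h2.0 = "\<lambda>q. - (1 / of_nat 3) * eis_lev 3 q",
          OF _ _ h sq _ _ nz(1) nz'])
      (use E_level_transforms(2) eis_lev_inversion[of _ 3] UHP_inversion(1) in
        \<open>auto simp: E_level_eq intro!: eis_lev_holomorphic holomorphic_intros\<close>)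
qed

lemma bimodular_level2:
  "bimodular_form (Gamma0 2) (Gamma0 2) 2 2 (\<lambda>(\<tau>1, \<tau>2). E_level2 \<tau>1 * E_level2 \<tau>2)"
proof -
  have "eis_lev 2 0 \<noteq> 0" by (simp add: eis_lev_0)
  then obtain \<tau>0 where nz: "\<tau>0 \<in> UHP" "E_level2 \<tau>0 \<noteq> 0"
    using cusp_region_nz[OF cusp_region_UHP eis_lev_holomorphic[of 2]] by (auto simp: E_level_eq)
  have "bimodular_form (Gamma0 2) (Gamma0 2) 2 2 (\<lambda>(\<tau>1, \<tau>2). 1 * E_level2 \<tau>1 * E_level2 \<tau>2)"
    by (rule bimodular_formI[where p = 2 and m = 1 and \<phi> = E_level2 and ?h1.0 = "eis_lev 2" and ?h2.0 = "\<lambda>q. - (1 / of_nat 2) * eis_lev 2 q",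
          OF _ _ E_level_holomorphic(1) _ _ _ nz])
      (use E_level_transforms(1) eis_lev_inversion[of _ 2] UHP_inversion(1) in
        \<open>auto simp: E_level_eq intro!: eis_lev_holomorphic holomorphic_intros\<close>)
  then show ?thesis by simp
qed

text \<open>Both sides have the same square, as the square of \<open>g\<close> is a form on the
  whole half-plane; the sign that remains is the root of unity.\<close>

lemma transforms_up_to_root_level2:
  assumes g: "root_branch 2 E_level2 \<Omega> g"
  shows "transforms_up_to_root 2 (Gamma0 2) (Gamma0 2) 1 1 (\<Omega> \<times> \<Omega>) (\<lambda>(\<tau>1, \<tau>2). g \<tau>1 * g \<tau>2)"
  unfolding transforms_up_to_root_def
proof (intro ballI allI impI)
  have \<Omega>: "\<Omega> \<subseteq> UHP" and sq: "\<And>\<tau>. \<tau> \<in> \<Omega> \<Longrightarrow> g \<tau> ^ 2 = E_level2 \<tau>"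
    using g by (auto simp: root_branch_def cusp_region_def)
  fix A B :: "int ^ 2 ^ 2" and \<tau>1 \<tau>2
  assume AB: "A \<in> Gamma0 2" "B \<in> Gamma0 2" and t: "(\<tau>1, \<tau>2) \<in> \<Omega> \<times> \<Omega>" "(mact A \<tau>1, mact B \<tau>2) \<in> \<Omega> \<times> \<Omega>"
  define x where "x = autj A \<tau>1 * autj B \<tau>2 * (g \<tau>1 * g \<tau>2)"
  have "(g (mact A \<tau>1) * g (mact B \<tau>2)) ^ 2 = E_level2 (mact A \<tau>1) * E_level2 (mact B \<tau>2)"
    using t sq by (simp add: power_mult_distrib)
  also have "\<dots> = x ^ 2"
  proof -
    have "E_level2 (mact C \<tau>) = autj C \<tau> ^ 2 * g \<tau> ^ 2" if "C \<in> Gamma0 2" "\<tau> \<in> \<Omega>" for C \<tau>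
      using E_level_transforms(1) that \<Omega> sq by (auto simp: transforms_def)
    then show ?thesis using AB t by (simp add: x_def power_mult_distrib)
  qed
  finally have "g (mact A \<tau>1) * g (mact B \<tau>2) = x \<or> g (mact A \<tau>1) * g (mact B \<tau>2) = - x"
    by (simp add: power2_eq_iff)
  then show "\<exists>\<epsilon>. \<epsilon> ^ 2 = 1 \<and> (case (mact A \<tau>1, mact B \<tau>2) of (\<tau>1, \<tau>2) \<Rightarrow> g \<tau>1 * g \<tau>2) =
      \<epsilon> * autj A \<tau>1 ^ 1 * autj B \<tau>2 ^ 1 * (case (\<tau>1, \<tau>2) of (\<tau>1, \<tau>2) \<Rightarrow> g \<tau>1 * g \<tau>2)"
  proof
    assume "g (mact A \<tau>1) * g (mact B \<tau>2) = x"
    then show ?thesis by (intro exI[of _ 1]) (simp add: x_def mult_ac)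
  next
    assume "g (mact A \<tau>1) * g (mact B \<tau>2) = - x"
    then show ?thesis by (intro exI[of _ "- 1"]) (simp add: x_def mult_ac)
  qed
qed

text \<open>The quotient b/a vanishes at infinity and has at most a simple pole at the cusp 0, as
  \<open>W\<close> and the expansion of a/b show; so both cusps satisfy the growth
  condition.\<close>

lemma coordinates_levelI:
  assumes p: "p = 2 \<or> p = 3" and t: "\<And>\<tau>. \<tau> \<in> UHP \<Longrightarrow> t \<tau> = c * (b (qq \<tau>) / a (qq \<tau>))" "c \<noteq> 0"
    and ab: "a holomorphic_on ball 0 1" "b holomorphic_on ball 0 1" "\<And>q. norm q < 1 \<Longrightarrow> a q \<noteq> 0"
      "\<And>q. norm q < 1 \<Longrightarrow> q \<noteq> 0 \<Longrightarrow> b q \<noteq> 0" "b 0 = 0"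
    and tr: "transforms p 0 (\<lambda>\<tau>. b (qq \<tau>) / a (qq \<tau>))"
    and W: "\<And>\<tau>. \<tau> \<in> UHP \<Longrightarrow> b (qq (-1 / (of_nat p * \<tau>))) / a (qq (-1 / (of_nat p * \<tau>))) = a (qq \<tau>) / (d * b (qq \<tau>))"
    and h: "h holomorphic_on ball 0 1" "\<And>q. norm q < 1 \<Longrightarrow> q \<noteq> 0 \<Longrightarrow> a q / b q = h q / q"
  shows "coordinates_modular (Gamma0 p) t"
proof -
  have n: "norm (qq \<tau>) < 1" if "\<tau> \<in> UHP" for \<tau> using norm_qq_less_1[OF that] .
  have r: "(\<lambda>q. b q / a q) holomorphic_on ball 0 1" using ab by (intro holomorphic_intros) auto
  have h2: "(\<lambda>q. 1 / d * h q) holomorphic_on ball 0 1" by (intro holomorphic_intros h)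
  have tr': "transforms p 0 t"
    using tr t(1) unfolding transforms_def by (simp add: Gamma0_UHP del: times_divide_eq_right)
  have "((\<lambda>\<tau>. c * (b (qq \<tau>) / a (qq \<tau>))) \<longlongrightarrow> c * (b 0 / a 0)) at_i_inf"
    by (intro tendsto_intros tendsto_at_i_inf_qq ab) (use ab(3) in simp)
  then have "\<forall>\<^sub>F \<tau> in at_i_inf. c * (b (qq \<tau>) / a (qq \<tau>)) \<noteq> 1"
    by (rule tendsto_imp_eventually_ne) (simp add: ab(5))
  from eventually_happens'[OF at_i_inf_nz eventually_conj[OF eventually_UHP this]]
  obtain \<tau>0 where \<tau>0: "\<tau>0 \<in> UHP" "t \<tau>0 \<noteq> 1" using t(1) by auto
  show ?thesis
  proof (rule coordinates_modularI[of t _ \<tau>0, OF _ _ _ \<tau>0(1) _ \<tau>0(2)])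
    show "t holomorphic_on UHP"
      by (rule holomorphic_transform[OF holomorphic_on_mult[OF holomorphic_on_const[of c] holomorphic_compose_qq[OF r order_refl]]])
        (simp add: t(1))
    show "t (mact A \<tau>) = t \<tau>" if "A \<in> Gamma0 p" "\<tau> \<in> UHP" for A \<tau>
      using tr' that by (simp add: transforms_def)
    show "t \<tau>0 \<noteq> 0" using t \<tau>0 ab(3,4)[OF n[OF \<tau>0(1)]] by simp
    have "cusp_growth (\<lambda>\<tau>. b (qq \<tau>) / a (qq \<tau>))"
    proof (rule cusp_growth_transforms[OF p tr r _ h2, where a = 0 and b = 1])
      show "b (qq (-1 / (of_nat p * \<tau>))) / a (qq (-1 / (of_nat p * \<tau>))) = 1 / d * h (qq \<tau>) / qq \<tau> ^ 1" if "\<tau> \<in> UHP" for \<tau>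
      proof -
        have "a (qq \<tau>) / (d * b (qq \<tau>)) = 1 / d * (a (qq \<tau>) / b (qq \<tau>))" by simp
        then show ?thesis unfolding W[OF that] h(2)[OF n[OF that] qq_nz] by simp
      qed
    qed simp
    then show "cusp_growth t"
      by (rule cusp_growth_dominated[of _ _ 0 "norm c"]) (simp_all add: t(1) norm_mult norm_divide)
  qed
qed

lemma coordinates_level3: "coordinates_modular (Gamma0 3) t_level3"
  and coordinates_level2: "coordinates_modular (Gamma0 2) t_level2"
proof -
  obtain h2 h3 where h: "h2 holomorphic_on ball 0 1" "\<And>q. norm q < 1 \<Longrightarrow> q \<noteq> 0 \<Longrightarrow> lev2a q / lev2b q = h2 q / q"
    "h3 holomorphic_on ball 0 1" "\<And>q. norm q < 1 \<Longrightarrow> q \<noteq> 0 \<Longrightarrow> lev3a q / lev3b q = h3 q / q"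
    using lev_ratio_pole by metis
  show "coordinates_modular (Gamma0 3) t_level3"
    by (rule coordinates_levelI[OF disjI2[OF refl] t_level_eq(2) _ lev_holomorphic(3,4) _ _ _ transforms_lev3(1) lev3_ratio_fricke h(3,4)])
      (simp_all add: lev_nz lev_0)
  show "coordinates_modular (Gamma0 2) t_level2"
    by (rule coordinates_levelI[OF disjI1[OF refl] t_level_eq(1) _ lev_holomorphic(1,2) _ _ _ transforms_lev2(3) lev2_ratio_fricke h(1,2)])
      (simp_all add: lev_nz lev_0)
qed

text \<open>The zeros of \<open>E\<close> are isolated, and \<open>g\<close> is continuous at them
  because |g|^2 = |E|; so they are removable singularities of \<open>g\<close>.\<close>

lemma holomorphic_square_root:
  assumes S: "open S" "connected S" and E: "E holomorphic_on S" "\<beta> \<in> S" "E \<beta> \<noteq> 0"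
    and g: "\<And>z. z \<in> S \<Longrightarrow> g z ^ 2 = E z" "\<And>z. z \<in> S \<Longrightarrow> E z \<noteq> 0 \<Longrightarrow> g field_differentiable at z"
  shows "g holomorphic_on S"
proof -
  have "g field_differentiable at z" if z: "z \<in> S" for z
  proof (cases "E z = 0")
    case True
    obtain r where r: "0 < r" "ball z r \<subseteq> S" "\<And>w. w \<in> ball z r - {z} \<Longrightarrow> E w \<noteq> 0"
      using isolated_zeros[OF E(1) S z True E(2,3)] by blast
    have norm_g: "norm (g w) = sqrt (norm (E w))" if "w \<in> S" for w
      using arg_cong[OF g(1)[OF that], of norm] by (simp add: norm_power real_sqrt_unique)
    have "isCont E z" using E(1) S(1) z by (metis continuous_on_eq_continuous_at holomorphic_on_imp_continuous_on)
    then have "((\<lambda>w. norm (E w)) \<longlongrightarrow> norm (E z)) (at z)" unfolding isCont_def by (rule tendsto_norm)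
    then have "((\<lambda>w. sqrt (norm (E w))) \<longlongrightarrow> sqrt (norm (E z))) (at z)" by (rule tendsto_real_sqrt)
    from Lim_transform_within_open[OF this S(1) z, of "\<lambda>w. norm (g w)"] have "((\<lambda>w. norm (g w)) \<longlongrightarrow> 0) (at z)"
      by (simp add: norm_g True)
    then have "(g \<longlongrightarrow> 0) (at z)" by (rule tendsto_norm_zero_cancel)
    moreover have "g z = 0" using g(1)[OF z] True by simp
    ultimately have "(g \<longlongrightarrow> g z) (at z within ball z r)" using tendsto_within_subset[of g "nhds (g z)" z UNIV "ball z r"] by simp
    then have lim: "\<And>w. w \<in> {z} \<Longrightarrow> (g \<longlongrightarrow> g w) (at w within ball z r)" by simp
    have hol: "g holomorphic_on ball z r - {z}"
      unfolding holomorphic_on_def using r g(2) by (blast intro: field_differentiable_at_within)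
    have "g holomorphic_on ball z r"
      by (rule no_isolated_singularity'[where K = "{z}"]) (erule lim, rule hol, simp_all)
    then show ?thesis using r(1) by (simp add: holomorphic_on_imp_differentiable_at)
  qed (use g z in auto)
  then show ?thesis by (simp add: holomorphic_on_def field_differentiable_at_within)
qed

text \<open>The root is 2^(1/2) times the cubic theta function a, realised as a^3/a^2 with the value
  0 filled in at the zeros of the denominator. With e for \<open>eis_lev 3 q / 2\<close> its square
  is 2 e^3 / e^2 = 2e by \<open>lev3_identities\<close>.\<close>

lemma root_branch_level3: "\<exists>g. root_branch 2 E_level3 UHP g"
proof -
  define w :: complex where "w = 2 powr (1 / of_nat 2)"
  have w: "w ^ 2 = 2" by (simp add: w_def power2_eq_square flip: powr_add)
  define f where "f = (\<lambda>q. w * (lev3c q / (eis_lev 3 q / 2)))"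
  define g where "g = (\<lambda>\<tau>. if eis_lev 3 (qq \<tau>) = 0 then 0 else f (qq \<tau>))"
  have e0: "eis_lev 3 0 = 2" by (simp add: eis_lev_0)
  obtain \<beta> where \<beta>: "\<beta> \<in> UHP" "eis_lev 3 (qq \<beta>) \<noteq> 0"
    using cusp_region_nz[OF cusp_region_UHP eis_lev_holomorphic[of 3]] e0 by auto
  have eh: "(\<lambda>\<tau>. eis_lev 3 (qq \<tau>)) holomorphic_on UHP" by (intro holomorphic_compose_qq eis_lev_holomorphic) auto
  have ch: "(\<lambda>\<tau>. lev3c (qq \<tau>)) holomorphic_on UHP" by (intro holomorphic_intros holomorphic_compose_qq lev_holomorphic) auto
  have sq: "g \<tau> ^ 2 = E_level3 \<tau>" if "\<tau> \<in> UHP" for \<tau>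
  proof (cases "eis_lev 3 (qq \<tau>) = 0")
    case False
    define e where "e = eis_lev 3 (qq \<tau>) / 2"
    have "g \<tau> ^ 2 = w ^ 2 * (lev3c (qq \<tau>) ^ 2 / e ^ 2)"
      by (simp only: g_def f_def e_def power_mult_distrib power_divide False if_False)
    also have "\<dots> = 2 * (e ^ 3 / e ^ 2)"
      unfolding w lev3_identities(1)[OF norm_qq_less_1[OF that], symmetric] e_def ..
    also have "\<dots> = 2 * e" using False by (simp add: e_def power2_eq_square power3_eq_cube)
    finally show ?thesis by (simp add: e_def E_level_eq[OF that])
  qed (simp add: g_def E_level_eq[OF that])
  have "g holomorphic_on UHP"
  proof (rule holomorphic_square_root[OF open_UHP connected_UHP eh \<beta>])
    show "g \<tau> ^ 2 = eis_lev 3 (qq \<tau>)" if "\<tau> \<in> UHP" for \<tau> using sq[OF that] by (simp add: E_level_eq[OF that])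
    fix z assume z: "z \<in> UHP" "eis_lev 3 (qq z) \<noteq> 0"
    define U where "U = {\<tau> \<in> UHP. eis_lev 3 (qq \<tau>) \<noteq> 0}"
    have "U = (\<lambda>\<tau>. eis_lev 3 (qq \<tau>)) -` (- {0}) \<inter> UHP" by (auto simp: U_def)
    then have U: "open U"
      using continuous_on_open_vimage[OF open_UHP] holomorphic_on_imp_continuous_on[OF eh] by (metis open_Compl closed_singleton)
    have "(\<lambda>\<tau>. f (qq \<tau>)) holomorphic_on U"
      unfolding f_def by (intro holomorphic_intros holomorphic_on_subset[OF ch] holomorphic_on_subset[OF eh]) (auto simp: U_def)
    then have "g holomorphic_on U" by (rule holomorphic_transform) (simp add: g_def U_def)
    then show "g field_differentiable at z" using U z by (simp add: U_def holomorphic_on_imp_differentiable_at)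
  qed
  moreover have "(g \<longlongrightarrow> w) at_i_inf"
  proof -
    have "((\<lambda>\<tau>. f (qq \<tau>)) \<longlongrightarrow> w * ((lev3a 0 + 27 * lev3b 0) / (eis_lev 3 0 / 2))) at_i_inf"
      unfolding f_def by (intro tendsto_intros tendsto_at_i_inf_qq lev_holomorphic eis_lev_holomorphic) (simp_all add: e0)
    moreover have "\<forall>\<^sub>F \<tau> in at_i_inf. f (qq \<tau>) = g \<tau>"
      using tendsto_imp_eventually_ne[OF tendsto_at_i_inf_qq[OF eis_lev_holomorphic[of 3]], of 0] e0
      by (auto elim!: eventually_mono simp: g_def)
    ultimately show ?thesis by (simp add: e0 lev_0 tendsto_cong)
  qed
  moreover have "(E_level3 \<longlongrightarrow> 2) at_i_inf"
  proof -
    have "((\<lambda>\<tau>. eis_lev 3 (qq \<tau>)) \<longlongrightarrow> 2) at_i_inf" using tendsto_at_i_inf_qq[OF eis_lev_holomorphic[of 3]] e0 by simp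
    moreover have "\<forall>\<^sub>F \<tau> in at_i_inf. eis_lev 3 (qq \<tau>) = E_level3 \<tau>"
      using eventually_UHP by (rule eventually_mono) (simp add: E_level_eq)
    ultimately show ?thesis by (simp add: tendsto_cong)
  qed
  ultimately have "root_branch 2 E_level3 UHP g"
    unfolding root_branch_def using cusp_region_UHP sq w_def by (intro conjI exI[of _ 2]) auto
  then show ?thesis by blast
qed

lemma tendsto_1_half_plane:
  fixes \<phi> :: "complex \<Rightarrow> complex"
  assumes "(\<phi> \<longlongrightarrow> 1) at_i_inf"
  obtains Y where "Y > 0" "\<And>\<tau>. Im \<tau> > Y \<Longrightarrow> 0 < Re (\<phi> \<tau>)"
proof -
  have "\<forall>\<^sub>F \<tau> in at_i_inf. 0 < Re (\<phi> \<tau>)" using order_tendstoD(1)[OF tendsto_Re[OF assms]] by simp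
  then show ?thesis using that unfolding eventually_at_i_inf_iff by blast
qed

lemma tendsto_csqrt_1: "(\<phi> \<longlongrightarrow> 1) F \<Longrightarrow> ((\<lambda>x. csqrt (\<phi> x)) \<longlongrightarrow> 1) F"
  using isCont_tendsto_compose[OF continuous_at_csqrt[of 1]] by fastforce

lemma Re_csqrt_pos: "0 < Re z \<Longrightarrow> 0 < Re (csqrt z)"
  by (simp add: add_nonneg_pos)

text \<open>High up \<open>\<phi>\<close> stays in the right half-plane, where the principal root is
  holomorphic.\<close>

lemma root_branch_csqrt:
  assumes "0 < Y" "\<phi> holomorphic_on {\<tau>. Im \<tau> > Y}" "\<And>\<tau>. Im \<tau> > Y \<Longrightarrow> 0 < Re (\<phi> \<tau>)" "(\<phi> \<longlongrightarrow> 1) at_i_inf"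
  shows "root_branch 2 \<phi> {\<tau>. Im \<tau> > Y} (\<lambda>\<tau>. csqrt (\<phi> \<tau>))"
  unfolding root_branch_def
proof (intro conjI exI[of _ 1] ballI)
  show "(\<lambda>\<tau>. csqrt (\<phi> \<tau>)) holomorphic_on {\<tau>. Im \<tau> > Y}"
    using assms(3) by (intro holomorphic_on_csqrt' assms(2)) (force simp: complex_nonpos_Reals_iff)
qed (use assms tendsto_csqrt_1 cusp_region_upper in auto)

lemma root_branch_level2: "\<exists>\<Omega> g. root_branch 2 E_level2 \<Omega> g"
proof -
  have "((\<lambda>\<tau>. eis_lev 2 (qq \<tau>)) \<longlongrightarrow> 1) at_i_inf"
    using tendsto_at_i_inf_qq[OF eis_lev_holomorphic[of 2]] by (simp add: eis_lev_0)
  moreover have "\<forall>\<^sub>F \<tau> in at_i_inf. eis_lev 2 (qq \<tau>) = E_level2 \<tau>"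
    using eventually_UHP by (rule eventually_mono) (simp add: E_level_eq)
  ultimately have l: "(E_level2 \<longlongrightarrow> 1) at_i_inf" by (simp add: tendsto_cong)
  obtain Y where Y: "Y > 0" "\<And>\<tau>. Im \<tau> > Y \<Longrightarrow> 0 < Re (E_level2 \<tau>)" using tendsto_1_half_plane[OF l] by blast
  have "{\<tau>. Im \<tau> > Y} \<subseteq> UHP" using Y(1) by (auto simp: UHP_def)
  from root_branch_csqrt[OF Y(1) holomorphic_on_subset[OF E_level_holomorphic(1) this] Y(2) l] show ?thesis by blast
qed

section \<open>Level 1\<close>

lemma klein_j_eq: "\<tau> \<in> UHP \<Longrightarrow> 1 - 1728 / klein_j \<tau> = 1 - 1728 * disc_form (qq \<tau>) / e4 (qq \<tau>) ^ 3"
  by (simp add: klein_j_def Eis4_eq eta_24 disc_form_def)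

lemma e6_holomorphic: "e6 holomorphic_on ball 0 1" and disc_form_holomorphic: "disc_form holomorphic_on ball 0 1"
  unfolding e6_def[abs_def] disc_form_def[abs_def]
  by (intro holomorphic_intros eis_lev_holomorphic lev_holomorphic euler_prod_holomorphic; simp)+

lemma disc_form_nz: "norm q < 1 \<Longrightarrow> q \<noteq> 0 \<Longrightarrow> disc_form q \<noteq> 0"
  using euler_prod_nz by (simp add: disc_form_def)

lemma at_i_inf2_fst_snd: "filterlim fst at_i_inf at_i_inf2" "filterlim snd at_i_inf at_i_inf2"
proof -
  have m: "filterlim (\<lambda>(\<tau>1, \<tau>2). min (Im \<tau>1) (Im \<tau>2)) at_top at_i_inf2"
    unfolding at_i_inf2_def by (rule filterlim_filtercomap)
  show "filterlim fst at_i_inf at_i_inf2" "filterlim snd at_i_inf at_i_inf2"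
    unfolding at_i_inf_def filterlim_filtercomap_iff o_def
    by (rule filterlim_at_top_mono[OF m]; force simp: case_prod_unfold intro: always_eventually)+
qed

lemma root_branches_level1:
  "\<exists>\<Omega> s F. root_branch 2 (\<lambda>\<tau>. 1 - 1728 / klein_j \<tau>) \<Omega> s \<and> root_branch2 4 (\<lambda>(\<tau>1, \<tau>2). Eis4 \<tau>1 * Eis4 \<tau>2) \<Omega> F"
proof -
  have le: "((\<lambda>\<tau>. e4 (qq \<tau>)) \<longlongrightarrow> 1) at_i_inf" using tendsto_at_i_inf_qq[OF e4_holomorphic] by (simp add: e4_0)
  have ld: "((\<lambda>\<tau>. disc_form (qq \<tau>)) \<longlongrightarrow> 0) at_i_inf"
    using tendsto_at_i_inf_qq[OF disc_form_holomorphic] by (simp add: disc_form_def)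
  have l1: "(Eis4 \<longlongrightarrow> 1) at_i_inf"
    by (rule Lim_transform_eventually[OF le eventually_mono[OF eventually_UHP]]) (simp add: Eis4_eq)
  have "((\<lambda>\<tau>. 1 - 1728 * disc_form (qq \<tau>) / e4 (qq \<tau>) ^ 3) \<longlongrightarrow> 1 - 1728 * 0 / 1 ^ 3) at_i_inf"
    by (intro tendsto_intros le ld) simp
  then have l2: "((\<lambda>\<tau>. 1 - 1728 / klein_j \<tau>) \<longlongrightarrow> 1) at_i_inf"
    by (rule Lim_transform_eventually[OF _ eventually_mono[OF eventually_UHP], THEN tendsto_eq_rhs]) (simp_all add: klein_j_eq)
  obtain Y1 where Y1: "Y1 > 0" "\<And>\<tau>. Im \<tau> > Y1 \<Longrightarrow> 0 < Re (Eis4 \<tau>)" using tendsto_1_half_plane[OF l1] by blast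
  obtain Y2 where Y2: "Y2 > 0" "\<And>\<tau>. Im \<tau> > Y2 \<Longrightarrow> 0 < Re (1 - 1728 / klein_j \<tau>)" using tendsto_1_half_plane[OF l2] by blast
  define Y where "Y = max Y1 Y2"
  define \<Omega> where "\<Omega> = {\<tau>. Im \<tau> > Y}"
  have Y: "Y > 0" using Y1 by (simp add: Y_def)
  have \<Omega>: "\<Omega> \<subseteq> UHP" "cusp_region \<Omega>" "open \<Omega>" using Y cusp_region_upper[of Y] by (auto simp: UHP_def \<Omega>_def open_halfspace_Im_gt)
  have R: "0 < Re (Eis4 \<tau>)" "0 < Re (1 - 1728 / klein_j \<tau>)" if "\<tau> \<in> \<Omega>" for \<tau>
    using that Y1(2) Y2(2) by (auto simp: \<Omega>_def Y_def)
  have hE: "Eis4 holomorphic_on \<Omega>"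
    by (rule holomorphic_transform[OF holomorphic_compose_qq[OF e4_holomorphic \<Omega>(1)]]) (use \<Omega>(1) Eis4_eq in auto)
  have "(\<lambda>\<tau>. 1 - 1728 * disc_form (qq \<tau>) / e4 (qq \<tau>) ^ 3) holomorphic_on \<Omega>"
    using R(1) \<Omega>(1) by (intro holomorphic_intros holomorphic_compose_qq disc_form_holomorphic e4_holomorphic) (force simp: Eis4_eq)+
  then have hj: "(\<lambda>\<tau>. 1 - 1728 / klein_j \<tau>) holomorphic_on \<Omega>"
    by (rule holomorphic_transform) (use \<Omega>(1) klein_j_eq in auto)
  have s: "root_branch 2 (\<lambda>\<tau>. 1 - 1728 / klein_j \<tau>) \<Omega> (\<lambda>\<tau>. csqrt (1 - 1728 / klein_j \<tau>))"
    unfolding \<Omega>_def by (rule root_branch_csqrt[OF Y _ _ l2]) (use hj R(2) in \<open>auto simp: \<Omega>_def\<close>)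
  \<comment> \<open>The principal root maps the right half-plane into itself, so it can be iterated
    holomorphically.\<close>
  define f where "f = (\<lambda>\<tau>. csqrt (csqrt (Eis4 \<tau>)))"
  have hf: "f holomorphic_on \<Omega>"
    unfolding f_def using R(1)
    by (intro holomorphic_on_csqrt' hE) (force simp: complex_nonpos_Reals_iff dest: Re_csqrt_pos)+
  have f4: "f \<tau> ^ 4 = Eis4 \<tau>" for \<tau>
  proof -
    have "f \<tau> ^ 4 = (f \<tau> ^ 2) ^ 2" by (simp flip: power_mult)
    then show ?thesis by (simp add: f_def)
  qed
  have lf: "(f \<longlongrightarrow> 1) at_i_inf" unfolding f_def by (intro tendsto_csqrt_1 l1)
  have "root_branch2 4 (\<lambda>(\<tau>1, \<tau>2). Eis4 \<tau>1 * Eis4 \<tau>2) \<Omega> (\<lambda>z. f (fst z) * f (snd z))"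
    unfolding root_branch2_def
  proof (intro conjI exI[of _ 1] ballI)
    show "holomorphic2_on (\<lambda>z. f (fst z) * f (snd z)) (\<Omega> \<times> \<Omega>)"
      by (intro holomorphic2_on_mult holomorphic2_on_fst_snd hf \<Omega>(3) open_Times)
    have "((\<lambda>z. Eis4 (fst z) * Eis4 (snd z)) \<longlongrightarrow> 1 * 1) at_i_inf2"
      by (intro tendsto_mult filterlim_compose[OF l1] at_i_inf2_fst_snd)
    then show "((\<lambda>(\<tau>1, \<tau>2). Eis4 \<tau>1 * Eis4 \<tau>2) \<longlongrightarrow> 1) at_i_inf2" by (simp add: case_prod_unfold)
    have "((\<lambda>z. f (fst z) * f (snd z)) \<longlongrightarrow> 1 * 1) at_i_inf2"
      by (intro tendsto_mult filterlim_compose[OF lf] at_i_inf2_fst_snd)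
    then show "((\<lambda>z. f (fst z) * f (snd z)) \<longlongrightarrow> 1 powr (1 / of_nat 4)) at_i_inf2" by simp
  qed (use \<Omega>(2) f4 in \<open>auto simp: power_mult_distrib\<close>)
  with s show ?thesis by blast
qed

text \<open>At a zero of E4 division by zero makes 1 - 1728/j equal to 1, so the equation for s^2 at
  that point alone is no contradiction. But s^2 E4^3 = E6^2 holds nearby and passes to the limit, so
  E6 would vanish along with E4, whereas the discriminant has no zero.\<close>

lemma root_branch_e4_nz:
  assumes s: "root_branch 2 (\<lambda>\<tau>. 1 - 1728 / klein_j \<tau>) \<Omega> s" and z: "z \<in> \<Omega>"
  shows "e4 (qq z) \<noteq> 0"
proof
  assume 0: "e4 (qq z) = 0"
  have \<Omega>: "cusp_region \<Omega>" "open \<Omega>" "connected \<Omega>" "\<Omega> \<subseteq> UHP" and h: "s holomorphic_on \<Omega>"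
    and sq: "\<And>\<tau>. \<tau> \<in> \<Omega> \<Longrightarrow> s \<tau> ^ 2 = 1 - 1728 / klein_j \<tau>" using s by (auto simp: root_branch_def cusp_region_def)
  have u: "norm (qq \<tau>) < 1" if "\<tau> \<in> \<Omega>" for \<tau> using that \<Omega>(4) norm_qq_less_1 by auto
  have h4: "(\<lambda>\<tau>. e4 (qq \<tau>)) holomorphic_on \<Omega>" and h6: "(\<lambda>\<tau>. e6 (qq \<tau>)) holomorphic_on \<Omega>"
    using \<Omega>(4) by (auto intro: holomorphic_compose_qq e4_holomorphic e6_holomorphic)
  obtain \<beta> where \<beta>: "\<beta> \<in> \<Omega>" "e4 (qq \<beta>) \<noteq> 0" using cusp_region_nz[OF \<Omega>(1) e4_holomorphic] e4_0 by auto
  obtain r where r: "0 < r" "ball z r \<subseteq> \<Omega>" "\<And>w. w \<in> ball z r - {z} \<Longrightarrow> e4 (qq w) \<noteq> 0"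
    using isolated_zeros[OF h4 \<Omega>(2,3) z 0 \<beta>] by blast
  define D where "D = (\<lambda>\<tau>. s \<tau> ^ 2 * e4 (qq \<tau>) ^ 3 - e6 (qq \<tau>) ^ 2)"
  have hD: "D holomorphic_on \<Omega>" unfolding D_def by (intro holomorphic_intros h h4 h6)
  have D0: "D w = 0" if w: "w \<in> ball z r" "w \<noteq> z" for w
  proof -
    have n: "e4 (qq w) \<noteq> 0" "w \<in> \<Omega>" using r(2,3) w by auto
    have "w \<in> UHP" using n \<Omega>(4) by auto
    then have "s w ^ 2 * e4 (qq w) ^ 3 = e4 (qq w) ^ 3 - 1728 * disc_form (qq w)"
      using n(1) by (simp add: sq[OF n(2)] klein_j_eq field_simps)
    then show ?thesis using e4_e6_disc[OF u[OF n(2)]] by (simp add: D_def algebra_simps)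
  qed
  have "isCont D z" using hD \<Omega>(2) z by (metis continuous_on_eq_continuous_at holomorphic_on_imp_continuous_on)
  then have "(D \<longlongrightarrow> D z) (at z)" by (simp add: isCont_def)
  moreover have "(D \<longlongrightarrow> 0) (at z)"
    by (rule Lim_transform_within_open[OF tendsto_const[of 0], where s = "ball z r"]) (use r(1) D0 in auto)
  ultimately have "D z = 0" by (rule LIM_unique)
  then show False
    using e4_e6_disc[OF u[OF z]] disc_form_nz[OF u[OF z]] by (simp add: D_def 0)
qed

text \<open>Near \<open>\<tau>\<close> with \<open>s \<tau> = 0\<close> the relation \<open>\<kappa>\<^sup>2 = (2 \<pi> \<i>)\<^sup>2 e4\<close> for the logarithmic derivative
  \<open>\<kappa>\<close> of \<open>t\<close> follows by continuation only, as differentiating \<open>s\<^sup>2\<close> determines \<open>s \<kappa>\<close>.\<close>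

lemma solves_level1:
  assumes s: "root_branch 2 (\<lambda>\<tau>. 1 - 1728 / klein_j \<tau>) \<Omega> s"
    and F: "root_branch2 4 (\<lambda>(\<tau>1, \<tau>2). Eis4 \<tau>1 * Eis4 \<tau>2) \<Omega> F"
  shows "solves_in_xy (1/6) (\<lambda>\<tau>. (s \<tau> - 1) / (s \<tau> + 1)) \<Omega> F"
proof -
  have \<Omega>: "cusp_region \<Omega>" "open \<Omega>" "connected \<Omega>" "\<Omega> \<subseteq> UHP" and h: "s holomorphic_on \<Omega>"
    and sq0: "\<And>\<tau>. \<tau> \<in> \<Omega> \<Longrightarrow> s \<tau> ^ 2 = 1 - 1728 / klein_j \<tau>" using s by (auto simp: root_branch_def cusp_region_def)
  have u: "\<tau> \<in> UHP" "norm (qq \<tau>) < 1" if "\<tau> \<in> \<Omega>" for \<tau> using that \<Omega>(4) norm_qq_less_1 by auto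
  note nz4 = root_branch_e4_nz[OF s]
  define E where "E = (\<lambda>\<tau>. e4 (qq \<tau>))"
  have hE: "E holomorphic_on \<Omega>" unfolding E_def using \<Omega>(4) by (intro holomorphic_compose_qq e4_holomorphic)
  have sq1: "s \<tau> ^ 2 - 1 = - (1728 * disc_form (qq \<tau>) / E \<tau> ^ 3)" if "\<tau> \<in> \<Omega>" for \<tau>
    using sq0[OF that] klein_j_eq[OF u(1)[OF that]] by (simp add: E_def)
  have sq: "s \<tau> ^ 2 = e6 (qq \<tau>) ^ 2 / E \<tau> ^ 3" if "\<tau> \<in> \<Omega>" for \<tau>
  proof -
    have "s \<tau> ^ 2 = (E \<tau> ^ 3 - 1728 * disc_form (qq \<tau>)) / E \<tau> ^ 3"
      using sq1[OF that] nz4[OF that] by (simp add: E_def diff_divide_distrib algebra_simps)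
    then show ?thesis unfolding E_def e4_e6_disc[OF u(2)[OF that], symmetric] by simp
  qed
  have s1: "s \<tau> ^ 2 - 1 \<noteq> 0" if "\<tau> \<in> \<Omega>" for \<tau>
    using sq1[OF that] disc_form_nz[OF u(2)[OF that]] nz4[OF that] by (simp add: E_def)
  have s2: "s \<tau> + 1 \<noteq> 0" "s \<tau> - 1 \<noteq> 0" if "\<tau> \<in> \<Omega>" for \<tau>
    using s1[OF that] by (auto simp: eq_neg_iff_add_eq_0[symmetric])
  \<comment> \<open>The logarithmic derivative of (s - 1)/(s + 1).\<close>
  define \<kappa> where "\<kappa> = (\<lambda>\<tau>. 2 * deriv s \<tau> / (s \<tau> ^ 2 - 1))"
  have h\<kappa>: "\<kappa> holomorphic_on \<Omega>"
    unfolding \<kappa>_def using s1 by (intro holomorphic_intros holomorphic_deriv h \<Omega>(2)) auto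
  have ds: "(s has_field_derivative deriv s \<tau>) (at \<tau>)" if "\<tau> \<in> \<Omega>" for \<tau>
    by (rule holomorphic_derivI[OF h \<Omega>(2) that])
  have dt: "((\<lambda>\<tau>. (s \<tau> - 1) / (s \<tau> + 1)) has_field_derivative \<kappa> \<tau> * ((s \<tau> - 1) / (s \<tau> + 1))) (at \<tau>)" if "\<tau> \<in> \<Omega>" for \<tau>
  proof -
    have f: "s \<tau> ^ 2 - 1 = (s \<tau> + 1) * (s \<tau> - 1)" by (simp add: algebra_simps power2_eq_square)
    have "((\<lambda>\<tau>. (s \<tau> - 1) / (s \<tau> + 1)) has_field_derivative
        (deriv s \<tau> * (s \<tau> + 1) - (s \<tau> - 1) * deriv s \<tau>) / ((s \<tau> + 1) * (s \<tau> + 1))) (at \<tau>)"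
      using s2[OF that] by (auto intro!: derivative_eq_intros ds that)
    moreover have "(deriv s \<tau> * (s \<tau> + 1) - (s \<tau> - 1) * deriv s \<tau>) / ((s \<tau> + 1) * (s \<tau> + 1)) = \<kappa> \<tau> * ((s \<tau> - 1) / (s \<tau> + 1))"
    proof -
      have "x / (a * a) = x / (a * b) * (b / a)" if "b \<noteq> 0" for a b x :: complex using that by simp
      moreover have "deriv s \<tau> * (s \<tau> + 1) - (s \<tau> - 1) * deriv s \<tau> = 2 * deriv s \<tau>" by (simp add: algebra_simps)
      ultimately show ?thesis using s2(2)[OF that] unfolding \<kappa>_def f by metis
    qed
    ultimately show ?thesis by simp
  qed
  \<comment> \<open>For s^2 = E6^2 / E4^3 Ramanujan's equations give D(s^2) = (s^2 - 1) E6 / E4;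
    this is divided by s^2 - 1.\<close>
  have s\<kappa>: "s \<tau> * \<kappa> \<tau> = c2pi * e6 (qq \<tau>) / E \<tau>" if \<tau>: "\<tau> \<in> \<Omega>" for \<tau>
  proof -
    note q = u(2)[OF \<tau>]
    define x y p where "x = e4 (qq \<tau>)" and "y = e6 (qq \<tau>)" and "p = e2 (qq \<tau>)"
    have x: "x \<noteq> 0" using nz4[OF \<tau>] by (simp add: x_def)
    have "has_Dq (\<lambda>q. e6 q ^ 2 / e4 q ^ 3) ((of_nat 2 * ((p * y - x ^ 2) / 2 * y ^ (2 - Suc 0)) * x ^ 3 -
        y ^ 2 * (of_nat 3 * ((p * x - y) / 3 * x ^ (3 - Suc 0)))) / (x ^ 3) ^ 2) (qq \<tau>)"
      unfolding x_def y_def p_def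
      by (intro has_Dq_divide has_Dq_power has_Dq_e4 has_Dq_e6 q) (use x in \<open>simp add: x_def\<close>)
    then have "has_Dq (\<lambda>q. e6 q ^ 2 / e4 q ^ 3) ((s \<tau> ^ 2 - 1) * (y / x)) (qq \<tau>)"
      by (rule has_Dq_eq) (use x in \<open>simp add: sq[OF \<tau>] E_def x_def[symmetric] y_def[symmetric] divide_simps; simp add: algebra_simps eval_nat_numeral\<close>)
    from has_Dq_compose_qq[OF this]
    have "((\<lambda>\<tau>. s \<tau> ^ 2) has_field_derivative c2pi * ((s \<tau> ^ 2 - 1) * (y / x))) (at \<tau>)"
      by (rule has_field_derivative_transform_within_open[OF _ \<Omega>(2) \<tau>]) (simp add: sq E_def)
    moreover have "((\<lambda>\<tau>. s \<tau> ^ 2) has_field_derivative 2 * s \<tau> * deriv s \<tau>) (at \<tau>)"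
      by (auto intro!: derivative_eq_intros ds \<tau>)
    ultimately have "2 * s \<tau> * deriv s \<tau> = c2pi * ((s \<tau> ^ 2 - 1) * (y / x))" by (rule DERIV_unique[rotated])
    moreover have "a * (2 * b / d) = c * (y / x)" if "2 * a * b = c * (d * (y / x))" "d \<noteq> 0" for a b c d :: complex
    proof -
      have "a * (2 * b / d) = 2 * a * b / d" by simp
      then show ?thesis unfolding that(1) using that(2) by simp
    qed
    ultimately have "s \<tau> * \<kappa> \<tau> = c2pi * (y / x)" unfolding \<kappa>_def using s1[OF \<tau>] by blast
    then show ?thesis by (simp add: E_def x_def y_def)
  qed
  have e60: "e6 0 \<noteq> 0" by (simp add: e6_def eis_lev_0 lev_0)
  obtain \<tau>0 where \<tau>0: "\<tau>0 \<in> \<Omega>" "e6 (qq \<tau>0) \<noteq> 0" using cusp_region_nz[OF \<Omega>(1) e6_holomorphic e60] .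
  have k2: "\<kappa> \<tau> ^ 2 = c2pi ^ 2 * E \<tau>" if "\<tau> \<in> \<Omega>" for \<tau>
  proof -
    define V where "V = {\<tau> \<in> \<Omega>. s \<tau> \<noteq> 0}"
    have "V = s -` (- {0}) \<inter> \<Omega>" by (auto simp: V_def)
    then have V: "open V" "V \<subseteq> \<Omega>"
      using continuous_on_open_vimage[OF \<Omega>(2)] holomorphic_on_imp_continuous_on[OF h] by (metis open_Compl closed_singleton) (auto simp: V_def)
    have "s \<tau>0 \<noteq> 0" using sq[OF \<tau>0(1)] \<tau>0(2) nz4[OF \<tau>0(1)] by (auto simp: E_def)
    then have ne: "V \<noteq> {}" using \<tau>0(1) by (auto simp: V_def)
    have eq: "\<kappa> z ^ 2 = c2pi ^ 2 * E z" if "z \<in> V" for z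
    proof -
      have z: "z \<in> \<Omega>" "s z \<noteq> 0" using that by (auto simp: V_def)
      have nz: "E z \<noteq> 0" using nz4[OF z(1)] by (simp add: E_def)
      have "s z ^ 2 * \<kappa> z ^ 2 = c2pi ^ 2 * e6 (qq z) ^ 2 / E z ^ 2"
        using arg_cong[OF s\<kappa>[OF z(1)], of "\<lambda>x. x ^ 2"] by (simp add: power_mult_distrib power_divide)
      also have "\<dots> = s z ^ 2 * (c2pi ^ 2 * E z)"
        unfolding sq[OF z(1)] using nz by (simp add: power2_eq_square power3_eq_cube)
      finally show ?thesis using z(2) by simp
    qed
    have hol: "(\<lambda>z. \<kappa> z ^ 2) holomorphic_on \<Omega>" "(\<lambda>z. c2pi ^ 2 * E z) holomorphic_on \<Omega>"
      by (intro holomorphic_intros h\<kappa> hE)+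
    show ?thesis
      by (rule analytic_continuation_open[OF V(1) \<Omega>(2) ne \<Omega>(3) V(2) hol eq that])
  qed
  have \<kappa>nz: "\<kappa> \<tau> \<noteq> 0" if "\<tau> \<in> \<Omega>" for \<tau>
    using k2[OF that] nz4[OF that] by (auto simp: E_def)
  have ode: "(2 * \<kappa> \<tau> * deriv (deriv \<kappa>) \<tau> - 3 * deriv \<kappa> \<tau> ^ 2) * (4 * \<kappa> \<tau> ^ 2) = c2pi ^ 6 * (960 * disc_form (qq \<tau>))" if \<tau>: "\<tau> \<in> \<Omega>" for \<tau>
  proof -
    have d: "(\<kappa> has_field_derivative deriv \<kappa> z) (at z)" "(deriv \<kappa> has_field_derivative deriv (deriv \<kappa>) z) (at z)" if "z \<in> \<Omega>" for z
      by (rule holomorphic_derivI[OF h\<kappa> \<Omega>(2) that], rule holomorphic_derivI[OF holomorphic_deriv[OF h\<kappa> \<Omega>(2)] \<Omega>(2) that])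
    have 1: "2 * \<kappa> z * deriv \<kappa> z = c2pi ^ 2 * (c2pi * Dq e4 (qq z))" if z: "z \<in> \<Omega>" for z
    proof -
      have "((\<lambda>z. c2pi ^ 2 * E z) has_field_derivative c2pi ^ 2 * (c2pi * Dq e4 (qq z))) (at z)"
        unfolding E_def by (intro DERIV_cmult deriv_compose_qq e4_holomorphic u z)
      then have "((\<lambda>z. \<kappa> z ^ 2) has_field_derivative c2pi ^ 2 * (c2pi * Dq e4 (qq z))) (at z)"
        by (rule has_field_derivative_transform_within_open[OF _ \<Omega>(2) z]) (simp add: k2)
      moreover have "((\<lambda>z. \<kappa> z ^ 2) has_field_derivative 2 * \<kappa> z * deriv \<kappa> z) (at z)"
        by (auto intro!: derivative_eq_intros d z)
      ultimately show ?thesis by (rule DERIV_unique[rotated])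
    qed
    have "((\<lambda>z. c2pi ^ 2 * (c2pi * Dq e4 (qq z))) has_field_derivative c2pi ^ 2 * (c2pi * (c2pi * Dq (Dq e4) (qq \<tau>)))) (at \<tau>)"
      by (intro DERIV_cmult deriv_compose_qq Dq_holomorphic e4_holomorphic u \<tau>)
    then have "((\<lambda>z. 2 * \<kappa> z * deriv \<kappa> z) has_field_derivative c2pi ^ 2 * (c2pi * (c2pi * Dq (Dq e4) (qq \<tau>)))) (at \<tau>)"
      by (rule has_field_derivative_transform_within_open[OF _ \<Omega>(2) \<tau>]) (simp add: 1)
    moreover have "((\<lambda>z. 2 * \<kappa> z * deriv \<kappa> z) has_field_derivative 2 * deriv \<kappa> \<tau> ^ 2 + 2 * \<kappa> \<tau> * deriv (deriv \<kappa>) \<tau>) (at \<tau>)"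
      by (auto intro!: derivative_eq_intros d \<tau> simp: power2_eq_square)
    ultimately have 2: "2 * deriv \<kappa> \<tau> ^ 2 + 2 * \<kappa> \<tau> * deriv (deriv \<kappa>) \<tau> = c2pi ^ 2 * (c2pi * (c2pi * Dq (Dq e4) (qq \<tau>)))"
      by (rule DERIV_unique[rotated])
    \<comment> \<open>The weight 2 bracket of \<open>\<kappa>\<close> and the weight 4 bracket of
      its square differ by the factor 4 \<open>\<kappa>\<close>^2; this brings in
      \<open>e4_ode\<close>.\<close>
    have "(2 * \<kappa> \<tau> * deriv (deriv \<kappa>) \<tau> - 3 * deriv \<kappa> \<tau> ^ 2) * (4 * \<kappa> \<tau> ^ 2) =
      4 * \<kappa> \<tau> ^ 2 * (2 * deriv \<kappa> \<tau> ^ 2 + 2 * \<kappa> \<tau> * deriv (deriv \<kappa>) \<tau>) - 5 * (2 * \<kappa> \<tau> * deriv \<kappa> \<tau>) ^ 2"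
      by (simp add: algebra_simps power2_eq_square)
    also have "\<dots> = c2pi ^ 6 * (4 * e4 (qq \<tau>) * Dq (Dq e4) (qq \<tau>) - 5 * Dq e4 (qq \<tau>) ^ 2)"
      unfolding 1[OF \<tau>] 2 k2[OF \<tau>] E_def by (simp add: algebra_simps eval_nat_numeral)
    finally show ?thesis unfolding e4_ode[OF u(2)[OF \<tau>]] .
  qed
  show ?thesis
  proof (rule solves_in_xyI[where \<kappa> = \<kappa> and C = "1 / c2pi ^ 4" and ?\<tau>0.0 = \<tau>0, OF \<Omega>(2,3) dt _ h\<kappa> \<tau>0(1) \<kappa>nz[OF \<tau>0(1)]])
    show "(s \<tau> - 1) / (s \<tau> + 1) \<noteq> 0" if "\<tau> \<in> \<Omega>" for \<tau> using s2[OF that] by simp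
    show "continuous_on (\<Omega> \<times> \<Omega>) F" using F holomorphic2_on_continuous by (auto simp: root_branch2_def)
    show "F (\<tau>1, \<tau>2) ^ 4 = 1 / c2pi ^ 4 * (\<kappa> \<tau>1 * \<kappa> \<tau>2) ^ 2" if t: "\<tau>1 \<in> \<Omega>" "\<tau>2 \<in> \<Omega>" for \<tau>1 \<tau>2
    proof -
      have "F (\<tau>1, \<tau>2) ^ 4 = Eis4 \<tau>1 * Eis4 \<tau>2" using F t by (auto simp: root_branch2_def)
      also have "\<dots> = 1 / c2pi ^ 4 * ((c2pi ^ 2 * E \<tau>1) * (c2pi ^ 2 * E \<tau>2))"
        using t u by (simp add: E_def Eis4_eq power2_eq_square power4_eq_xxxx)
      finally show ?thesis unfolding power_mult_distrib k2[OF t(1)] k2[OF t(2)] .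
    qed
    fix \<tau> assume \<tau>: "\<tau> \<in> \<Omega>"
    define x d where "x = E \<tau>" and "d = disc_form (qq \<tau>)"
    have x: "x \<noteq> 0" using nz4[OF \<tau>] by (simp add: x_def E_def)
    have "(s \<tau> - 1) / (s \<tau> + 1) - 1 = - 2 / (s \<tau> + 1)" using s2[OF \<tau>] by (simp add: field_simps)
    moreover have "b / a / (- 2 / a) ^ 2 = a * b / 4" if "a \<noteq> 0" for a b :: complex
      using that by (simp add: power2_eq_square)
    ultimately have "(s \<tau> - 1) / (s \<tau> + 1) / ((s \<tau> - 1) / (s \<tau> + 1) - 1) ^ 2 = (s \<tau> + 1) * (s \<tau> - 1) / 4"
      using s2(1)[OF \<tau>] by presburger
    also have "\<dots> = (s \<tau> ^ 2 - 1) / 4" by (simp add: algebra_simps power2_eq_square)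
    also have "\<dots> = - 432 * d / x ^ 3" by (simp add: sq1[OF \<tau>] x_def d_def)
    finally have T: "(s \<tau> - 1) / (s \<tau> + 1) / ((s \<tau> - 1) / (s \<tau> + 1) - 1) ^ 2 = - 432 * d / x ^ 3" .
    have "\<kappa> \<tau> ^ 4 = (\<kappa> \<tau> ^ 2) ^ 2" by (simp flip: power_mult)
    then have k4: "\<kappa> \<tau> ^ 4 = c2pi ^ 4 * x ^ 2" by (simp add: k2[OF \<tau>] x_def power_mult_distrib flip: power_mult)
    \<comment> \<open>By \<open>T\<close>, t / (t - 1)^2 is -432 times the discriminant over E4^3,
      and the constants match as 4 * (5/36) * 432 = 240 = 960/4.\<close>
    have "2 * \<kappa> \<tau> * deriv (deriv \<kappa>) \<tau> - 3 * deriv \<kappa> \<tau> ^ 2 = c2pi ^ 6 * (960 * d) / (4 * (c2pi ^ 2 * x))"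
      using ode[OF \<tau>] x by (simp add: k2[OF \<tau>] x_def[symmetric] d_def[symmetric] nonzero_eq_divide_eq mult_ac)
    also have "\<dots> = 4 * (- of_real (1/6 * (1 - 1/6)) * (- 432 * d / x ^ 3)) * (c2pi ^ 4 * x ^ 2)"
      using x by (simp add: divide_simps) (simp add: eval_nat_numeral)
    finally show "2 * \<kappa> \<tau> * deriv (deriv \<kappa>) \<tau> - 3 * deriv \<kappa> \<tau> ^ 2 =
      4 * (- of_real (1/6 * (1 - 1/6)) * ((s \<tau> - 1) / (s \<tau> + 1)) / ((s \<tau> - 1) / (s \<tau> + 1) - 1) ^ 2) * \<kappa> \<tau> ^ 4"
      unfolding T[symmetric] k4[symmetric] by simp
  qed
qed

text \<open>The existence clauses keep the universally quantified claims about branches from being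
  vacuous.\<close>

theorem theorem4p1:
  shows
   "(let F = (\<lambda>(\<tau>1, \<tau>2). theta4 \<tau>1 ^ 2 * theta4 \<tau>2 ^ 2) in
       solves_in_xy (1/2) t_level4 UHP F \<and>
       bimodular_form (Gamma0 4) (Gamma0 4) 1 1 F \<and>
       coordinates_modular (Gamma0 4) t_level4)
    \<and>
    ((\<exists>g. root_branch 2 E_level3 UHP g) \<and>
     (\<forall>g. root_branch 2 E_level3 UHP g \<longrightarrow>
       (let F = (\<lambda>(\<tau>1, \<tau>2). 1/2 * g \<tau>1 * g \<tau>2) in
          solves_in_xy (1/3) t_level3 UHP F \<and>
          bimodular_form (Gamma0 3) (Gamma0 3) 1 1 F)) \<and>
     coordinates_modular (Gamma0 3) t_level3)
    \<and>
    ((\<exists>\<Omega> g. root_branch 2 E_level2 \<Omega> g) \<and>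
     (\<forall>\<Omega> g. root_branch 2 E_level2 \<Omega> g \<longrightarrow>
       (let F = (\<lambda>(\<tau>1, \<tau>2). g \<tau>1 * g \<tau>2) in
          solves_in_xy (1/4) t_level2 \<Omega> F \<and>
          transforms_up_to_root 2 (Gamma0 2) (Gamma0 2) 1 1 (\<Omega> \<times> \<Omega>) F)) \<and>
     bimodular_form (Gamma0 2) (Gamma0 2) 2 2 (\<lambda>(\<tau>1, \<tau>2). E_level2 \<tau>1 * E_level2 \<tau>2) \<and>
     coordinates_modular (Gamma0 2) t_level2)
    \<and>
    ((\<exists>\<Omega> s F. root_branch 2 (\<lambda>\<tau>. 1 - 1728 / klein_j \<tau>) \<Omega> s \<and>
        root_branch2 4 (\<lambda>(\<tau>1, \<tau>2). Eis4 \<tau>1 * Eis4 \<tau>2) \<Omega> F) \<and>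
     (\<forall>\<Omega> s F. root_branch 2 (\<lambda>\<tau>. 1 - 1728 / klein_j \<tau>) \<Omega> s \<longrightarrow>
        root_branch2 4 (\<lambda>(\<tau>1, \<tau>2). Eis4 \<tau>1 * Eis4 \<tau>2) \<Omega> F \<longrightarrow>
        solves_in_xy (1/6) (\<lambda>\<tau>. (s \<tau> - 1) / (s \<tau> + 1)) \<Omega> F))"
  unfolding Let_def
  using solves_level4 bimodular_level4 coordinates_level4 root_branch_level3 solves_level3 bimodular_level3 coordinates_level3
    root_branch_level2 solves_level2 transforms_up_to_root_level2 bimodular_level2 coordinates_level2
    root_branches_level1 solves_level1
  by blast

end
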